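(* Let $\Gamma$ be a finite group, let $(G,g,f)$ be a third-type datum, and put $A=k[\Gamma]$, $H=\mathfrak A^3_G(g,f)$, with skew-primitive generator $x\in H$. Matched pairs of Hopf algebras $(A,H,\triangleright,\triangleleft)$ are in bijection with the following data: (1) a matched pair of finite groups $(\Gamma,G,\triangleright,\triangleleft)$ such that $g\triangleright h=h$ and $g\triangleleft h=g$ for all $h\in\Gamma$; (2) a group homomorphism $\gamma:\Gamma\to k_g^+$, $h\mapsto\gamma_h$, satisfying $$f(t\triangleleft h)=f(t)+\gamma_{t\triangleright h}-\gamma_h\qquad\text{for all }t\in G,\ h\in\Gamma.$$ The bijection sends a Hopf matched pair to the restrictions of its actions to $G\times\Gamma$ together with the map $\gamma$ determined by $x\triangleleft h=x+\gamma_h(1-g)$; one has $x\triangleright h=0$ for all $h\in\Gamma$. Moreover, for these data, with $L=\Gamma\bowtie G$ the group bicrossed product, $g$ identified with $(1,g)\in L$, and $F:L\to k$ given by $F(h,t)=f(t)-\gamma_h$, there is an isomorphism of Hopf algebras $$k[\Gamma]\bowtie\mathfrak A^3_G(g,f)\cong\mathfrak A^3_{L}(g,F).$$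
   Context: $k$ is an algebraically closed field of characteristic $p>0$; all algebras, tensor products etc. are over $k$; all groups are finite. A third-type datum is a triple $(G,g,f)$ where $G$ is a finite group, $g\in Z(G)$, $f:G\to(k,+)$ is a group homomorphism with $f(g)=1$, and $(f(t)^p-f(t))(1-g^p)=0$ in $k[G]$ for all $t\in G$. The Hopf algebra $\mathfrak A^3_G(g,f)$ is generated as an algebra by the group algebra $k[G]$ and an element $x$ subject to $tx-xt=f(t)\,t(1-g)$ for $t\in G$ and $x^p=x$; its coalgebra structure and antipode are given by $\Delta(t)=t\otimes t$, $\varepsilon(t)=1$, $S(t)=t^{-1}$ for $t\in G$, and $\Delta(x)=x\otimes 1+g\otimes x$, $\varepsilon(x)=0$, $S(x)=-g^{-1}x$. It has basis $\{tx^i\mid t\in G,\ 0\le i<p\}$. A matched pair of Hopf algebras $(A,H,\triangleright,\triangleleft)$ consists of a left action $\triangleright:H\otimes A\to A$ making $A$ a left $H$-module coalgebra and a right action $\triangleleft:H\otimes A\to H$ making $H$ a right $A$-module coalgebra such that, for $a,b\in A$, $u,v\in H$ (Sweedler notation): $u\triangleright 1=\varepsilon(u)1$, $1\triangleleft a=\varepsilon(a)1$; $u\triangleright(ab)=(u_{(1)}\triangleright a_{(1)})((u_{(2)}\triangleleft a_{(2)})\triangleright b)$; $(uv)\triangleleft a=(u\triangleleft(v_{(1)}\triangleright a_{(1)}))(v_{(2)}\triangleleft a_{(2)})$; $u_{(1)}\triangleleft a_{(1)}\otimes u_{(2)}\triangleright a_{(2)}=u_{(2)}\triangleleft a_{(2)}\otimes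 u_{(1)}\triangleright a_{(1)}$. The bicrossed product $A\bowtie H$ is the tensor coalgebra $A\otimes H$ with multiplication $(a\bowtie u)(b\bowtie v)=a(u_{(1)}\triangleright b_{(1)})\bowtie(u_{(2)}\triangleleft b_{(2)})v$. A matched pair of groups $(\Gamma,G,\triangleright,\triangleleft)$ consists of a left action $\triangleright$ of $G$ on the set $\Gamma$ and a right action $\triangleleft$ of $\Gamma$ on the set $G$ with $t\triangleright(hk)=(t\triangleright h)((t\triangleleft h)\triangleright k)$ and $(ts)\triangleleft h=(t\triangleleft(s\triangleright h))(s\triangleleft h)$. The group bicrossed product $\Gamma\bowtie G$ is the set $\Gamma\times G$ with multiplication $(h,t)(k,s)=(h(t\triangleright k),(t\triangleleft k)s)$. $k_g=\{a\in k\mid (a^p-a)(1-g^p)=0\}$ (equal to $k$ if $g^p=1$ and to $\mathbb F_p$ otherwise), and $k_g^+$ is its additive group. *)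

theory Defs
  imports
    "HOL-Algebra.Algebraic_Closure_Type"
    "HOL-Algebra.QuotRing"
    "HOL-Algebra.Module"
    "HOL-Library.Poly_Mapping"
    "HOL-Library.FuncSet"
begin

section \<open>Linear algebra over a ground field\<close>

text \<open>
  The ground field is a type of class \<open>field\<close>. Vector spaces and (not necessarily commutative)
  algebras over it are \<^type>\<open>module\<close> records; for a mere vector space the fields \<^const>\<open>monoid.mult\<close> and
  \<^const>\<open>one\<close> carry no information. The free vector space on a type is given by the finitely
  supported functions.
\<close>

definition ground :: "('k::field, 'k) module" where
  "ground = ring.extend ring_of_type_algebra (module.fields (*))"

definition vspace :: "('k::field, 'a, 'm) module_scheme \<Rightarrow> bool" where
  "vspace V \<longleftrightarrow> module ground V"

definition klinear ::
  "('k::field, 'a, 'm) module_scheme \<Rightarrow> ('k, 'b, 'n) module_scheme \<Rightarrow> ('a \<Rightarrow> 'b) \<Rightarrow> bool" where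
  "klinear V W \<phi> \<longleftrightarrow> \<phi> \<in> carrier V \<rightarrow> carrier W \<and>
     (\<forall>a\<in>carrier V. \<forall>b\<in>carrier V. \<phi> (a \<oplus>\<^bsub>V\<^esub> b) = \<phi> a \<oplus>\<^bsub>W\<^esub> \<phi> b) \<and>
     (\<forall>c. \<forall>a\<in>carrier V. \<phi> (c \<odot>\<^bsub>V\<^esub> a) = c \<odot>\<^bsub>W\<^esub> \<phi> a)"

definition kalgebra :: "('k::field, 'a, 'm) module_scheme \<Rightarrow> bool" where
  "kalgebra A \<longleftrightarrow> vspace A \<and> Ring.ring A \<and>
     (\<forall>c. \<forall>a\<in>carrier A. \<forall>b\<in>carrier A.
        (c \<odot>\<^bsub>A\<^esub> a) \<otimes>\<^bsub>A\<^esub> b = c \<odot>\<^bsub>A\<^esub> (a \<otimes>\<^bsub>A\<^esub> b) \<and>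
        a \<otimes>\<^bsub>A\<^esub> (c \<odot>\<^bsub>A\<^esub> b) = c \<odot>\<^bsub>A\<^esub> (a \<otimes>\<^bsub>A\<^esub> b))"

definition opposite :: "('k, 'a) module \<Rightarrow> ('k, 'a) module" where
  "opposite A = A\<lparr>monoid.mult := (\<lambda>a b. b \<otimes>\<^bsub>A\<^esub> a)\<rparr>"

definition basis_vec :: "'x \<Rightarrow> ('x \<Rightarrow>\<^sub>0 'k::field)" where
  "basis_vec b = Poly_Mapping.single b 1"

definition fscale :: "'k::field \<Rightarrow> ('x \<Rightarrow>\<^sub>0 'k) \<Rightarrow> ('x \<Rightarrow>\<^sub>0 'k)" where
  "fscale c v = Poly_Mapping.map ((*) c) v"

text \<open>The bilinear extension of a binary operation on basis elements\<close>

definition convolve ::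
  "('x \<Rightarrow> 'x \<Rightarrow> 'x) \<Rightarrow> ('x \<Rightarrow>\<^sub>0 'k::field) \<Rightarrow> ('x \<Rightarrow>\<^sub>0 'k) \<Rightarrow> ('x \<Rightarrow>\<^sub>0 'k)" where
  "convolve m v w = (\<Sum>a\<in>Poly_Mapping.keys v. \<Sum>b\<in>Poly_Mapping.keys w.
     Poly_Mapping.single (m a b) (Poly_Mapping.lookup v a * Poly_Mapping.lookup w b))"

text \<open>The linear extension of a map from basis elements to a vector space.\<close>

definition lin_ext ::
  "('k::field, 'b, 'm) module_scheme \<Rightarrow> ('x \<Rightarrow> 'b) \<Rightarrow> ('x \<Rightarrow>\<^sub>0 'k) \<Rightarrow> 'b" where
  "lin_ext V \<beta> v =
     (\<Oplus>\<^bsub>V\<^esub>a\<in>Poly_Mapping.keys v. Poly_Mapping.lookup v a \<odot>\<^bsub>V\<^esub> \<beta> a)"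

definition rep :: "'a set \<Rightarrow> 'a" where
  "rep C = (SOME v. v \<in> C)"

section \<open>Tensor products\<close>

text \<open>
  The tensor product is the free vector space on \<^term>\<open>carrier V \<times> carrier W\<close> modulo the bilinearity
  relations. If both factors are algebras, \<^const>\<open>monoid.mult\<close> and \<^const>\<open>one\<close> make it their tensor product
  algebra.
\<close>

inductive_set tensor_rel ::
  "('k::field, 'a, 'm) module_scheme \<Rightarrow> ('k, 'b, 'n) module_scheme \<Rightarrow> ('a \<times> 'b \<Rightarrow>\<^sub>0 'k) set"
  for V :: "('k::field, 'a, 'm) module_scheme" and W :: "('k, 'b, 'n) module_scheme" where
  "0 \<in> tensor_rel V W"
| "\<lbrakk>v \<in> tensor_rel V W; w \<in> tensor_rel V W\<rbrakk> \<Longrightarrow> v + w \<in> tensor_rel V W"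
| "v \<in> tensor_rel V W \<Longrightarrow> fscale c v \<in> tensor_rel V W"
| "\<lbrakk>a \<in> carrier V; a' \<in> carrier V; b \<in> carrier W\<rbrakk> \<Longrightarrow>
     basis_vec (a \<oplus>\<^bsub>V\<^esub> a', b) - basis_vec (a, b) - basis_vec (a', b) \<in> tensor_rel V W"
| "\<lbrakk>a \<in> carrier V; b \<in> carrier W; b' \<in> carrier W\<rbrakk> \<Longrightarrow>
     basis_vec (a, b \<oplus>\<^bsub>W\<^esub> b') - basis_vec (a, b) - basis_vec (a, b') \<in> tensor_rel V W"
| "\<lbrakk>a \<in> carrier V; b \<in> carrier W\<rbrakk> \<Longrightarrow>
     basis_vec (c \<odot>\<^bsub>V\<^esub> a, b) - fscale c (basis_vec (a, b)) \<in> tensor_rel V W"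
| "\<lbrakk>a \<in> carrier V; b \<in> carrier W\<rbrakk> \<Longrightarrow>
     basis_vec (a, c \<odot>\<^bsub>W\<^esub> b) - fscale c (basis_vec (a, b)) \<in> tensor_rel V W"

definition tensor_free ::
  "('k::field, 'a, 'm) module_scheme \<Rightarrow> ('k, 'b, 'n) module_scheme \<Rightarrow> ('a \<times> 'b \<Rightarrow>\<^sub>0 'k) set" where
  "tensor_free V W = {v. Poly_Mapping.keys v \<subseteq> carrier V \<times> carrier W}"

definition tensor_class ::
  "('k::field, 'a, 'm) module_scheme \<Rightarrow> ('k, 'b, 'n) module_scheme \<Rightarrow>
     ('a \<times> 'b \<Rightarrow>\<^sub>0 'k) \<Rightarrow> ('a \<times> 'b \<Rightarrow>\<^sub>0 'k) set" where
  "tensor_class V W v = {w \<in> tensor_free V W. w - v \<in> tensor_rel V W}"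

definition pure_tensor ::
  "('k::field, 'a, 'm) module_scheme \<Rightarrow> ('k, 'b, 'n) module_scheme \<Rightarrow>
     'a \<Rightarrow> 'b \<Rightarrow> ('a \<times> 'b \<Rightarrow>\<^sub>0 'k) set" where
  "pure_tensor V W a b = tensor_class V W (basis_vec (a, b))"

definition tensor ::
  "('k::field, 'a, 'm) module_scheme \<Rightarrow> ('k, 'b, 'n) module_scheme \<Rightarrow>
     ('k, ('a \<times> 'b \<Rightarrow>\<^sub>0 'k) set) module" where
  "tensor V W =
     \<lparr>carrier = tensor_class V W ` tensor_free V W,
      monoid.mult = (\<lambda>S T. tensor_class V W
        (convolve (\<lambda>(a, b) (a', b'). (a \<otimes>\<^bsub>V\<^esub> a', b \<otimes>\<^bsub>W\<^esub> b')) (rep S) (rep T))),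
      monoid.one = pure_tensor V W \<one>\<^bsub>V\<^esub> \<one>\<^bsub>W\<^esub>,
      ring.zero = tensor_class V W 0,
      add = (\<lambda>S T. tensor_class V W (rep S + rep T)),
      module.smult = (\<lambda>c T. tensor_class V W (fscale c (rep T)))\<rparr>"

text \<open>
  \<open>sweedler P T \<beta>\<close> is the image of the tensor \<open>T\<close> under the linear map to \<open>P\<close> induced by the bilinear
  map \<open>\<beta>\<close>; it does not depend on the chosen representative of \<open>T\<close>. In particular
  \<open>sweedler P (\<Delta> u) (\<lambda>u\<^sub>1 u\<^sub>2. \<beta> u\<^sub>1 u\<^sub>2)\<close> is what Sweedler notation abbreviates as \<open>\<beta> u\<^sub>1 u\<^sub>2\<close>.
\<close>

definition sweedler ::
  "('k::field, 'c, 'm) module_scheme \<Rightarrow> ('a \<times> 'b \<Rightarrow>\<^sub>0 'k) set \<Rightarrow> ('a \<Rightarrow> 'b \<Rightarrow> 'c) \<Rightarrow> 'c" where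
  "sweedler P T \<beta> = lin_ext P (\<lambda>(a, b). \<beta> a b) (rep T)"

section \<open>Hopf algebras\<close>

record (overloaded) ('k::zero, 'a) hopf = "('k, 'a) module" +
  comult :: "'a \<Rightarrow> ('a \<times> 'a \<Rightarrow>\<^sub>0 'k) set"
  counit :: "'a \<Rightarrow> 'k"
  antipode :: "'a \<Rightarrow> 'a"

definition coalgebra :: "('k::field, 'a) hopf \<Rightarrow> bool" where
  "coalgebra C \<longleftrightarrow> vspace C \<and>
     klinear C (tensor C C) (comult C) \<and> klinear C ground (counit C) \<and>
     (\<forall>c\<in>carrier C.
        sweedler (tensor C (tensor C C)) (comult C c)
          (\<lambda>c1 c2. pure_tensor C (tensor C C) c1 (comult C c2)) =
        sweedler (tensor C (tensor C C)) (comult C c) (\<lambda>c1 c2.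
          sweedler (tensor C (tensor C C)) (comult C c1)
            (\<lambda>c11 c12. pure_tensor C (tensor C C) c11 (pure_tensor C C c12 c2)))) \<and>
     (\<forall>c\<in>carrier C.
        sweedler C (comult C c) (\<lambda>c1 c2. counit C c1 \<odot>\<^bsub>C\<^esub> c2) = c \<and>
        sweedler C (comult C c) (\<lambda>c1 c2. counit C c2 \<odot>\<^bsub>C\<^esub> c1) = c)"

definition bialgebra :: "('k::field, 'a) hopf \<Rightarrow> bool" where
  "bialgebra B \<longleftrightarrow> kalgebra B \<and> coalgebra B \<and>
     comult B \<in> ring_hom B (tensor B B) \<and> counit B \<in> ring_hom B ground"

definition hopf_algebra :: "('k::field, 'a) hopf \<Rightarrow> bool" where
  "hopf_algebra H \<longleftrightarrow> bialgebra H \<and> klinear H H (antipode H) \<and>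
     (\<forall>u\<in>carrier H.
        sweedler H (comult H u) (\<lambda>u1 u2. antipode H u1 \<otimes>\<^bsub>H\<^esub> u2) = counit H u \<odot>\<^bsub>H\<^esub> \<one>\<^bsub>H\<^esub> \<and>
        sweedler H (comult H u) (\<lambda>u1 u2. u1 \<otimes>\<^bsub>H\<^esub> antipode H u2) = counit H u \<odot>\<^bsub>H\<^esub> \<one>\<^bsub>H\<^esub>)"

definition hopf_iso :: "('k::field, 'a) hopf \<Rightarrow> ('k, 'b) hopf \<Rightarrow> ('a \<Rightarrow> 'b) set" where
  "hopf_iso A B = {\<phi>. \<phi> \<in> ring_iso A B \<and> klinear A B \<phi> \<and>
     (\<forall>a\<in>carrier A.
        comult B (\<phi> a) =
          sweedler (tensor B B) (comult A a) (\<lambda>a1 a2. pure_tensor B B (\<phi> a1) (\<phi> a2)) \<and>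
        counit B (\<phi> a) = counit A a \<and>
        antipode B (\<phi> a) = \<phi> (antipode A a))}"

definition hopf_isomorphic :: "('k::field, 'a) hopf \<Rightarrow> ('k, 'b) hopf \<Rightarrow> bool" where
  "hopf_isomorphic A B \<longleftrightarrow> hopf_algebra A \<and> hopf_algebra B \<and> hopf_iso A B \<noteq> {}"

section \<open>Group algebras\<close>

definition group_alg :: "('g, 'm) monoid_scheme \<Rightarrow> ('k::field, 'g \<Rightarrow>\<^sub>0 'k) module" where
  "group_alg G =
     \<lparr>carrier = {v. Poly_Mapping.keys v \<subseteq> carrier G},
      monoid.mult = convolve (monoid.mult G),
      monoid.one = basis_vec \<one>\<^bsub>G\<^esub>,
      ring.zero = 0,
      add = (+),
      module.smult = fscale\<rparr>"

definition group_hopf :: "('g, 'm) monoid_scheme \<Rightarrow> ('k::field, 'g \<Rightarrow>\<^sub>0 'k) hopf" where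
  "group_hopf G = (let A = group_alg G in
     module.extend A (hopf.fields
       (lin_ext (tensor A A) (\<lambda>t. pure_tensor A A (basis_vec t) (basis_vec t)))
       (lin_ext ground (\<lambda>t. 1))
       (lin_ext A (\<lambda>t. basis_vec (inv\<^bsub>G\<^esub> t)))))"

section \<open>Algebras given by generators and relations\<close>

definition free_alg :: "'x set \<Rightarrow> ('k::field, 'x list \<Rightarrow>\<^sub>0 'k) module" where
  "free_alg letters =
     \<lparr>carrier = {v. Poly_Mapping.keys v \<subseteq> lists letters},
      monoid.mult = convolve (@),
      monoid.one = basis_vec [],
      ring.zero = 0,
      add = (+),
      module.smult = fscale\<rparr>"

definition quotient_alg :: "('k, 'a) module \<Rightarrow> 'a set \<Rightarrow> ('k, 'a set) module" where
  "quotient_alg A I = ring.extend (A Quot I)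
     (module.fields (\<lambda>c C. (I +>\<^bsub>A\<^esub> (c \<odot>\<^bsub>A\<^esub> \<one>\<^bsub>A\<^esub>)) \<otimes>\<^bsub>A Quot I\<^esub> C))"

text \<open>
  Evaluation of a class of noncommutative polynomials at the elements \<open>\<phi> a\<close> of \<open>B\<close>, for letters \<open>a\<close>:
  if the relations hold in \<open>B\<close>, this is the algebra homomorphism to \<open>B\<close> sending the class of
  each letter \<open>a\<close> to \<open>\<phi> a\<close>.
\<close>

definition alg_eval ::
  "('k::field, 'b, 'm) module_scheme \<Rightarrow> ('x \<Rightarrow> 'b) \<Rightarrow> ('x list \<Rightarrow>\<^sub>0 'k) set \<Rightarrow> 'b" where
  "alg_eval B \<phi> C = lin_ext B (\<lambda>w. foldr (\<lambda>a b. \<phi> a \<otimes>\<^bsub>B\<^esub> b) w \<one>\<^bsub>B\<^esub>) (rep C)"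

section \<open>The Hopf algebras of the third type\<close>

definition k_set :: "'g monoid \<Rightarrow> 'g \<Rightarrow> 'k::field set" where
  "k_set G g = {a. (a ^ CHAR('k) - a) \<odot>\<^bsub>group_alg G\<^esub>
     (\<one>\<^bsub>group_alg G\<^esub> \<ominus>\<^bsub>group_alg G\<^esub> basis_vec (g [^]\<^bsub>G\<^esub> CHAR('k))) = \<zero>\<^bsub>group_alg G\<^esub>}"

definition third_type_datum :: "'g monoid \<Rightarrow> 'g \<Rightarrow> ('g \<Rightarrow> 'k::field) \<Rightarrow> bool" where
  "third_type_datum G g f \<longleftrightarrow> group G \<and> finite (carrier G) \<and>
     g \<in> carrier G \<and> (\<forall>t\<in>carrier G. g \<otimes>\<^bsub>G\<^esub> t = t \<otimes>\<^bsub>G\<^esub> g) \<and>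
     f \<in> hom G (add_monoid ground) \<and> f g = 1 \<and>
     (\<forall>t\<in>carrier G. f t \<in> k_set G g)"

datatype 'g letter = Grp 'g | Skew

abbreviation a3_free :: "'g monoid \<Rightarrow> ('k::field, 'g letter list \<Rightarrow>\<^sub>0 'k) module" where
  "a3_free G \<equiv> free_alg (insert Skew (Grp ` carrier G))"

text \<open>
  The first two families of relations say that the letters \<^term>\<open>Grp t\<close> generate an image of
  the group algebra.
\<close>

definition a3_relations ::
  "'g monoid \<Rightarrow> 'g \<Rightarrow> ('g \<Rightarrow> 'k::field) \<Rightarrow> ('g letter list \<Rightarrow>\<^sub>0 'k) set" where
  "a3_relations G g f = (let F = a3_free G; e = (\<lambda>t. basis_vec [Grp t]); x = basis_vec [Skew] in
     {(e t \<otimes>\<^bsub>F\<^esub> e s) \<ominus>\<^bsub>F\<^esub> e (t \<otimes>\<^bsub>G\<^esub> s) |t s. t \<in> carrier G \<and> s \<in> carrier G} \<union>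
     {e \<one>\<^bsub>G\<^esub> \<ominus>\<^bsub>F\<^esub> \<one>\<^bsub>F\<^esub>} \<union>
     {((e t \<otimes>\<^bsub>F\<^esub> x) \<ominus>\<^bsub>F\<^esub> (x \<otimes>\<^bsub>F\<^esub> e t)) \<ominus>\<^bsub>F\<^esub>
        (f t \<odot>\<^bsub>F\<^esub> (e t \<otimes>\<^bsub>F\<^esub> (\<one>\<^bsub>F\<^esub> \<ominus>\<^bsub>F\<^esub> e g))) |t. t \<in> carrier G} \<union>
     {(x [^]\<^bsub>F\<^esub> CHAR('k)) \<ominus>\<^bsub>F\<^esub> x})"

definition a3_alg ::
  "'g monoid \<Rightarrow> 'g \<Rightarrow> ('g \<Rightarrow> 'k::field) \<Rightarrow> ('k, ('g letter list \<Rightarrow>\<^sub>0 'k) set) module" where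
  "a3_alg G g f = quotient_alg (a3_free G) (genideal (a3_free G) (a3_relations G g f))"

definition a3_letter ::
  "'g monoid \<Rightarrow> 'g \<Rightarrow> ('g \<Rightarrow> 'k::field) \<Rightarrow> 'g letter \<Rightarrow> ('g letter list \<Rightarrow>\<^sub>0 'k) set" where
  "a3_letter G g f a =
     genideal (a3_free G) (a3_relations G g f) +>\<^bsub>a3_free G\<^esub> basis_vec [a]"

definition a3_hopf ::
  "'g monoid \<Rightarrow> 'g \<Rightarrow> ('g \<Rightarrow> 'k::field) \<Rightarrow> ('k, ('g letter list \<Rightarrow>\<^sub>0 'k) set) hopf" where
  "a3_hopf G g f =
    (let A = a3_alg G g f; e = (\<lambda>t. a3_letter G g f (Grp t)); x = a3_letter G g f Skew in
     module.extend A (hopf.fields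
       (alg_eval (tensor A A) (\<lambda>a. case a of
            Grp t \<Rightarrow> pure_tensor A A (e t) (e t)
          | Skew \<Rightarrow> pure_tensor A A x \<one>\<^bsub>A\<^esub> \<oplus>\<^bsub>tensor A A\<^esub> pure_tensor A A (e g) x))
       (alg_eval ground (\<lambda>a. case a of Grp t \<Rightarrow> 1 | Skew \<Rightarrow> 0))
       (alg_eval (opposite A) (\<lambda>a. case a of
            Grp t \<Rightarrow> e (inv\<^bsub>G\<^esub> t)
          | Skew \<Rightarrow> \<ominus>\<^bsub>A\<^esub> (e (inv\<^bsub>G\<^esub> g) \<otimes>\<^bsub>A\<^esub> x)))))"

section \<open>Matched pairs of Hopf algebras\<close>

definition left_module_coalgebra ::
  "('k::field, 'h) hopf \<Rightarrow> ('k, 'a) hopf \<Rightarrow> ('h \<Rightarrow> 'a \<Rightarrow> 'a) \<Rightarrow> bool" where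
  "left_module_coalgebra H A l \<longleftrightarrow>
     (\<forall>a\<in>carrier A. l \<one>\<^bsub>H\<^esub> a = a) \<and>
     (\<forall>u\<in>carrier H. \<forall>v\<in>carrier H. \<forall>a\<in>carrier A. l (u \<otimes>\<^bsub>H\<^esub> v) a = l u (l v a)) \<and>
     (\<forall>u\<in>carrier H. \<forall>a\<in>carrier A.
        comult A (l u a) = sweedler (tensor A A) (comult H u) (\<lambda>u1 u2.
          sweedler (tensor A A) (comult A a) (\<lambda>a1 a2. pure_tensor A A (l u1 a1) (l u2 a2))) \<and>
        counit A (l u a) = counit H u * counit A a)"

definition right_module_coalgebra ::
  "('k::field, 'h) hopf \<Rightarrow> ('k, 'a) hopf \<Rightarrow> ('h \<Rightarrow> 'a \<Rightarrow> 'h) \<Rightarrow> bool" where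
  "right_module_coalgebra H A r \<longleftrightarrow>
     (\<forall>u\<in>carrier H. r u \<one>\<^bsub>A\<^esub> = u) \<and>
     (\<forall>u\<in>carrier H. \<forall>a\<in>carrier A. \<forall>b\<in>carrier A. r u (a \<otimes>\<^bsub>A\<^esub> b) = r (r u a) b) \<and>
     (\<forall>u\<in>carrier H. \<forall>a\<in>carrier A.
        comult H (r u a) = sweedler (tensor H H) (comult H u) (\<lambda>u1 u2.
          sweedler (tensor H H) (comult A a) (\<lambda>a1 a2. pure_tensor H H (r u1 a1) (r u2 a2))) \<and>
        counit H (r u a) = counit H u * counit A a)"

text \<open>
  The actions are linear maps on \<^term>\<open>tensor H A\<close>, restricted to its carrier so that equality of
  matched pairs is equality of functions.
\<close>

definition hopf_matched_pair ::
  "('k::field, 'a) hopf \<Rightarrow> ('k, 'h) hopf \<Rightarrow>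
     (('h \<times> 'a \<Rightarrow>\<^sub>0 'k) set \<Rightarrow> 'a) \<Rightarrow> (('h \<times> 'a \<Rightarrow>\<^sub>0 'k) set \<Rightarrow> 'h) \<Rightarrow> bool" where
  "hopf_matched_pair A H \<alpha> \<beta> \<longleftrightarrow>
    (let l = (\<lambda>u a. \<alpha> (pure_tensor H A u a)); r = (\<lambda>u a. \<beta> (pure_tensor H A u a)) in
     hopf_algebra A \<and> hopf_algebra H \<and>
     klinear (tensor H A) A \<alpha> \<and> \<alpha> \<in> extensional (carrier (tensor H A)) \<and>
     klinear (tensor H A) H \<beta> \<and> \<beta> \<in> extensional (carrier (tensor H A)) \<and>
     left_module_coalgebra H A l \<and> right_module_coalgebra H A r \<and>
     (\<forall>u\<in>carrier H. l u \<one>\<^bsub>A\<^esub> = counit H u \<odot>\<^bsub>A\<^esub> \<one>\<^bsub>A\<^esub>) \<and>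
     (\<forall>a\<in>carrier A. r \<one>\<^bsub>H\<^esub> a = counit A a \<odot>\<^bsub>H\<^esub> \<one>\<^bsub>H\<^esub>) \<and>
     (\<forall>u\<in>carrier H. \<forall>a\<in>carrier A. \<forall>b\<in>carrier A.
        l u (a \<otimes>\<^bsub>A\<^esub> b) = sweedler A (comult H u) (\<lambda>u1 u2. sweedler A (comult A a) (\<lambda>a1 a2.
          l u1 a1 \<otimes>\<^bsub>A\<^esub> l (r u2 a2) b))) \<and>
     (\<forall>u\<in>carrier H. \<forall>v\<in>carrier H. \<forall>a\<in>carrier A.
        r (u \<otimes>\<^bsub>H\<^esub> v) a = sweedler H (comult H v) (\<lambda>v1 v2. sweedler H (comult A a) (\<lambda>a1 a2.
          r u (l v1 a1) \<otimes>\<^bsub>H\<^esub> r v2 a2))) \<and>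
     (\<forall>u\<in>carrier H. \<forall>a\<in>carrier A.
        sweedler (tensor H A) (comult H u) (\<lambda>u1 u2. sweedler (tensor H A) (comult A a) (\<lambda>a1 a2.
          pure_tensor H A (r u1 a1) (l u2 a2))) =
        sweedler (tensor H A) (comult H u) (\<lambda>u1 u2. sweedler (tensor H A) (comult A a) (\<lambda>a1 a2.
          pure_tensor H A (r u2 a2) (l u1 a1)))))"

definition bicrossed_mult ::
  "('k::field, 'a) hopf \<Rightarrow> ('k, 'h) hopf \<Rightarrow>
     (('h \<times> 'a \<Rightarrow>\<^sub>0 'k) set \<Rightarrow> 'a) \<Rightarrow> (('h \<times> 'a \<Rightarrow>\<^sub>0 'k) set \<Rightarrow> 'h) \<Rightarrow>
     ('a \<times> 'h \<Rightarrow>\<^sub>0 'k) set \<Rightarrow> ('a \<times> 'h \<Rightarrow>\<^sub>0 'k) set \<Rightarrow> ('a \<times> 'h \<Rightarrow>\<^sub>0 'k) set" where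
  "bicrossed_mult A H \<alpha> \<beta> S T =
    (let V = tensor A H;
         l = (\<lambda>u a. \<alpha> (pure_tensor H A u a)); r = (\<lambda>u a. \<beta> (pure_tensor H A u a)) in
     sweedler V S (\<lambda>a u. sweedler V T (\<lambda>b v.
       sweedler V (comult H u) (\<lambda>u1 u2. sweedler V (comult A b) (\<lambda>b1 b2.
         pure_tensor A H (a \<otimes>\<^bsub>A\<^esub> l u1 b1) (r u2 b2 \<otimes>\<^bsub>H\<^esub> v))))))"

text \<open>
  The antipode is forced by \<open>a \<bowtie> u = (a \<bowtie> 1)(1 \<bowtie> u)\<close>, the fact that \<open>A\<close> and \<open>H\<close> are Hopf subalgebras,
  and antimultiplicativity: \<open>S(a \<bowtie> u) = (1 \<bowtie> S(u))(S(a) \<bowtie> 1)\<close>.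
\<close>

definition bicrossed ::
  "('k::field, 'a) hopf \<Rightarrow> ('k, 'h) hopf \<Rightarrow>
     (('h \<times> 'a \<Rightarrow>\<^sub>0 'k) set \<Rightarrow> 'a) \<Rightarrow> (('h \<times> 'a \<Rightarrow>\<^sub>0 'k) set \<Rightarrow> 'h) \<Rightarrow>
     ('k, ('a \<times> 'h \<Rightarrow>\<^sub>0 'k) set) hopf" where
  "bicrossed A H \<alpha> \<beta> = (let V = (tensor A H)\<lparr>monoid.mult := bicrossed_mult A H \<alpha> \<beta>\<rparr> in
     module.extend V (hopf.fields
       (\<lambda>T. sweedler (tensor V V) T (\<lambda>a u.
          sweedler (tensor V V) (comult A a) (\<lambda>a1 a2.
            sweedler (tensor V V) (comult H u) (\<lambda>u1 u2.
              pure_tensor V V (pure_tensor A H a1 u1) (pure_tensor A H a2 u2)))))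
       (\<lambda>T. sweedler ground T (\<lambda>a u. counit A a * counit H u))
       (\<lambda>T. sweedler V T (\<lambda>a u.
          pure_tensor A H \<one>\<^bsub>A\<^esub> (antipode H u) \<otimes>\<^bsub>V\<^esub> pure_tensor A H (antipode A a) \<one>\<^bsub>H\<^esub>))))"

section \<open>Matched pairs of groups\<close>

definition group_matched_pair ::
  "'c monoid \<Rightarrow> 'g monoid \<Rightarrow> ('g \<times> 'c \<Rightarrow> 'c) \<Rightarrow> ('g \<times> 'c \<Rightarrow> 'g) \<Rightarrow> bool" where
  "group_matched_pair \<Gamma> G l r \<longleftrightarrow> group \<Gamma> \<and> group G \<and>
     l \<in> carrier G \<times> carrier \<Gamma> \<rightarrow>\<^sub>E carrier \<Gamma> \<and>
     r \<in> carrier G \<times> carrier \<Gamma> \<rightarrow>\<^sub>E carrier G \<and>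
     (\<forall>h\<in>carrier \<Gamma>. l (\<one>\<^bsub>G\<^esub>, h) = h) \<and>
     (\<forall>t\<in>carrier G. \<forall>s\<in>carrier G. \<forall>h\<in>carrier \<Gamma>. l (t \<otimes>\<^bsub>G\<^esub> s, h) = l (t, l (s, h))) \<and>
     (\<forall>t\<in>carrier G. r (t, \<one>\<^bsub>\<Gamma>\<^esub>) = t) \<and>
     (\<forall>t\<in>carrier G. \<forall>h\<in>carrier \<Gamma>. \<forall>k\<in>carrier \<Gamma>. r (t, h \<otimes>\<^bsub>\<Gamma>\<^esub> k) = r (r (t, h), k)) \<and>
     (\<forall>t\<in>carrier G. \<forall>h\<in>carrier \<Gamma>. \<forall>k\<in>carrier \<Gamma>.
        l (t, h \<otimes>\<^bsub>\<Gamma>\<^esub> k) = l (t, h) \<otimes>\<^bsub>\<Gamma>\<^esub> l (r (t, h), k)) \<and>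
     (\<forall>t\<in>carrier G. \<forall>s\<in>carrier G. \<forall>h\<in>carrier \<Gamma>.
        r (t \<otimes>\<^bsub>G\<^esub> s, h) = r (t, l (s, h)) \<otimes>\<^bsub>G\<^esub> r (s, h))"

definition group_bicrossed ::
  "'c monoid \<Rightarrow> 'g monoid \<Rightarrow> ('g \<times> 'c \<Rightarrow> 'c) \<Rightarrow> ('g \<times> 'c \<Rightarrow> 'g) \<Rightarrow> ('c \<times> 'g) monoid" where
  "group_bicrossed \<Gamma> G l r =
     \<lparr>carrier = carrier \<Gamma> \<times> carrier G,
      monoid.mult = (\<lambda>(h, t) (k, s). (h \<otimes>\<^bsub>\<Gamma>\<^esub> l (t, k), r (t, k) \<otimes>\<^bsub>G\<^esub> s)),
      monoid.one = (\<one>\<^bsub>\<Gamma>\<^esub>, \<one>\<^bsub>G\<^esub>)\<rparr>"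

definition matched_pair_datum ::
  "'c monoid \<Rightarrow> 'g monoid \<Rightarrow> 'g \<Rightarrow> ('g \<Rightarrow> 'k::field) \<Rightarrow>
     ('g \<times> 'c \<Rightarrow> 'c) \<Rightarrow> ('g \<times> 'c \<Rightarrow> 'g) \<Rightarrow> ('c \<Rightarrow> 'k) \<Rightarrow> bool" where
  "matched_pair_datum \<Gamma> G g f l r \<gamma> \<longleftrightarrow>
     group_matched_pair \<Gamma> G l r \<and>
     (\<forall>h\<in>carrier \<Gamma>. l (g, h) = h \<and> r (g, h) = g) \<and>
     \<gamma> \<in> hom \<Gamma> ((add_monoid ground)\<lparr>carrier := k_set G g\<rparr>) \<and> \<gamma> \<in> extensional (carrier \<Gamma>) \<and>
     (\<forall>t\<in>carrier G. \<forall>h\<in>carrier \<Gamma>. f (r (t, h)) = f t + \<gamma> (l (t, h)) - \<gamma> h)"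

end

theory Submission
  imports Defs
begin

text \<open>
  Write \<open>A = k[\<Gamma>]\<close>, let \<open>H\<close> be the third-type Hopf algebra, \<open>p\<close> the characteristic, and write
  \<open>x\<^bsup>(n)\<^esup>\<close> for the falling factorial \<open>x (x - 1) \<dots> (x - n + 1)\<close>.

  Restriction to group-like elements. The actions are coalgebra maps, so they send a pair of
  group-like elements to a group-like element. The nonzero group-like elements of \<open>A\<close> and \<open>H\<close> are
  the elements of \<open>\<Gamma>\<close> and \<open>G\<close> (\<open>group_like_A\<close>, \<open>group_like_H\<close>), and there the axioms of a matched pair of Hopf
  algebras become those of a matched pair of groups.

  The generator \<open>x\<close>. The element \<open>x \<triangleleft> h\<close> is skew-primitive for \<open>s = g \<triangleleft> h\<close>, hence equal to
  \<open>a x + b (1 - s)\<close>, and \<open>a \<noteq> 0\<close> forces \<open>s = g\<close> (\<open>skew_primitive_H\<close>). If \<open>a\<close> were \<open>0\<close>, acting with the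
  inverse of \<open>h\<close> would bring \<open>x\<close> into \<open>k[G]\<close>. Comparing coordinates in the last compatibility axiom at
  \<open>(x, h)\<close> gives \<open>g \<triangleright> h = h\<close> and \<open>x \<triangleright> h = 0\<close> (\<open>L_x\<close>). The relation \<open>t x - x t = f(t) t (1 - g)\<close>, acted on
  by \<open>h\<close>, gives \<open>a = 1\<close> for \<open>t = g\<close>, and for general \<open>t\<close> the equation relating \<open>f\<close> and \<open>\<gamma>\<close>
  (\<open>R_x_shift\<close>). Finally \<open>x\<^sup>p = x\<close> forces \<open>\<gamma>\<^sub>h \<in> k\<^sub>g\<close>, and \<open>x \<triangleleft> (h k) = (x \<triangleleft> h) \<triangleleft> k\<close> makes \<open>\<gamma>\<close> additive.

  The converse. In characteristic \<open>p\<close> the relation \<open>x\<^sup>p = x\<close> says \<open>x\<^bsup>(p)\<^esup> = 0\<close>, and the elements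
  \<open>t x\<^bsup>(n)\<^esup>\<close> with \<open>t \<in> G\<close> and \<open>n < p\<close> form a basis of \<open>H\<close>. On this basis the actions have to be
  \<open>t x\<^bsup>(n)\<^esup> \<triangleleft> h = (t \<triangleleft> h) (x + \<gamma>\<^sub>h (1 - g))\<^bsup>(n)\<^esup>\<close>, and \<open>t x\<^bsup>(n)\<^esup> \<triangleright> h\<close> is \<open>t \<triangleright> h\<close> for \<open>n = 0\<close> and \<open>0\<close>
  otherwise. Falling factorials are used in place of powers because they obey a binomial theorem
  for \<open>x + g y\<close> when \<open>g x = x g + g - g\<^sup>2\<close> and \<open>y\<close> commutes with \<open>x\<close> and \<open>g\<close> (\<open>ffact_binomial\<close>). It
  gives the coproduct of the basis, and with \<open>p\<close> factors it gives
  \<open>(x + c (1 - g))\<^bsup>(p)\<^esup> = (c\<^sup>p - c) (1 - g\<^sup>p)\<close>, which vanishes exactly for \<open>c \<in> k\<^sub>g\<close>. Both sides of every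
  axiom are multilinear, so the axioms need to be compared on basis elements only
  (\<open>hopf_matched_pair_datum\<close>).

  The bicrossed product. Let \<open>L = \<Gamma> \<bowtie> G\<close> and let \<open>B\<close> be the third-type Hopf algebra of
  \<open>(L, (1, g), F)\<close>. The inclusions of \<open>\<Gamma>\<close> and \<open>G\<close> into \<open>L\<close> induce homomorphisms \<open>i\<close> from \<open>A\<close> and \<open>j\<close> from
  \<open>H\<close> to \<open>B\<close>, and \<open>\<mu>(a \<otimes> u) = i(a) j(u)\<close> maps the basis \<open>h \<otimes> t x\<^bsup>(n)\<^esup>\<close> to the basis \<open>(h, t) x\<^bsup>(n)\<^esup>\<close> of \<open>B\<close>.
  The commutation rule \<open>j(u) i(b) = i(u\<^sub>1 \<triangleright> b\<^sub>1) j(u\<^sub>2 \<triangleleft> b\<^sub>2)\<close> (\<open>inc_commute\<close>) says that \<open>\<mu>\<close> carries the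
  bicrossed multiplication to that of \<open>B\<close>. As \<open>\<mu>\<close> also respects the remaining structure, the
  bicrossed product is a Hopf algebra and \<open>\<mu>\<close> is an isomorphism (\<open>hopf_transport\<close>).
\<close>

section \<open>Linear algebra over the ground field\<close>


lemma ground_simps [simp]:
  "carrier ground = UNIV" "c \<otimes>\<^bsub>ground\<^esub> d = c * d" "\<one>\<^bsub>ground\<^esub> = 1" "\<zero>\<^bsub>ground\<^esub> = 0"
  "c \<oplus>\<^bsub>ground\<^esub> d = c + d" "c \<odot>\<^bsub>ground\<^esub> d = c * d"
  by (simp_all add: ground_def ring.defs module.defs ring_of_type_algebra_def)

lemma cring_ground: "cring (ground :: ('k::field, 'k) module)"
proof -
  have "\<exists>y. x + y = 0" for x :: 'k
    using add.right_inverse by blast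
  thus ?thesis
    by unfold_locales (auto simp: algebra_simps Units_def)
qed

lemma vspaceI:
  assumes "abelian_group V"
    and "\<And>c a. a \<in> carrier V \<Longrightarrow> c \<odot>\<^bsub>V\<^esub> a \<in> carrier V"
    and "\<And>c d a. a \<in> carrier V \<Longrightarrow> (c + d) \<odot>\<^bsub>V\<^esub> a = c \<odot>\<^bsub>V\<^esub> a \<oplus>\<^bsub>V\<^esub> d \<odot>\<^bsub>V\<^esub> a"
    and "\<And>c a b. a \<in> carrier V \<Longrightarrow> b \<in> carrier V \<Longrightarrow> c \<odot>\<^bsub>V\<^esub> (a \<oplus>\<^bsub>V\<^esub> b) = c \<odot>\<^bsub>V\<^esub> a \<oplus>\<^bsub>V\<^esub> c \<odot>\<^bsub>V\<^esub> b"
    and "\<And>c d a. a \<in> carrier V \<Longrightarrow> (c * d) \<odot>\<^bsub>V\<^esub> a = c \<odot>\<^bsub>V\<^esub> (d \<odot>\<^bsub>V\<^esub> a)"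
    and "\<And>a. a \<in> carrier V \<Longrightarrow> 1 \<odot>\<^bsub>V\<^esub> a = a"
  shows "vspace V"
  unfolding vspace_def by (rule moduleI) (use assms cring_ground in auto)

lemma vspace_abelian_group: "vspace V \<Longrightarrow> abelian_group V"
  by (simp add: vspace_def module_def)

text \<open>
  The laws of vector spaces, and below those of algebras, with carrier memberships as premises: in
  this form they serve as rewrite rules for all the concrete structures that follow.
\<close>

context
  fixes V :: "('k::field, 'a, 'm) module_scheme" (structure)
  assumes V: "vspace V"
begin

interpretation module ground V using V by (simp add: vspace_def)

lemma vs_zero [simp]: "\<zero> \<in> carrier V" by simp
lemma vs_add [simp]: "a \<in> carrier V \<Longrightarrow> b \<in> carrier V \<Longrightarrow> a \<oplus> b \<in> carrier V" by simp
lemma vs_uminus [simp]: "a \<in> carrier V \<Longrightarrow> \<ominus> a \<in> carrier V" by simp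
lemma vs_minus [simp]: "a \<in> carrier V \<Longrightarrow> b \<in> carrier V \<Longrightarrow> a \<ominus> b \<in> carrier V" by simp
lemma vs_smult [simp]: "a \<in> carrier V \<Longrightarrow> c \<odot> a \<in> carrier V" by simp
lemma vs_comm: "a \<in> carrier V \<Longrightarrow> b \<in> carrier V \<Longrightarrow> a \<oplus> b = b \<oplus> a" by (rule M.a_comm)
lemma vs_assoc: "a \<in> carrier V \<Longrightarrow> b \<in> carrier V \<Longrightarrow> c \<in> carrier V \<Longrightarrow>
   a \<oplus> b \<oplus> c = a \<oplus> (b \<oplus> c)" by (rule M.a_assoc)
lemma vs_zero_add [simp]: "a \<in> carrier V \<Longrightarrow> \<zero> \<oplus> a = a" by simp
lemma vs_add_zero [simp]: "a \<in> carrier V \<Longrightarrow> a \<oplus> \<zero> = a" by simp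
lemma vs_smult_add: "a \<in> carrier V \<Longrightarrow> (c + d) \<odot> a = c \<odot> a \<oplus> d \<odot> a"
  using smult_l_distr[of c d a] by simp
lemma vs_smult_distr: "a \<in> carrier V \<Longrightarrow> b \<in> carrier V \<Longrightarrow>
   c \<odot> (a \<oplus> b) = c \<odot> a \<oplus> c \<odot> b"
  by (simp add: smult_r_distr)
lemma vs_smult_smult [simp]: "a \<in> carrier V \<Longrightarrow> c \<odot> (d \<odot> a) = (c * d) \<odot> a"
  using smult_assoc1[of c d a] by simp
lemma vs_one_smult [simp]: "a \<in> carrier V \<Longrightarrow> 1 \<odot> a = a"
  using smult_one[of a] by simp
lemma vs_zero_smult [simp]: "a \<in> carrier V \<Longrightarrow> 0 \<odot> a = \<zero>"
  using smult_l_null[of a] by simp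
lemma vs_smult_zero [simp]: "c \<odot> \<zero> = \<zero>"
  by simp
lemma vs_uminus_smult: "a \<in> carrier V \<Longrightarrow> \<ominus> a = (-1) \<odot> a"
proof -
  assume a: "a \<in> carrier V"
  have "(-1) \<odot> a \<oplus> a = ((-1) + 1) \<odot> a"
    using a by (subst vs_smult_add) auto
  also have "\<dots> = \<zero>" using a by simp
  finally show ?thesis using a M.minus_equality by simp
qed
lemma vs_minus_smult: "a \<in> carrier V \<Longrightarrow> b \<in> carrier V \<Longrightarrow> a \<ominus> b = a \<oplus> (-1) \<odot> b"
  by (simp add: a_minus_def vs_uminus_smult)
lemma vs_minus_eq_zero: "a \<in> carrier V \<Longrightarrow> b \<in> carrier V \<Longrightarrow> a \<ominus> b = \<zero> \<longleftrightarrow> a = b"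
  by (simp add: a_minus_def M.add.inv_solve_right'[symmetric] M.add.right_cancel M.add.inv_solve_right')

lemma vs_smult_cancel: "a \<in> carrier V \<Longrightarrow> c \<noteq> 0 \<Longrightarrow> c \<odot> a = \<zero> \<Longrightarrow> a = \<zero>"
  by (metis field_class.field_inverse vs_one_smult vs_smult_smult vs_smult_zero)

end

lemma vspace_ground [simp]: "vspace ground"
  using cring_ground by (intro vspaceI cring.axioms(1)[THEN ring.is_abelian_group])
    (simp_all add: algebra_simps cring_def ring.is_abelian_group)

lemma kalgebra_vspace [simp]: "kalgebra B \<Longrightarrow> vspace B" by (simp add: kalgebra_def)
lemma kalgebra_ring: "kalgebra B \<Longrightarrow> Ring.ring B" by (simp add: kalgebra_def)

context
  fixes B :: "('k::field, 'a, 'm) module_scheme" (structure)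
  assumes B: "kalgebra B"
begin

interpretation Ring.ring B using B by (simp add: kalgebra_def)

lemma ka_one [simp]: "\<one> \<in> carrier B" by simp
lemma ka_mult [simp]: "a \<in> carrier B \<Longrightarrow> b \<in> carrier B \<Longrightarrow> a \<otimes> b \<in> carrier B" by simp
lemma ka_pow [simp]: "a \<in> carrier B \<Longrightarrow> a [^] (n::nat) \<in> carrier B" by simp
lemma ka_one_mult [simp]: "a \<in> carrier B \<Longrightarrow> \<one> \<otimes> a = a" by simp
lemma ka_mult_one [simp]: "a \<in> carrier B \<Longrightarrow> a \<otimes> \<one> = a" by simp
lemma ka_assoc: "a \<in> carrier B \<Longrightarrow> b \<in> carrier B \<Longrightarrow> c \<in> carrier B \<Longrightarrow>
   a \<otimes> b \<otimes> c = a \<otimes> (b \<otimes> c)" by (rule m_assoc)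
lemma ka_smult_mult: "a \<in> carrier B \<Longrightarrow> b \<in> carrier B \<Longrightarrow> (c \<odot> a) \<otimes> b = c \<odot> (a \<otimes> b)"
  using B by (simp add: kalgebra_def)
lemma ka_mult_smult: "a \<in> carrier B \<Longrightarrow> b \<in> carrier B \<Longrightarrow> a \<otimes> (c \<odot> b) = c \<odot> (a \<otimes> b)"
  using B by (simp add: kalgebra_def)
lemma ka_add_mult: "a \<in> carrier B \<Longrightarrow> b \<in> carrier B \<Longrightarrow> c \<in> carrier B \<Longrightarrow>
   (a \<oplus> b) \<otimes> c = a \<otimes> c \<oplus> b \<otimes> c" by (rule l_distr)
lemma ka_mult_add: "a \<in> carrier B \<Longrightarrow> b \<in> carrier B \<Longrightarrow> c \<in> carrier B \<Longrightarrow>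
   a \<otimes> (b \<oplus> c) = a \<otimes> b \<oplus> a \<otimes> c" by (simp add: r_distr)
lemma ka_minus_mult: "a \<in> carrier B \<Longrightarrow> b \<in> carrier B \<Longrightarrow> c \<in> carrier B \<Longrightarrow>
   (a \<ominus> b) \<otimes> c = a \<otimes> c \<ominus> b \<otimes> c" by (simp add: a_minus_def l_distr l_minus)
lemma ka_mult_minus: "a \<in> carrier B \<Longrightarrow> b \<in> carrier B \<Longrightarrow> c \<in> carrier B \<Longrightarrow>
   a \<otimes> (b \<ominus> c) = a \<otimes> b \<ominus> a \<otimes> c" by (simp add: a_minus_def r_distr r_minus)
lemma ka_zero_mult [simp]: "a \<in> carrier B \<Longrightarrow> \<zero> \<otimes> a = \<zero>" by simp
lemma ka_mult_zero [simp]: "a \<in> carrier B \<Longrightarrow> a \<otimes> \<zero> = \<zero>" by simp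
lemma ka_uminus_mult: "a \<in> carrier B \<Longrightarrow> b \<in> carrier B \<Longrightarrow> (\<ominus> a) \<otimes> b = \<ominus> (a \<otimes> b)" by (simp add: l_minus)
lemma ka_mult_uminus: "a \<in> carrier B \<Longrightarrow> b \<in> carrier B \<Longrightarrow> a \<otimes> (\<ominus> b) = \<ominus> (a \<otimes> b)" by (simp add: r_minus)

end

lemmas ka_distribs = ka_add_mult ka_mult_add ka_minus_mult ka_mult_minus ka_smult_mult
  ka_mult_smult ka_uminus_mult ka_mult_uminus

lemma kalgebraI:
  assumes "vspace B" "\<one>\<^bsub>B\<^esub> \<in> carrier B"
    and "\<And>a b. a \<in> carrier B \<Longrightarrow> b \<in> carrier B \<Longrightarrow> a \<otimes>\<^bsub>B\<^esub> b \<in> carrier B"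
    and "\<And>a b c. a \<in> carrier B \<Longrightarrow> b \<in> carrier B \<Longrightarrow> c \<in> carrier B \<Longrightarrow>
       a \<otimes>\<^bsub>B\<^esub> b \<otimes>\<^bsub>B\<^esub> c = a \<otimes>\<^bsub>B\<^esub> (b \<otimes>\<^bsub>B\<^esub> c)"
    and "\<And>a. a \<in> carrier B \<Longrightarrow> \<one>\<^bsub>B\<^esub> \<otimes>\<^bsub>B\<^esub> a = a" "\<And>a. a \<in> carrier B \<Longrightarrow> a \<otimes>\<^bsub>B\<^esub> \<one>\<^bsub>B\<^esub> = a"
    and "\<And>a b c. a \<in> carrier B \<Longrightarrow> b \<in> carrier B \<Longrightarrow> c \<in> carrier B \<Longrightarrow>
       (a \<oplus>\<^bsub>B\<^esub> b) \<otimes>\<^bsub>B\<^esub> c = a \<otimes>\<^bsub>B\<^esub> c \<oplus>\<^bsub>B\<^esub> b \<otimes>\<^bsub>B\<^esub> c"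
    and "\<And>a b c. a \<in> carrier B \<Longrightarrow> b \<in> carrier B \<Longrightarrow> c \<in> carrier B \<Longrightarrow>
       c \<otimes>\<^bsub>B\<^esub> (a \<oplus>\<^bsub>B\<^esub> b) = c \<otimes>\<^bsub>B\<^esub> a \<oplus>\<^bsub>B\<^esub> c \<otimes>\<^bsub>B\<^esub> b"
    and "\<And>c a b. a \<in> carrier B \<Longrightarrow> b \<in> carrier B \<Longrightarrow> (c \<odot>\<^bsub>B\<^esub> a) \<otimes>\<^bsub>B\<^esub> b = c \<odot>\<^bsub>B\<^esub> (a \<otimes>\<^bsub>B\<^esub> b)"
    and "\<And>c a b. a \<in> carrier B \<Longrightarrow> b \<in> carrier B \<Longrightarrow> a \<otimes>\<^bsub>B\<^esub> (c \<odot>\<^bsub>B\<^esub> b) = c \<odot>\<^bsub>B\<^esub> (a \<otimes>\<^bsub>B\<^esub> b)"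
  shows "kalgebra B"
  unfolding kalgebra_def using assms
  by (auto intro!: ringI vspace_abelian_group monoidI)

subsection \<open>Linear maps\<close>

lemma klinearI [intro?]:
  assumes "\<And>a. a \<in> carrier V \<Longrightarrow> \<phi> a \<in> carrier W"
    and "\<And>a b. a \<in> carrier V \<Longrightarrow> b \<in> carrier V \<Longrightarrow> \<phi> (a \<oplus>\<^bsub>V\<^esub> b) = \<phi> a \<oplus>\<^bsub>W\<^esub> \<phi> b"
    and "\<And>c a. a \<in> carrier V \<Longrightarrow> \<phi> (c \<odot>\<^bsub>V\<^esub> a) = c \<odot>\<^bsub>W\<^esub> \<phi> a"
  shows "klinear V W \<phi>"
  using assms by (auto simp: klinear_def)

lemma klinear_closed: "klinear V W \<phi> \<Longrightarrow> a \<in> carrier V \<Longrightarrow> \<phi> a \<in> carrier W"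
  by (auto simp: klinear_def)
lemma klinear_add: "klinear V W \<phi> \<Longrightarrow> a \<in> carrier V \<Longrightarrow> b \<in> carrier V \<Longrightarrow>
   \<phi> (a \<oplus>\<^bsub>V\<^esub> b) = \<phi> a \<oplus>\<^bsub>W\<^esub> \<phi> b"
  by (auto simp: klinear_def)
lemma klinear_smult: "klinear V W \<phi> \<Longrightarrow> a \<in> carrier V \<Longrightarrow> \<phi> (c \<odot>\<^bsub>V\<^esub> a) = c \<odot>\<^bsub>W\<^esub> \<phi> a"
  by (auto simp: klinear_def)
lemma klinear_zero: "klinear V W \<phi> \<Longrightarrow> vspace V \<Longrightarrow> vspace W \<Longrightarrow> \<phi> \<zero>\<^bsub>V\<^esub> = \<zero>\<^bsub>W\<^esub>"
  using klinear_smult[of V W \<phi> "\<zero>\<^bsub>V\<^esub>" 0] klinear_closed[of V W \<phi> "\<zero>\<^bsub>V\<^esub>"] by simp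
lemma klinear_uminus: "klinear V W \<phi> \<Longrightarrow> vspace V \<Longrightarrow> vspace W \<Longrightarrow> a \<in> carrier V \<Longrightarrow> \<phi> (\<ominus>\<^bsub>V\<^esub> a) = \<ominus>\<^bsub>W\<^esub> \<phi> a"
  by (simp add: vs_uminus_smult[of V] vs_uminus_smult[of W] klinear_smult[of V W] klinear_closed[of V W])
lemma klinear_minus: "klinear V W \<phi> \<Longrightarrow> vspace V \<Longrightarrow> vspace W \<Longrightarrow> a \<in> carrier V \<Longrightarrow> b \<in> carrier V \<Longrightarrow>
   \<phi> (a \<ominus>\<^bsub>V\<^esub> b) = \<phi> a \<ominus>\<^bsub>W\<^esub> \<phi> b"
  by (simp add: a_minus_def klinear_add[of V W] klinear_uminus[of V W])

lemma klinear_id: "klinear V V (\<lambda>a. a)"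
  by (rule klinearI) auto
lemma klinear_comp: "klinear V W \<phi> \<Longrightarrow> klinear W U \<psi> \<Longrightarrow> klinear V U (\<lambda>a. \<psi> (\<phi> a))"
  by (auto simp: klinear_def Pi_def)
lemma klinear_sum: "klinear V W \<phi> \<Longrightarrow> klinear V W \<psi> \<Longrightarrow> vspace W \<Longrightarrow> klinear V W (\<lambda>a. \<phi> a \<oplus>\<^bsub>W\<^esub> \<psi> a)"
proof (rule klinearI, goal_cases)
  case (2 a b)
  then have c: "\<phi> a \<in> carrier W" "\<phi> b \<in> carrier W" "\<psi> a \<in> carrier W" "\<psi> b \<in> carrier W"
    by (auto intro: klinear_closed)
  interpret abelian_group W using 2 by (simp add: vspace_abelian_group)
  show ?case using 2 c by (simp add: klinear_add[OF 2(1)] klinear_add[OF 2(2)] a_ac)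
qed (simp_all add: klinear_smult[of V W] klinear_closed[of V W] vs_smult_distr)
lemma klinear_scale: "klinear V W \<phi> \<Longrightarrow> vspace W \<Longrightarrow> klinear V W (\<lambda>a. c \<odot>\<^bsub>W\<^esub> \<phi> a)"
  by (rule klinearI) (simp_all add: klinear_add[of V W] klinear_smult[of V W] klinear_closed[of V W] vs_smult_distr mult.commute)
lemma klinear_const_zero: "vspace W \<Longrightarrow> klinear V W (\<lambda>a. \<zero>\<^bsub>W\<^esub>)"
  by (rule klinearI) auto
lemma klinear_cong: "klinear V W \<phi> \<Longrightarrow> (\<And>a. a \<in> carrier V \<Longrightarrow> \<phi> a = \<psi> a) \<Longrightarrow> vspace V \<Longrightarrow> klinear V W \<psi>"
  by (auto simp: klinear_def Pi_def)
lemma klinear_mult_left: "kalgebra B \<Longrightarrow> b \<in> carrier B \<Longrightarrow> klinear B B (\<lambda>a. b \<otimes>\<^bsub>B\<^esub> a)"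
  by (rule klinearI) (auto simp: ka_distribs)
lemma klinear_mult_right: "kalgebra B \<Longrightarrow> b \<in> carrier B \<Longrightarrow> klinear B B (\<lambda>a. a \<otimes>\<^bsub>B\<^esub> b)"
  by (rule klinearI) (auto simp: ka_distribs)
lemma klinear_smult_vec: "vspace V \<Longrightarrow> b \<in> carrier V \<Longrightarrow> klinear ground V (\<lambda>c. c \<odot>\<^bsub>V\<^esub> b)"
  by (rule klinearI) (auto simp: vs_smult_add)

subsection \<open>Free vector spaces\<close>

lemma lookup_fscale [simp]: "Poly_Mapping.lookup (fscale c v) a = c * Poly_Mapping.lookup v a"
  by (simp add: fscale_def map.rep_eq when_def)

lemma keys_fscale: "Poly_Mapping.keys (fscale c v) \<subseteq> Poly_Mapping.keys v"
  by (auto simp: in_keys_iff)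

lemma fscale_simps [simp]:
  "fscale c (v + w) = fscale c v + fscale c w" "fscale (c + d) v = fscale c v + fscale d v"
  "fscale c (fscale d v) = fscale (c * d) v" "fscale 1 v = v" "fscale 0 v = 0" "fscale c 0 = 0"
  "fscale c (Poly_Mapping.single a d) = Poly_Mapping.single a (c * d)"
  "fscale c (v - w) = fscale c v - fscale c w" "fscale (-1) v = - v"
  by (rule poly_mapping_eqI; simp add: algebra_simps lookup_add lookup_minus lookup_single when_def)+

lemma free_induct [consumes 1, case_names zero add single]:
  fixes P :: "('x \<Rightarrow>\<^sub>0 'k::field) \<Rightarrow> bool"
  assumes "Poly_Mapping.keys v \<subseteq> U"
    and "P 0"
    and "\<And>v w. \<lbrakk>Poly_Mapping.keys v \<subseteq> U; Poly_Mapping.keys w \<subseteq> U; P v; P w\<rbrakk> \<Longrightarrow> P (v + w)"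
    and "\<And>a c. a \<in> U \<Longrightarrow> P (Poly_Mapping.single a c)"
  shows "P v"
proof -
  have "finite F \<Longrightarrow> \<forall>v::'x \<Rightarrow>\<^sub>0 'k. Poly_Mapping.keys v = F \<longrightarrow> F \<subseteq> U \<longrightarrow> P v" for F
  proof (induction F rule: finite_induct)
    case empty
    then show ?case using assms(2) by simp
  next
    case (insert a F)
    show ?case
    proof (intro allI impI)
      fix v :: "'x \<Rightarrow>\<^sub>0 'k"
      assume v: "Poly_Mapping.keys v = insert a F" "insert a F \<subseteq> U"
      let ?s = "Poly_Mapping.single a (Poly_Mapping.lookup v a)"
      have k: "Poly_Mapping.keys (v - ?s) = F"
        using v insert(2) by (auto simp: in_keys_iff lookup_minus lookup_single when_def split: if_splits)
      have "P (v - ?s)" using insert(3) k v(2) by blast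
      moreover have "P ?s" using v assms(4) by simp
      moreover have "Poly_Mapping.keys ?s \<subseteq> U" using v by auto
      ultimately have "P ((v - ?s) + ?s)" using k v(2) by (intro assms(3)) auto
      then show "P v" by simp
    qed
  qed
  from this[of "Poly_Mapping.keys v"] show ?thesis using assms(1) by simp
qed

definition free_space :: "'x set \<Rightarrow> ('k::field, 'x \<Rightarrow>\<^sub>0 'k) module" where
  "free_space U = \<lparr>carrier = {v. Poly_Mapping.keys v \<subseteq> U}, monoid.mult = undefined, one = undefined,
     ring.zero = 0, add = (+), module.smult = fscale\<rparr>"

lemma free_space_simps [simp]:
  "carrier (free_space U) = {v. Poly_Mapping.keys v \<subseteq> U}" "v \<oplus>\<^bsub>free_space U\<^esub> w = v + w"
  "\<zero>\<^bsub>free_space U\<^esub> = 0" "c \<odot>\<^bsub>free_space U\<^esub> v = fscale c v"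
  by (simp_all add: free_space_def)

lemma keys_add_subset: "Poly_Mapping.keys v \<subseteq> U \<Longrightarrow> Poly_Mapping.keys w \<subseteq> U \<Longrightarrow> Poly_Mapping.keys (v + w) \<subseteq> U"
  using Poly_Mapping.keys_add[of v w] by blast

lemma keys_minus_subset: "Poly_Mapping.keys v \<subseteq> U \<Longrightarrow> Poly_Mapping.keys w \<subseteq> U \<Longrightarrow> Poly_Mapping.keys (v - w) \<subseteq> U"
  using keys_diff[of v w] by blast 

lemma vspace_free_space [simp]: "vspace (free_space U)"
proof (rule vspaceI, rule abelian_groupI)
  fix v assume "v \<in> carrier (free_space U)"
  then show "\<exists>w\<in>carrier (free_space U). w \<oplus>\<^bsub>free_space U\<^esub> v = \<zero>\<^bsub>free_space U\<^esub>"
    by (intro bexI[of _ "- v"]) auto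
next
  fix c v assume "v \<in> carrier (free_space U)"
  then show "c \<odot>\<^bsub>free_space U\<^esub> v \<in> carrier (free_space U)" using keys_fscale[of c v] by auto
qed (auto simp only: free_space_simps fscale_simps mem_Collect_eq keys_add_subset add_ac
  add_0 add_0_right keys_zero empty_subsetI)

subsection \<open>Linear extensions\<close>

text \<open>
  Enlarging the index set beyond the support makes sums with different supports comparable.
\<close>

lemma lin_ext_superset:
  assumes V: "vspace V" and S: "finite S" "Poly_Mapping.keys v \<subseteq> S" and \<beta>: "\<And>a. a \<in> S \<Longrightarrow> \<beta> a \<in> carrier V"
  shows "lin_ext V \<beta> v = (\<Oplus>\<^bsub>V\<^esub>a\<in>S. Poly_Mapping.lookup v a \<odot>\<^bsub>V\<^esub> \<beta> a)"
proof -
  interpret abelian_group V using V by (rule vspace_abelian_group)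
  show ?thesis unfolding lin_ext_def
    using S V \<beta> by (intro add.finprod_mono_neutral_cong_left) (auto simp: in_keys_iff)
qed

lemma klinear_lin_ext:
  assumes V: "vspace V" and \<beta>: "\<And>a. a \<in> U \<Longrightarrow> \<beta> a \<in> carrier V"
  shows "klinear (free_space U) V (lin_ext V \<beta>)"
proof -
  interpret abelian_group V using V by (rule vspace_abelian_group)
  have 1: "lin_ext V \<beta> v \<in> carrier V" if "Poly_Mapping.keys v \<subseteq> U" for v
    unfolding lin_ext_def using that V \<beta> by (intro finsum_closed) auto
  have 2: "lin_ext V \<beta> (v + w) = lin_ext V \<beta> v \<oplus>\<^bsub>V\<^esub> lin_ext V \<beta> w"
    if vw: "Poly_Mapping.keys v \<subseteq> U" "Poly_Mapping.keys w \<subseteq> U" for v w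
  proof -
    let ?S = "Poly_Mapping.keys v \<union> Poly_Mapping.keys w"
    have b: "\<And>a. a \<in> ?S \<Longrightarrow> \<beta> a \<in> carrier V" using vw \<beta> by auto
    have "lin_ext V \<beta> (v + w) =
        (\<Oplus>\<^bsub>V\<^esub>a\<in>?S. Poly_Mapping.lookup v a \<odot>\<^bsub>V\<^esub> \<beta> a \<oplus>\<^bsub>V\<^esub> Poly_Mapping.lookup w a \<odot>\<^bsub>V\<^esub> \<beta> a)"
    proof -
      have "lin_ext V \<beta> (v + w) = (\<Oplus>\<^bsub>V\<^esub>a\<in>?S. Poly_Mapping.lookup (v + w) a \<odot>\<^bsub>V\<^esub> \<beta> a)"
        by (rule lin_ext_superset) (use b V Poly_Mapping.keys_add[of v w] in auto)
      also have "\<dots> = (\<Oplus>\<^bsub>V\<^esub>a\<in>?S. Poly_Mapping.lookup v a \<odot>\<^bsub>V\<^esub> \<beta> a \<oplus>\<^bsub>V\<^esub> Poly_Mapping.lookup w a \<odot>\<^bsub>V\<^esub> \<beta> a)"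
        by (rule finsum_cong') (use b V in \<open>auto simp: lookup_add vs_smult_add\<close>)
      finally show ?thesis .
    qed
    also have "\<dots> = lin_ext V \<beta> v \<oplus>\<^bsub>V\<^esub> lin_ext V \<beta> w"
      using b V lin_ext_superset[OF V, of ?S v \<beta>] lin_ext_superset[OF V, of ?S w \<beta>]
      by (subst finsum_addf) auto
    finally show ?thesis .
  qed
  have 3: "lin_ext V \<beta> (fscale c v) = c \<odot>\<^bsub>V\<^esub> lin_ext V \<beta> v" if v: "Poly_Mapping.keys v \<subseteq> U" for c v
  proof -
    have b: "\<And>a. a \<in> Poly_Mapping.keys v \<Longrightarrow> \<beta> a \<in> carrier V" using v \<beta> by auto
    have "lin_ext V \<beta> (fscale c v) = (\<Oplus>\<^bsub>V\<^esub>a\<in>Poly_Mapping.keys v. c \<odot>\<^bsub>V\<^esub> (Poly_Mapping.lookup v a \<odot>\<^bsub>V\<^esub> \<beta> a))"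
    proof -
      have "lin_ext V \<beta> (fscale c v) = (\<Oplus>\<^bsub>V\<^esub>a\<in>Poly_Mapping.keys v. Poly_Mapping.lookup (fscale c v) a \<odot>\<^bsub>V\<^esub> \<beta> a)"
        by (rule lin_ext_superset) (use b V keys_fscale[of c v] in auto)
      also have "\<dots> = (\<Oplus>\<^bsub>V\<^esub>a\<in>Poly_Mapping.keys v. c \<odot>\<^bsub>V\<^esub> (Poly_Mapping.lookup v a \<odot>\<^bsub>V\<^esub> \<beta> a))"
        by (rule finsum_cong') (use b V in auto)
      finally show ?thesis .
    qed
    also have "\<dots> = c \<odot>\<^bsub>V\<^esub> lin_ext V \<beta> v"
      unfolding lin_ext_def by (rule module.finsum_smult_ldistr[symmetric, of ground]) (use b V in \<open>auto simp: vspace_def\<close>)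
    finally show ?thesis .
  qed
  show ?thesis by (rule klinearI) (use 1 2 3 in auto)
qed

lemma lin_ext_single [simp]:
  assumes "vspace V" "\<beta> a \<in> carrier V"
  shows "lin_ext V \<beta> (Poly_Mapping.single a c) = c \<odot>\<^bsub>V\<^esub> \<beta> a"
proof -
  interpret abelian_group V using assms by (simp add: vspace_abelian_group)
  show ?thesis using assms by (subst lin_ext_superset[of V "{a}"]) auto
qed

lemma lin_ext_basis [simp]:
  "vspace V \<Longrightarrow> \<beta> a \<in> carrier V \<Longrightarrow> lin_ext V \<beta> (basis_vec a) = \<beta> a"
  by (simp add: basis_vec_def)

lemma basis_vec_keys [simp]: "Poly_Mapping.keys (basis_vec a :: _ \<Rightarrow>\<^sub>0 'k::field) = {a}"
  by (simp add: basis_vec_def)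

lemma basis_vec_inj: "(basis_vec h :: 'x \<Rightarrow>\<^sub>0 'k::field) = basis_vec k \<longleftrightarrow> h = k"
  by (metis basis_vec_keys singleton_inject)

lemma lin_ext_cong:
  assumes "\<And>a. a \<in> Poly_Mapping.keys v \<Longrightarrow> \<beta> a = \<beta>' a" "vspace V"
    "\<And>a. a \<in> Poly_Mapping.keys v \<Longrightarrow> \<beta> a \<in> carrier V"
  shows "lin_ext V \<beta> v = lin_ext V \<beta>' v"
proof -
  interpret abelian_group V using assms by (simp add: vspace_abelian_group)
  show ?thesis unfolding lin_ext_def using assms by (intro finsum_cong') auto
qed

lemma free_ext:
  assumes "klinear (free_space U) W \<phi>" "klinear (free_space U) W \<psi>" "vspace W"
    and "\<And>a. a \<in> U \<Longrightarrow> \<phi> (basis_vec a) = \<psi> (basis_vec a)" "Poly_Mapping.keys v \<subseteq> U"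
  shows "\<phi> v = \<psi> v"
  using assms(5)
proof (induction rule: free_induct)
  case zero
  show ?case using klinear_zero[OF assms(1)] klinear_zero[OF assms(2)] assms(3) by simp
next
  case (add v w)
  then show ?case using klinear_add[OF assms(1), of v w] klinear_add[OF assms(2), of v w] by simp
next
  case (single a c)
  have "Poly_Mapping.single a c = fscale c (basis_vec a)" by (simp add: basis_vec_def)
  then show ?case using single assms(4)[OF single]
      klinear_smult[OF assms(1), of "basis_vec a" c] klinear_smult[OF assms(2), of "basis_vec a" c] by simp
qed

lemma klinear_lin_ext_commute:
  assumes "klinear V W \<phi>" "vspace V" "vspace W" "\<And>a. a \<in> Poly_Mapping.keys v \<Longrightarrow> \<beta> a \<in> carrier V"
  shows "\<phi> (lin_ext V \<beta> v) = lin_ext W (\<lambda>a. \<phi> (\<beta> a)) v"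
proof (rule free_ext[of "Poly_Mapping.keys v" W "\<lambda>v. \<phi> (lin_ext V \<beta> v)"])
  show "klinear (free_space (Poly_Mapping.keys v)) W (\<lambda>v. \<phi> (lin_ext V \<beta> v))"
    by (rule klinear_comp[OF klinear_lin_ext assms(1)]) (use assms in auto)
  show "klinear (free_space (Poly_Mapping.keys v)) W (lin_ext W (\<lambda>a. \<phi> (\<beta> a)))"
    by (rule klinear_lin_ext) (use assms klinear_closed[OF assms(1)] in auto)
qed (use assms klinear_closed[OF assms(1)] in auto)

lemma lin_ext_closed:
  "vspace V \<Longrightarrow> (\<And>a. a \<in> Poly_Mapping.keys v \<Longrightarrow> \<beta> a \<in> carrier V) \<Longrightarrow> lin_ext V \<beta> v \<in> carrier V"
  by (rule klinear_closed[OF klinear_lin_ext[of V "Poly_Mapping.keys v"]]) auto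

text \<open>
  Identities between explicit linear combinations can be decided in the scalars: it is enough to
  compare the values under an arbitrary assignment of scalars to the vectors involved, because such
  combinations lift to the free space on the carrier.
\<close>

definition lincomb :: "('k::field, 'a, 'm) module_scheme \<Rightarrow> 'a \<Rightarrow> (('a \<Rightarrow> 'k) \<Rightarrow> 'k) \<Rightarrow> bool" where
  "lincomb V a F \<longleftrightarrow> (\<exists>v. Poly_Mapping.keys v \<subseteq> carrier V \<and> a = lin_ext V (\<lambda>z. z) v \<and>
     (\<forall>\<phi>. F \<phi> = lin_ext ground \<phi> v))"

lemma lincomb_eqI:
  fixes V :: "('k::field, 'a, 'm) module_scheme"
  assumes a: "lincomb V a F" and b: "lincomb V b F'" and eq: "\<And>\<phi>. F \<phi> = F' \<phi>"
  shows "a = b"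
proof -
  from a obtain v where v: "a = lin_ext V (\<lambda>z. z) v" "\<And>\<phi>. F \<phi> = lin_ext ground \<phi> v"
    by (auto simp: lincomb_def)
  from b obtain w where w: "b = lin_ext V (\<lambda>z. z) w" "\<And>\<phi>. F' \<phi> = lin_ext ground \<phi> w"
    by (auto simp: lincomb_def)
  have coord: "lin_ext ground (\<lambda>z. if z = k then 1 else 0) u = Poly_Mapping.lookup u k" for k and u :: "'a \<Rightarrow>\<^sub>0 'k"
    by (rule free_ext[of UNIV ground], rule klinear_lin_ext)
      (auto simp: klinear_def lookup_add basis_vec_def lookup_single when_def)
  have "v = w"
    by (rule poly_mapping_eqI) (metis coord eq v(2) w(2))
  then show ?thesis by (simp add: v w)
qed

lemma lincomb_atom: "vspace V \<Longrightarrow> a \<in> carrier V \<Longrightarrow> lincomb V a (\<lambda>\<phi>. \<phi> a)"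
  unfolding lincomb_def by (rule exI[of _ "basis_vec a"]) auto
lemma lincomb_zero: "vspace V \<Longrightarrow> lincomb V \<zero>\<^bsub>V\<^esub> (\<lambda>\<phi>. 0)"
  unfolding lincomb_def
  using klinear_zero[OF klinear_lin_ext[of V "{}" "\<lambda>z. z"]] klinear_zero[OF klinear_lin_ext[of ground "{}"]]
  by (intro exI[of _ 0]) auto
lemma lincomb_add:
  assumes "vspace V" "lincomb V a F" "lincomb V b F'"
  shows "lincomb V (a \<oplus>\<^bsub>V\<^esub> b) (\<lambda>\<phi>. F \<phi> + F' \<phi>)"
proof -
  from assms obtain v w where vw: "Poly_Mapping.keys v \<subseteq> carrier V" "Poly_Mapping.keys w \<subseteq> carrier V"
    "a = lin_ext V (\<lambda>z. z) v" "\<And>\<phi>. F \<phi> = lin_ext ground \<phi> v"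
    "b = lin_ext V (\<lambda>z. z) w" "\<And>\<phi>. F' \<phi> = lin_ext ground \<phi> w"
    by (auto simp: lincomb_def)
  then show ?thesis unfolding lincomb_def
    using klinear_add[OF klinear_lin_ext[OF assms(1), of "carrier V" "\<lambda>z. z"], of v w]
      klinear_add[OF klinear_lin_ext[OF vspace_ground, of UNIV], of _ v w]
    by (intro exI[of _ "v + w"]) (auto simp: keys_add_subset[THEN subsetD])
qed
lemma lincomb_smult:
  assumes "vspace V" "lincomb V a F"
  shows "lincomb V (c \<odot>\<^bsub>V\<^esub> a) (\<lambda>\<phi>. c * F \<phi>)"
proof -
  from assms obtain v where v: "Poly_Mapping.keys v \<subseteq> carrier V"
    "a = lin_ext V (\<lambda>z. z) v" "\<And>\<phi>. F \<phi> = lin_ext ground \<phi> v"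
    by (auto simp: lincomb_def)
  then show ?thesis unfolding lincomb_def
    using klinear_smult[OF klinear_lin_ext[OF assms(1), of "carrier V" "\<lambda>z. z"], of v c]
      klinear_smult[OF klinear_lin_ext[OF vspace_ground, of UNIV], of _ v c]
    by (intro exI[of _ "fscale c v"]) (auto simp: keys_fscale[THEN subsetD])
qed
lemma lincomb_closed: "vspace V \<Longrightarrow> lincomb V a F \<Longrightarrow> a \<in> carrier V"
  by (auto simp: lincomb_def intro!: lin_ext_closed)
lemma lincomb_uminus: "vspace V \<Longrightarrow> lincomb V a F \<Longrightarrow> lincomb V (\<ominus>\<^bsub>V\<^esub> a) (\<lambda>\<phi>. - F \<phi>)"
  using lincomb_smult[of V a F "-1"] by (simp add: vs_uminus_smult lincomb_closed)
lemma lincomb_minus: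
  "vspace V \<Longrightarrow> lincomb V a F \<Longrightarrow> lincomb V b F' \<Longrightarrow> lincomb V (a \<ominus>\<^bsub>V\<^esub> b) (\<lambda>\<phi>. F \<phi> - F' \<phi>)"
  using lincomb_add[of V a F "\<ominus>\<^bsub>V\<^esub> b" "\<lambda>\<phi>. - F' \<phi>"] lincomb_uminus[of V b F'] by (simp add: a_minus_def)

lemmas lincomb_intros = lincomb_add lincomb_minus lincomb_uminus lincomb_smult lincomb_zero

section \<open>Tensor products\<close>

definition bilin :: "('k::field, 'a, 'm) module_scheme \<Rightarrow> ('k, 'b, 'n) module_scheme \<Rightarrow>
    ('k, 'c, 'p) module_scheme \<Rightarrow> ('a \<Rightarrow> 'b \<Rightarrow> 'c) \<Rightarrow> bool" where
  "bilin V W P \<beta> \<longleftrightarrow> (\<forall>b\<in>carrier W. klinear V P (\<lambda>a. \<beta> a b)) \<and> (\<forall>a\<in>carrier V. klinear W P (\<beta> a))"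

lemma bilinI [intro?]:
  "(\<And>b. b \<in> carrier W \<Longrightarrow> klinear V P (\<lambda>a. \<beta> a b)) \<Longrightarrow> (\<And>a. a \<in> carrier V \<Longrightarrow> klinear W P (\<lambda>b. \<beta> a b)) \<Longrightarrow>
   bilin V W P \<beta>"
  by (auto simp: bilin_def)
lemma bilin_left: "bilin V W P \<beta> \<Longrightarrow> b \<in> carrier W \<Longrightarrow> klinear V P (\<lambda>a. \<beta> a b)"
  by (auto simp: bilin_def)
lemma bilin_right: "bilin V W P \<beta> \<Longrightarrow> a \<in> carrier V \<Longrightarrow> klinear W P (\<lambda>b. \<beta> a b)"
  by (auto simp: bilin_def)
lemma bilin_closed: "bilin V W P \<beta> \<Longrightarrow> a \<in> carrier V \<Longrightarrow> b \<in> carrier W \<Longrightarrow> \<beta> a b \<in> carrier P"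
  by (rule klinear_closed[OF bilin_left])

lemma tensor_simps:
  "carrier (tensor V W) = tensor_class V W ` tensor_free V W"
  "\<zero>\<^bsub>tensor V W\<^esub> = tensor_class V W 0"
  "S \<oplus>\<^bsub>tensor V W\<^esub> T = tensor_class V W (rep S + rep T)"
  "c \<odot>\<^bsub>tensor V W\<^esub> T = tensor_class V W (fscale c (rep T))"
  "S \<otimes>\<^bsub>tensor V W\<^esub> T = tensor_class V W
        (convolve (\<lambda>(a, b) (a', b'). (a \<otimes>\<^bsub>V\<^esub> a', b \<otimes>\<^bsub>W\<^esub> b')) (rep S) (rep T))"
  "\<one>\<^bsub>tensor V W\<^esub> = pure_tensor V W \<one>\<^bsub>V\<^esub> \<one>\<^bsub>W\<^esub>"
  by (simp_all add: tensor_def)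

context
  fixes V :: "('k::field, 'a, 'm) module_scheme" and W :: "('k, 'b, 'n) module_scheme"
  assumes V: "vspace V" and W: "vspace W"
begin

lemma tensor_free_closed [simp]:
  "v \<in> tensor_free V W \<Longrightarrow> w \<in> tensor_free V W \<Longrightarrow> v + w \<in> tensor_free V W"
  "v \<in> tensor_free V W \<Longrightarrow> w \<in> tensor_free V W \<Longrightarrow> v - w \<in> tensor_free V W"
  "v \<in> tensor_free V W \<Longrightarrow> fscale c v \<in> tensor_free V W"
  "a \<in> carrier V \<Longrightarrow> b \<in> carrier W \<Longrightarrow> basis_vec (a, b) \<in> tensor_free V W"
  "0 \<in> tensor_free V W"
  unfolding tensor_free_def mem_Collect_eq
  by (rule keys_add_subset keys_minus_subset keys_fscale[THEN subset_trans]; assumption | simp)+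

lemma tensor_rel_free: "v \<in> tensor_rel V W \<Longrightarrow> v \<in> tensor_free V W"
  by (induction rule: tensor_rel.induct) (use V W in simp_all)

lemma tensor_rel_minus: "v \<in> tensor_rel V W \<Longrightarrow> w \<in> tensor_rel V W \<Longrightarrow> v - w \<in> tensor_rel V W"
  using tensor_rel.intros(2)[of v V W "- w"] tensor_rel.intros(3)[of w V W "-1"] by simp

lemma tensor_class_eq_iff:
  assumes "v \<in> tensor_free V W" "w \<in> tensor_free V W"
  shows "tensor_class V W v = tensor_class V W w \<longleftrightarrow> v - w \<in> tensor_rel V W"
proof
  assume "tensor_class V W v = tensor_class V W w"
  moreover have "v \<in> tensor_class V W v" using assms tensor_rel.intros(1) by (simp add: tensor_class_def)
  ultimately show "v - w \<in> tensor_rel V W" by (auto simp: tensor_class_def)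
next
  assume r: "v - w \<in> tensor_rel V W"
  have "u - v \<in> tensor_rel V W \<longleftrightarrow> u - w \<in> tensor_rel V W" for u
    using tensor_rel.intros(2)[OF _ r, of "u - v"] tensor_rel_minus[OF _ r, of "u - w"] by auto
  then show "tensor_class V W v = tensor_class V W w" by (auto simp: tensor_class_def)
qed

lemma rep_tensor_class:
  assumes "v \<in> tensor_free V W"
  shows "rep (tensor_class V W v) \<in> tensor_free V W" "rep (tensor_class V W v) - v \<in> tensor_rel V W"
proof -
  have "v \<in> tensor_class V W v" using assms tensor_rel.intros(1) by (simp add: tensor_class_def)
  then have "rep (tensor_class V W v) \<in> tensor_class V W v" unfolding rep_def by (rule someI)
  then show "rep (tensor_class V W v) \<in> tensor_free V W" "rep (tensor_class V W v) - v \<in> tensor_rel V W"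
    by (auto simp: tensor_class_def)
qed

lemma rep_tensor:
  assumes "T \<in> carrier (tensor V W)"
  shows "rep T \<in> tensor_free V W" "tensor_class V W (rep T) = T"
proof -
  from assms obtain v where v: "v \<in> tensor_free V W" "T = tensor_class V W v" by (auto simp: tensor_simps)
  show "rep T \<in> tensor_free V W" using rep_tensor_class(1)[OF v(1)] v(2) by simp
  show "tensor_class V W (rep T) = T"
    using rep_tensor_class[OF v(1)] tensor_class_eq_iff[OF _ v(1)] v(2) by simp
qed

lemma tensor_class_add:
  assumes "v \<in> tensor_free V W" "w \<in> tensor_free V W"
  shows "tensor_class V W v \<oplus>\<^bsub>tensor V W\<^esub> tensor_class V W w = tensor_class V W (v + w)"
proof -
  let ?v = "rep (tensor_class V W v)" and ?w = "rep (tensor_class V W w)"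
  have "(?v - v) + (?w - w) \<in> tensor_rel V W"
    using assms by (intro tensor_rel.intros rep_tensor_class)
  moreover have "?v + ?w \<in> tensor_free V W" "v + w \<in> tensor_free V W"
    using rep_tensor_class(1)[OF assms(1)] rep_tensor_class(1)[OF assms(2)] assms by simp_all
  ultimately show ?thesis by (simp add: tensor_simps tensor_class_eq_iff algebra_simps)
qed

lemma tensor_class_smult:
  assumes "v \<in> tensor_free V W"
  shows "c \<odot>\<^bsub>tensor V W\<^esub> tensor_class V W v = tensor_class V W (fscale c v)"
proof -
  let ?v = "rep (tensor_class V W v)"
  have "fscale c (?v - v) \<in> tensor_rel V W"
    using assms by (intro tensor_rel.intros rep_tensor_class)
  moreover have "fscale c ?v \<in> tensor_free V W" "fscale c v \<in> tensor_free V W"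
    using rep_tensor_class(1)[OF assms(1)] assms by simp_all
  ultimately show ?thesis by (simp add: tensor_simps tensor_class_eq_iff)
qed

lemma tensor_free_space: "tensor_free V W = carrier (free_space (carrier V \<times> carrier W))"
  by (simp add: tensor_free_def)

lemma vspace_tensor [simp]: "vspace (tensor V W)"
proof -
  let ?F = "free_space (carrier V \<times> carrier W) :: ('k, _) module"
  interpret F: abelian_group ?F by (rule vspace_abelian_group) simp
  have c: "\<exists>v. v \<in> carrier ?F \<and> T = tensor_class V W v" if "T \<in> carrier (tensor V W)" for T
    using that by (auto simp: tensor_simps tensor_free_space)
  have i: "tensor_class V W v \<in> carrier (tensor V W)" if "v \<in> carrier ?F" for v
    using that by (auto simp: tensor_simps tensor_free_space)
  have a: "tensor_class V W v \<oplus>\<^bsub>tensor V W\<^esub> tensor_class V W w = tensor_class V W (v \<oplus>\<^bsub>?F\<^esub> w)"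
    if "v \<in> carrier ?F" "w \<in> carrier ?F" for v w
    using tensor_class_add that by (simp add: tensor_free_space)
  have s: "c \<odot>\<^bsub>tensor V W\<^esub> tensor_class V W v = tensor_class V W (c \<odot>\<^bsub>?F\<^esub> v)" if "v \<in> carrier ?F" for c v
    using tensor_class_smult that by (simp add: tensor_free_space)
  have z: "\<zero>\<^bsub>tensor V W\<^esub> = tensor_class V W \<zero>\<^bsub>?F\<^esub>" by (simp add: tensor_simps)
  have F: "vspace ?F" by simp
  note cl = vs_add[OF F] vs_smult[OF F] vs_zero[OF F] vs_uminus[OF F]
  show ?thesis
  proof (rule vspaceI, rule abelian_groupI, goal_cases)
    case (6 T)
    from c[OF 6] obtain v where v: "v \<in> carrier ?F" "T = tensor_class V W v" by auto
    show ?case using v F.l_neg[OF v(1)] cl(4)[OF v(1)] 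
      by (intro bexI[of _ "tensor_class V W (\<ominus>\<^bsub>?F\<^esub> v)"]) (simp_all only: a z i)
  next
    case (8 c d T)
    from c[OF 8] obtain v where v: "v \<in> carrier ?F" "T = tensor_class V W v" by auto
    show ?case unfolding v(2) using v(1) cl vs_smult_add[OF F v(1)] by (simp only: a s)
  next
    case (10 c d T)
    from c[OF 10] obtain v where v: "v \<in> carrier ?F" "T = tensor_class V W v" by auto
    show ?case unfolding v(2) using v(1) cl vs_smult_smult[OF F v(1)] by (simp only: s)
  next
    case (9 c S T)
    from c[OF 9(1)] c[OF 9(2)] obtain v w
      where v: "v \<in> carrier ?F" "S = tensor_class V W v" "w \<in> carrier ?F" "T = tensor_class V W w" by auto
    show ?case unfolding v(2,4) using v(1,3) cl vs_smult_distr[OF F v(1) v(3)] by (simp only: a s)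
  next
    case (11 T)
    from c[OF 11] obtain v where v: "v \<in> carrier ?F" "T = tensor_class V W v" by auto
    show ?case unfolding v(2) using v(1) cl vs_one_smult[OF F v(1)] by (simp only: s)
  next
    case (3 S T R)
    from c[OF 3(1)] c[OF 3(2)] c[OF 3(3)] obtain u v w
      where v: "v \<in> carrier ?F" "S = tensor_class V W v" "w \<in> carrier ?F" "T = tensor_class V W w"
       "u \<in> carrier ?F" "R = tensor_class V W u" by auto
    show ?case unfolding v(2,4,6) using v(1,3,5) cl F.a_assoc[OF v(1,3,5)] by (simp only: a)
  next
    case (4 S T)
    from c[OF 4(1)] c[OF 4(2)] obtain v w
      where v: "v \<in> carrier ?F" "S = tensor_class V W v" "w \<in> carrier ?F" "T = tensor_class V W w" by auto
    show ?case unfolding v(2,4) using v(1,3) cl F.a_comm[OF v(1,3)] by (simp only: a)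
  next
    case (5 T)
    from c[OF 5] obtain v where v: "v \<in> carrier ?F" "T = tensor_class V W v" by auto
    show ?case unfolding v(2) z using v(1) cl F.l_zero[OF v(1)] by (simp only: a)
  next
    case (1 S T)
    from c[OF 1(1)] c[OF 1(2)] obtain v w
      where v: "v \<in> carrier ?F" "S = tensor_class V W v" "w \<in> carrier ?F" "T = tensor_class V W w" by auto
    show ?case unfolding v(2,4) using v(1,3) cl(1)[OF v(1,3)] by (simp only: a i)
  next
    case 2
    show ?case unfolding z by (rule i) (rule cl(3))
  next
    case (7 c T)
    from c[OF 7] obtain v where v: "v \<in> carrier ?F" "T = tensor_class V W v" by auto
    show ?case unfolding v(2) using v(1) cl(2)[OF v(1)] by (simp only: s i)
  qed
qed

lemma klinear_tensor_class:
  "klinear (free_space (carrier V \<times> carrier W)) (tensor V W) (tensor_class V W)"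
  using tensor_class_add tensor_class_smult
  by (intro klinearI) (auto simp: tensor_simps(1) tensor_free_space)

lemma pure_tensor_closed [simp]:
  "a \<in> carrier V \<Longrightarrow> b \<in> carrier W \<Longrightarrow> pure_tensor V W a b \<in> carrier (tensor V W)"
  by (auto simp: tensor_simps pure_tensor_def tensor_free_def)

lemma bilin_pure_tensor: "bilin V W (tensor V W) (pure_tensor V W)"
proof -
  show ?thesis
  proof (rule bilinI; rule klinearI)
    fix a a' b assume ab: "b \<in> carrier W" "a \<in> carrier V" "a' \<in> carrier V"
    show "pure_tensor V W (a \<oplus>\<^bsub>V\<^esub> a') b = pure_tensor V W a b \<oplus>\<^bsub>tensor V W\<^esub> pure_tensor V W a' b"
      using tensor_rel.intros(4)[OF ab(2,3,1)] ab V
      by (simp add: pure_tensor_def tensor_class_add tensor_class_eq_iff diff_diff_eq)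
  next
    fix a b b' assume ab: "a \<in> carrier V" "b \<in> carrier W" "b' \<in> carrier W"
    show "pure_tensor V W a (b \<oplus>\<^bsub>W\<^esub> b') = pure_tensor V W a b \<oplus>\<^bsub>tensor V W\<^esub> pure_tensor V W a b'"
      using tensor_rel.intros(5)[OF ab] ab W
      by (simp add: pure_tensor_def tensor_class_add tensor_class_eq_iff diff_diff_eq)
  next
    fix c a b assume ab: "b \<in> carrier W" "a \<in> carrier V"
    show "pure_tensor V W (c \<odot>\<^bsub>V\<^esub> a) b = c \<odot>\<^bsub>tensor V W\<^esub> pure_tensor V W a b"
      using tensor_rel.intros(6)[OF ab(2,1)] ab V
      by (simp add: pure_tensor_def tensor_class_smult tensor_class_eq_iff)
  next
    fix c a b assume ab: "a \<in> carrier V" "b \<in> carrier W"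
    show "pure_tensor V W a (c \<odot>\<^bsub>W\<^esub> b) = c \<odot>\<^bsub>tensor V W\<^esub> pure_tensor V W a b"
      using tensor_rel.intros(7)[OF ab] ab W
      by (simp add: pure_tensor_def tensor_class_smult tensor_class_eq_iff)
  qed auto
qed

lemma tensor_ext:
  assumes "klinear (tensor V W) P \<phi>" "klinear (tensor V W) P \<psi>" "vspace P"
    and "\<And>a b. a \<in> carrier V \<Longrightarrow> b \<in> carrier W \<Longrightarrow> \<phi> (pure_tensor V W a b) = \<psi> (pure_tensor V W a b)"
    and "T \<in> carrier (tensor V W)"
  shows "\<phi> T = \<psi> T"
proof -
  have "\<phi> (tensor_class V W (rep T)) = \<psi> (tensor_class V W (rep T))"
    by (rule free_ext[OF klinear_comp[OF klinear_tensor_class assms(1)] klinear_comp[OF klinear_tensor_class assms(2)]])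
      (use assms rep_tensor(1)[OF assms(5)] in \<open>auto simp: pure_tensor_def tensor_free_space\<close>)
  then show ?thesis by (simp add: rep_tensor(2) assms(5))
qed

context
  fixes P :: "('k, 'c, 'p) module_scheme" and \<beta> :: "'a \<Rightarrow> 'b \<Rightarrow> 'c"
  assumes P: "vspace P" and \<beta>: "bilin V W P \<beta>"
begin

lemma klinear_lin_ext_bilin: "klinear (free_space (carrier V \<times> carrier W)) P (lin_ext P (\<lambda>(a, b). \<beta> a b))"
  by (rule klinear_lin_ext[OF P]) (auto intro: bilin_closed[OF \<beta>])

text \<open>
  A bilinear map annihilates the generators of the relations, so its linear extension factors
  through the tensor product: this is why \<^const>\<open>sweedler\<close> does not depend on representatives.
\<close>

lemma lin_ext_tensor_rel: "v \<in> tensor_rel V W \<Longrightarrow> lin_ext P (\<lambda>(a, b). \<beta> a b) v = \<zero>\<^bsub>P\<^esub>"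
proof (induction rule: tensor_rel.induct)
  note L = klinear_lin_ext_bilin
  note cl = bilin_closed[OF \<beta>]
  interpret P: abelian_group P using P by (rule vspace_abelian_group)
  have m: "lin_ext P (\<lambda>(a, b). \<beta> a b) (v - w) = lin_ext P (\<lambda>(a, b). \<beta> a b) v \<ominus>\<^bsub>P\<^esub> lin_ext P (\<lambda>(a, b). \<beta> a b) w"
    if "v \<in> tensor_free V W" "w \<in> tensor_free V W" for v w
  proof -
    have "v - w = v \<oplus>\<^bsub>free_space (carrier V \<times> carrier W)\<^esub> fscale (-1) w" by simp
    then show ?thesis
      using that klinear_add[OF L, of v "fscale (-1) w"] klinear_smult[OF L, of w "-1"]
        klinear_closed[OF L, of w] klinear_closed[OF L, of v] P
      by (simp add: tensor_free_def vs_minus_smult)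
  qed
  {
    case 1
    show ?case using klinear_zero[OF L vspace_free_space P] by simp
  next
    case (2 v w)
    then show ?case using klinear_add[OF L, of v w] tensor_rel_free[of v] tensor_rel_free[of w] P
      by (simp add: tensor_free_def)
  next
    case (3 v c)
    then show ?case using klinear_smult[OF L, of v c] tensor_rel_free[of v] P by (simp add: tensor_free_def)
  next
    case (4 a a' b)
    then show ?case using V P cl by (simp add: m klinear_add[OF bilin_left[OF \<beta> 4(3)]])
       (rule lincomb_eqI, (rule lincomb_intros lincomb_atom | simp)+)
  next
    case (5 a b b')
    then show ?case using W P cl by (simp add: m klinear_add[OF bilin_right[OF \<beta> 5(1)]])
       (rule lincomb_eqI, (rule lincomb_intros lincomb_atom | simp)+)
  next
    case (6 a b c)
    then show ?case using V P cl 6 klinear_smult[OF L, of "basis_vec (a, b)" c]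
      by (simp add: m klinear_smult[OF bilin_left[OF \<beta> 6(2)]] vs_minus_eq_zero)
  next
    case (7 a b c)
    then show ?case using W P cl 7 klinear_smult[OF L, of "basis_vec (a, b)" c]
      by (simp add: m klinear_smult[OF bilin_right[OF \<beta> 7(1)]] vs_minus_eq_zero)
  }
qed

lemma sweedler_class:
  assumes "v \<in> tensor_free V W"
  shows "sweedler P (tensor_class V W v) \<beta> = lin_ext P (\<lambda>(a, b). \<beta> a b) v"
proof -
  let ?v = "rep (tensor_class V W v)"
  note L = klinear_lin_ext_bilin
  have v: "?v - v \<in> tensor_free V W" using rep_tensor_class(2)[OF assms] by (rule tensor_rel_free)
  have "lin_ext P (\<lambda>(a, b). \<beta> a b) ((?v - v) + v) = lin_ext P (\<lambda>(a, b). \<beta> a b) (?v - v) \<oplus>\<^bsub>P\<^esub> lin_ext P (\<lambda>(a, b). \<beta> a b) v"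
    using klinear_add[OF L, of "?v - v" v] v assms by (simp add: tensor_free_def)
  also have "lin_ext P (\<lambda>(a, b). \<beta> a b) (?v - v) = \<zero>\<^bsub>P\<^esub>"
    by (rule lin_ext_tensor_rel) (rule rep_tensor_class(2)[OF assms])
  finally show ?thesis using assms P klinear_closed[OF L, of v] by (simp add: sweedler_def tensor_free_def)
qed

lemma sweedler_pure: "a \<in> carrier V \<Longrightarrow> b \<in> carrier W \<Longrightarrow> sweedler P (pure_tensor V W a b) \<beta> = \<beta> a b"
  unfolding pure_tensor_def
  by (subst sweedler_class) (auto simp: tensor_free_def P bilin_closed[OF \<beta>])

lemma klinear_sweedler: "klinear (tensor V W) P (\<lambda>T. sweedler P T \<beta>)"
proof -
  note L = klinear_lin_ext_bilin
  show ?thesis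
  proof (rule klinearI)
    fix T assume "T \<in> carrier (tensor V W)"
    then show "sweedler P T \<beta> \<in> carrier P"
      using klinear_closed[OF L] by (auto simp: tensor_simps sweedler_class tensor_free_space)
  next
    fix S T assume "S \<in> carrier (tensor V W)" "T \<in> carrier (tensor V W)"
    then show "sweedler P (S \<oplus>\<^bsub>tensor V W\<^esub> T) \<beta> = sweedler P S \<beta> \<oplus>\<^bsub>P\<^esub> sweedler P T \<beta>"
      using klinear_add[OF L] by (auto simp: tensor_simps(1) tensor_class_add sweedler_class) (simp_all add: tensor_free_def)
  next
    fix c T assume "T \<in> carrier (tensor V W)"
    then show "sweedler P (c \<odot>\<^bsub>tensor V W\<^esub> T) \<beta> = c \<odot>\<^bsub>P\<^esub> sweedler P T \<beta>"
      using klinear_smult[OF L] by (auto simp: tensor_simps(1) tensor_class_smult sweedler_class) (simp_all add: tensor_free_def)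
  qed
qed

lemma sweedler_closed: "T \<in> carrier (tensor V W) \<Longrightarrow> sweedler P T \<beta> \<in> carrier P"
  by (rule klinear_closed[OF klinear_sweedler])

lemma sweedler_cong:
  assumes "T \<in> carrier (tensor V W)"
    and "\<And>a b. a \<in> carrier V \<Longrightarrow> b \<in> carrier W \<Longrightarrow> \<beta> a b = \<beta>' a b"
  shows "sweedler P T \<beta> = sweedler P T \<beta>'"
  unfolding sweedler_def
  by (rule lin_ext_cong[OF _ P]) (use rep_tensor(1)[OF assms(1)] assms(2) bilin_closed[OF \<beta>] in
    \<open>auto simp: tensor_free_def subset_iff\<close>)

lemma sweedler_comp:
  assumes "klinear P Q \<phi>" "vspace Q" "T \<in> carrier (tensor V W)"
  shows "\<phi> (sweedler P T \<beta>) = sweedler Q T (\<lambda>a b. \<phi> (\<beta> a b))"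
  unfolding sweedler_def
  by (subst klinear_lin_ext_commute[OF assms(1) P assms(2)])
    (use rep_tensor(1)[OF assms(3)] bilin_closed[OF \<beta>] in
    \<open>auto simp: tensor_free_def subset_iff intro!: arg_cong[of _ _ "\<lambda>\<beta>. lin_ext Q \<beta> (rep T)"]\<close>)

end

lemma sweedler_id: "T \<in> carrier (tensor V W) \<Longrightarrow> sweedler (tensor V W) T (pure_tensor V W) = T"
  by (rule tensor_ext[OF klinear_sweedler klinear_id])
    (simp_all add: bilin_pure_tensor sweedler_pure)

lemma tensor_induct [consumes 1, case_names pure add]:
  assumes "T \<in> carrier (tensor V W)"
    and "\<And>a b. a \<in> carrier V \<Longrightarrow> b \<in> carrier W \<Longrightarrow> R (pure_tensor V W a b)"
    and "\<And>S T. S \<in> carrier (tensor V W) \<Longrightarrow> T \<in> carrier (tensor V W) \<Longrightarrow> R S \<Longrightarrow> R T \<Longrightarrow> R (S \<oplus>\<^bsub>tensor V W\<^esub> T)"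
  shows "R T"
proof -
  have "R (tensor_class V W v)" if "Poly_Mapping.keys v \<subseteq> carrier V \<times> carrier W" for v
    using that
  proof (induction rule: free_induct)
    case zero
    have "pure_tensor V W (0 \<odot>\<^bsub>V\<^esub> \<zero>\<^bsub>V\<^esub>) \<zero>\<^bsub>W\<^esub> = 0 \<odot>\<^bsub>tensor V W\<^esub> pure_tensor V W \<zero>\<^bsub>V\<^esub> \<zero>\<^bsub>W\<^esub>"
      by (rule klinear_smult[OF bilin_left[OF bilin_pure_tensor]]) (use V W in auto)
    also have "\<dots> = tensor_class V W 0" using V W by (simp add: tensor_simps(2)[symmetric])
    finally show ?case using assms(2)[of "0 \<odot>\<^bsub>V\<^esub> \<zero>\<^bsub>V\<^esub>" "\<zero>\<^bsub>W\<^esub>"] V W by simp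
  next
    case (add v w)
    then show ?case using klinear_add[OF klinear_tensor_class, of v w] klinear_closed[OF klinear_tensor_class]
        assms(3)[of "tensor_class V W v" "tensor_class V W w"] by simp
  next
    case (single a c)
    then obtain x y where a: "a = (x, y)" "x \<in> carrier V" "y \<in> carrier W" by auto
    have "tensor_class V W (Poly_Mapping.single a c) = pure_tensor V W (c \<odot>\<^bsub>V\<^esub> x) y"
      using klinear_smult[OF klinear_tensor_class, of "basis_vec a" c] a
        klinear_smult[OF bilin_left[OF bilin_pure_tensor a(3)] a(2), of c]
      by (simp add: basis_vec_def pure_tensor_def)
    then show ?case using assms(2) a V by simp
  qed
  then show ?thesis using assms(1) by (auto simp: tensor_simps(1) tensor_free_def)
qed

end

text \<open>
  For rewriting a summand before it is known to be bilinear.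
\<close>

lemma sweedler_cong_closed:
  assumes "vspace P" "T \<in> carrier (tensor V W)" "vspace V" "vspace W"
    and "\<And>a b. a \<in> carrier V \<Longrightarrow> b \<in> carrier W \<Longrightarrow> \<beta> a b = \<beta>' a b"
    and "\<And>a b. a \<in> carrier V \<Longrightarrow> b \<in> carrier W \<Longrightarrow> \<beta>' a b \<in> carrier P"
  shows "sweedler P T \<beta> = sweedler P T \<beta>'"
  unfolding sweedler_def
  by (rule lin_ext_cong[OF _ assms(1)]) (use rep_tensor(1)[OF assms(3,4,2)] assms(5,6) in \<open>auto simp: tensor_free_def subset_iff\<close>)

text \<open>
  For a fixed tensor a fixed representative is used, so that a parameter may be moved through the
  finite sum.
\<close>

lemma klinear_sweedler_param:
  assumes "vspace V" "vspace W" "vspace P" "vspace U"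
    and \<beta>: "\<And>z. z \<in> carrier U \<Longrightarrow> bilin V W P (\<beta> z)"
    and lin: "\<And>a b. a \<in> carrier V \<Longrightarrow> b \<in> carrier W \<Longrightarrow> klinear U P (\<lambda>z. \<beta> z a b)"
    and T: "T \<in> carrier (tensor V W)"
  shows "klinear U P (\<lambda>z. sweedler P T (\<beta> z))"
proof (rule klinearI)
  fix z assume z: "z \<in> carrier U"
  then show "sweedler P T (\<beta> z) \<in> carrier P" by (intro sweedler_closed[OF _ _ _ \<beta>]) (use assms in auto)
next
  fix z z' assume z: "z \<in> carrier U" "z' \<in> carrier U"
  then have zz: "z \<oplus>\<^bsub>U\<^esub> z' \<in> carrier U" using assms by simp
  note L = klinear_sweedler[OF assms(1,2,3) \<beta>]
  show "sweedler P T (\<beta> (z \<oplus>\<^bsub>U\<^esub> z')) = sweedler P T (\<beta> z) \<oplus>\<^bsub>P\<^esub> sweedler P T (\<beta> z')"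
    by (rule tensor_ext[OF assms(1,2) L[OF zz] klinear_sum[OF L[OF z(1)] L[OF z(2)]] _ _ T])
      (use assms z zz in \<open>auto simp: sweedler_pure klinear_add[OF lin]\<close>)
next
  fix z c assume z: "z \<in> carrier U"
  then have zz: "c \<odot>\<^bsub>U\<^esub> z \<in> carrier U" using assms by simp
  note L = klinear_sweedler[OF assms(1,2,3) \<beta>]
  show "sweedler P T (\<beta> (c \<odot>\<^bsub>U\<^esub> z)) = c \<odot>\<^bsub>P\<^esub> sweedler P T (\<beta> z)"
    by (rule tensor_ext[OF assms(1,2) L[OF zz] klinear_scale[OF L[OF z(1)]] _ _ T])
      (use assms z zz in \<open>auto simp: sweedler_pure klinear_smult[OF lin]\<close>)
qed

lemma bilin_comp:
  assumes "bilin V' W' P \<beta>" "klinear V V' F" "klinear W W' K"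
  shows "bilin V W P (\<lambda>a b. \<beta> (F a) (K b))"
  by (rule bilinI)
    (auto intro!: klinear_comp[OF assms(2) bilin_left[OF assms(1)]] klinear_comp[OF assms(3) bilin_right[OF assms(1)]]
      klinear_closed[OF assms(2)] klinear_closed[OF assms(3)])

lemma bilin_out: "bilin V W P \<beta> \<Longrightarrow> klinear P Q \<phi> \<Longrightarrow> bilin V W Q (\<lambda>a b. \<phi> (\<beta> a b))"
  by (rule bilinI) (auto intro: klinear_comp[OF bilin_left] klinear_comp[OF bilin_right])

lemma bilin_flip: "bilin V W P \<beta> \<Longrightarrow> bilin W V P (\<lambda>a b. \<beta> b a)"
  by (auto simp: bilin_def)

lemma bilin_mult: "kalgebra B \<Longrightarrow> bilin B B B (\<lambda>a b. a \<otimes>\<^bsub>B\<^esub> b)"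
  by (rule bilinI) (auto intro: klinear_mult_left klinear_mult_right)

lemma bilin_smult: "vspace P \<Longrightarrow> bilin ground P P (\<lambda>c b. c \<odot>\<^bsub>P\<^esub> b)"
  by (rule bilinI) (auto intro: klinear_smult_vec klinear_scale[OF klinear_id])

lemmas bilin_pure_comp = bilin_comp[OF bilin_pure_tensor]

text \<open>
  Substitution for a tensor that is itself given by a Sweedler sum.
\<close>

lemma sweedler_map:
  assumes "vspace V" "vspace W" "vspace V'" "vspace W'" "vspace P" "bilin V' W' P \<beta>"
    "bilin V W (tensor V' W') (\<lambda>a b. pure_tensor V' W' (F a b) (K a b))"
    "\<And>a b. a \<in> carrier V \<Longrightarrow> b \<in> carrier W \<Longrightarrow> F a b \<in> carrier V'"
    "\<And>a b. a \<in> carrier V \<Longrightarrow> b \<in> carrier W \<Longrightarrow> K a b \<in> carrier W'"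
    "T \<in> carrier (tensor V W)"
  shows "sweedler P (sweedler (tensor V' W') T (\<lambda>a b. pure_tensor V' W' (F a b) (K a b))) \<beta> =
    sweedler P T (\<lambda>a b. \<beta> (F a b) (K a b))"
proof -
  have "sweedler P (sweedler (tensor V' W') T (\<lambda>a b. pure_tensor V' W' (F a b) (K a b))) \<beta> =
     sweedler P T (\<lambda>a b. sweedler P (pure_tensor V' W' (F a b) (K a b)) \<beta>)"
    by (rule sweedler_comp[OF assms(1,2) _ assms(7) klinear_sweedler]) (use assms in auto)
  also have "\<dots> = sweedler P T (\<lambda>a b. \<beta> (F a b) (K a b))"
    by (rule sweedler_cong[OF assms(1,2,5) bilin_out[OF assms(7) klinear_sweedler]])
      (use assms in \<open>auto simp: sweedler_pure\<close>)
  finally show ?thesis .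
qed

text \<open>
  The double Sweedler sums in the axioms of matched pairs, and the coproduct of a bicrossed product,
  have the form \<open>\<Phi>(p(u\<^sub>1, a\<^sub>1), q(u\<^sub>2, a\<^sub>2))\<close>.
\<close>

lemma bilin_sweedler_sweedler:
  assumes v: "vspace Z" "vspace Y" "vspace W" and dX: "klinear Z (tensor Z Z) dX" and dY: "klinear Y (tensor Y Y) dY"
    and p: "bilin Z Y U p" and q: "bilin Z Y V q" and \<Phi>: "bilin U V W \<Phi>"
  shows "T \<in> carrier (tensor Y Y) \<Longrightarrow> bilin Z Z W (\<lambda>x1 x2. sweedler W T (\<lambda>y1 y2. \<Phi> (p x1 y1) (q x2 y2)))"
    and "bilin Z Y W (\<lambda>x y. sweedler W (dX x) (\<lambda>x1 x2. sweedler W (dY y) (\<lambda>y1 y2. \<Phi> (p x1 y1) (q x2 y2))))"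
proof -
  have iY: "bilin Y Y W (\<lambda>y1 y2. \<Phi> (p x1 y1) (q x2 y2))" if "x1 \<in> carrier Z" "x2 \<in> carrier Z" for x1 x2
    by (rule bilin_comp[OF \<Phi> bilin_right[OF p that(1)] bilin_right[OF q that(2)]])
  have iX: "bilin Z Z W (\<lambda>x1 x2. \<Phi> (p x1 y1) (q x2 y2))" if "y1 \<in> carrier Y" "y2 \<in> carrier Y" for y1 y2
    by (rule bilin_comp[OF \<Phi> bilin_left[OF p that(1)] bilin_left[OF q that(2)]])
  show m: "bilin Z Z W (\<lambda>x1 x2. sweedler W T (\<lambda>y1 y2. \<Phi> (p x1 y1) (q x2 y2)))" if T: "T \<in> carrier (tensor Y Y)" for T
  proof (rule bilinI)
    fix x2 assume x: "x2 \<in> carrier Z"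
    show "klinear Z W (\<lambda>x1. sweedler W T (\<lambda>y1 y2. \<Phi> (p x1 y1) (q x2 y2)))"
      by (rule klinear_sweedler_param[OF v(2,2,3,1) iY[OF _ x] bilin_left[OF iX x] T])
  next
    fix x1 assume x: "x1 \<in> carrier Z"
    show "klinear Z W (\<lambda>x2. sweedler W T (\<lambda>y1 y2. \<Phi> (p x1 y1) (q x2 y2)))"
      by (rule klinear_sweedler_param[OF v(2,2,3,1) iY[OF x] bilin_right[OF iX x] T])
  qed
  show "bilin Z Y W (\<lambda>x y. sweedler W (dX x) (\<lambda>x1 x2. sweedler W (dY y) (\<lambda>y1 y2. \<Phi> (p x1 y1) (q x2 y2))))"
  proof (rule bilinI)
    fix y assume y: "y \<in> carrier Y"
    show "klinear Z W (\<lambda>x. sweedler W (dX x) (\<lambda>x1 x2. sweedler W (dY y) (\<lambda>y1 y2. \<Phi> (p x1 y1) (q x2 y2))))"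
      by (rule klinear_comp[OF dX klinear_sweedler[OF v(1,1,3) m[OF klinear_closed[OF dY y]]]])
  next
    fix x assume x: "x \<in> carrier Z"
    show "klinear Y W (\<lambda>y. sweedler W (dX x) (\<lambda>x1 x2. sweedler W (dY y) (\<lambda>y1 y2. \<Phi> (p x1 y1) (q x2 y2))))"
      by (rule klinear_sweedler_param[OF v(1,1,3,2) m[OF klinear_closed[OF dY]]
        klinear_comp[OF dY klinear_sweedler[OF v(2,2,3) iY]] klinear_closed[OF dX x]])
  qed
qed

text \<open>
  The summands of the two sides of coassociativity.
\<close>

lemma bilin_coassoc:
  assumes V [simp]: "vspace V"
  shows "klinear V (tensor V V) D \<Longrightarrow> bilin V V (tensor V (tensor V V)) (\<lambda>c1 c2. pure_tensor V (tensor V V) c1 (D c2))"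
    and "c2 \<in> carrier V \<Longrightarrow> bilin V V (tensor V (tensor V V)) (\<lambda>c11 c12. pure_tensor V (tensor V V) c11 (pure_tensor V V c12 c2))"
    and "klinear V (tensor V V) D \<Longrightarrow> bilin V V (tensor V (tensor V V)) (\<lambda>c1 c2.
      sweedler (tensor V (tensor V V)) (D c1) (\<lambda>c11 c12. pure_tensor V (tensor V V) c11 (pure_tensor V V c12 c2)))"
proof -
  let ?T = "tensor V V" and ?TT = "tensor V (tensor V V)"
  show "bilin V V ?TT (\<lambda>c1 c2. pure_tensor V ?T c1 (D c2))" if "klinear V ?T D"
    by (rule bilin_pure_comp[OF _ _ klinear_id that]) simp_all
  show 2: "bilin V V ?TT (\<lambda>c11 c12. pure_tensor V ?T c11 (pure_tensor V V c12 c2))" if "c2 \<in> carrier V" for c2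
    by (rule bilin_pure_comp[OF _ _ klinear_id bilin_left[OF bilin_pure_tensor]]) (use that in simp_all)
  have 3: "klinear V ?TT (\<lambda>c2. pure_tensor V ?T c11 (pure_tensor V V c12 c2))" if "c11 \<in> carrier V" "c12 \<in> carrier V" for c11 c12
    by (rule klinear_comp[OF bilin_right[OF bilin_pure_tensor] bilin_right[OF bilin_pure_tensor]]) (use that in simp_all)
  show "bilin V V ?TT (\<lambda>c1 c2. sweedler ?TT (D c1) (\<lambda>c11 c12. pure_tensor V ?T c11 (pure_tensor V V c12 c2)))" if D: "klinear V ?T D"
    by (rule bilinI) (auto intro!: klinear_comp[OF D klinear_sweedler[OF _ _ _ 2]] klinear_sweedler_param[OF _ _ _ _ 2 3] klinear_closed[OF D])
qed

section \<open>Tensor products of algebras\<close>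

lemma lin_ext_free_space:
  fixes v :: "'x \<Rightarrow>\<^sub>0 'k::field" and \<beta> :: "'x \<Rightarrow> 'y \<Rightarrow>\<^sub>0 'k"
  assumes "\<And>a. a \<in> Poly_Mapping.keys v \<Longrightarrow> Poly_Mapping.keys (\<beta> a) \<subseteq> U"
  shows "lin_ext (free_space U) \<beta> v = (\<Sum>a\<in>Poly_Mapping.keys v. fscale (Poly_Mapping.lookup v a) (\<beta> a))"
proof -
  interpret abelian_group "free_space U :: ('k, 'y \<Rightarrow>\<^sub>0 'k) module"
    by (rule vspace_abelian_group) simp
  have "(\<Oplus>\<^bsub>free_space U\<^esub>a\<in>A. fscale (Poly_Mapping.lookup v a) (\<beta> a)) =
     (\<Sum>a\<in>A. fscale (Poly_Mapping.lookup v a) (\<beta> a))" if "finite A" "A \<subseteq> Poly_Mapping.keys v" for A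
    using that
  proof (induction A rule: finite_induct)
    case (insert x F)
    have "\<And>a. a \<in> insert x F \<Longrightarrow> fscale (Poly_Mapping.lookup v a) (\<beta> a) \<in> carrier (free_space U)"
      using insert.prems assms keys_fscale[THEN subsetD] by fastforce
    then show ?case using insert by (subst finsum_insert) auto
  qed simp
  then show ?thesis by (simp add: lin_ext_def)
qed

text \<open>
  As a bilinear extension the product of a monoid algebra inherits the lemmas on linear extensions.
\<close>

lemma convolve_eq_lin_ext:
  fixes v :: "'x \<Rightarrow>\<^sub>0 'k::field"
  assumes "\<And>a b. a \<in> Poly_Mapping.keys v \<Longrightarrow> b \<in> Poly_Mapping.keys w \<Longrightarrow> m a b \<in> U"
  shows "convolve m v w = lin_ext (free_space U) (\<lambda>a. lin_ext (free_space U) (\<lambda>b. basis_vec (m a b)) w) v"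
proof -
  have 1: "lin_ext (free_space U) (\<lambda>b. basis_vec (m a b)) w =
      (\<Sum>b\<in>Poly_Mapping.keys w. fscale (Poly_Mapping.lookup w b) (basis_vec (m a b)))"
    if "a \<in> Poly_Mapping.keys v" for a
    using that assms by (intro lin_ext_free_space) auto
  have f: "fscale c (\<Sum>a\<in>A. F a) = (\<Sum>a\<in>A. fscale c (F a))" if "finite A" for c :: 'k and A and F :: "'x \<Rightarrow> 'x \<Rightarrow>\<^sub>0 'k"
    using that by (induction A rule: finite_induct) auto
  have k: "Poly_Mapping.keys (lin_ext (free_space U) (\<lambda>b. basis_vec (m a b)) w) \<subseteq> U"
    if "a \<in> Poly_Mapping.keys v" for a
    using lin_ext_closed[of "free_space U" w "\<lambda>b. basis_vec (m a b)"] that assms by auto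
  show ?thesis
    by (subst lin_ext_free_space[OF k])
      (auto simp: convolve_def 1[unfolded basis_vec_def] f basis_vec_def intro!: sum.cong)
qed

context
  fixes V :: "('k::field, 'a, 'm) module_scheme" and W :: "('k, 'b, 'n) module_scheme"
  assumes V: "kalgebra V" and W: "kalgebra W"
begin

lemma bilin_tensor_mult1:
  assumes "x \<in> carrier V" "y \<in> carrier W"
  shows "bilin V W (tensor V W) (\<lambda>a' b'. pure_tensor V W (x \<otimes>\<^bsub>V\<^esub> a') (y \<otimes>\<^bsub>W\<^esub> b'))"
  by (rule bilin_pure_comp[OF _ _ klinear_mult_left klinear_mult_left]) (use V W assms in auto)

lemma bilin_tensor_mult2':
  assumes "x \<in> carrier V" "y \<in> carrier W"
  shows "bilin V W (tensor V W) (\<lambda>a' b'. pure_tensor V W (a' \<otimes>\<^bsub>V\<^esub> x) (b' \<otimes>\<^bsub>W\<^esub> y))"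
  by (rule bilin_pure_comp[OF _ _ klinear_mult_right klinear_mult_right]) (use V W assms in auto)

lemma bilin_tensor_mult3:
  assumes "T \<in> carrier (tensor V W)"
  shows "bilin V W (tensor V W)
    (\<lambda>a b. sweedler (tensor V W) T (\<lambda>a' b'. pure_tensor V W (a \<otimes>\<^bsub>V\<^esub> a') (b \<otimes>\<^bsub>W\<^esub> b')))"
proof (rule bilinI)
  have VW: "vspace V" "vspace W" "vspace (tensor V W)" using V W by auto
  {
    fix b assume b: "b \<in> carrier W"
    show "klinear V (tensor V W) (\<lambda>a. sweedler (tensor V W) T (\<lambda>a' b'. pure_tensor V W (a \<otimes>\<^bsub>V\<^esub> a') (b \<otimes>\<^bsub>W\<^esub> b')))"
      by (rule klinear_sweedler_param[OF VW VW(1) bilin_tensor_mult1 bilin_left[OF bilin_tensor_mult2'] assms])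
        (use b W in auto)
  next
    fix a assume a: "a \<in> carrier V"
    show "klinear W (tensor V W) (\<lambda>b. sweedler (tensor V W) T (\<lambda>a' b'. pure_tensor V W (a \<otimes>\<^bsub>V\<^esub> a') (b \<otimes>\<^bsub>W\<^esub> b')))"
      by (rule klinear_sweedler_param[OF VW VW(2) bilin_tensor_mult1 bilin_right[OF bilin_tensor_mult2'] assms])
        (use a V in auto)
  }
qed

lemma tensor_mult:
  assumes S: "S \<in> carrier (tensor V W)" and T: "T \<in> carrier (tensor V W)"
  shows "S \<otimes>\<^bsub>tensor V W\<^esub> T = sweedler (tensor V W) S (\<lambda>a b. sweedler (tensor V W) T
    (\<lambda>a' b'. pure_tensor V W (a \<otimes>\<^bsub>V\<^esub> a') (b \<otimes>\<^bsub>W\<^esub> b')))"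
proof -
  let ?U = "carrier V \<times> carrier W"
  let ?F = "free_space ?U :: ('k, _) module"
  let ?m = "\<lambda>(a, b) (a', b'). (a \<otimes>\<^bsub>V\<^esub> a', b \<otimes>\<^bsub>W\<^esub> b')"
  have VW: "vspace V" "vspace W" using V W by auto
  have kS: "Poly_Mapping.keys (rep S) \<subseteq> ?U" "Poly_Mapping.keys (rep T) \<subseteq> ?U"
    using rep_tensor(1)[OF VW] S T by (auto simp: tensor_free_def)
  have m: "?m x y \<in> ?U" if "x \<in> ?U" "y \<in> ?U" for x y using that V W by auto
  have m': "?m x y \<in> ?U" if "x \<in> Poly_Mapping.keys (rep S)" "y \<in> Poly_Mapping.keys (rep T)" for x y
    using m that kS by blast
  have k: "basis_vec (?m x y) \<in> carrier ?F" if "x \<in> Poly_Mapping.keys (rep S)" "y \<in> Poly_Mapping.keys (rep T)" for x y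
    using m'[OF that] by simp
  have "S \<otimes>\<^bsub>tensor V W\<^esub> T = tensor_class V W (convolve ?m (rep S) (rep T))"
    by (simp add: tensor_simps)
  also have "convolve ?m (rep S) (rep T) = lin_ext ?F (\<lambda>a. lin_ext ?F (\<lambda>b. basis_vec (?m a b)) (rep T)) (rep S)"
    by (rule convolve_eq_lin_ext) (rule m')
  also have "tensor_class V W \<dots> = lin_ext (tensor V W) (\<lambda>a. tensor_class V W (lin_ext ?F (\<lambda>b. basis_vec (?m a b)) (rep T))) (rep S)"
    by (rule klinear_lin_ext_commute[OF klinear_tensor_class[OF VW]])
      (use VW k in \<open>auto intro!: lin_ext_closed simp del: free_space_simps\<close>)
  also have "\<dots> = lin_ext (tensor V W) (\<lambda>a. lin_ext (tensor V W) (\<lambda>b. tensor_class V W (basis_vec (?m a b))) (rep T)) (rep S)"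
    by (rule lin_ext_cong, rule klinear_lin_ext_commute[OF klinear_tensor_class[OF VW]])
      (use VW k in \<open>auto intro!: lin_ext_closed klinear_closed[OF klinear_tensor_class[OF VW]] simp del: free_space_simps\<close>)
  also have "\<dots> = lin_ext (tensor V W) (\<lambda>(a, b). lin_ext (tensor V W) (\<lambda>(a', b'). pure_tensor V W (a \<otimes>\<^bsub>V\<^esub> a') (b \<otimes>\<^bsub>W\<^esub> b')) (rep T)) (rep S)"
    by (simp add: pure_tensor_def case_prod_beta')
  finally show ?thesis by (simp add: sweedler_def)
qed

lemma bilin_tensor_mult: "bilin (tensor V W) (tensor V W) (tensor V W) (\<lambda>S T. S \<otimes>\<^bsub>tensor V W\<^esub> T)"
proof (rule bilinI)
  fix T assume T: "T \<in> carrier (tensor V W)"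
  have "klinear (tensor V W) (tensor V W) (\<lambda>S. sweedler (tensor V W) S (\<lambda>a b. sweedler (tensor V W) T
    (\<lambda>a' b'. pure_tensor V W (a \<otimes>\<^bsub>V\<^esub> a') (b \<otimes>\<^bsub>W\<^esub> b'))))"
    by (rule klinear_sweedler[OF _ _ _ bilin_tensor_mult3[OF T]]) (use V W in auto)
  then show "klinear (tensor V W) (tensor V W) (\<lambda>S. S \<otimes>\<^bsub>tensor V W\<^esub> T)"
    by (rule klinear_cong) (use T V W tensor_mult in auto)
next
  fix S assume S: "S \<in> carrier (tensor V W)"
  have VW: "vspace V" "vspace W" "vspace (tensor V W)" using V W by auto
  have "klinear (tensor V W) (tensor V W) (\<lambda>T. sweedler (tensor V W) S (\<lambda>a b. sweedler (tensor V W) T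
    (\<lambda>a' b'. pure_tensor V W (a \<otimes>\<^bsub>V\<^esub> a') (b \<otimes>\<^bsub>W\<^esub> b'))))"
    by (rule klinear_sweedler_param[OF VW VW(3) bilin_tensor_mult3 klinear_sweedler[OF VW bilin_tensor_mult1] S])
  then show "klinear (tensor V W) (tensor V W) (\<lambda>T. S \<otimes>\<^bsub>tensor V W\<^esub> T)"
    by (rule klinear_cong) (use S V W tensor_mult in auto)
qed

lemma tensor_mult_pure:
  assumes "a \<in> carrier V" "b \<in> carrier W" "a' \<in> carrier V" "b' \<in> carrier W"
  shows "pure_tensor V W a b \<otimes>\<^bsub>tensor V W\<^esub> pure_tensor V W a' b' = pure_tensor V W (a \<otimes>\<^bsub>V\<^esub> a') (b \<otimes>\<^bsub>W\<^esub> b')"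
  using V W assms
  by (simp add: tensor_mult sweedler_pure[OF _ _ _ bilin_tensor_mult3] sweedler_pure[OF _ _ _ bilin_tensor_mult1])

lemma kalgebra_tensor [simp]: "kalgebra (tensor V W)"
proof -
  have VW: "vspace V" "vspace W" "vspace (tensor V W)" using V W by auto
  note L = bilin_left[OF bilin_tensor_mult] and R = bilin_right[OF bilin_tensor_mult]
  have cl: "S \<otimes>\<^bsub>tensor V W\<^esub> T \<in> carrier (tensor V W)" if "S \<in> carrier (tensor V W)" "T \<in> carrier (tensor V W)" for S T
    using that by (rule bilin_closed[OF bilin_tensor_mult])
  have p: "pure_tensor V W a b \<in> carrier (tensor V W)" if "a \<in> carrier V" "b \<in> carrier W" for a b
    using that VW by simp
  have 1: "S \<otimes>\<^bsub>tensor V W\<^esub> T \<otimes>\<^bsub>tensor V W\<^esub> pure_tensor V W a b = S \<otimes>\<^bsub>tensor V W\<^esub> (T \<otimes>\<^bsub>tensor V W\<^esub> pure_tensor V W a b)"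
    if "S \<in> carrier (tensor V W)" "T \<in> carrier (tensor V W)" "a \<in> carrier V" "b \<in> carrier W" for S T a b
    using that(1)
  proof (induction rule: tensor_induct[OF VW(1,2), consumes 1, case_names pure add])
    case (pure x y)
    show ?case using that(2)
    proof (induction rule: tensor_induct[OF VW(1,2), consumes 1, case_names pure add])
      case (pure x' y')
      then show ?case using \<open>x \<in> _\<close> \<open>y \<in> _\<close> that V W by (simp add: tensor_mult_pure ka_assoc)
    next
      case (add S T)
      then show ?case using \<open>x \<in> _\<close> \<open>y \<in> _\<close> that p cl by (simp add: klinear_add[OF L] klinear_add[OF R])
    qed
  next
    case (add S S')
    then show ?case using that p cl by (simp add: klinear_add[OF L])
  qed
  show ?thesis
  proof (rule kalgebraI, goal_cases)
    case (4 S T R)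
    show ?case using 4(3)
    proof (induction rule: tensor_induct[OF VW(1,2), consumes 1, case_names pure add])
      case (pure x y)
      then show ?case using 1 4 by simp
    next
      case (add R R')
      then show ?case using 4 cl by (simp add: klinear_add[OF R])
    qed
  next
    case (5 T)
    then show ?case
    proof (induction rule: tensor_induct[OF VW(1,2), consumes 1, case_names pure add])
      case (pure x y)
      then show ?case using V W by (simp add: tensor_simps(6) tensor_mult_pure)
    next
      case (add S T)
      then show ?case using V W p by (simp add: klinear_add[OF R] tensor_simps(6))
    qed
  next
    case (6 T)
    then show ?case
    proof (induction rule: tensor_induct[OF VW(1,2), consumes 1, case_names pure add])
      case (pure x y)
      then show ?case using V W by (simp add: tensor_simps(6) tensor_mult_pure)
    next
      case (add S T)
      then show ?case using V W p by (simp add: klinear_add[OF L] tensor_simps(6))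
    qed
  qed (use VW V W cl in \<open>auto simp: tensor_simps(6) klinear_add[OF L] klinear_add[OF R] klinear_smult[OF L] klinear_smult[OF R]\<close>)
qed

lemma sweedler_mult_expand:
  assumes P: "vspace P" and \<beta>: "bilin V W P \<beta>" and S: "S \<in> carrier (tensor V W)" and T: "T \<in> carrier (tensor V W)"
  shows "sweedler P (S \<otimes>\<^bsub>tensor V W\<^esub> T) \<beta> =
    sweedler P S (\<lambda>a b. sweedler P T (\<lambda>a' b'. \<beta> (a \<otimes>\<^bsub>V\<^esub> a') (b \<otimes>\<^bsub>W\<^esub> b')))"
proof -
  have VW: "vspace V" "vspace W" "vspace (tensor V W)" using V W by auto
  have in': "sweedler P (sweedler (tensor V W) T (\<lambda>a' b'. pure_tensor V W (a \<otimes>\<^bsub>V\<^esub> a') (b \<otimes>\<^bsub>W\<^esub> b'))) \<beta> =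
     sweedler P T (\<lambda>a' b'. \<beta> (a \<otimes>\<^bsub>V\<^esub> a') (b \<otimes>\<^bsub>W\<^esub> b'))" if "a \<in> carrier V" "b \<in> carrier W" for a b
    by (rule sweedler_map[OF VW(1,2) VW(1,2) P \<beta> bilin_tensor_mult1]) (use that V W T in auto)
  have "sweedler P (S \<otimes>\<^bsub>tensor V W\<^esub> T) \<beta> = sweedler P S (\<lambda>a b. sweedler P (sweedler (tensor V W) T
    (\<lambda>a' b'. pure_tensor V W (a \<otimes>\<^bsub>V\<^esub> a') (b \<otimes>\<^bsub>W\<^esub> b'))) \<beta>)"
    unfolding tensor_mult[OF S T]
    by (rule sweedler_comp[OF VW bilin_tensor_mult3[OF T] klinear_sweedler[OF VW(1,2) P \<beta>] P S])
  also have "\<dots> = sweedler P S (\<lambda>a b. sweedler P T (\<lambda>a' b'. \<beta> (a \<otimes>\<^bsub>V\<^esub> a') (b \<otimes>\<^bsub>W\<^esub> b')))"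
    by (rule sweedler_cong[OF VW(1,2) P bilin_out[OF bilin_tensor_mult3[OF T] klinear_sweedler[OF VW(1,2) P \<beta>]] S])
      (rule in')
  finally show ?thesis .
qed

text \<open>
  This makes \<open>u \<mapsto> \<beta>(u\<^sub>1, u\<^sub>2)\<close> multiplicative for suitable \<open>\<beta>\<close>, given that \<open>\<Delta>\<close> is.
\<close>

lemma sweedler_mult:
  assumes P: "kalgebra P" and \<beta>: "bilin V W P \<beta>" "bilin V W P \<beta>'" "bilin V W P \<beta>''"
    and S: "S \<in> carrier (tensor V W)" and T: "T \<in> carrier (tensor V W)"
    and eq: "\<And>a b a' b'. a \<in> carrier V \<Longrightarrow> b \<in> carrier W \<Longrightarrow> a' \<in> carrier V \<Longrightarrow> b' \<in> carrier W \<Longrightarrow>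
      \<beta>'' (a \<otimes>\<^bsub>V\<^esub> a') (b \<otimes>\<^bsub>W\<^esub> b') = \<beta> a b \<otimes>\<^bsub>P\<^esub> \<beta>' a' b'"
  shows "sweedler P (S \<otimes>\<^bsub>tensor V W\<^esub> T) \<beta>'' = sweedler P S \<beta> \<otimes>\<^bsub>P\<^esub> sweedler P T \<beta>'"
proof -
  have VW: "vspace V" "vspace W" "vspace (tensor V W)" "vspace P" using V W P by auto
  note cl = sweedler_closed[OF VW(1,2,4) \<beta>(1)] sweedler_closed[OF VW(1,2,4) \<beta>(2)]
    sweedler_closed[OF VW(1,2,4) \<beta>(3)]
  note lin = klinear_sweedler[OF VW(1,2,4)]
  have A: "kalgebra (tensor V W)" by simp
  show ?thesis using S
  proof (induction rule: tensor_induct[OF VW(1,2), consumes 1, case_names pure add])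
    case (pure x y)
    show ?case using T
    proof (induction rule: tensor_induct[OF VW(1,2), consumes 1, case_names pure add])
      case (pure x' y')
      then show ?case using \<open>x \<in> _\<close> \<open>y \<in> _\<close> V W
        by (simp add: tensor_mult_pure sweedler_pure[OF VW(1,2,4) \<beta>(1)]
          sweedler_pure[OF VW(1,2,4) \<beta>(2)] sweedler_pure[OF VW(1,2,4) \<beta>(3)] eq)
    next
      case (add S T)
      then show ?case using \<open>x \<in> _\<close> \<open>y \<in> _\<close> VW P A cl
        by (simp add: ka_mult_add klinear_add[OF lin[OF \<beta>(2)]] klinear_add[OF lin[OF \<beta>(3)]])
    qed
  next
    case (add S S')
    then show ?case using T VW P A cl
      by (simp add: ka_add_mult klinear_add[OF lin[OF \<beta>(1)]] klinear_add[OF lin[OF \<beta>(3)]])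
  qed
qed

end

section \<open>Algebra homomorphisms and Hopf algebras\<close>

definition khom :: "('k::field, 'a, 'm) module_scheme \<Rightarrow> ('k, 'b, 'n) module_scheme \<Rightarrow> ('a \<Rightarrow> 'b) \<Rightarrow> bool" where
  "khom A B \<phi> \<longleftrightarrow> klinear A B \<phi> \<and> \<phi> \<in> ring_hom A B"

lemma khomI:
  "klinear A B \<phi> \<Longrightarrow> \<phi> \<one>\<^bsub>A\<^esub> = \<one>\<^bsub>B\<^esub> \<Longrightarrow>
   (\<And>a b. a \<in> carrier A \<Longrightarrow> b \<in> carrier A \<Longrightarrow> \<phi> (a \<otimes>\<^bsub>A\<^esub> b) = \<phi> a \<otimes>\<^bsub>B\<^esub> \<phi> b) \<Longrightarrow> khom A B \<phi>"
  unfolding khom_def by (auto intro!: ring_hom_memI dest: klinear_closed klinear_add)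
lemma khom_klinear: "khom A B \<phi> \<Longrightarrow> klinear A B \<phi>" by (simp add: khom_def)
lemma khom_ring_hom: "khom A B \<phi> \<Longrightarrow> \<phi> \<in> ring_hom A B" by (simp add: khom_def)
lemma khom_one: "khom A B \<phi> \<Longrightarrow> \<phi> \<one>\<^bsub>A\<^esub> = \<one>\<^bsub>B\<^esub>" by (auto simp: khom_def ring_hom_one)
lemma khom_mult: "khom A B \<phi> \<Longrightarrow> a \<in> carrier A \<Longrightarrow> b \<in> carrier A \<Longrightarrow> \<phi> (a \<otimes>\<^bsub>A\<^esub> b) = \<phi> a \<otimes>\<^bsub>B\<^esub> \<phi> b"
  by (auto simp: khom_def ring_hom_mult)
lemma khom_closed: "khom A B \<phi> \<Longrightarrow> a \<in> carrier A \<Longrightarrow> \<phi> a \<in> carrier B"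
  by (rule klinear_closed[OF khom_klinear])
lemma khom_comp: "khom A B \<phi> \<Longrightarrow> khom B C \<psi> \<Longrightarrow> khom A C (\<lambda>a. \<psi> (\<phi> a))"
  by (rule khomI) (auto simp: khom_one khom_mult khom_closed intro: klinear_comp khom_klinear)

lemma khom_sweedler:
  assumes "kalgebra V" "kalgebra W" "kalgebra P" "bilin V W P \<beta>" "\<beta> \<one>\<^bsub>V\<^esub> \<one>\<^bsub>W\<^esub> = \<one>\<^bsub>P\<^esub>"
    and "\<And>a b a' b'. a \<in> carrier V \<Longrightarrow> b \<in> carrier W \<Longrightarrow> a' \<in> carrier V \<Longrightarrow> b' \<in> carrier W \<Longrightarrow>
      \<beta> (a \<otimes>\<^bsub>V\<^esub> a') (b \<otimes>\<^bsub>W\<^esub> b') = \<beta> a b \<otimes>\<^bsub>P\<^esub> \<beta> a' b'"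
  shows "khom (tensor V W) P (\<lambda>T. sweedler P T \<beta>)"
proof (rule khomI)
  show "klinear (tensor V W) P (\<lambda>T. sweedler P T \<beta>)" using assms by (intro klinear_sweedler) auto
  show "sweedler P \<one>\<^bsub>tensor V W\<^esub> \<beta> = \<one>\<^bsub>P\<^esub>" using assms by (simp add: tensor_simps(6) sweedler_pure)
qed (rule sweedler_mult, use assms in auto)

lemma kalgebra_ground [simp]: "kalgebra ground"
  by (rule kalgebraI) (auto simp: algebra_simps)

text \<open>
  Closure under left multiplication by generators, rather than under arbitrary products, yields an
  induction that removes one generator at a time.
\<close>

definition generates :: "('k::field, 'a, 'm) module_scheme \<Rightarrow> 'a set \<Rightarrow> bool" where
  "generates B U \<longleftrightarrow> U \<subseteq> carrier B \<and> (\<forall>Q. \<one>\<^bsub>B\<^esub> \<in> Q \<longrightarrow>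
     (\<forall>u\<in>U. \<forall>w\<in>carrier B \<inter> Q. u \<otimes>\<^bsub>B\<^esub> w \<in> Q) \<longrightarrow>
     (\<forall>u\<in>carrier B \<inter> Q. \<forall>v\<in>carrier B \<inter> Q. u \<oplus>\<^bsub>B\<^esub> v \<in> Q) \<longrightarrow>
     (\<forall>c. \<forall>u\<in>carrier B \<inter> Q. c \<odot>\<^bsub>B\<^esub> u \<in> Q) \<longrightarrow> carrier B \<subseteq> Q)"

lemma generates_induct [consumes 2, case_names one mult add smult]:
  assumes "generates B U" "u \<in> carrier B" "Q \<one>\<^bsub>B\<^esub>"
    "\<And>u w. u \<in> U \<Longrightarrow> u \<in> carrier B \<Longrightarrow> w \<in> carrier B \<Longrightarrow> Q w \<Longrightarrow> Q (u \<otimes>\<^bsub>B\<^esub> w)"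
    "\<And>u v. u \<in> carrier B \<Longrightarrow> v \<in> carrier B \<Longrightarrow> Q u \<Longrightarrow> Q v \<Longrightarrow> Q (u \<oplus>\<^bsub>B\<^esub> v)"
    "\<And>c u. u \<in> carrier B \<Longrightarrow> Q u \<Longrightarrow> Q (c \<odot>\<^bsub>B\<^esub> u)"
  shows "Q u"
proof -
  have "carrier B \<subseteq> Collect Q"
  proof -
    have U: "U \<subseteq> carrier B" using assms(1) by (simp add: generates_def)
    have "\<one>\<^bsub>B\<^esub> \<in> Collect Q \<longrightarrow>
     (\<forall>u\<in>U. \<forall>w\<in>carrier B \<inter> Collect Q. u \<otimes>\<^bsub>B\<^esub> w \<in> Collect Q) \<longrightarrow>
     (\<forall>u\<in>carrier B \<inter> Collect Q. \<forall>v\<in>carrier B \<inter> Collect Q. u \<oplus>\<^bsub>B\<^esub> v \<in> Collect Q) \<longrightarrow>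
     (\<forall>c. \<forall>u\<in>carrier B \<inter> Collect Q. c \<odot>\<^bsub>B\<^esub> u \<in> Collect Q) \<longrightarrow> carrier B \<subseteq> Collect Q"
      using assms(1) unfolding generates_def by (elim conjE) (erule spec)
    moreover have "\<one>\<^bsub>B\<^esub> \<in> Collect Q" using assms(3) by simp
    moreover have "\<forall>u\<in>U. \<forall>w\<in>carrier B \<inter> Collect Q. u \<otimes>\<^bsub>B\<^esub> w \<in> Collect Q"
      using assms(4) U by auto
    moreover have "\<forall>u\<in>carrier B \<inter> Collect Q. \<forall>v\<in>carrier B \<inter> Collect Q. u \<oplus>\<^bsub>B\<^esub> v \<in> Collect Q"
      using assms(5) by auto
    moreover have "\<forall>c. \<forall>u\<in>carrier B \<inter> Collect Q. c \<odot>\<^bsub>B\<^esub> u \<in> Collect Q" using assms(6) by auto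
    ultimately show ?thesis by blast
  qed
  then show ?thesis using assms(2) by auto
qed

lemma khom_ext:
  assumes "generates A U" "khom A B \<phi>" "khom A B \<psi>" "\<And>u. u \<in> U \<Longrightarrow> \<phi> u = \<psi> u" "u \<in> carrier A"
  shows "\<phi> u = \<psi> u"
  using assms(1,5)
proof (induction rule: generates_induct)
  case (add u v)
  then show ?case by (simp add: klinear_add[OF khom_klinear[OF assms(2)]] klinear_add[OF khom_klinear[OF assms(3)]])
next
  case (smult c u)
  then show ?case by (simp add: klinear_smult[OF khom_klinear[OF assms(2)]] klinear_smult[OF khom_klinear[OF assms(3)]])
qed (use assms in \<open>auto simp: khom_one[of A B] khom_mult[of A B]\<close>)

text \<open>
  All bialgebra axioms compare algebra homomorphisms, and the elements satisfying the antipode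
  equations are closed under products when \<open>S\<close> is antimultiplicative: as
  \<open>S(v\<^sub>1) S(u\<^sub>1) u\<^sub>2 v\<^sub>2 = \<epsilon>(u) S(v\<^sub>1) v\<^sub>2\<close>. So the axioms need to be checked on
  algebra generators only.
\<close>

theorem hopf_algebra_generators:
  fixes B :: "('k::field, 'a) hopf" (structure)
  assumes B: "kalgebra B" and D: "khom B (tensor B B) (comult B)" and E: "khom B ground (counit B)"
    and S: "klinear B B (antipode B)" "antipode B \<one> = \<one>"
      "\<And>u v. u \<in> carrier B \<Longrightarrow> v \<in> carrier B \<Longrightarrow> antipode B (u \<otimes> v) = antipode B v \<otimes> antipode B u"
    and gen: "generates B U"
    and coassoc: "\<And>c. c \<in> U \<Longrightarrow> sweedler (tensor B (tensor B B)) (comult B c)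
          (\<lambda>c1 c2. pure_tensor B (tensor B B) c1 (comult B c2)) =
        sweedler (tensor B (tensor B B)) (comult B c) (\<lambda>c1 c2.
          sweedler (tensor B (tensor B B)) (comult B c1)
            (\<lambda>c11 c12. pure_tensor B (tensor B B) c11 (pure_tensor B B c12 c2)))"
    and counit: "\<And>c. c \<in> U \<Longrightarrow> sweedler B (comult B c) (\<lambda>c1 c2. counit B c1 \<odot> c2) = c"
      "\<And>c. c \<in> U \<Longrightarrow> sweedler B (comult B c) (\<lambda>c1 c2. counit B c2 \<odot> c1) = c"
    and antipode: "\<And>u. u \<in> U \<Longrightarrow> sweedler B (comult B u) (\<lambda>u1 u2. antipode B u1 \<otimes> u2) = counit B u \<odot> \<one>"
      "\<And>u. u \<in> U \<Longrightarrow> sweedler B (comult B u) (\<lambda>u1 u2. u1 \<otimes> antipode B u2) = counit B u \<odot> \<one>"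
  shows "hopf_algebra B"
proof -
  have v [simp]: "vspace B" using B by simp
  note lD = khom_klinear[OF D] and lE = khom_klinear[OF E]
  have Dc [simp]: "comult B u \<in> carrier (tensor B B)" if "u \<in> carrier B" for u
    using that by (rule klinear_closed[OF lD])
  have Sc [simp]: "antipode B u \<in> carrier B" if "u \<in> carrier B" for u
    using that by (rule klinear_closed[OF S(1)])
  let ?T = "tensor B B" and ?TT = "tensor B (tensor B B)"
  have alg: "kalgebra ?T" "kalgebra ?TT" using B by auto
  note b1 = bilin_coassoc(1)[OF v lD] and b2 = bilin_coassoc(2)[OF v] and b3 = bilin_coassoc(3)[OF v lD]
  have h1: "khom B ?TT (\<lambda>c. sweedler ?TT (comult B c) (\<lambda>c1 c2. pure_tensor B ?T c1 (comult B c2)))"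
    by (rule khom_comp[OF D khom_sweedler[OF B B alg(2) b1]])
      (use B alg in \<open>auto simp: khom_one[OF D] khom_mult[OF D] tensor_simps(6) tensor_mult_pure\<close>)
  have h2: "khom B ?TT (\<lambda>c. sweedler ?TT (comult B c) (\<lambda>c1 c2.
          sweedler ?TT (comult B c1) (\<lambda>c11 c12. pure_tensor B ?T c11 (pure_tensor B B c12 c2))))"
  proof (rule khom_comp[OF D khom_sweedler[OF B B alg(2) b3]])
    show "sweedler ?TT (comult B \<one>) (\<lambda>c11 c12. pure_tensor B ?T c11 (pure_tensor B B c12 \<one>)) = \<one>\<^bsub>?TT\<^esub>"
      using B by (simp add: khom_one[OF D] tensor_simps(6) sweedler_pure[OF _ _ _ b2])
  next
    fix a b a' b' assume "a \<in> carrier B" "b \<in> carrier B" "a' \<in> carrier B" "b' \<in> carrier B"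
    then show "sweedler ?TT (comult B (a \<otimes> a')) (\<lambda>c11 c12. pure_tensor B ?T c11 (pure_tensor B B c12 (b \<otimes> b')))
      = sweedler ?TT (comult B a) (\<lambda>c11 c12. pure_tensor B ?T c11 (pure_tensor B B c12 b)) \<otimes>\<^bsub>?TT\<^esub>
        sweedler ?TT (comult B a') (\<lambda>c11 c12. pure_tensor B ?T c11 (pure_tensor B B c12 b'))"
      unfolding khom_mult[OF D \<open>a \<in> carrier B\<close> \<open>a' \<in> carrier B\<close>] using B alg
      by (intro sweedler_mult[OF B B alg(2) b2 b2 b2]) (auto simp: tensor_mult_pure)
  qed
  have co: "sweedler ?TT (comult B c) (\<lambda>c1 c2. pure_tensor B ?T c1 (comult B c2)) =
     sweedler ?TT (comult B c) (\<lambda>c1 c2.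
          sweedler ?TT (comult B c1) (\<lambda>c11 c12. pure_tensor B ?T c11 (pure_tensor B B c12 c2)))"
    if "c \<in> carrier B" for c
    by (rule khom_ext[OF gen h1 h2 coassoc that])
  have b4: "bilin B B B (\<lambda>c1 c2. counit B c1 \<odot> c2)"
    by (rule bilin_comp[OF bilin_smult lE klinear_id]) simp
  have b5: "bilin B B B (\<lambda>c1 c2. counit B c2 \<odot> c1)"
    by (rule bilin_flip[OF b4])
  have Em: "counit B (a \<otimes> b) = counit B a * counit B b" if "a \<in> carrier B" "b \<in> carrier B" for a b
    using khom_mult[OF E that] by simp
  have E1: "counit B \<one> = 1" using khom_one[OF E] by simp
  have h4: "khom B B (\<lambda>c. sweedler B (comult B c) (\<lambda>c1 c2. counit B c1 \<odot> c2))"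
    by (rule khom_comp[OF D khom_sweedler[OF B B B b4]])
      (use B in \<open>auto simp: E1 Em ka_smult_mult ka_mult_smult mult.commute\<close>)
  have h5: "khom B B (\<lambda>c. sweedler B (comult B c) (\<lambda>c1 c2. counit B c2 \<odot> c1))"
    by (rule khom_comp[OF D khom_sweedler[OF B B B b5]])
      (use B in \<open>auto simp: E1 Em ka_smult_mult ka_mult_smult mult.commute\<close>)
  have h6: "khom B B (\<lambda>c. c)" by (rule khomI[OF klinear_id]) auto
  have cu1: "sweedler B (comult B c) (\<lambda>c1 c2. counit B c1 \<odot> c2) = c" if "c \<in> carrier B" for c
    by (rule khom_ext[OF gen h4 h6 counit(1) that])
  have cu2: "sweedler B (comult B c) (\<lambda>c1 c2. counit B c2 \<odot> c1) = c" if "c \<in> carrier B" for c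
    by (rule khom_ext[OF gen h5 h6 counit(2) that])
  have b6: "bilin B B B (\<lambda>u1 u2. antipode B u1 \<otimes> u2)"
    by (rule bilin_comp[OF bilin_mult[OF B] S(1) klinear_id])
  have b7: "bilin B B B (\<lambda>u1 u2. u1 \<otimes> antipode B u2)"
    by (rule bilin_comp[OF bilin_mult[OF B] klinear_id S(1)])
  note lin6 = klinear_comp[OF lD klinear_sweedler[OF v v v b6]]
  note lin7 = klinear_comp[OF lD klinear_sweedler[OF v v v b7]]
  have ap1: "sweedler B (comult B u) (\<lambda>u1 u2. antipode B u1 \<otimes> u2) = counit B u \<odot> \<one>"
    if "u \<in> carrier B" for u
    using gen that
  proof (induction rule: generates_induct)
    case one
    show ?case using B by (simp add: khom_one[OF D] tensor_simps(6) sweedler_pure[OF _ _ _ b6] S(2) E1)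
  next
    case (add u v)
    then show ?case using B klinear_add[OF lin6, of u v] klinear_add[OF lE, of u v]
      by (simp add: vs_smult_add)
  next
    case (smult c u)
    then show ?case using B klinear_smult[OF lin6, of u c] klinear_smult[OF lE, of u c] by simp
  next
    case (mult u w)
    note [simp] = \<open>u \<in> carrier B\<close> \<open>w \<in> carrier B\<close>
    have b8: "bilin B B B (\<lambda>v1 v2. (antipode B v1 \<otimes> b) \<otimes> v2)" if "b \<in> carrier B" for b
      by (rule bilin_comp[OF bilin_mult[OF B] klinear_comp[OF S(1) klinear_mult_right[OF B]] klinear_id]) (use that in auto)
    let ?L = "\<lambda>b. sweedler B (comult B w) (\<lambda>v1 v2. (antipode B v1 \<otimes> b) \<otimes> v2)"
    have lL: "klinear B B ?L"
      by (rule klinear_sweedler_param[OF v v v v b8 klinear_comp[OF klinear_mult_left[OF B] klinear_mult_right[OF B]]]) auto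
    have "sweedler B (comult B (u \<otimes> w)) (\<lambda>u1 u2. antipode B u1 \<otimes> u2) =
      sweedler B (comult B u) (\<lambda>u1 u2. sweedler B (comult B w) (\<lambda>v1 v2. antipode B (u1 \<otimes> v1) \<otimes> (u2 \<otimes> v2)))"
      by (simp add: khom_mult[OF D]) (rule sweedler_mult_expand[OF B B v b6], auto)
    also have "\<dots> = sweedler B (comult B u) (\<lambda>u1 u2. ?L (antipode B u1 \<otimes> u2))"
    proof (rule sym, rule sweedler_cong[OF v v v bilin_out[OF b6 lL] Dc[OF \<open>u \<in> carrier B\<close>]])
      fix a b assume "a \<in> carrier B" "b \<in> carrier B"
      then show "?L (antipode B a \<otimes> b) = sweedler B (comult B w) (\<lambda>v1 v2. antipode B (a \<otimes> v1) \<otimes> (b \<otimes> v2))"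
        using B by (intro sweedler_cong[OF v v v b8]) (auto simp: S(3) ka_assoc)
    qed
    also have "\<dots> = ?L (sweedler B (comult B u) (\<lambda>u1 u2. antipode B u1 \<otimes> u2))"
      by (rule sweedler_comp[symmetric, OF v v v b6 lL]) auto
    also have "\<dots> = counit B u \<odot> ?L \<one>"
      unfolding antipode(1)[OF mult(1)] by (rule klinear_smult[OF lL]) (use B in auto)
    also have "?L \<one> = sweedler B (comult B w) (\<lambda>v1 v2. antipode B v1 \<otimes> v2)"
      using B by (intro sweedler_cong[OF v v v b8]) auto
    finally show ?case using mult B by (simp add: Em)
  qed
  have ap2: "sweedler B (comult B u) (\<lambda>u1 u2. u1 \<otimes> antipode B u2) = counit B u \<odot> \<one>"
    if "u \<in> carrier B" for u
    using gen that
  proof (induction rule: generates_induct)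
    case one
    show ?case using B by (simp add: khom_one[OF D] tensor_simps(6) sweedler_pure[OF _ _ _ b7] S(2) E1)
  next
    case (add u v)
    then show ?case using B klinear_add[OF lin7, of u v] klinear_add[OF lE, of u v]
      by (simp add: vs_smult_add)
  next
    case (smult c u)
    then show ?case using B klinear_smult[OF lin7, of u c] klinear_smult[OF lE, of u c] by simp
  next
    case (mult u w)
    note [simp] = \<open>u \<in> carrier B\<close> \<open>w \<in> carrier B\<close>
    have b8: "bilin B B B (\<lambda>v1 v2. (v1 \<otimes> b) \<otimes> antipode B v2)" if "b \<in> carrier B" for b
      by (rule bilin_comp[OF bilin_mult[OF B] klinear_mult_right[OF B] S(1)]) (use that in auto)
    let ?L = "\<lambda>u1 u2. sweedler B (comult B w) (\<lambda>v1 v2. (u1 \<otimes> (v1 \<otimes> antipode B v2)) \<otimes> antipode B u2)"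
    have "sweedler B (comult B (u \<otimes> w)) (\<lambda>u1 u2. u1 \<otimes> antipode B u2) =
      sweedler B (comult B u) (\<lambda>u1 u2. sweedler B (comult B w) (\<lambda>v1 v2. (u1 \<otimes> v1) \<otimes> antipode B (u2 \<otimes> v2)))"
      by (simp add: khom_mult[OF D]) (rule sweedler_mult_expand[OF B B v b7], auto)
    also have "\<dots> = sweedler B (comult B u) (\<lambda>u1 u2. (u1 \<otimes> (counit B w \<odot> \<one>)) \<otimes> antipode B u2)"
    proof (rule sym, rule sweedler_cong[OF v v v b8 Dc[OF \<open>u \<in> carrier B\<close>]])
      fix a b assume ab: "a \<in> carrier B" "b \<in> carrier B"
      have l: "klinear B B (\<lambda>z. (a \<otimes> z) \<otimes> antipode B b)"
        by (rule klinear_comp[OF klinear_mult_left[OF B] klinear_mult_right[OF B]]) (use ab in auto)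
      have "(a \<otimes> (counit B w \<odot> \<one>)) \<otimes> antipode B b = ?L a b"
        unfolding mult(4)[symmetric] by (rule sweedler_comp[OF v v v b7 l]) auto
      also have "\<dots> = sweedler B (comult B w) (\<lambda>v1 v2. (a \<otimes> v1) \<otimes> antipode B (b \<otimes> v2))"
        using B ab by (intro sweedler_cong[OF v v v bilin_out[OF b7 l]]) (auto simp: S(3) ka_assoc)
      finally show "(a \<otimes> (counit B w \<odot> \<one>)) \<otimes> antipode B b =
        sweedler B (comult B w) (\<lambda>v1 v2. (a \<otimes> v1) \<otimes> antipode B (b \<otimes> v2))" .
    qed (use B in auto)
    also have "\<dots> = sweedler B (comult B u) (\<lambda>u1 u2. counit B w \<odot> (u1 \<otimes> antipode B u2))"
      using B by (intro sweedler_cong[OF v v v b8]) (auto simp: ka_distribs)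
    also have "\<dots> = counit B w \<odot> sweedler B (comult B u) (\<lambda>u1 u2. u1 \<otimes> antipode B u2)"
      by (rule sweedler_comp[symmetric, OF v v v b7 klinear_scale[OF klinear_id]]) auto
    finally show ?case using antipode(2)[OF mult(1)] B by (simp add: Em mult.commute)
  qed
  show ?thesis
    unfolding hopf_algebra_def bialgebra_def coalgebra_def
    using B lD lE S(1) co cu1 cu2 ap1 ap2 khom_ring_hom[OF D] khom_ring_hom[OF E] by auto
qed

section \<open>Structures with the same operations\<close>

lemma vspace_cong:
  assumes V: "vspace V" and eq: "carrier W = carrier V" "\<zero>\<^bsub>W\<^esub> = \<zero>\<^bsub>V\<^esub>"
    "\<And>a b. a \<oplus>\<^bsub>W\<^esub> b = a \<oplus>\<^bsub>V\<^esub> b" "\<And>c a. c \<odot>\<^bsub>W\<^esub> a = c \<odot>\<^bsub>V\<^esub> a"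
  shows "vspace W"
proof -
  interpret V: abelian_group V using V by (rule vspace_abelian_group)
  show ?thesis
  proof (rule vspaceI, rule abelian_groupI)
    fix a assume "a \<in> carrier W"
    then show "\<exists>b\<in>carrier W. b \<oplus>\<^bsub>W\<^esub> a = \<zero>\<^bsub>W\<^esub>"
      using V.l_neg[of a] by (auto simp: eq intro!: bexI[of _ "\<ominus>\<^bsub>V\<^esub> a"])
  qed (use V in \<open>auto simp: eq vs_assoc vs_smult_add vs_smult_distr intro: vs_comm\<close>)
qed

lemma kalgebra_cong:
  assumes V: "kalgebra V" and eq: "carrier W = carrier V" "\<zero>\<^bsub>W\<^esub> = \<zero>\<^bsub>V\<^esub>" "\<one>\<^bsub>W\<^esub> = \<one>\<^bsub>V\<^esub>"
    "\<And>a b. a \<oplus>\<^bsub>W\<^esub> b = a \<oplus>\<^bsub>V\<^esub> b" "\<And>c a. c \<odot>\<^bsub>W\<^esub> a = c \<odot>\<^bsub>V\<^esub> a" "\<And>a b. a \<otimes>\<^bsub>W\<^esub> b = a \<otimes>\<^bsub>V\<^esub> b"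
  shows "kalgebra W"
proof (rule kalgebraI)
  show "vspace W" by (rule vspace_cong[of V]) (use V eq in auto)
qed (use V in \<open>auto simp: eq ka_distribs ka_assoc\<close>)

lemma tensor_rel_mono:
  assumes eq: "carrier V' = carrier V" "\<And>a b. a \<oplus>\<^bsub>V'\<^esub> b = a \<oplus>\<^bsub>V\<^esub> b" "\<And>c a. c \<odot>\<^bsub>V'\<^esub> a = c \<odot>\<^bsub>V\<^esub> a"
    "carrier W' = carrier W" "\<And>a b. a \<oplus>\<^bsub>W'\<^esub> b = a \<oplus>\<^bsub>W\<^esub> b" "\<And>c a. c \<odot>\<^bsub>W'\<^esub> a = c \<odot>\<^bsub>W\<^esub> a"
  shows "v \<in> tensor_rel V W \<Longrightarrow> v \<in> tensor_rel V' W'"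
proof (induction rule: tensor_rel.induct)
  case (4 a a' b)
  then show ?case using tensor_rel.intros(4)[of a V' a' b W'] by (simp add: eq)
next
  case (5 a b b')
  then show ?case using tensor_rel.intros(5)[of a V' b W' b'] by (simp add: eq)
next
  case (6 a b c)
  then show ?case using tensor_rel.intros(6)[of a V' b W' c] by (simp add: eq)
next
  case (7 a b c)
  then show ?case using tensor_rel.intros(7)[of a V' b W' c] by (simp add: eq)
qed (auto intro: tensor_rel.intros)

text \<open>
  The algebra underlying a Hopf algebra and the Hopf algebra itself are different records with equal
  operations, and \<open>tensor\<close> refers to the operations only.
\<close>

lemma tensor_cong:
  assumes eq: "carrier V' = carrier V" "\<And>a b. a \<oplus>\<^bsub>V'\<^esub> b = a \<oplus>\<^bsub>V\<^esub> b" "\<And>c a. c \<odot>\<^bsub>V'\<^esub> a = c \<odot>\<^bsub>V\<^esub> a"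
    "\<And>a b. a \<otimes>\<^bsub>V'\<^esub> b = a \<otimes>\<^bsub>V\<^esub> b" "\<one>\<^bsub>V'\<^esub> = \<one>\<^bsub>V\<^esub>"
    "carrier W' = carrier W" "\<And>a b. a \<oplus>\<^bsub>W'\<^esub> b = a \<oplus>\<^bsub>W\<^esub> b" "\<And>c a. c \<odot>\<^bsub>W'\<^esub> a = c \<odot>\<^bsub>W\<^esub> a"
    "\<And>a b. a \<otimes>\<^bsub>W'\<^esub> b = a \<otimes>\<^bsub>W\<^esub> b" "\<one>\<^bsub>W'\<^esub> = \<one>\<^bsub>W\<^esub>"
  shows "tensor V' W' = tensor V W" "pure_tensor V' W' = pure_tensor V W"
proof -
  have r: "tensor_rel V' W' = tensor_rel V W"
  proof (rule subset_antisym; rule subsetI)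
    fix v
    show "v \<in> tensor_rel V W" if "v \<in> tensor_rel V' W'"
      by (rule tensor_rel_mono[OF _ _ _ _ _ _ that]) (simp_all add: eq)
    show "v \<in> tensor_rel V' W'" if "v \<in> tensor_rel V W"
      by (rule tensor_rel_mono[OF _ _ _ _ _ _ that]) (simp_all add: eq)
  qed
  have c: "tensor_class V' W' = tensor_class V W" "tensor_free V' W' = tensor_free V W"
    unfolding tensor_class_def tensor_free_def r by (simp_all add: eq)
  show p: "pure_tensor V' W' = pure_tensor V W" unfolding pure_tensor_def c ..
  show "tensor V' W' = tensor V W" unfolding tensor_def c p by (simp add: eq)
qed

lemma lin_ext_cong_struct:
  assumes V: "vspace V" and eq: "carrier W = carrier V" "\<zero>\<^bsub>W\<^esub> = \<zero>\<^bsub>V\<^esub>"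
    "\<And>a b. a \<oplus>\<^bsub>W\<^esub> b = a \<oplus>\<^bsub>V\<^esub> b" "\<And>c a. c \<odot>\<^bsub>W\<^esub> a = c \<odot>\<^bsub>V\<^esub> a"
    and \<beta>: "\<And>a. a \<in> Poly_Mapping.keys v \<Longrightarrow> \<beta> a \<in> carrier V"
  shows "lin_ext W \<beta> v = lin_ext V \<beta> v"
proof -
  have W: "vspace W" by (rule vspace_cong[OF V eq])
  have "klinear (free_space (Poly_Mapping.keys v)) W (lin_ext W \<beta>)"
    by (rule klinear_lin_ext[OF W]) (use \<beta> eq in auto)
  then have "klinear (free_space (Poly_Mapping.keys v)) V (lin_ext W \<beta>)"
    by (auto simp: klinear_def eq)
  then show ?thesis
    by (rule free_ext[OF _ klinear_lin_ext[OF V] V]) (use \<beta> V W eq in auto)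
qed

lemma opposite_simps [simp]:
  "carrier (opposite A) = carrier A" "\<zero>\<^bsub>opposite A\<^esub> = \<zero>\<^bsub>A\<^esub>" "\<one>\<^bsub>opposite A\<^esub> = \<one>\<^bsub>A\<^esub>"
  "a \<oplus>\<^bsub>opposite A\<^esub> b = a \<oplus>\<^bsub>A\<^esub> b" "c \<odot>\<^bsub>opposite A\<^esub> a = c \<odot>\<^bsub>A\<^esub> a" "a \<otimes>\<^bsub>opposite A\<^esub> b = b \<otimes>\<^bsub>A\<^esub> a"
  by (simp_all add: opposite_def)

lemma kalgebra_opposite: "kalgebra A \<Longrightarrow> kalgebra (opposite A)"
proof (rule kalgebraI)
  assume A: "kalgebra A"
  show "vspace (opposite A)" by (rule vspace_cong[of A]) (use A in auto)
qed (auto simp: ka_distribs ka_assoc)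

lemma khom_opposite:
  "khom A (opposite B) \<phi> \<Longrightarrow> klinear A B \<phi>"
  "khom A (opposite B) \<phi> \<Longrightarrow> \<phi> \<one>\<^bsub>A\<^esub> = \<one>\<^bsub>B\<^esub>"
  "khom A (opposite B) \<phi> \<Longrightarrow> u \<in> carrier A \<Longrightarrow> v \<in> carrier A \<Longrightarrow> \<phi> (u \<otimes>\<^bsub>A\<^esub> v) = \<phi> v \<otimes>\<^bsub>B\<^esub> \<phi> u"
  by (auto simp: khom_def klinear_def ring_hom_def)

section \<open>Monoid algebras\<close>

lemma convolve_single [simp]:
  "convolve m (Poly_Mapping.single a c) (Poly_Mapping.single b d) = Poly_Mapping.single (m a b) (c * d :: 'k::field)"
  by (cases "c = 0"; cases "d = 0") (auto simp: convolve_def)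

lemma convolve_swap: "convolve m v w = convolve (\<lambda>a b. m b a) w v"
  unfolding convolve_def by (subst sum.swap) (simp add: mult.commute)

lemma convolve_left:
  "convolve m (v + v') w = convolve m v w + convolve m v' w"
  "convolve m (fscale c v) w = fscale c (convolve m v w)"
proof -
  have e: "convolve m v w = lin_ext (free_space UNIV) (\<lambda>a. lin_ext (free_space UNIV) (\<lambda>b. basis_vec (m a b)) w) v" for v
    by (rule convolve_eq_lin_ext) simp
  have L: "klinear (free_space UNIV) (free_space UNIV) (lin_ext (free_space UNIV) (\<lambda>a. lin_ext (free_space UNIV) (\<lambda>b. basis_vec (m a b)) w))"
    by (rule klinear_lin_ext) auto
  show "convolve m (v + v') w = convolve m v w + convolve m v' w"
    "convolve m (fscale c v) w = fscale c (convolve m v w)"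
    using klinear_add[OF L, of v v'] klinear_smult[OF L, of v c] by (simp_all add: e)
qed

lemma convolve_right:
  "convolve m v (w + w') = convolve m v w + convolve m v w'"
  "convolve m v (fscale c w) = fscale c (convolve m v w)"
  using convolve_left[of "\<lambda>a b. m b a"] by (simp_all add: convolve_swap[of m v])

lemma convolve_zero [simp]: "convolve m 0 w = 0" "convolve m v 0 = 0"
  by (simp_all add: convolve_def)

lemma keys_convolve:
  assumes "\<And>a b. a \<in> Poly_Mapping.keys v \<Longrightarrow> b \<in> Poly_Mapping.keys w \<Longrightarrow> m a b \<in> U"
  shows "Poly_Mapping.keys (convolve m v w) \<subseteq> U"
proof -
  have "convolve m v w \<in> carrier (free_space U)"
    by (subst convolve_eq_lin_ext[OF assms]) (auto intro!: lin_ext_closed simp: assms simp del: free_space_simps, simp add: assms)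
  then show ?thesis by simp
qed

lemma group_alg_simps [simp]:
  "carrier (group_alg G) = {v. Poly_Mapping.keys v \<subseteq> carrier G}" "v \<otimes>\<^bsub>group_alg G\<^esub> w = convolve (monoid.mult G) v w"
  "\<one>\<^bsub>group_alg G\<^esub> = basis_vec \<one>\<^bsub>G\<^esub>" "\<zero>\<^bsub>group_alg G\<^esub> = 0" "v \<oplus>\<^bsub>group_alg G\<^esub> w = v + w"
  "c \<odot>\<^bsub>group_alg G\<^esub> v = fscale c v"
  by (simp_all add: group_alg_def)

lemma kalgebra_group_alg:
  assumes "Group.monoid G"
  shows "kalgebra (group_alg G :: ('k::field, 'g \<Rightarrow>\<^sub>0 'k) module)"
proof (rule kalgebraI)
  interpret Group.monoid G by fact
  let ?A = "group_alg G :: ('k::field, 'g \<Rightarrow>\<^sub>0 'k) module"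
  show "vspace ?A" by (rule vspace_cong[of "free_space (carrier G)"]) auto
  {
    fix u v w assume uvw: "u \<in> carrier ?A" "v \<in> carrier ?A" "w \<in> carrier ?A"
    from uvw have "Poly_Mapping.keys u \<subseteq> carrier G" "Poly_Mapping.keys v \<subseteq> carrier G" "Poly_Mapping.keys w \<subseteq> carrier G"
      by auto
    then show "u \<otimes>\<^bsub>?A\<^esub> v \<otimes>\<^bsub>?A\<^esub> w = u \<otimes>\<^bsub>?A\<^esub> (v \<otimes>\<^bsub>?A\<^esub> w)"
    proof (induction u rule: free_induct)
      case (single a c)
      note a = single
      from single(2,3) show ?case
      proof (induction v rule: free_induct)
        case (single b d)
        from single(2) show ?case
        proof (induction w rule: free_induct)
          case (single e k)
          then show ?case using a \<open>b \<in> _\<close> by (simp add: m_assoc mult.assoc)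
        qed (use a in \<open>auto simp: convolve_left convolve_right\<close>)
      qed (use a in \<open>auto simp: convolve_left convolve_right\<close>)
    qed (auto simp: convolve_left convolve_right)
  next
    fix u assume "u \<in> carrier ?A"
    then have "Poly_Mapping.keys u \<subseteq> carrier G" by simp
    then show "\<one>\<^bsub>?A\<^esub> \<otimes>\<^bsub>?A\<^esub> u = u" "u \<otimes>\<^bsub>?A\<^esub> \<one>\<^bsub>?A\<^esub> = u"
      by (induction u rule: free_induct) (auto simp: convolve_left convolve_right basis_vec_def)
  next
    fix u v assume "u \<in> carrier ?A" "v \<in> carrier ?A"
    then show "u \<otimes>\<^bsub>?A\<^esub> v \<in> carrier ?A"
      using keys_convolve[of u v "monoid.mult G" "carrier G"] by auto
  }
qed (use assms in \<open>auto simp: convolve_left convolve_right\<close>)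

lemma vspace_group_alg [simp]: "vspace (group_alg G)"
  by (rule vspace_cong[of "free_space (carrier G)"]) auto

lemma klinear_group_alg_iff: "klinear (group_alg G) V \<phi> \<longleftrightarrow> klinear (free_space (carrier G)) V \<phi>"
  by (simp add: klinear_def)

lemma group_alg_ext:
  assumes "klinear (group_alg G) W \<phi>" "klinear (group_alg G) W \<psi>" "vspace W"
    and "\<And>a. a \<in> carrier G \<Longrightarrow> \<phi> (basis_vec a) = \<psi> (basis_vec a)" "v \<in> carrier (group_alg G)"
  shows "\<phi> v = \<psi> v"
  by (rule free_ext[OF assms(1)[unfolded klinear_group_alg_iff] assms(2)[unfolded klinear_group_alg_iff] assms(3,4)])
    (use assms(5) in simp_all)

lemma klinear_group_alg: "vspace V \<Longrightarrow> (\<And>a. a \<in> carrier G \<Longrightarrow> \<beta> a \<in> carrier V) \<Longrightarrow> klinear (group_alg G) V (lin_ext V \<beta>)"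
  unfolding klinear_group_alg_iff by (rule klinear_lin_ext)

lemma khom_group_alg:
  fixes G :: "('g, 'm) monoid_scheme" and B :: "('k::field, 'b, 'n) module_scheme"
  assumes G: "Group.monoid G" and B: "kalgebra B" and \<beta>: "\<And>a. a \<in> carrier G \<Longrightarrow> \<beta> a \<in> carrier B" "\<beta> \<one>\<^bsub>G\<^esub> = \<one>\<^bsub>B\<^esub>"
    "\<And>a b. a \<in> carrier G \<Longrightarrow> b \<in> carrier G \<Longrightarrow> \<beta> (a \<otimes>\<^bsub>G\<^esub> b) = \<beta> a \<otimes>\<^bsub>B\<^esub> \<beta> b"
  shows "khom (group_alg G) B (lin_ext B \<beta>)"
proof (rule khomI)
  interpret Group.monoid G by fact
  let ?A = "group_alg G :: ('k, 'g \<Rightarrow>\<^sub>0 'k) module"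
  have A: "kalgebra ?A" using G by (rule kalgebra_group_alg)
  show L: "klinear ?A B (lin_ext B \<beta>)" using B \<beta> by (intro klinear_group_alg) auto
  show "lin_ext B \<beta> \<one>\<^bsub>?A\<^esub> = \<one>\<^bsub>B\<^esub>" using \<beta> B by simp
  fix u v assume uv: "u \<in> carrier ?A" "v \<in> carrier ?A"
  have cl: "lin_ext B \<beta> u \<in> carrier B" if "u \<in> carrier ?A" for u using that by (rule klinear_closed[OF L])
  have 1: "lin_ext B \<beta> (basis_vec a \<otimes>\<^bsub>?A\<^esub> v) = lin_ext B \<beta> (basis_vec a) \<otimes>\<^bsub>B\<^esub> lin_ext B \<beta> v" if a: "a \<in> carrier G" for a
    by (rule group_alg_ext[OF klinear_comp[OF klinear_mult_left[OF A] L] klinear_comp[OF L klinear_mult_left[OF B]] _ _ uv(2)])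
      (use a B \<beta> in \<open>auto simp: basis_vec_def\<close>)
  show "lin_ext B \<beta> (u \<otimes>\<^bsub>?A\<^esub> v) = lin_ext B \<beta> u \<otimes>\<^bsub>B\<^esub> lin_ext B \<beta> v"
    by (rule group_alg_ext[OF klinear_comp[OF klinear_mult_right[OF A] L] klinear_comp[OF L klinear_mult_right[OF B]] _ _ uv(1)])
      (use uv B 1 cl in auto)
qed

lemma generates_group_alg:
  assumes "Group.monoid G"
  shows "generates (group_alg G :: ('k::field, 'g \<Rightarrow>\<^sub>0 'k) module) (basis_vec ` carrier G)"
  unfolding generates_def
proof (intro conjI allI impI subsetI)
  interpret Group.monoid G by fact
  let ?A = "group_alg G :: ('k::field, 'g \<Rightarrow>\<^sub>0 'k) module"
  fix Q v
  assume one: "\<one>\<^bsub>?A\<^esub> \<in> Q" and m: "\<forall>u\<in>basis_vec ` carrier G. \<forall>w\<in>carrier ?A \<inter> Q. u \<otimes>\<^bsub>?A\<^esub> w \<in> Q"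
    and a: "\<forall>u\<in>carrier ?A \<inter> Q. \<forall>v\<in>carrier ?A \<inter> Q. u \<oplus>\<^bsub>?A\<^esub> v \<in> Q"
    and s: "\<forall>c. \<forall>u\<in>carrier ?A \<inter> Q. c \<odot>\<^bsub>?A\<^esub> u \<in> Q" and v: "v \<in> carrier ?A"
  have b: "basis_vec t \<in> Q" if "t \<in> carrier G" for t
    using m[rule_format, of "basis_vec t" "\<one>\<^bsub>?A\<^esub>"] that one by (simp add: basis_vec_def)
  from v have "Poly_Mapping.keys v \<subseteq> carrier G" by simp
  then show "v \<in> Q"
  proof (induction v rule: free_induct)
    case zero
    show ?case using s[rule_format, of "\<one>\<^bsub>?A\<^esub>" 0] one by simp
  next
    case (add v w)
    then show ?case using a by auto
  next
    case (single t c)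
    then show ?case using s[rule_format, of "basis_vec t" c] b by (simp add: basis_vec_def)
  qed
qed auto

section \<open>Hopf algebras of groups\<close>

lemma group_hopf_simps [simp]:
  fixes G :: "('g, 'm) monoid_scheme"
  shows "carrier (group_hopf G) = carrier (group_alg G)" "monoid.mult (group_hopf G) = monoid.mult (group_alg G)"
  "\<one>\<^bsub>group_hopf G\<^esub> = \<one>\<^bsub>group_alg G\<^esub>" "\<zero>\<^bsub>group_hopf G\<^esub> = (\<zero>\<^bsub>group_alg G\<^esub> :: 'g \<Rightarrow>\<^sub>0 'k::field)" "add (group_hopf G) = add (group_alg G)"
  "module.smult (group_hopf G) = module.smult (group_alg G)"
  by (simp_all add: group_hopf_def Let_def module.defs hopf.defs)

lemma group_hopf_tensor:
  "tensor (group_hopf G) (group_hopf G) = tensor (group_alg G) (group_alg G)"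
  "pure_tensor (group_hopf G) (group_hopf G) = pure_tensor (group_alg G) (group_alg G)"
  by (rule tensor_cong; simp)+

lemma group_hopf_coalgebra:
  fixes G :: "('g, 'm) monoid_scheme"
  shows "comult (group_hopf G :: ('k::field, 'g \<Rightarrow>\<^sub>0 'k) hopf) = lin_ext (tensor (group_hopf G) (group_hopf G))
       (\<lambda>t. pure_tensor (group_hopf G) (group_hopf G) (basis_vec t) (basis_vec t))"
    "counit (group_hopf G :: ('k, 'g \<Rightarrow>\<^sub>0 'k) hopf) = lin_ext ground (\<lambda>t. 1)"
    "antipode (group_hopf G :: ('k, 'g \<Rightarrow>\<^sub>0 'k) hopf) = lin_ext (group_alg G) (\<lambda>t. basis_vec (inv\<^bsub>G\<^esub> t))"
  unfolding group_hopf_tensor by (simp_all add: group_hopf_def Let_def module.defs hopf.defs)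

context
  fixes G :: "('g, 'm) monoid_scheme" (structure) and A :: "('k::field, 'g \<Rightarrow>\<^sub>0 'k) hopf"
  assumes G: "group G"
  defines "A \<equiv> group_hopf G"
begin

interpretation group G by (rule G)

lemma kalgebra_group_hopf: "kalgebra A"
  unfolding A_def by (rule kalgebra_cong[OF kalgebra_group_alg[OF is_monoid]]) auto

lemma basis_closed: "t \<in> carrier G \<Longrightarrow> basis_vec t \<in> carrier A"
  by (simp add: A_def)

lemma basis_mult: "basis_vec s \<otimes>\<^bsub>A\<^esub> basis_vec t = basis_vec (s \<otimes> t)"
  by (simp add: A_def basis_vec_def)

lemma khom_group_hopf:
  assumes "kalgebra B" "\<And>a. a \<in> carrier G \<Longrightarrow> \<beta> a \<in> carrier B" "\<beta> \<one> = \<one>\<^bsub>B\<^esub>"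
    "\<And>a b. a \<in> carrier G \<Longrightarrow> b \<in> carrier G \<Longrightarrow> \<beta> (a \<otimes> b) = \<beta> a \<otimes>\<^bsub>B\<^esub> \<beta> b"
  shows "khom A B (lin_ext B \<beta>)"
  using khom_group_alg[OF is_monoid, of B \<beta>] assms by (simp add: A_def khom_def klinear_def ring_hom_def)

lemma generates_group_hopf: "generates A (basis_vec ` carrier G)"
  using generates_group_alg[OF is_monoid] by (simp add: A_def generates_def)

lemma group_hopf_ext:
  assumes "klinear A W \<phi>" "klinear A W \<psi>" "vspace W"
    and "\<And>a. a \<in> carrier G \<Longrightarrow> \<phi> (basis_vec a) = \<psi> (basis_vec a)" "v \<in> carrier A"
  shows "\<phi> v = \<psi> v"
proof (rule group_alg_ext[of G W \<phi> \<psi>])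
  show "vspace W" by fact
  show "\<phi> (basis_vec a) = \<psi> (basis_vec a)" if "a \<in> carrier G" for a by (rule assms(4)[OF that])
  show "klinear (group_alg G) W \<phi>" "klinear (group_alg G) W \<psi>" "v \<in> carrier (group_alg G)"
    using assms(1,2,5) by (simp_all add: A_def klinear_def)
qed

lemma khom_comult_group: "khom A (tensor A A) (comult A)"
proof -
  have A: "kalgebra A" by (rule kalgebra_group_hopf)
  have "khom A (tensor A A) (lin_ext (tensor A A) (\<lambda>t. pure_tensor A A (basis_vec t) (basis_vec t)))"
  proof (rule khom_group_hopf)
    have "\<one>\<^bsub>A\<^esub> = basis_vec \<one>" by (simp add: A_def)
    then show "pure_tensor A A (basis_vec \<one>) (basis_vec \<one>) = \<one>\<^bsub>tensor A A\<^esub>"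
      by (simp add: tensor_simps(6))
  qed (use A in \<open>simp_all add: basis_closed tensor_mult_pure basis_mult\<close>)
  then show ?thesis by (simp add: A_def group_hopf_coalgebra)
qed

lemma khom_counit_group: "khom A ground (counit A)"
proof -
  have "khom A ground (lin_ext ground (\<lambda>t. 1))" by (rule khom_group_hopf) auto
  then show ?thesis by (simp add: A_def group_hopf_coalgebra)
qed

lemma group_hopf_basis:
  assumes "t \<in> carrier G"
  shows "comult A (basis_vec t) = pure_tensor A A (basis_vec t) (basis_vec t)" "counit A (basis_vec t) = 1"
    "antipode A (basis_vec t) = basis_vec (inv t)"
proof -
  have A: "kalgebra A" by (rule kalgebra_group_hopf)
  show "comult A (basis_vec t) = pure_tensor A A (basis_vec t) (basis_vec t)"
    using A assms basis_closed[OF assms] unfolding A_def group_hopf_coalgebra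
    by (subst lin_ext_basis) auto
  show "counit A (basis_vec t) = 1" unfolding A_def group_hopf_coalgebra by simp
  show "antipode A (basis_vec t) = basis_vec (inv t)"
    unfolding A_def group_hopf_coalgebra by (subst lin_ext_basis) (use assms in auto)
qed

lemma antipode_group:
  "klinear A A (antipode A)" "antipode A \<one>\<^bsub>A\<^esub> = \<one>\<^bsub>A\<^esub>"
  "u \<in> carrier A \<Longrightarrow> v \<in> carrier A \<Longrightarrow> antipode A (u \<otimes>\<^bsub>A\<^esub> v) = antipode A v \<otimes>\<^bsub>A\<^esub> antipode A u"
proof -
  let ?B = "group_alg G :: ('k, 'g \<Rightarrow>\<^sub>0 'k) module"
  have B: "kalgebra ?B" by (rule kalgebra_group_alg[OF is_monoid])
  have h: "khom ?B (opposite ?B) (lin_ext (opposite ?B) (\<lambda>t. basis_vec (inv t)))"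
    by (rule khom_group_alg[OF is_monoid kalgebra_opposite[OF B]]) (auto simp: basis_vec_def inv_mult_group)
  have e: "lin_ext (opposite ?B) (\<lambda>t. basis_vec (inv t)) u = antipode A u" if "u \<in> carrier A" for u
    unfolding A_def group_hopf_coalgebra
    by (rule lin_ext_cong_struct) (use that in \<open>auto simp: A_def\<close>)
  have c: "\<one>\<^bsub>A\<^esub> \<in> carrier A" "u \<otimes>\<^bsub>A\<^esub> v \<in> carrier A" if "u \<in> carrier A" "v \<in> carrier A"
    for u v using kalgebra_group_hopf that by auto
  have "klinear ?B ?B (antipode A)"
    by (rule klinear_cong[OF khom_opposite(1)[OF h]]) (use e in \<open>auto simp: A_def\<close>)
  then show "klinear A A (antipode A)" by (simp add: klinear_def A_def)
  show "antipode A \<one>\<^bsub>A\<^esub> = \<one>\<^bsub>A\<^esub>" by (simp add: A_def group_hopf_basis[unfolded A_def])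
  show "antipode A (u \<otimes>\<^bsub>A\<^esub> v) = antipode A v \<otimes>\<^bsub>A\<^esub> antipode A u" if "u \<in> carrier A" "v \<in> carrier A"
    using khom_opposite(3)[OF h, of u v] that c(2)[OF that] e by (simp add: A_def)
qed

theorem hopf_algebra_group_hopf: "hopf_algebra A"
proof -
  have A [simp]: "kalgebra A" by (rule kalgebra_group_hopf)
  note D = khom_comult_group and E = khom_counit_group
  have v: "vspace A" "vspace (tensor A A)" "vspace (tensor A (tensor A A))" by simp_all
  note lD = khom_klinear[OF D] and lE = khom_klinear[OF E]
  show ?thesis
  proof (rule hopf_algebra_generators[OF A D E antipode_group generates_group_hopf])
    fix c :: "'g \<Rightarrow>\<^sub>0 'k" assume "c \<in> basis_vec ` carrier G"
    then obtain t where t: "t \<in> carrier G" "c = basis_vec t" by auto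
    note [simp] = group_hopf_basis[OF t(1)] basis_closed[OF t(1)] basis_closed[OF inv_closed[OF t(1)]]
    note b2 = bilin_coassoc(2)[OF v(1)] and b3 = bilin_coassoc(3)[OF v(1) lD]
    show "sweedler (tensor A (tensor A A)) (comult A c) (\<lambda>c1 c2. pure_tensor A (tensor A A) c1 (comult A c2)) =
        sweedler (tensor A (tensor A A)) (comult A c) (\<lambda>c1 c2.
          sweedler (tensor A (tensor A A)) (comult A c1) (\<lambda>c11 c12. pure_tensor A (tensor A A) c11 (pure_tensor A A c12 c2)))"
      unfolding t by (simp add: sweedler_pure[OF v(1) v(1) v(3) bilin_pure_comp[OF v(1) v(2) klinear_id lD]]
         sweedler_pure[OF v(1) v(1) v(3) b3] sweedler_pure[OF v(1) v(1) v(3) b2])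
    have b4: "bilin A A A (\<lambda>c1 c2. counit A c1 \<odot>\<^bsub>A\<^esub> c2)" by (rule bilin_comp[OF bilin_smult lE klinear_id]) simp
    show "sweedler A (comult A c) (\<lambda>c1 c2. counit A c1 \<odot>\<^bsub>A\<^esub> c2) = c"
      "sweedler A (comult A c) (\<lambda>c1 c2. counit A c2 \<odot>\<^bsub>A\<^esub> c1) = c"
      unfolding t using v by (simp_all add: sweedler_pure[OF v(1) v(1) v(1) b4] sweedler_pure[OF v(1) v(1) v(1) bilin_flip[OF b4]])
    have b6: "bilin A A A (\<lambda>u1 u2. antipode A u1 \<otimes>\<^bsub>A\<^esub> u2)" "bilin A A A (\<lambda>u1 u2. u1 \<otimes>\<^bsub>A\<^esub> antipode A u2)"
      by (rule bilin_comp[OF bilin_mult[OF A] antipode_group(1) klinear_id] bilin_comp[OF bilin_mult[OF A] klinear_id antipode_group(1)])+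
    show "sweedler A (comult A c) (\<lambda>u1 u2. antipode A u1 \<otimes>\<^bsub>A\<^esub> u2) = counit A c \<odot>\<^bsub>A\<^esub> \<one>\<^bsub>A\<^esub>"
      "sweedler A (comult A c) (\<lambda>u1 u2. u1 \<otimes>\<^bsub>A\<^esub> antipode A u2) = counit A c \<odot>\<^bsub>A\<^esub> \<one>\<^bsub>A\<^esub>"
      unfolding t using v t(1) by (simp_all add: sweedler_pure[OF v(1) v(1) v(1) b6(1)] sweedler_pure[OF v(1) v(1) v(1) b6(2)] basis_mult)
       (simp_all add: A_def)
  qed
qed

end

section \<open>Algebras given by generators and relations\<close>

text \<open>
  The algebra laws are equations, so they pass to the image under a map that respects the operations.
  It is applied to quotients, and to structures transported along bijections.
\<close>

lemma kalgebra_image: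
  fixes Q :: "('k::field, 'b, 'm) module_scheme" (structure)
  assumes F: "kalgebra F" and \<pi>: "\<And>v. v \<in> carrier F \<Longrightarrow> \<pi> v \<in> carrier Q" "carrier Q \<subseteq> \<pi> ` carrier F"
    "\<And>v w. v \<in> carrier F \<Longrightarrow> w \<in> carrier F \<Longrightarrow> \<pi> v \<oplus> \<pi> w = \<pi> (v \<oplus>\<^bsub>F\<^esub> w)"
    "\<And>v w. v \<in> carrier F \<Longrightarrow> w \<in> carrier F \<Longrightarrow> \<pi> v \<otimes> \<pi> w = \<pi> (v \<otimes>\<^bsub>F\<^esub> w)"
    "\<And>c v. v \<in> carrier F \<Longrightarrow> c \<odot> \<pi> v = \<pi> (c \<odot>\<^bsub>F\<^esub> v)"
    "\<zero> = \<pi> \<zero>\<^bsub>F\<^esub>" "\<one> = \<pi> \<one>\<^bsub>F\<^esub>"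
  shows "kalgebra Q" "khom F Q \<pi>"
proof -
  have v: "vspace F" using F by simp
  interpret F: abelian_group F using v by (rule vspace_abelian_group)
  have ex: "\<exists>v. v \<in> carrier F \<and> a = \<pi> v" if "a \<in> carrier Q" for a using that \<pi>(2) by auto
  show "kalgebra Q"
  proof (rule kalgebraI, rule vspaceI, rule abelian_groupI)
    fix a assume "a \<in> carrier Q"
    then obtain x where x: "x \<in> carrier F" "a = \<pi> x" using ex by blast
    then show "\<exists>b\<in>carrier Q. b \<oplus> a = \<zero>"
      using F.l_neg[of x] \<pi> by (intro bexI[of _ "\<pi> (\<ominus>\<^bsub>F\<^esub> x)"]) auto
  next
    fix a b assume ab: "a \<in> carrier Q" "b \<in> carrier Q"
    from ex[OF ab(1)] ex[OF ab(2)] obtain x y where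
      x: "x \<in> carrier F" "a = \<pi> x" "y \<in> carrier F" "b = \<pi> y" by blast
    show "a \<oplus> b \<in> carrier Q" "a \<otimes> b \<in> carrier Q" using x \<pi> F by simp_all
    show "a \<oplus> b = b \<oplus> a" using x \<pi> F F.a_comm[of x y] by simp
    fix c
    show "c \<odot> (a \<oplus> b) = c \<odot> a \<oplus> c \<odot> b" using x \<pi> v by (simp add: vs_smult_distr)
    show "(c \<odot> a) \<otimes> b = c \<odot> (a \<otimes> b)" "a \<otimes> (c \<odot> b) = c \<odot> (a \<otimes> b)"
      using x \<pi> F by (simp_all add: ka_smult_mult ka_mult_smult)
  next
    fix a b c assume abc: "a \<in> carrier Q" "b \<in> carrier Q" "c \<in> carrier Q"
    from ex[OF abc(1)] ex[OF abc(2)] ex[OF abc(3)] obtain x y z where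
      x: "x \<in> carrier F" "a = \<pi> x" "y \<in> carrier F" "b = \<pi> y" "z \<in> carrier F" "c = \<pi> z" by blast
    show "a \<oplus> b \<oplus> c = a \<oplus> (b \<oplus> c)" using x \<pi> v by (simp add: vs_assoc)
    show "a \<otimes> b \<otimes> c = a \<otimes> (b \<otimes> c)" using x \<pi> F by (simp add: ka_assoc)
    show "(a \<oplus> b) \<otimes> c = a \<otimes> c \<oplus> b \<otimes> c" using x \<pi> F by (simp add: ka_add_mult)
    show "c \<otimes> (a \<oplus> b) = c \<otimes> a \<oplus> c \<otimes> b" using x \<pi> F by (simp add: ka_mult_add)
  next
    fix a c d assume a: "a \<in> carrier Q"
    from ex[OF a] obtain x where x: "x \<in> carrier F" "a = \<pi> x" by blast
    show "(c + d) \<odot> a = c \<odot> a \<oplus> d \<odot> a" using x \<pi> v by (simp add: vs_smult_add)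
    show "(c * d) \<odot> a = c \<odot> (d \<odot> a)" using x \<pi> v by simp
  next
    fix a c assume a: "a \<in> carrier Q"
    from ex[OF a] obtain x where x: "x \<in> carrier F" "a = \<pi> x" by blast
    show "c \<odot> a \<in> carrier Q" "1 \<odot> a = a" "\<zero> \<oplus> a = a" "\<one> \<otimes> a = a" "a \<otimes> \<one> = a"
      using x \<pi> F v by simp_all
  qed (use \<pi> F in simp_all)
  show "khom F Q \<pi>" by (rule khomI, rule klinearI) (use \<pi> F in auto)
qed

lemma generates_image:
  assumes "generates F U" "khom F Q \<pi>" "carrier Q \<subseteq> \<pi> ` carrier F"
  shows "generates Q (\<pi> ` U)"
  unfolding generates_def
proof (intro conjI allI impI subsetI)
  fix a assume "a \<in> \<pi> ` U" then show "a \<in> carrier Q"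
    using assms khom_closed[OF assms(2)] by (auto simp: generates_def)
next
  fix R a
  assume R: "\<one>\<^bsub>Q\<^esub> \<in> R" "\<forall>u\<in>\<pi> ` U. \<forall>w\<in>carrier Q \<inter> R. u \<otimes>\<^bsub>Q\<^esub> w \<in> R"
    "\<forall>u\<in>carrier Q \<inter> R. \<forall>v\<in>carrier Q \<inter> R. u \<oplus>\<^bsub>Q\<^esub> v \<in> R" "\<forall>c. \<forall>u\<in>carrier Q \<inter> R. c \<odot>\<^bsub>Q\<^esub> u \<in> R"
    and "a \<in> carrier Q"
  then obtain v where v: "v \<in> carrier F" "a = \<pi> v" using assms(3) by auto
  note l = khom_klinear[OF assms(2)]
  from assms(1) v(1) have "\<pi> v \<in> R"
  proof (induction rule: generates_induct)
    case one then show ?case using R(1) by (simp add: khom_one[OF assms(2)])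
  next
    case (mult u w) then show ?case using R(2) by (simp add: khom_mult[OF assms(2)] khom_closed[OF assms(2)])
  next
    case (add u w) then show ?case using R(3) by (simp add: klinear_add[OF l] klinear_closed[OF l])
  next
    case (smult c u) then show ?case using R(4) by (simp add: klinear_smult[OF l] klinear_closed[OF l])
  qed
  then show "a \<in> R" by (simp add: v)
qed

context
  fixes F :: "('k::field, 'a) module" and R :: "'a set"
  assumes F: "kalgebra F" and R: "R \<subseteq> carrier F"
begin

interpretation Ring.ring F using F by (rule kalgebra_ring)
interpretation I: ideal "genideal F R" F using R by (rule genideal_ideal)

lemma quotient_alg_simps:
  shows "carrier (quotient_alg F (genideal F R)) = (\<lambda>v. genideal F R +>\<^bsub>F\<^esub> v) ` carrier F"
    "v \<in> carrier F \<Longrightarrow> w \<in> carrier F \<Longrightarrow> (genideal F R +>\<^bsub>F\<^esub> v) \<oplus>\<^bsub>quotient_alg F (genideal F R)\<^esub> (genideal F R +>\<^bsub>F\<^esub> w) = genideal F R +>\<^bsub>F\<^esub> (v \<oplus>\<^bsub>F\<^esub> w)"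
    "v \<in> carrier F \<Longrightarrow> w \<in> carrier F \<Longrightarrow> (genideal F R +>\<^bsub>F\<^esub> v) \<otimes>\<^bsub>quotient_alg F (genideal F R)\<^esub> (genideal F R +>\<^bsub>F\<^esub> w) = genideal F R +>\<^bsub>F\<^esub> (v \<otimes>\<^bsub>F\<^esub> w)"
    "v \<in> carrier F \<Longrightarrow> c \<odot>\<^bsub>quotient_alg F (genideal F R)\<^esub> (genideal F R +>\<^bsub>F\<^esub> v) = genideal F R +>\<^bsub>F\<^esub> (c \<odot>\<^bsub>F\<^esub> v)"
    "\<zero>\<^bsub>quotient_alg F (genideal F R)\<^esub> = genideal F R +>\<^bsub>F\<^esub> \<zero>\<^bsub>F\<^esub>"
    "\<one>\<^bsub>quotient_alg F (genideal F R)\<^esub> = genideal F R +>\<^bsub>F\<^esub> \<one>\<^bsub>F\<^esub>"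
  using F unfolding quotient_alg_def
  by (auto simp: ring.defs module.defs FactRing_def A_RCOSETS_def' I.a_rcos_sum I.rcoset_mult_add
      I.a_subset ka_smult_mult)

lemma quotient_alg_hom:
  shows "kalgebra (quotient_alg F (genideal F R))"
    "khom F (quotient_alg F (genideal F R)) (\<lambda>v. genideal F R +>\<^bsub>F\<^esub> v)"
  by (rule kalgebra_image[OF F, of "\<lambda>v. genideal F R +>\<^bsub>F\<^esub> v"]; use quotient_alg_simps in auto)+

lemma rep_quotient:
  assumes v: "v \<in> carrier F"
  shows "rep (genideal F R +>\<^bsub>F\<^esub> v) \<in> carrier F" "rep (genideal F R +>\<^bsub>F\<^esub> v) \<ominus>\<^bsub>F\<^esub> v \<in> genideal F R"
proof -
  have "v \<in> genideal F R +>\<^bsub>F\<^esub> v" using v by (rule I.a_rcos_self)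
  then have "rep (genideal F R +>\<^bsub>F\<^esub> v) \<in> genideal F R +>\<^bsub>F\<^esub> v" unfolding rep_def by (rule someI)
  then obtain i where i: "i \<in> genideal F R" "rep (genideal F R +>\<^bsub>F\<^esub> v) = i \<oplus>\<^bsub>F\<^esub> v"
    by (auto simp: a_r_coset_def')
  have ic: "i \<in> carrier F" using i(1) I.a_subset by auto
  show "rep (genideal F R +>\<^bsub>F\<^esub> v) \<in> carrier F" using i(2) ic v by simp
  show "rep (genideal F R +>\<^bsub>F\<^esub> v) \<ominus>\<^bsub>F\<^esub> v \<in> genideal F R" using i ic v by (simp add: a_minus_def a_assoc r_neg)
qed

lemma quotient_relation:
  assumes "a \<in> carrier F" "b \<in> carrier F" "a \<ominus>\<^bsub>F\<^esub> b \<in> R"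
  shows "genideal F R +>\<^bsub>F\<^esub> a = genideal F R +>\<^bsub>F\<^esub> b"
proof -
  have "a \<ominus>\<^bsub>F\<^esub> b \<in> genideal F R" using genideal_self[OF R] assms by auto
  then have "a \<in> genideal F R +>\<^bsub>F\<^esub> b"
    using assms(1,2) by (auto simp: a_r_coset_def' a_minus_def a_assoc l_neg intro!: bexI[of _ "a \<ominus>\<^bsub>F\<^esub> b"])
  then show ?thesis using I.a_repr_independence'[OF _ assms(2)] by simp
qed

text \<open>
  A homomorphism killing the relations kills the ideal they generate, so it can be evaluated at any
  representative of a class; \<^const>\<open>rep\<close> picks one.
\<close>

lemma quotient_universal:
  assumes B: "kalgebra B" and h: "khom F B \<phi>" and r: "\<And>r. r \<in> R \<Longrightarrow> \<phi> r = \<zero>\<^bsub>B\<^esub>"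
  shows "v \<in> carrier F \<Longrightarrow> \<phi> (rep (genideal F R +>\<^bsub>F\<^esub> v)) = \<phi> v"
    "khom (quotient_alg F (genideal F R)) B (\<lambda>C. \<phi> (rep C))"
proof -
  interpret B: Ring.ring B using B by (rule kalgebra_ring)
  interpret h: ring_hom_ring F B \<phi>
    by (rule ring_hom_ringI2[OF ring_axioms B.ring_axioms khom_ring_hom[OF h]])
  have "genideal F R \<subseteq> a_kernel F B \<phi>"
    by (rule genideal_minimal[OF h.kernel_is_ideal]) (use r R in \<open>unfold a_kernel_def', blast\<close>)
  then have k: "\<phi> i = \<zero>\<^bsub>B\<^esub>" if "i \<in> genideal F R" for i using that unfolding a_kernel_def' by blast
  show 1: "\<phi> (rep (genideal F R +>\<^bsub>F\<^esub> v)) = \<phi> v" if v: "v \<in> carrier F" for v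
  proof -
    have "\<phi> (rep (genideal F R +>\<^bsub>F\<^esub> v)) \<ominus>\<^bsub>B\<^esub> \<phi> v = \<zero>\<^bsub>B\<^esub>"
      using k[OF rep_quotient(2)[OF v]] klinear_minus[OF khom_klinear[OF h] _ _ rep_quotient(1)[OF v] v] F B by simp
    then show ?thesis
      using vs_minus_eq_zero[OF kalgebra_vspace[OF B] khom_closed[OF h rep_quotient(1)[OF v]] khom_closed[OF h v]]
      by simp
  qed
  have q: "\<exists>v\<in>carrier F. C = genideal F R +>\<^bsub>F\<^esub> v" if "C \<in> carrier (quotient_alg F (genideal F R))" for C
    using that by (auto simp: quotient_alg_simps(1))
  note l = khom_klinear[OF h]
  show "khom (quotient_alg F (genideal F R)) B (\<lambda>C. \<phi> (rep C))"
  proof (rule khomI, rule klinearI)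
    let ?Q = "quotient_alg F (genideal F R)"
    fix C assume "C \<in> carrier ?Q"
    then obtain v where v: "v \<in> carrier F" "C = genideal F R +>\<^bsub>F\<^esub> v" using q by blast
    show "\<phi> (rep C) \<in> carrier B" using v by (simp add: 1 khom_closed[OF h])
    show "\<phi> (rep (c \<odot>\<^bsub>?Q\<^esub> C)) = c \<odot>\<^bsub>B\<^esub> \<phi> (rep C)" for c
      using v F by (simp add: quotient_alg_simps(4) 1 klinear_smult[OF l])
    fix D assume "D \<in> carrier ?Q"
    then obtain w where w: "w \<in> carrier F" "D = genideal F R +>\<^bsub>F\<^esub> w" using q by blast
    show "\<phi> (rep (C \<oplus>\<^bsub>?Q\<^esub> D)) = \<phi> (rep C) \<oplus>\<^bsub>B\<^esub> \<phi> (rep D)"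
      using v w F by (simp add: quotient_alg_simps(2) 1 klinear_add[OF l])
    show "\<phi> (rep (C \<otimes>\<^bsub>?Q\<^esub> D)) = \<phi> (rep C) \<otimes>\<^bsub>B\<^esub> \<phi> (rep D)"
      using v w F by (simp add: quotient_alg_simps(3) 1 khom_mult[OF h])
  next
    show "\<phi> (rep \<one>\<^bsub>quotient_alg F (genideal F R)\<^esub>) = \<one>\<^bsub>B\<^esub>"
      using F by (simp add: quotient_alg_simps(6) 1 khom_one[OF h])
  qed
qed

end

text \<open>
  The free algebra is the monoid algebra of the monoid of words.
\<close>

abbreviation word_monoid :: "'x set \<Rightarrow> 'x list monoid" where
  "word_monoid U \<equiv> \<lparr>carrier = lists U, monoid.mult = (@), one = []\<rparr>"

lemma free_alg_eq: "free_alg U = group_alg (word_monoid U)"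
  by (simp add: free_alg_def group_alg_def)

lemma word_monoid: "Group.monoid (word_monoid U)"
  by (rule Group.monoidI) auto

lemma kalgebra_free_alg: "kalgebra (free_alg U)"
  unfolding free_alg_eq by (rule kalgebra_group_alg[OF word_monoid])

lemma free_alg_simps [simp]:
  "carrier (free_alg U) = {v. Poly_Mapping.keys v \<subseteq> lists U}" "v \<otimes>\<^bsub>free_alg U\<^esub> w = convolve (@) v w"
  "\<one>\<^bsub>free_alg U\<^esub> = basis_vec []" "\<zero>\<^bsub>free_alg U\<^esub> = 0" "v \<oplus>\<^bsub>free_alg U\<^esub> w = v + w"
  "c \<odot>\<^bsub>free_alg U\<^esub> v = fscale c v"
  by (simp_all add: free_alg_def)

lemma khom_free_alg:
  assumes B: "kalgebra B" and \<phi>: "\<And>a. a \<in> U \<Longrightarrow> \<phi> a \<in> carrier B"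
  shows "khom (free_alg U) B (lin_ext B (\<lambda>w. foldr (\<lambda>a b. \<phi> a \<otimes>\<^bsub>B\<^esub> b) w \<one>\<^bsub>B\<^esub>))"
    "a \<in> U \<Longrightarrow> lin_ext B (\<lambda>w. foldr (\<lambda>a b. \<phi> a \<otimes>\<^bsub>B\<^esub> b) w \<one>\<^bsub>B\<^esub>) (basis_vec [a]) = \<phi> a"
proof -
  let ?w = "\<lambda>w. foldr (\<lambda>a b. \<phi> a \<otimes>\<^bsub>B\<^esub> b) w \<one>\<^bsub>B\<^esub>"
  have cl: "?w w \<in> carrier B" if "w \<in> lists U" for w
    using that by (induction w) (use B \<phi> in auto)
  have "?w (v @ w) = ?w v \<otimes>\<^bsub>B\<^esub> ?w w" if "v \<in> lists U" "w \<in> lists U" for v w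
    using that(1) by (induction v) (use B \<phi> cl that(2) in \<open>auto simp: ka_assoc simp del: foldr_append\<close>)
  then show "khom (free_alg U) B (lin_ext B ?w)"
    unfolding free_alg_eq by (intro khom_group_alg[OF word_monoid B]) (use cl in auto)
  show "lin_ext B ?w (basis_vec [a]) = \<phi> a" if "a \<in> U"
    using \<phi>[OF that] B by (subst lin_ext_basis) auto
qed

lemma generates_free_alg: "generates (free_alg U :: ('k::field, 'x list \<Rightarrow>\<^sub>0 'k) module) ((\<lambda>a. basis_vec [a]) ` U)"
  unfolding generates_def
proof (intro conjI allI impI subsetI)
  let ?A = "free_alg U :: ('k, 'x list \<Rightarrow>\<^sub>0 'k) module"
  fix Q v
  assume one: "\<one>\<^bsub>?A\<^esub> \<in> Q" and m: "\<forall>u\<in>(\<lambda>a. basis_vec [a]) ` U. \<forall>w\<in>carrier ?A \<inter> Q. u \<otimes>\<^bsub>?A\<^esub> w \<in> Q"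
    and a: "\<forall>u\<in>carrier ?A \<inter> Q. \<forall>v\<in>carrier ?A \<inter> Q. u \<oplus>\<^bsub>?A\<^esub> v \<in> Q"
    and s: "\<forall>c. \<forall>u\<in>carrier ?A \<inter> Q. c \<odot>\<^bsub>?A\<^esub> u \<in> Q" and v: "v \<in> carrier ?A"
  have b: "basis_vec w \<in> Q" if "w \<in> lists U" for w
    using that
  proof (induction w)
    case Nil then show ?case using one by simp
  next
    case (Cons x w)
    then show ?case using m[rule_format, of "basis_vec [x]" "basis_vec w"] by (simp add: basis_vec_def)
  qed
  from v have "Poly_Mapping.keys v \<subseteq> lists U" by simp
  then show "v \<in> Q"
  proof (induction v rule: free_induct)
    case zero
    show ?case using s[rule_format, of "\<one>\<^bsub>?A\<^esub>" 0] one by simp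
  next
    case (add v w)
    then show ?case using a by auto
  next
    case (single t c)
    then show ?case using s[rule_format, of "basis_vec t" c] b by (simp add: basis_vec_def)
  qed
qed auto

section \<open>Falling factorials in an algebra\<close>

text \<open>
  The falling factorial \<open>x (x - 1) \<dots> (x - n + 1)\<close>. In characteristic \<open>p\<close> it is \<open>x\<^sup>p - x\<close> for \<open>n = p\<close>, so
  that \<open>x\<^sup>p = x\<close> becomes \<open>ffact B x p = 0\<close>; and it obeys a binomial theorem for the commutation
  relations of the third-type Hopf algebras, unlike the powers of \<open>x\<close>.
\<close>

primrec ffact :: "('k::field, 'a, 'm) module_scheme \<Rightarrow> 'a \<Rightarrow> nat \<Rightarrow> 'a" where
  "ffact B x 0 = \<one>\<^bsub>B\<^esub>"
| "ffact B x (Suc n) = ffact B x n \<otimes>\<^bsub>B\<^esub> (x \<ominus>\<^bsub>B\<^esub> of_nat n \<odot>\<^bsub>B\<^esub> \<one>\<^bsub>B\<^esub>)"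

lemma lincomb_finsum:
  assumes V: "vspace V" and "finite A" "\<And>k. k \<in> A \<Longrightarrow> lincomb V (a k) (F k)"
  shows "lincomb V (\<Oplus>\<^bsub>V\<^esub>k\<in>A. a k) (\<lambda>\<phi>. \<Sum>k\<in>A. F k \<phi>)"
proof -
  interpret abelian_group V using V by (rule vspace_abelian_group)
  show ?thesis using assms(2,3)
  proof (induction A rule: finite_induct)
    case empty
    show ?case using lincomb_zero[OF V] by simp
  next
    case (insert x A)
    have "a \<in> insert x A \<rightarrow> carrier V" using insert(4) lincomb_closed[OF V] by blast
    then show ?case using insert lincomb_add[OF V, of "a x" "F x"] by (subst finsum_insert) auto
  qed
qed

lemma klinear_finsum:
  assumes "klinear V W \<phi>" "vspace V" "vspace W" "finite A" "\<And>k. k \<in> A \<Longrightarrow> a k \<in> carrier V"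
  shows "\<phi> (\<Oplus>\<^bsub>V\<^esub>k\<in>A. a k) = (\<Oplus>\<^bsub>W\<^esub>k\<in>A. \<phi> (a k))"
proof -
  interpret V: abelian_group V using assms by (simp add: vspace_abelian_group)
  interpret W: abelian_group W using assms by (simp add: vspace_abelian_group)
  show ?thesis using assms(4,5)
  proof (induction A rule: finite_induct)
    case empty
    then show ?case using klinear_zero[OF assms(1-3)] by simp
  next
    case (insert x A)
    have c: "a \<in> insert x A \<rightarrow> carrier V" "(\<lambda>k. \<phi> (a k)) \<in> insert x A \<rightarrow> carrier W"
      using insert(4) klinear_closed[OF assms(1)] by auto
    then have "(\<Oplus>\<^bsub>V\<^esub>k\<in>A. a k) \<in> carrier V" by (intro V.finsum_closed) auto
    then show ?case using insert c
      by (subst V.finsum_insert) (auto simp: W.finsum_insert klinear_add[OF assms(1)])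
  qed
qed

lemma of_nat_power_CHAR:
  assumes "CHAR('k::field) > 0"
  shows "(of_nat i :: 'k) ^ CHAR('k) = of_nat i"
proof (induction i)
  case 0
  then show ?case using assms by simp
next
  case (Suc i)
  have "prime (CHAR('k))" using assms by (rule prime_CHAR_semidom)
  then have "(1 + of_nat i :: 'k) ^ CHAR('k) = 1 ^ CHAR('k) + of_nat i ^ CHAR('k)"
    by (rule freshmans_dream) simp
  then show ?case using Suc by simp
qed

definition ffact_poly :: "nat \<Rightarrow> 'k::field poly" where
  "ffact_poly n = (\<Prod>i<n. [:- of_nat i, 1:])"

text \<open>
  Both sides are monic of degree \<open>p\<close> and vanish at the \<open>p\<close> elements of the prime field.
\<close>

lemma ffact_poly_CHAR:
  assumes p: "CHAR('k::field) > 0"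
  shows "ffact_poly (CHAR('k)) = (monom 1 (CHAR('k)) - monom 1 1 :: 'k poly)"
proof (rule poly_eqI_degree_lead_coeff)
  let ?p = "CHAR('k)"
  have p1: "?p > 1" using prime_CHAR_semidom[OF p] prime_gt_1_nat by blast
  have d: "degree (ffact_poly n :: 'k poly) = n \<and> lead_coeff (ffact_poly n :: 'k poly) = 1" for n
  proof (induction n)
    case (Suc n)
    have e: "(ffact_poly (Suc n) :: 'k poly) = ffact_poly n * [:- of_nat n, 1:]"
      unfolding ffact_poly_def by (rule prod.lessThan_Suc)
    have "(ffact_poly n :: 'k poly) \<noteq> 0" using Suc by auto
    then show ?case using Suc unfolding e lead_coeff_mult by (subst degree_mult_eq) auto
  qed (simp add: ffact_poly_def)
  show "card (of_nat ` {..<?p} :: 'k set) \<ge> ?p"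
  proof -
    have "inj_on (of_nat :: nat \<Rightarrow> 'k) {..<?p}"
    proof (rule linorder_inj_onI')
      fix i j assume ij: "i \<in> {..<?p}" "j \<in> {..<?p}" "i < j"
      then have "\<not> ?p dvd (j - i)" by (auto dest: dvd_imp_le)
      then have "(of_nat (j - i) :: 'k) \<noteq> 0" by (simp add: of_nat_eq_0_iff_char_dvd)
      then show "(of_nat i :: 'k) \<noteq> of_nat j" using ij by (simp add: of_nat_diff)
    qed
    then show ?thesis by (simp add: card_image)
  qed
  show "degree (ffact_poly ?p :: 'k poly) \<le> ?p" using d by simp
  show "degree (monom 1 ?p - monom 1 1 :: 'k poly) \<le> ?p"
    using p1 by (intro degree_diff_le) (auto simp: degree_monom_eq)
  show "coeff (ffact_poly ?p :: 'k poly) ?p = coeff (monom 1 ?p - monom 1 1) ?p"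
    using d[of ?p] p1 by auto
  fix z :: 'k assume "z \<in> of_nat ` {..<?p}"
  then obtain i where i: "i < ?p" "z = of_nat i" by auto
  have "poly (ffact_poly ?p) z = 0"
    unfolding ffact_poly_def poly_prod using i by (intro prod_zero) auto
  moreover have "poly (monom 1 ?p - monom 1 1) z = 0"
    using of_nat_power_CHAR[OF p, of i] by (simp add: i poly_monom)
  ultimately show "poly (ffact_poly ?p) z = poly (monom 1 ?p - monom 1 1) z" by simp
qed

context
  fixes B :: "('k::field, 'a, 'm) module_scheme" (structure)
  assumes B: "kalgebra B"
begin

interpretation Ring.ring B using B by (rule kalgebra_ring)

lemma ffact_closed [simp]: "x \<in> carrier B \<Longrightarrow> ffact B x n \<in> carrier B"
  using B by (induction n) auto

lemma ffact_mult:
  assumes "x \<in> carrier B"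
  shows "ffact B x n \<otimes> x = ffact B x (Suc n) \<oplus> of_nat n \<odot> ffact B x n"
  using B assms
  by (simp add: ka_distribs) (rule lincomb_eqI[where V = B], (rule lincomb_intros | rule lincomb_atom | simp)+)

lemma ffact_commute:
  assumes "x \<in> carrier B" "y \<in> carrier B" "y \<otimes> x = x \<otimes> y"
  shows "y \<otimes> ffact B x n = ffact B x n \<otimes> y"
proof (induction n)
  case (Suc n)
  have "y \<otimes> ffact B x (Suc n) = (y \<otimes> ffact B x n) \<otimes> (x \<ominus> of_nat n \<odot> \<one>)"
    using B assms by (simp add: ka_assoc)
  also have "\<dots> = ffact B x n \<otimes> (y \<otimes> (x \<ominus> of_nat n \<odot> \<one>))"
    unfolding Suc using B assms by (simp add: ka_assoc)
  also have "y \<otimes> (x \<ominus> of_nat n \<odot> \<one>) = (x \<ominus> of_nat n \<odot> \<one>) \<otimes> y"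
    using B assms by (simp add: ka_distribs)
  finally show ?case using B assms by (simp add: ka_assoc)
qed (use B assms in auto)

lemma ffact_khom:
  assumes "khom B C \<phi>" "kalgebra C" "x \<in> carrier B"
  shows "\<phi> (ffact B x n) = ffact C (\<phi> x) n"
proof -
  note l = khom_klinear[OF assms(1)]
  show ?thesis
    by (induction n) (use assms B in \<open>auto simp: khom_one[OF assms(1)] khom_mult[OF assms(1)]
      klinear_minus[OF l] klinear_smult[OF l]\<close>)
qed

lemma khom_power: "khom B C \<phi> \<Longrightarrow> kalgebra C \<Longrightarrow> x \<in> carrier B \<Longrightarrow> \<phi> (x [^] (n::nat)) = \<phi> x [^]\<^bsub>C\<^esub> n"
  by (induction n) (use B in \<open>auto simp: khom_one[of B C] khom_mult[of B C]\<close>)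

lemma smult_power: "x \<in> carrier B \<Longrightarrow> (c \<odot> x) [^] (n::nat) = c ^ n \<odot> x [^] n"
  by (induction n) (use B in \<open>auto simp: ka_distribs mult.commute\<close>)

lemma power_commute:
  assumes "x \<in> carrier B" "y \<in> carrier B" "y \<otimes> x = x \<otimes> y"
  shows "y \<otimes> x [^] (n::nat) = x [^] n \<otimes> y"
proof (induction n)
  case (Suc n)
  have "y \<otimes> x [^] Suc n = (y \<otimes> x [^] n) \<otimes> x" using B assms by (simp add: ka_assoc)
  then show ?case unfolding Suc using B assms by (simp add: ka_assoc)
qed (use B assms in auto)

lemma ffact_eq_poly:
  assumes x: "x \<in> carrier B"
  shows "ffact B x n = (\<Oplus>i\<in>{..n}. poly.coeff (ffact_poly n) i \<odot> x [^] i)"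
proof (induction n)
  case 0
  then show ?case using B by (simp add: ffact_poly_def)
next
  case (Suc n)
  let ?c = "poly.coeff (ffact_poly n :: 'k poly)"
  have "Polynomial.degree (ffact_poly n :: 'k poly) \<le> n"
    unfolding ffact_poly_def by (rule order.trans[OF degree_prod_sum_le]) auto
  then have top: "?c (Suc n) = 0" by (intro Polynomial.coeff_eq_0) auto
  have rec: "poly.coeff (ffact_poly (Suc n) :: 'k poly) i = (case i of 0 \<Rightarrow> 0 | Suc j \<Rightarrow> ?c j) - of_nat n * ?c i" for i
  proof -
    have "(ffact_poly (Suc n) :: 'k poly) = pCons 0 (ffact_poly n) - smult (of_nat n) (ffact_poly n)"
      by (simp add: ffact_poly_def mult.commute)
    then show ?thesis by (simp add: coeff_pCons split: nat.split)
  qed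
  have "ffact B x (Suc n) = (\<Oplus>i\<in>{..n}. (?c i \<odot> x [^] i) \<otimes> (x \<ominus> of_nat n \<odot> \<one>))"
    unfolding ffact.simps Suc by (rule finsum_ldistr) (use B x in auto)
  also have "\<dots> = (\<Oplus>i\<in>{..n}. ?c i \<odot> x [^] Suc i \<ominus> (of_nat n * ?c i) \<odot> x [^] i)"
    by (rule finsum_cong') (use B x in \<open>auto simp: ka_distribs mult.commute\<close>)
  also have "\<dots> = (\<Oplus>i\<in>{..Suc n}. poly.coeff (ffact_poly (Suc n)) i \<odot> x [^] i)"
  proof (rule lincomb_eqI)
    show "lincomb B (\<Oplus>i\<in>{..n}. ?c i \<odot> x [^] Suc i \<ominus> (of_nat n * ?c i) \<odot> x [^] i)
       (\<lambda>\<phi>. \<Sum>i\<in>{..n}. ?c i * \<phi> (x [^] Suc i) - (of_nat n * ?c i) * \<phi> (x [^] i))"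
      by (intro lincomb_finsum lincomb_minus lincomb_smult lincomb_atom) (use B x in auto)
    show "lincomb B (\<Oplus>i\<in>{..Suc n}. poly.coeff (ffact_poly (Suc n)) i \<odot> x [^] i)
       (\<lambda>\<phi>. \<Sum>i\<in>{..Suc n}. poly.coeff (ffact_poly (Suc n)) i * \<phi> (x [^] i))"
      by (intro lincomb_finsum lincomb_smult lincomb_atom) (use B x in auto)
    fix \<phi> :: "'a \<Rightarrow> 'k"
    have "(\<Sum>i\<in>{..Suc n}. poly.coeff (ffact_poly (Suc n)) i * \<phi> (x [^] i)) =
      (\<Sum>i\<in>{..Suc n}. (case i of 0 \<Rightarrow> 0 | Suc j \<Rightarrow> ?c j) * \<phi> (x [^] i)) - (\<Sum>i\<in>{..Suc n}. of_nat n * ?c i * \<phi> (x [^] i))"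
      by (simp only: rec sum_subtractf[symmetric] left_diff_distrib)
    also have "(\<Sum>i\<in>{..Suc n}. (case i of 0 \<Rightarrow> 0 | Suc j \<Rightarrow> ?c j) * \<phi> (x [^] i)) = (\<Sum>i\<in>{..n}. ?c i * \<phi> (x [^] Suc i))"
      by (subst sum.atMost_Suc_shift) (simp del: nat_pow_Suc)
    also have "(\<Sum>i\<in>{..Suc n}. of_nat n * ?c i * \<phi> (x [^] i)) = (\<Sum>i\<in>{..n}. of_nat n * ?c i * \<phi> (x [^] i))"
      using top by simp
    finally show "(\<Sum>i\<in>{..n}. ?c i * \<phi> (x [^] Suc i) - (of_nat n * ?c i) * \<phi> (x [^] i)) =
       (\<Sum>i\<in>{..Suc n}. poly.coeff (ffact_poly (Suc n)) i * \<phi> (x [^] i))"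
      by (simp only: sum_subtractf)
  qed
  finally show ?case .
qed

lemma ffact_CHAR:
  assumes x: "x \<in> carrier B" and p: "CHAR('k) > 0"
  shows "ffact B x (CHAR('k)) = x [^] CHAR('k) \<ominus> x"
proof -
  let ?p = "CHAR('k)"
  have p1: "?p > 1" using prime_CHAR_semidom[OF p] prime_gt_1_nat by blast
  have "ffact B x ?p = (\<Oplus>i\<in>{..?p}. poly.coeff (ffact_poly ?p) i \<odot> x [^] i)" by (rule ffact_eq_poly[OF x])
  also have "\<dots> = x [^] ?p \<ominus> x [^] (1::nat)"
  proof (rule lincomb_eqI)
    show "lincomb B (\<Oplus>i\<in>{..?p}. poly.coeff (ffact_poly ?p) i \<odot> x [^] i)
       (\<lambda>\<phi>. \<Sum>i\<in>{..?p}. poly.coeff (ffact_poly ?p) i * \<phi> (x [^] i))"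
      by (intro lincomb_finsum lincomb_smult lincomb_atom) (use B x in auto)
    show "lincomb B (x [^] ?p \<ominus> x [^] (1::nat)) (\<lambda>\<phi>. \<phi> (x [^] ?p) - \<phi> (x [^] (1::nat)))"
      by (intro lincomb_minus lincomb_atom) (use B x in auto)
    fix \<phi> :: "'a \<Rightarrow> 'k"
    have "(\<Sum>i\<in>{..?p}. poly.coeff (ffact_poly ?p) i * \<phi> (x [^] i)) =
      (\<Sum>i\<in>{..?p}. (if i = ?p then \<phi> (x [^] i) else 0)) - (\<Sum>i\<in>{..?p}. (if i = 1 then \<phi> (x [^] i) else 0))"
      unfolding ffact_poly_CHAR[OF p] sum_subtractf[symmetric]
      using p1 by (intro sum.cong) (auto simp del: nat_pow_Suc)
    then show "(\<Sum>i\<in>{..?p}. poly.coeff (ffact_poly ?p) i * \<phi> (x [^] i)) = \<phi> (x [^] ?p) - \<phi> (x [^] (1::nat))"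
      using p1 by (simp del: One_nat_def)
  qed
  finally show ?thesis using x B by simp
qed

lemma power_CHAR_iff:
  assumes "x \<in> carrier B" "CHAR('k) > 0"
  shows "x [^] CHAR('k) = x \<longleftrightarrow> ffact B x (CHAR('k)) = \<zero>"
  using ffact_CHAR[OF assms] vs_minus_eq_zero[of B] assms B by simp

lemma gpow_commute:
  assumes "x \<in> carrier B" "g \<in> carrier B" "g \<otimes> x = x \<otimes> g \<oplus> g \<ominus> g \<otimes> g"
  shows "g [^] j \<otimes> x = x \<otimes> g [^] j \<oplus> of_nat j \<odot> (g [^] j \<ominus> g [^] Suc j)"
proof (induction j)
  case 0
  then show ?case using B assms by (simp add: vs_zero_smult)
next
  case (Suc j)
  have "g [^] Suc j \<otimes> x = g [^] j \<otimes> (g \<otimes> x)" using B assms by (simp add: ka_assoc)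
  also have "\<dots> = (g [^] j \<otimes> x) \<otimes> g \<oplus> g [^] Suc j \<ominus> g [^] Suc (Suc j)"
    unfolding assms(3) using B assms(1,2) by (simp add: ka_distribs ka_assoc)
  also have "\<dots> = x \<otimes> g [^] Suc j \<oplus> of_nat (Suc j) \<odot> (g [^] Suc j \<ominus> g [^] Suc (Suc j))"
    unfolding Suc using B assms(1,2) by (simp add: ka_distribs ka_assoc)
      (rule lincomb_eqI[where V = B], (rule lincomb_intros | rule lincomb_atom | simp)+, simp add: algebra_simps)
  finally show ?case .
qed

context
  fixes x g y :: 'a
  assumes x: "x \<in> carrier B" and g: "g \<in> carrier B" and y: "y \<in> carrier B"
    and gx: "g \<otimes> x = x \<otimes> g \<oplus> g \<ominus> g \<otimes> g"
    and yx: "y \<otimes> x = x \<otimes> y" and yg: "y \<otimes> g = g \<otimes> y"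
begin

text \<open>
  The summand of the binomial theorem with indices \<open>i\<close> and \<open>j\<close>, multiplied by the next factor. Moving
  \<open>g\<^sup>j\<close> past \<open>x\<close> produces \<open>j (g\<^sup>j - g\<^bsup>j+1\<^esup>)\<close>: the first term turns \<open>x - (i + j)\<close> into \<open>x - i\<close>, and the
  second one turns \<open>y\<close> into \<open>y - j\<close>.
\<close>

lemma ffact_binomial_step:
  "ffact B x i \<otimes> (g [^] j \<otimes> ffact B y j) \<otimes> (x \<oplus> g \<otimes> y \<ominus> of_nat (i + j) \<odot> \<one>) =
   ffact B x (Suc i) \<otimes> (g [^] j \<otimes> ffact B y j) \<oplus> ffact B x i \<otimes> (g [^] Suc j \<otimes> ffact B y (Suc j))"
proof -
  let ?X = "ffact B x i" and ?G = "g [^] j" and ?Y = "ffact B y j"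
  note c = x g y B
  have cl: "?X \<in> carrier B" "?G \<in> carrier B" "?Y \<in> carrier B" "ffact B x (Suc i) \<in> carrier B" "ffact B y (Suc j) \<in> carrier B"
    using c by (simp_all del: ffact.simps)
  have 1: "?X \<otimes> (?G \<otimes> ?Y) \<otimes> x = ?X \<otimes> ((?G \<otimes> x) \<otimes> ?Y)"
  proof -
    have "?Y \<otimes> x = x \<otimes> ?Y" by (rule ffact_commute[symmetric]) (use c yx in auto)
    then show ?thesis using c cl by (simp add: ka_assoc)
  qed
  have 2: "\<dots> = (?X \<otimes> x) \<otimes> (?G \<otimes> ?Y) \<oplus> of_nat j \<odot> (?X \<otimes> (?G \<otimes> ?Y) \<ominus> ?X \<otimes> (g [^] Suc j \<otimes> ?Y))"
    unfolding gpow_commute[OF x g gx] using c cl by (simp add: ka_distribs ka_assoc del: nat_pow_Suc)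
  have 3: "?X \<otimes> (?G \<otimes> ?Y) \<otimes> (g \<otimes> y) = ?X \<otimes> (g [^] Suc j \<otimes> (?Y \<otimes> y))"
  proof -
    have e: "?Y \<otimes> g = g \<otimes> ?Y" by (rule ffact_commute[symmetric]) (use c yg in auto)
    have "?Y \<otimes> (g \<otimes> y) = g \<otimes> (?Y \<otimes> y)"
      using c cl by (simp add: ka_assoc[symmetric] e)
    then show ?thesis using c cl by (simp add: ka_assoc)
  qed
  have "?X \<otimes> (?G \<otimes> ?Y) \<otimes> (x \<oplus> g \<otimes> y \<ominus> of_nat (i + j) \<odot> \<one>) =
     ?X \<otimes> (?G \<otimes> ?Y) \<otimes> x \<oplus> ?X \<otimes> (?G \<otimes> ?Y) \<otimes> (g \<otimes> y) \<ominus> of_nat (i + j) \<odot> (?X \<otimes> (?G \<otimes> ?Y))"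
    using c cl by (simp add: ka_mult_add ka_mult_minus ka_mult_smult)
  also have "\<dots> = ffact B x (Suc i) \<otimes> (g [^] j \<otimes> ffact B y j) \<oplus> ffact B x i \<otimes> (g [^] Suc j \<otimes> ffact B y (Suc j))"
    unfolding 1 2 3 ffact_mult[OF x] ffact_mult[OF y] using c cl
    by (simp add: ka_distribs del: nat_pow_Suc ffact.simps)
      (rule lincomb_eqI[where V = B], (rule lincomb_intros | rule lincomb_atom | simp del: nat_pow_Suc ffact.simps)+, simp add: algebra_simps del: nat_pow_Suc ffact.simps)
  finally show ?thesis .
qed

text \<open>
  The binomial theorem for falling factorials. The hypothesis on \<open>g\<close> and \<open>x\<close> is the relation
  \<open>g x - x g = f(g) g (1 - g)\<close> with \<open>f(g) = 1\<close>.
\<close>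

lemma ffact_binomial:
  "ffact B (x \<oplus> g \<otimes> y) n =
   (\<Oplus>k\<in>{..n}. of_nat (n choose k) \<odot> (ffact B x (n - k) \<otimes> (g [^] k \<otimes> ffact B y k)))"
proof (induction n)
  case 0
  then show ?case using B by simp
next
  case (Suc n)
  note c = x g y B
  let ?T = "\<lambda>i j. ffact B x i \<otimes> (g [^] j \<otimes> ffact B y j)"
  have T: "?T i j \<in> carrier B" for i j using c by simp
  have "ffact B (x \<oplus> g \<otimes> y) (Suc n) =
    (\<Oplus>k\<in>{..n}. (of_nat (n choose k) \<odot> ?T (n - k) k) \<otimes> (x \<oplus> g \<otimes> y \<ominus> of_nat n \<odot> \<one>))"
    unfolding ffact.simps(2)[of B "x \<oplus> g \<otimes> y"] Suc by (rule finsum_ldistr) (use c T in auto)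
  also have "\<dots> = (\<Oplus>k\<in>{..n}. of_nat (n choose k) \<odot> (?T (Suc n - k) k \<oplus> ?T (Suc n - Suc k) (Suc k)))"
  proof (rule finsum_cong'[OF refl])
    fix k assume k: "k \<in> {..n}"
    then have "Suc (n - k) = Suc n - k" "n - k + k = n" "Suc n - Suc k = n - k" by auto
    then show "(of_nat (n choose k) \<odot> ?T (n - k) k) \<otimes> (x \<oplus> g \<otimes> y \<ominus> of_nat n \<odot> \<one>) =
      of_nat (n choose k) \<odot> (?T (Suc n - k) k \<oplus> ?T (Suc n - Suc k) (Suc k))"
      using ffact_binomial_step[of "n - k" k] c T by (simp add: ka_smult_mult del: ffact.simps nat_pow_Suc)
  qed (use c T in auto)
  also have "\<dots> = (\<Oplus>k\<in>{..Suc n}. of_nat (Suc n choose k) \<odot> ?T (Suc n - k) k)"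
  proof (rule lincomb_eqI)
    show "lincomb B (\<Oplus>k\<in>{..n}. of_nat (n choose k) \<odot> (?T (Suc n - k) k \<oplus> ?T (Suc n - Suc k) (Suc k)))
      (\<lambda>\<phi>. \<Sum>k\<in>{..n}. of_nat (n choose k) * (\<phi> (?T (Suc n - k) k) + \<phi> (?T (Suc n - Suc k) (Suc k))))"
      by (intro lincomb_finsum lincomb_smult lincomb_add lincomb_atom) (use c T in \<open>auto simp del: ffact.simps nat_pow_Suc\<close>)
    show "lincomb B (\<Oplus>k\<in>{..Suc n}. of_nat (Suc n choose k) \<odot> ?T (Suc n - k) k)
      (\<lambda>\<phi>. \<Sum>k\<in>{..Suc n}. of_nat (Suc n choose k) * \<phi> (?T (Suc n - k) k))"
      by (intro lincomb_finsum lincomb_smult lincomb_atom) (use c T in \<open>auto simp del: ffact.simps nat_pow_Suc\<close>)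
    fix \<phi> :: "'a \<Rightarrow> 'k"
    define F where "F k = \<phi> (?T (Suc n - k) k)" for k
    have "(\<Sum>k\<in>{..Suc n}. of_nat (Suc n choose k) * F k) = F 0 + (\<Sum>k\<in>{..n}. of_nat (Suc n choose Suc k) * F (Suc k))"
      by (subst sum.atMost_Suc_shift) simp
    also have "\<dots> = (\<Sum>k\<in>{..n}. of_nat (n choose k) * F (Suc k)) + (F 0 + (\<Sum>k\<in>{..n}. of_nat (n choose Suc k) * F (Suc k)))"
      by (simp add: sum.distrib algebra_simps)
    also have "F 0 + (\<Sum>k\<in>{..n}. of_nat (n choose Suc k) * F (Suc k)) = (\<Sum>k\<in>{..Suc n}. of_nat (n choose k) * F k)"
      by (subst sum.atMost_Suc_shift) simp
    also have "\<dots> = (\<Sum>k\<in>{..n}. of_nat (n choose k) * F k)"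
      by (simp add: binomial_eq_0)
    finally have "(\<Sum>k\<in>{..n}. of_nat (n choose k) * (F k + F (Suc k))) = (\<Sum>k\<in>{..Suc n}. of_nat (Suc n choose k) * F k)"
      by (simp add: sum.distrib algebra_simps)
    then show "(\<Sum>k\<in>{..n}. of_nat (n choose k) * (\<phi> (?T (Suc n - k) k) + \<phi> (?T (Suc n - Suc k) (Suc k)))) =
      (\<Sum>k\<in>{..Suc n}. of_nat (Suc n choose k) * \<phi> (?T (Suc n - k) k))"
      unfolding F_def .
  qed
  finally show ?case .
qed

text \<open>
  The binomial coefficients strictly between the ends vanish in characteristic \<open>p\<close>.
\<close>

lemma ffact_CHAR_add:
  assumes p: "CHAR('k) > 0"
  shows "ffact B (x \<oplus> g \<otimes> y) (CHAR('k)) =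
    ffact B x (CHAR('k)) \<oplus> g [^] CHAR('k) \<otimes> ffact B y (CHAR('k))"
proof -
  let ?p = "CHAR('k)"
  note c = x g y B
  let ?T = "\<lambda>i j. ffact B x i \<otimes> (g [^] j \<otimes> ffact B y j)"
  have T: "?T i j \<in> carrier B" for i j using c by simp
  have "(\<Oplus>k\<in>{..?p}. of_nat (?p choose k) \<odot> ?T (?p - k) k) = ?T ?p 0 \<oplus> ?T 0 ?p"
  proof (rule lincomb_eqI)
    show "lincomb B (\<Oplus>k\<in>{..?p}. of_nat (?p choose k) \<odot> ?T (?p - k) k)
      (\<lambda>\<phi>. \<Sum>k\<in>{..?p}. of_nat (?p choose k) * \<phi> (?T (?p - k) k))"
      by (intro lincomb_finsum lincomb_smult lincomb_atom) (use c T in \<open>auto simp del: ffact.simps nat_pow_Suc\<close>)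
    show "lincomb B (?T ?p 0 \<oplus> ?T 0 ?p) (\<lambda>\<phi>. \<phi> (?T ?p 0) + \<phi> (?T 0 ?p))"
      by (intro lincomb_add lincomb_atom) (use c T in \<open>auto simp del: ffact.simps nat_pow_Suc\<close>)
    fix \<phi> :: "'a \<Rightarrow> 'k"
    have z: "(of_nat (?p choose k) :: 'k) = 0" if "k \<noteq> 0" "k \<noteq> ?p" for k
    proof (cases "k < ?p")
      case True
      have "?p dvd (?p choose k)" using prime_CHAR_semidom[OF p] True that by (intro dvd_choose_prime) auto
      then show ?thesis by (simp add: of_nat_eq_0_iff_char_dvd)
    qed (use that in \<open>simp add: binomial_eq_0\<close>)
    have "(\<Sum>k\<in>{..?p}. of_nat (?p choose k) * \<phi> (?T (?p - k) k)) =
      (\<Sum>k\<in>{0, ?p}. of_nat (?p choose k) * \<phi> (?T (?p - k) k))"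
      by (rule sum.mono_neutral_right) (auto simp: z)
    then show "(\<Sum>k\<in>{..?p}. of_nat (?p choose k) * \<phi> (?T (?p - k) k)) = \<phi> (?T ?p 0) + \<phi> (?T 0 ?p)"
      using p by simp
  qed
  then show ?thesis unfolding ffact_binomial using c by simp
qed

end

lemma ffact_CHAR_add_commuting:
  assumes p: "CHAR('k) > 0" and x: "x \<in> carrier B" "y \<in> carrier B" "y \<otimes> x = x \<otimes> y"
  shows "ffact B (x \<oplus> y) (CHAR('k)) = ffact B x (CHAR('k)) \<oplus> ffact B y (CHAR('k))"
proof -
  have "\<one> \<otimes> x = x \<otimes> \<one> \<oplus> \<one> \<ominus> \<one> \<otimes> \<one>"
    using B x by simp (rule lincomb_eqI[where V = B], (rule lincomb_intros | rule lincomb_atom | simp)+)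
  from ffact_CHAR_add[OF x(1) ka_one[OF B] x(2) this x(3) _ p] show ?thesis using B x by simp
qed

lemma power_CHAR_uminus:
  assumes p: "CHAR('k) > 0" and x: "x \<in> carrier B"
  shows "(\<ominus> x) [^] CHAR('k) = \<ominus> (x [^] CHAR('k))"
proof -
  have "(-1 :: 'k) ^ CHAR('k) = - (1 ^ CHAR('k))"
    using prime_CHAR_semidom[OF p] by (intro minus_power_prime_CHAR) simp_all
  then show ?thesis using B x by (simp add: vs_uminus_smult smult_power)
qed

text \<open>
  Since \<open>s\<close> shifts \<open>E\<close> by one, each new factor \<open>1 - s\<close> moves to the left through the falling factorial
  of \<open>E\<close> and leaves the next factor of it behind. This applies to \<open>x\<close> acting on functions on \<open>G\<close> and
  to the antipode of \<open>x\<close>.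
\<close>

lemma ffact_shift:
  assumes s: "s \<in> carrier B" and E: "E \<in> carrier B" and Es: "E \<otimes> s = s \<otimes> E \<ominus> s"
  shows "ffact B ((\<one> \<ominus> s) \<otimes> E) n = (\<one> \<ominus> s) [^] n \<otimes> ffact B E n"
proof (induction n)
  case 0
  then show ?case using B by simp
next
  case (Suc n)
  have sh: "ffact B E n \<otimes> (s \<otimes> E) = s \<otimes> ffact B E (Suc n)" for n
  proof (induction n)
    case 0
    then show ?case using B s E by (simp add: vs_zero_smult a_minus_def)
  next
    case (Suc n)
    have e: "(E \<ominus> of_nat n \<odot> \<one>) \<otimes> (s \<otimes> E) = (s \<otimes> E) \<otimes> (E \<ominus> of_nat (Suc n) \<odot> \<one>)"
    proof -
      have "(E \<ominus> of_nat n \<odot> \<one>) \<otimes> (s \<otimes> E) = (E \<otimes> s) \<otimes> E \<ominus> of_nat n \<odot> (s \<otimes> E)"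
        using B s E by (simp add: ka_distribs ka_assoc)
      then show ?thesis unfolding Es using B s E by (simp add: ka_distribs ka_assoc)
         (rule lincomb_eqI[where V = B], (rule lincomb_intros | rule lincomb_atom | simp)+, simp add: algebra_simps)
    qed
    have "ffact B E (Suc n) \<otimes> (s \<otimes> E) = ffact B E n \<otimes> ((s \<otimes> E) \<otimes> (E \<ominus> of_nat (Suc n) \<odot> \<one>))"
      unfolding e[symmetric] using B s E by (simp add: ka_assoc)
    also have "\<dots> = (ffact B E n \<otimes> (s \<otimes> E)) \<otimes> (E \<ominus> of_nat (Suc n) \<odot> \<one>)"
      using B s E by (simp add: ka_assoc)
    also have "\<dots> = s \<otimes> ffact B E (Suc (Suc n))"
      unfolding Suc using B s E by (simp add: ka_assoc)
    finally show ?case .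
  qed
  let ?r = "\<one> \<ominus> s"
  have r: "?r \<in> carrier B" using B s by simp
  have "ffact B E n \<otimes> (?r \<otimes> E \<ominus> of_nat n \<odot> \<one>) =
     ffact B E n \<otimes> E \<ominus> ffact B E n \<otimes> (s \<otimes> E) \<ominus> of_nat n \<odot> ffact B E n"
    using B s E by (simp add: ka_distribs)
  also have "\<dots> = ?r \<otimes> ffact B E (Suc n)"
    unfolding sh ffact_mult[OF E] using B s E by (simp add: ka_minus_mult del: ffact.simps)
      (rule lincomb_eqI[where V = B], (rule lincomb_intros | rule lincomb_atom | simp del: ffact.simps)+)
  finally have st: "ffact B E n \<otimes> (?r \<otimes> E \<ominus> of_nat n \<odot> \<one>) = ?r \<otimes> ffact B E (Suc n)" .
  have "ffact B (?r \<otimes> E) (Suc n) = ?r [^] n \<otimes> (ffact B E n \<otimes> (?r \<otimes> E \<ominus> of_nat n \<odot> \<one>))"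
    using Suc B s E r by (simp add: ka_assoc)
  also have "\<dots> = ?r [^] Suc n \<otimes> ffact B E (Suc n)"
    unfolding st using B r E by (simp add: ka_assoc del: ffact.simps)
  finally show ?case .
qed

end

lemma klinear_finsum_map:
  assumes "finite I" "vspace W" "\<And>i. i \<in> I \<Longrightarrow> klinear V W (\<phi> i)" "vspace V"
  shows "klinear V W (\<lambda>u. \<Oplus>\<^bsub>W\<^esub>i\<in>I. \<phi> i u)"
  using assms(1,3)
proof (induction I rule: finite_induct)
  case empty
  interpret W: abelian_group W using assms(2) by (rule vspace_abelian_group)
  show ?case using klinear_const_zero[OF assms(2)] by simp
next
  case (insert i I)
  interpret W: abelian_group W using assms(2) by (rule vspace_abelian_group)
  have s: "klinear V W (\<lambda>u. \<phi> i u \<oplus>\<^bsub>W\<^esub> (\<Oplus>\<^bsub>W\<^esub>i\<in>I. \<phi> i u))"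
    by (rule klinear_sum) (use insert assms(2) in auto)
  have e: "(\<Oplus>\<^bsub>W\<^esub>i\<in>insert i I. \<phi> i u) = \<phi> i u \<oplus>\<^bsub>W\<^esub> (\<Oplus>\<^bsub>W\<^esub>i\<in>I. \<phi> i u)" if "u \<in> carrier V" for u
    using insert that klinear_closed[OF insert(4)] by (intro W.finsum_insert) auto
  show ?case by (rule klinear_cong[OF s e[symmetric] assms(4)])
qed

text \<open>
  Later \<open>s\<close> is the image of an element of \<open>\<Gamma>\<close>, \<open>a\<close> is \<open>x\<close> and \<open>b\<close> is \<open>x \<triangleleft> h\<close>.
\<close>

lemma ffact_intertwine:
  assumes B: "kalgebra B" and c: "a \<in> carrier B" "b \<in> carrier B" "s \<in> carrier B" and eq: "a \<otimes>\<^bsub>B\<^esub> s = s \<otimes>\<^bsub>B\<^esub> b"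
  shows "ffact B a n \<otimes>\<^bsub>B\<^esub> s = s \<otimes>\<^bsub>B\<^esub> ffact B b n"
proof (induction n)
  case (Suc n)
  note [simp] = ffact_closed[OF B]
  have "ffact B a (Suc n) \<otimes>\<^bsub>B\<^esub> s = ffact B a n \<otimes>\<^bsub>B\<^esub> (a \<otimes>\<^bsub>B\<^esub> s \<ominus>\<^bsub>B\<^esub> of_nat n \<odot>\<^bsub>B\<^esub> s)"
    using B c by (simp add: ka_assoc ka_distribs)
  also have "\<dots> = (ffact B a n \<otimes>\<^bsub>B\<^esub> s) \<otimes>\<^bsub>B\<^esub> (b \<ominus>\<^bsub>B\<^esub> of_nat n \<odot>\<^bsub>B\<^esub> \<one>\<^bsub>B\<^esub>)"
    unfolding eq using B c by (simp add: ka_assoc ka_distribs ka_mult_smult)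
  finally show ?case unfolding Suc using B c by (simp add: ka_assoc)
qed (use B c in simp)

lemma ffact_scalar:
  assumes B: "kalgebra (B :: ('k::field, 'a, 'm) module_scheme)"
  shows "ffact B (c \<odot>\<^bsub>B\<^esub> \<one>\<^bsub>B\<^esub>) n = (\<Prod>i<n. c - of_nat i) \<odot>\<^bsub>B\<^esub> \<one>\<^bsub>B\<^esub>"
proof (induction n)
  case (Suc n)
  have "c \<odot>\<^bsub>B\<^esub> \<one>\<^bsub>B\<^esub> \<ominus>\<^bsub>B\<^esub> of_nat n \<odot>\<^bsub>B\<^esub> \<one>\<^bsub>B\<^esub> = (c - of_nat n) \<odot>\<^bsub>B\<^esub> \<one>\<^bsub>B\<^esub>"
    using B by (intro lincomb_eqI[where V = B]) (rule lincomb_intros | rule lincomb_atom | simp add: algebra_simps)+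
  then show ?case using B Suc by (simp add: ka_distribs mult.commute)
qed (use B in simp)

lemma power_CHAR_one_minus:
  assumes B: "kalgebra (B :: ('k::field, 'a, 'm) module_scheme)" and p: "CHAR('k) > 0" and s: "s \<in> carrier B"
  shows "(\<one>\<^bsub>B\<^esub> \<ominus>\<^bsub>B\<^esub> s) [^]\<^bsub>B\<^esub> CHAR('k) = \<one>\<^bsub>B\<^esub> \<ominus>\<^bsub>B\<^esub> s [^]\<^bsub>B\<^esub> CHAR('k)"
proof -
  let ?n = "CHAR('k)"
  interpret Ring.ring B using B by (rule kalgebra_ring)
  have o: "\<one>\<^bsub>B\<^esub> [^]\<^bsub>B\<^esub> ?n = \<one>\<^bsub>B\<^esub>" by simp
  have "ffact B (\<one>\<^bsub>B\<^esub> \<oplus>\<^bsub>B\<^esub> \<ominus>\<^bsub>B\<^esub> s) ?n = ffact B \<one>\<^bsub>B\<^esub> ?n \<oplus>\<^bsub>B\<^esub> ffact B (\<ominus>\<^bsub>B\<^esub> s) ?n"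
    by (rule ffact_CHAR_add_commuting[OF B p]) (use s in auto)
  then have e: "(\<one>\<^bsub>B\<^esub> \<ominus>\<^bsub>B\<^esub> s) [^]\<^bsub>B\<^esub> ?n \<ominus>\<^bsub>B\<^esub> (\<one>\<^bsub>B\<^esub> \<ominus>\<^bsub>B\<^esub> s) =
     (\<one>\<^bsub>B\<^esub> \<ominus>\<^bsub>B\<^esub> \<one>\<^bsub>B\<^esub>) \<oplus>\<^bsub>B\<^esub> (\<ominus>\<^bsub>B\<^esub> (s [^]\<^bsub>B\<^esub> ?n) \<ominus>\<^bsub>B\<^esub> \<ominus>\<^bsub>B\<^esub> s)"
    using s B p by (simp add: ffact_CHAR[OF B _ p] o power_CHAR_uminus[OF B p] a_minus_def)
  have "(\<one>\<^bsub>B\<^esub> \<ominus>\<^bsub>B\<^esub> s) [^]\<^bsub>B\<^esub> ?n = ((\<one>\<^bsub>B\<^esub> \<ominus>\<^bsub>B\<^esub> s) [^]\<^bsub>B\<^esub> ?n \<ominus>\<^bsub>B\<^esub> (\<one>\<^bsub>B\<^esub> \<ominus>\<^bsub>B\<^esub> s)) \<oplus>\<^bsub>B\<^esub> (\<one>\<^bsub>B\<^esub> \<ominus>\<^bsub>B\<^esub> s)"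
    using B s by (intro lincomb_eqI[where V = B]) (rule lincomb_intros | rule lincomb_atom | simp add: algebra_simps)+
  also have "\<dots> = \<one>\<^bsub>B\<^esub> \<ominus>\<^bsub>B\<^esub> s [^]\<^bsub>B\<^esub> ?n"
    unfolding e using B s by (intro lincomb_eqI[where V = B]) (rule lincomb_intros | rule lincomb_atom | simp add: algebra_simps)+
  finally show ?thesis .
qed

lemma opposite_power: "kalgebra B \<Longrightarrow> a \<in> carrier B \<Longrightarrow> a [^]\<^bsub>opposite B\<^esub> (n::nat) = a [^]\<^bsub>B\<^esub> n"
proof (induction n)
  case (Suc n)
  then show ?case using power_commute[of B a a n] by simp
qed simp

section \<open>The Hopf algebras of the third type\<close>

lemma group_alg_minus: "v \<in> carrier (group_alg G) \<Longrightarrow> w \<in> carrier (group_alg G) \<Longrightarrow> v \<ominus>\<^bsub>group_alg G\<^esub> w = v - w"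
  by (subst vs_minus_smult) auto

lemma k_set_iff:
  fixes a :: "'k::field"
  assumes "group G" "g \<in> carrier G"
  shows "a \<in> k_set G g \<longleftrightarrow> a ^ CHAR('k) = a \<or> g [^]\<^bsub>G\<^esub> CHAR('k) = \<one>\<^bsub>G\<^esub>"
proof -
  interpret group G by fact
  have m: "\<one>\<^bsub>group_alg G\<^esub> \<ominus>\<^bsub>group_alg G\<^esub> (basis_vec (g [^]\<^bsub>G\<^esub> CHAR('k)) :: _ \<Rightarrow>\<^sub>0 'k) =
      basis_vec \<one>\<^bsub>G\<^esub> - basis_vec (g [^]\<^bsub>G\<^esub> CHAR('k))"
    using assms by (subst group_alg_minus) auto
  let ?d = "basis_vec \<one>\<^bsub>G\<^esub> - basis_vec (g [^]\<^bsub>G\<^esub> CHAR('k)) :: _ \<Rightarrow>\<^sub>0 'k"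
  have 1: "fscale c v = 0 \<longleftrightarrow> c = 0 \<or> v = 0" for c :: 'k and v :: "'a \<Rightarrow>\<^sub>0 'k"
    by (auto simp: poly_mapping_eq_iff fun_eq_iff)
  have 2: "?d = 0 \<longleftrightarrow> g [^]\<^bsub>G\<^esub> CHAR('k) = \<one>\<^bsub>G\<^esub>"
  proof
    assume "?d = 0"
    then have "Poly_Mapping.lookup ?d \<one>\<^bsub>G\<^esub> = 0" by simp
    then show "g [^]\<^bsub>G\<^esub> CHAR('k) = \<one>\<^bsub>G\<^esub>"
      by (auto simp: lookup_minus basis_vec_def lookup_single when_def split: if_splits)
  qed simp
  show ?thesis unfolding k_set_def mem_Collect_eq m using 1[of "a ^ CHAR('k) - a" ?d] 2 by simp
qed

locale third_type =
  fixes G :: "'g monoid" (structure) and g :: 'g and f :: "'g \<Rightarrow> 'k::field"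
  assumes char_pos: "CHAR('k) > 0" and datum: "third_type_datum G g f"
begin

sublocale group G using datum by (simp add: third_type_datum_def)

lemma finite_G: "finite (carrier G)" and g_closed [simp]: "g \<in> carrier G"
  and g_central: "t \<in> carrier G \<Longrightarrow> g \<otimes> t = t \<otimes> g"
  and f_g [simp]: "f g = 1"
  and f_k_set: "t \<in> carrier G \<Longrightarrow> f t \<in> k_set G g"
  using datum by (simp_all add: third_type_datum_def)

lemma f_mult [simp]: "s \<in> carrier G \<Longrightarrow> t \<in> carrier G \<Longrightarrow> f (s \<otimes> t) = f s + f t"
  using datum by (auto simp: third_type_datum_def hom_def)

lemma f_one [simp]: "f \<one> = 0"
  using f_mult[of "\<one>" "\<one>"] by (metis add_cancel_right_right l_one one_closed)

lemma f_inv [simp]: "t \<in> carrier G \<Longrightarrow> f (inv t) = - f t"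
  using f_mult[of t "inv t"] by (simp add: add_eq_0_iff2)

lemma g_neq_one: "g \<noteq> \<one>"
  using f_g f_one by fastforce

abbreviation "A0 \<equiv> a3_alg G g f"
definition "H = a3_hopf G g f"
abbreviation H_mult (infixl "\<otimes>\<^sub>H" 70) where "u \<otimes>\<^sub>H v \<equiv> u \<otimes>\<^bsub>H\<^esub> v"
abbreviation H_add (infixl "\<oplus>\<^sub>H" 65) where "u \<oplus>\<^sub>H v \<equiv> u \<oplus>\<^bsub>H\<^esub> v"
abbreviation H_minus ("(_ \<ominus>\<^sub>H _)" [65,66] 65) where "u \<ominus>\<^sub>H v \<equiv> u \<ominus>\<^bsub>H\<^esub> v"
abbreviation H_uminus ("\<ominus>\<^sub>H _" [81] 80) where "\<ominus>\<^sub>H u \<equiv> \<ominus>\<^bsub>H\<^esub> u"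
abbreviation H_smult (infixl "\<odot>\<^sub>H" 70) where "c \<odot>\<^sub>H u \<equiv> c \<odot>\<^bsub>H\<^esub> u"
abbreviation H_one ("\<one>\<^sub>H") where "\<one>\<^sub>H \<equiv> \<one>\<^bsub>H\<^esub>"
abbreviation H_zero ("\<zero>\<^sub>H") where "\<zero>\<^sub>H \<equiv> \<zero>\<^bsub>H\<^esub>"
definition "e t = a3_letter G g f (Grp t)"
definition "x = a3_letter G g f Skew"
abbreviation "FA \<equiv> a3_free G :: ('k, 'g letter list \<Rightarrow>\<^sub>0 'k) module"
abbreviation "proj v \<equiv> genideal FA (a3_relations G g f) +>\<^bsub>FA\<^esub> v"

lemma H_sel: "carrier H = carrier A0" "monoid.mult H = monoid.mult A0" "\<one>\<^sub>H = \<one>\<^bsub>A0\<^esub>"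
  "\<zero>\<^sub>H = \<zero>\<^bsub>A0\<^esub>" "add H = add A0" "module.smult H = module.smult A0"
  by (simp_all add: H_def a3_hopf_def Let_def module.defs hopf.defs)

lemma FA_kalgebra [simp]: "kalgebra FA" by (rule kalgebra_free_alg)

lemma letter_closed [simp]: "basis_vec [Skew] \<in> carrier FA" "t \<in> carrier G \<Longrightarrow> basis_vec [Grp t] \<in> carrier FA"
  by auto

lemma relations_closed: "a3_relations G g f \<subseteq> carrier FA"
proof -
  note [simp del] = free_alg_simps
  have v: "vspace FA" by simp
  note cl = ka_one[OF FA_kalgebra] ka_mult[OF FA_kalgebra] ka_pow[OF FA_kalgebra] vs_minus[OF v] vs_smult[OF v] letter_closed
  show ?thesis unfolding a3_relations_def Let_def by (auto intro!: cl)
qed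

lemma A0_kalgebra: "kalgebra A0"
  unfolding a3_alg_def by (rule quotient_alg_hom(1)[OF FA_kalgebra relations_closed])

lemma H_kalgebra [simp]: "kalgebra H"
  by (rule kalgebra_cong[OF A0_kalgebra]) (simp_all add: H_sel)

lemma H_vspace [simp]: "vspace H" by simp

lemma khom_H_iff: "khom B H \<phi> \<longleftrightarrow> khom B A0 \<phi>" "khom H B \<psi> \<longleftrightarrow> khom A0 B \<psi>"
  by (simp_all add: khom_def klinear_def ring_hom_def H_sel)

lemma khom_proj: "khom FA H proj"
  unfolding khom_H_iff a3_alg_def by (rule quotient_alg_hom(2)[OF FA_kalgebra relations_closed])

lemma proj_letter: "e t = proj (basis_vec [Grp t])" "x = proj (basis_vec [Skew])"
  by (simp_all add: e_def x_def a3_letter_def)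

lemma x_closed [simp]: "x \<in> carrier H"
  unfolding proj_letter by (rule khom_closed[OF khom_proj]) simp

lemma e_closed [simp]: "t \<in> carrier G \<Longrightarrow> e t \<in> carrier H"
  unfolding proj_letter by (rule khom_closed[OF khom_proj]) simp

lemma proj_relation:
  assumes "a \<in> carrier FA" "b \<in> carrier FA" "a \<ominus>\<^bsub>FA\<^esub> b \<in> a3_relations G g f"
  shows "proj a = proj b"
  by (rule quotient_relation[OF FA_kalgebra relations_closed assms])

lemma e_mult: "s \<in> carrier G \<Longrightarrow> t \<in> carrier G \<Longrightarrow> e s \<otimes>\<^sub>H e t = e (s \<otimes> t)"
  unfolding proj_letter khom_mult[OF khom_proj letter_closed(2) letter_closed(2), symmetric]
  by (rule proj_relation) (auto simp: a3_relations_def Let_def basis_vec_def simp del: free_alg_simps(2-),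
      auto simp: basis_vec_def)

lemma e_one: "e \<one> = \<one>\<^sub>H"
  unfolding proj_letter khom_one[OF khom_proj, symmetric]
  by (rule proj_relation) (auto simp: a3_relations_def Let_def)

lemma e_inv: "t \<in> carrier G \<Longrightarrow> e t \<otimes>\<^sub>H e (inv t) = \<one>\<^sub>H" "t \<in> carrier G \<Longrightarrow> e (inv t) \<otimes>\<^sub>H e t = \<one>\<^sub>H"
  by (simp_all add: e_mult e_one)

lemma commutator:
  assumes t: "t \<in> carrier G"
  shows "(e t \<otimes>\<^sub>H x) \<ominus>\<^sub>H (x \<otimes>\<^sub>H e t) = f t \<odot>\<^sub>H (e t \<otimes>\<^sub>H (\<one>\<^sub>H \<ominus>\<^sub>H e g))"
proof -
  note [simp del] = free_alg_simps
  let ?E = "\<lambda>t. basis_vec [Grp t] :: 'g letter list \<Rightarrow>\<^sub>0 'k" and ?X = "basis_vec [Skew] :: 'g letter list \<Rightarrow>\<^sub>0 'k"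
  have v: "vspace FA" by simp
  note cl = ka_one[OF FA_kalgebra] ka_mult[OF FA_kalgebra] vs_minus[OF v] vs_smult[OF v] letter_closed
  note l = khom_klinear[OF khom_proj]
  have "proj ((?E t \<otimes>\<^bsub>FA\<^esub> ?X) \<ominus>\<^bsub>FA\<^esub> (?X \<otimes>\<^bsub>FA\<^esub> ?E t)) = proj (f t \<odot>\<^bsub>FA\<^esub> (?E t \<otimes>\<^bsub>FA\<^esub> (\<one>\<^bsub>FA\<^esub> \<ominus>\<^bsub>FA\<^esub> ?E g)))"
    by (rule proj_relation) (use t in \<open>auto intro!: cl simp: a3_relations_def Let_def\<close>)
  then show ?thesis unfolding proj_letter
    using t by (simp add: klinear_minus[OF l] klinear_smult[OF l] khom_mult[OF khom_proj] khom_one[OF khom_proj])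
qed

lemma x_mult_e:
  assumes t: "t \<in> carrier G"
  shows "x \<otimes>\<^sub>H e t = e t \<otimes>\<^sub>H x \<ominus>\<^sub>H f t \<odot>\<^sub>H (e t \<ominus>\<^sub>H e (t \<otimes> g))"
proof -
  have "f t \<odot>\<^sub>H (e t \<otimes>\<^sub>H (\<one>\<^sub>H \<ominus>\<^sub>H e g)) = f t \<odot>\<^sub>H (e t \<ominus>\<^sub>H e (t \<otimes> g))"
    using t by (simp add: ka_distribs e_mult)
  then have c: "(e t \<otimes>\<^sub>H x) \<ominus>\<^sub>H (x \<otimes>\<^sub>H e t) = f t \<odot>\<^sub>H (e t \<ominus>\<^sub>H e (t \<otimes> g))"
    using commutator[OF t] by simp
  show ?thesis unfolding c[symmetric] using t
    by (intro lincomb_eqI[where V = H]) (rule lincomb_intros | rule lincomb_atom | simp)+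
qed

lemma x_power: "x [^]\<^bsub>H\<^esub> CHAR('k) = x"
proof -
  note [simp del] = free_alg_simps
  have "proj (basis_vec [Skew] [^]\<^bsub>FA\<^esub> CHAR('k)) = proj (basis_vec [Skew])"
    by (rule proj_relation) (use ka_pow[OF FA_kalgebra letter_closed(1)] in \<open>auto simp: a3_relations_def Let_def\<close>)
  then show ?thesis unfolding proj_letter by (simp add: khom_power[OF FA_kalgebra khom_proj])
qed

lemma ffact_x: "ffact H x CHAR('k) = \<zero>\<^sub>H"
  using power_CHAR_iff[OF H_kalgebra x_closed char_pos] x_power by simp

text \<open>
  The relations are required in the form in which \<open>x\<close> is moved to the right of group elements.
\<close>

lemma universal:
  fixes B :: "('k, 'b, 'n) module_scheme" and \<psi> :: "'g letter \<Rightarrow> 'b"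
  assumes B: "kalgebra B" and cl: "\<And>t. t \<in> carrier G \<Longrightarrow> \<psi> (Grp t) \<in> carrier B" "\<psi> Skew \<in> carrier B"
    and mult: "\<And>s t. s \<in> carrier G \<Longrightarrow> t \<in> carrier G \<Longrightarrow> \<psi> (Grp s) \<otimes>\<^bsub>B\<^esub> \<psi> (Grp t) = \<psi> (Grp (s \<otimes> t))"
    and one: "\<psi> (Grp \<one>) = \<one>\<^bsub>B\<^esub>"
    and comm: "\<And>t. t \<in> carrier G \<Longrightarrow> \<psi> Skew \<otimes>\<^bsub>B\<^esub> \<psi> (Grp t) =
       \<psi> (Grp t) \<otimes>\<^bsub>B\<^esub> \<psi> Skew \<ominus>\<^bsub>B\<^esub> f t \<odot>\<^bsub>B\<^esub> (\<psi> (Grp t) \<ominus>\<^bsub>B\<^esub> \<psi> (Grp (t \<otimes> g)))"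
    and pow: "\<psi> Skew [^]\<^bsub>B\<^esub> CHAR('k) = \<psi> Skew"
  shows "khom H B (alg_eval B \<psi>)" "t \<in> carrier G \<Longrightarrow> alg_eval B \<psi> (e t) = \<psi> (Grp t)" "alg_eval B \<psi> x = \<psi> Skew"
proof -
  let ?U = "insert Skew (Grp ` carrier G)"
  let ?ev = "lin_ext B (\<lambda>w. foldr (\<lambda>a b. \<psi> a \<otimes>\<^bsub>B\<^esub> b) w \<one>\<^bsub>B\<^esub>)"
  have cl': "\<psi> a \<in> carrier B" if "a \<in> ?U" for a using that cl by auto
  have h: "khom FA B ?ev" by (rule khom_free_alg(1)[OF B cl'])
  have l: "?ev (basis_vec [a]) = \<psi> a" if "a \<in> ?U" for a
    by (rule khom_free_alg(2)[OF B cl' that])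
  have ev: "alg_eval B \<psi> = (\<lambda>C. ?ev (rep C))" by (simp add: alg_eval_def fun_eq_iff)
  have r: "?ev r = \<zero>\<^bsub>B\<^esub>" if "r \<in> a3_relations G g f" for r
  proof -
    note [simp del] = free_alg_simps
    let ?E = "\<lambda>t. basis_vec [Grp t] :: 'g letter list \<Rightarrow>\<^sub>0 'k" and ?X = "basis_vec [Skew] :: 'g letter list \<Rightarrow>\<^sub>0 'k"
    have v: "vspace FA" "vspace B" using B by simp_all
    note lin = khom_klinear[OF h]
    note s = klinear_minus[OF lin v] klinear_smult[OF lin] khom_mult[OF h] khom_one[OF h] khom_power[OF FA_kalgebra h B]
      ka_pow[OF FA_kalgebra] vs_minus_eq_zero[OF v(2)] l
    from that consider s t where "s \<in> carrier G" "t \<in> carrier G" "r = (?E t \<otimes>\<^bsub>FA\<^esub> ?E s) \<ominus>\<^bsub>FA\<^esub> ?E (t \<otimes> s)"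
      | "r = ?E \<one> \<ominus>\<^bsub>FA\<^esub> \<one>\<^bsub>FA\<^esub>"
      | t where "t \<in> carrier G" "r = ((?E t \<otimes>\<^bsub>FA\<^esub> ?X) \<ominus>\<^bsub>FA\<^esub> (?X \<otimes>\<^bsub>FA\<^esub> ?E t)) \<ominus>\<^bsub>FA\<^esub> (f t \<odot>\<^bsub>FA\<^esub> (?E t \<otimes>\<^bsub>FA\<^esub> (\<one>\<^bsub>FA\<^esub> \<ominus>\<^bsub>FA\<^esub> ?E g)))"
      | "r = (?X [^]\<^bsub>FA\<^esub> CHAR('k)) \<ominus>\<^bsub>FA\<^esub> ?X"
      by (auto simp: a3_relations_def Let_def)
    then show ?thesis
    proof cases
      case 1 then show ?thesis using B cl mult by (simp add: s)
    next
      case 2 then show ?thesis using B cl one by (simp add: s)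
    next
      case 3
      have "?ev r = (\<psi> (Grp t) \<otimes>\<^bsub>B\<^esub> \<psi> Skew \<ominus>\<^bsub>B\<^esub> \<psi> Skew \<otimes>\<^bsub>B\<^esub> \<psi> (Grp t)) \<ominus>\<^bsub>B\<^esub> f t \<odot>\<^bsub>B\<^esub> (\<psi> (Grp t) \<ominus>\<^bsub>B\<^esub> \<psi> (Grp (t \<otimes> g)))"
        unfolding 3(2) using 3(1) B cl by (simp add: s mult ka_distribs)
      also have "\<dots> = \<zero>\<^bsub>B\<^esub>" unfolding comm[OF 3(1)] using 3(1) B cl
        by (intro lincomb_eqI[where V = B]) (rule lincomb_intros | rule lincomb_atom | simp)+
      finally show ?thesis .
    next
      case 4 then show ?thesis using B cl pow by (simp add: s)
    qed
  qed
  have q: "?ev (rep (proj v)) = ?ev v" if "v \<in> carrier FA" for v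
    by (rule quotient_universal(1)[OF FA_kalgebra relations_closed B h _ that]) (rule r)
  show "khom H B (alg_eval B \<psi>)" unfolding khom_H_iff ev a3_alg_def
    by (rule quotient_universal(2)[OF FA_kalgebra relations_closed B h]) (rule r)
  show "alg_eval B \<psi> (e t) = \<psi> (Grp t)" if "t \<in> carrier G"
    unfolding ev proj_letter using q[OF letter_closed(2)[OF that]] l[of "Grp t"] that by simp
  show "alg_eval B \<psi> x = \<psi> Skew"
    unfolding ev proj_letter using q[OF letter_closed(1)] l[of Skew] by simp
qed

lemma generates_H: "generates H (insert x (e ` carrier G))"
proof -
  have "carrier H \<subseteq> proj ` carrier FA"
    unfolding H_sel a3_alg_def quotient_alg_simps(1)[OF FA_kalgebra relations_closed] by simp
  from generates_image[OF generates_free_alg khom_proj this] show ?thesis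
    by (simp add: image_image proj_letter)
qed

subsection \<open>Hopf algebra structure\<close>

abbreviation "HH \<equiv> tensor H H"

lemma H_tensor: "tensor A0 A0 = HH" "pure_tensor A0 A0 = pure_tensor H H"
  by (rule tensor_cong; simp add: H_sel)+

lemma comult_H: "comult H = alg_eval HH (\<lambda>a. case a of
            Grp t \<Rightarrow> pure_tensor H H (e t) (e t)
          | Skew \<Rightarrow> pure_tensor H H x \<one>\<^sub>H \<oplus>\<^bsub>HH\<^esub> pure_tensor H H (e g) x)"
  unfolding H_tensor[symmetric] H_sel e_def x_def
  by (simp add: H_def a3_hopf_def Let_def module.defs hopf.defs)

lemma counit_H: "counit H = alg_eval ground (\<lambda>a. case a of Grp t \<Rightarrow> 1 | Skew \<Rightarrow> 0)"
  by (simp add: H_def a3_hopf_def Let_def module.defs hopf.defs)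

lemma antipode_H: "antipode H = alg_eval (opposite A0) (\<lambda>a. case a of
            Grp t \<Rightarrow> e (inv t) | Skew \<Rightarrow> \<ominus>\<^bsub>A0\<^esub> (e (inv g) \<otimes>\<^bsub>A0\<^esub> x))"
  unfolding e_def x_def by (simp add: H_def a3_hopf_def Let_def module.defs hopf.defs)

lemmas pure_add_left = klinear_add[OF bilin_left[OF bilin_pure_tensor]]
lemmas pure_add_right = klinear_add[OF bilin_right[OF bilin_pure_tensor]]
lemmas pure_smult_left = klinear_smult[OF bilin_left[OF bilin_pure_tensor]]
lemmas pure_smult_right = klinear_smult[OF bilin_right[OF bilin_pure_tensor]]
lemmas pure_minus_left = klinear_minus[OF bilin_left[OF bilin_pure_tensor]]
lemmas pure_minus_right = klinear_minus[OF bilin_right[OF bilin_pure_tensor]]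
lemmas pure_linear = pure_add_left pure_add_right pure_smult_left pure_smult_right pure_minus_left pure_minus_right

lemma pure_zero [simp]:
  "vspace V \<Longrightarrow> vspace W \<Longrightarrow> b \<in> carrier W \<Longrightarrow> pure_tensor V W \<zero>\<^bsub>V\<^esub> b = \<zero>\<^bsub>tensor V W\<^esub>"
  "vspace V \<Longrightarrow> vspace W \<Longrightarrow> a \<in> carrier V \<Longrightarrow> pure_tensor V W a \<zero>\<^bsub>W\<^esub> = \<zero>\<^bsub>tensor V W\<^esub>"
  using klinear_zero[OF bilin_left[OF bilin_pure_tensor]] klinear_zero[OF bilin_right[OF bilin_pure_tensor]]
  by (metis vspace_tensor)+

lemma khom_tensor_left: "kalgebra V \<Longrightarrow> kalgebra W \<Longrightarrow> khom V (tensor V W) (\<lambda>a. pure_tensor V W a \<one>\<^bsub>W\<^esub>)"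
  by (rule khomI) (auto simp: tensor_simps(6) tensor_mult_pure intro: bilin_left[OF bilin_pure_tensor])

lemma khom_tensor_right: "kalgebra V \<Longrightarrow> kalgebra W \<Longrightarrow> khom W (tensor V W) (\<lambda>b. pure_tensor V W \<one>\<^bsub>V\<^esub> b)"
  by (rule khomI) (auto simp: tensor_simps(6) tensor_mult_pure intro: bilin_right[OF bilin_pure_tensor])

lemma skew_commute:
  assumes t: "t \<in> carrier G"
  shows "e t \<otimes>\<^sub>H x = x \<otimes>\<^sub>H e t \<oplus>\<^sub>H f t \<odot>\<^sub>H (e t \<ominus>\<^sub>H e (t \<otimes> g))"
  unfolding x_mult_e[OF t] using t
  by (intro lincomb_eqI[where V = H]) (rule lincomb_intros | rule lincomb_atom | simp)+

text \<open>
  For \<open>\<Delta>\<close> to be defined on \<open>H\<close>, the relations have to hold for the proposed images. For \<open>x\<^sup>p = x\<close> note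
  that \<open>x \<otimes> 1 + g \<otimes> x\<close> is \<open>x \<otimes> 1 + (g \<otimes> 1) (1 \<otimes> x)\<close>, a sum to which \<open>ffact_CHAR_add\<close> applies.
\<close>

lemma comult_khom: "khom H HH (comult H)"
  and comult_e: "t \<in> carrier G \<Longrightarrow> comult H (e t) = pure_tensor H H (e t) (e t)"
  and comult_x: "comult H x = pure_tensor H H x \<one>\<^sub>H \<oplus>\<^bsub>HH\<^esub> pure_tensor H H (e g) x"
proof -
  let ?\<psi> = "\<lambda>a. case a of Grp t \<Rightarrow> pure_tensor H H (e t) (e t)
          | Skew \<Rightarrow> pure_tensor H H x \<one>\<^sub>H \<oplus>\<^bsub>HH\<^esub> pure_tensor H H (e g) x"
  let ?X = "pure_tensor H H x \<one>\<^sub>H \<oplus>\<^bsub>HH\<^esub> pure_tensor H H (e g) x"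
  have T: "kalgebra HH" by simp
  have comm: "?X \<otimes>\<^bsub>HH\<^esub> pure_tensor H H (e t) (e t) = pure_tensor H H (e t) (e t) \<otimes>\<^bsub>HH\<^esub> ?X \<ominus>\<^bsub>HH\<^esub>
    f t \<odot>\<^bsub>HH\<^esub> (pure_tensor H H (e t) (e t) \<ominus>\<^bsub>HH\<^esub> pure_tensor H H (e (t \<otimes> g)) (e (t \<otimes> g)))"
    if t: "t \<in> carrier G" for t
  proof -
    have "?X \<otimes>\<^bsub>HH\<^esub> pure_tensor H H (e t) (e t) = pure_tensor H H (x \<otimes>\<^sub>H e t) (e t) \<oplus>\<^bsub>HH\<^esub> pure_tensor H H (e (t \<otimes> g)) (x \<otimes>\<^sub>H e t)"
      using t T by (simp add: ka_add_mult tensor_mult_pure e_mult g_central)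
    also have "\<dots> = pure_tensor H H (e t) (e t) \<otimes>\<^bsub>HH\<^esub> ?X \<ominus>\<^bsub>HH\<^esub>
    f t \<odot>\<^bsub>HH\<^esub> (pure_tensor H H (e t) (e t) \<ominus>\<^bsub>HH\<^esub> pure_tensor H H (e (t \<otimes> g)) (e (t \<otimes> g)))"
      using t T by (simp add: ka_mult_add tensor_mult_pure e_mult x_mult_e pure_linear)
        (rule lincomb_eqI[where V = HH], (rule lincomb_intros | rule lincomb_atom | simp)+, (simp add: algebra_simps)?)
    finally show ?thesis .
  qed
  have pow: "?X [^]\<^bsub>HH\<^esub> CHAR('k) = ?X"
  proof -
    let ?x = "pure_tensor H H x \<one>\<^sub>H" and ?g = "pure_tensor H H (e g) \<one>\<^sub>H" and ?y = "pure_tensor H H \<one>\<^sub>H x"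
    have e: "?X = ?x \<oplus>\<^bsub>HH\<^esub> ?g \<otimes>\<^bsub>HH\<^esub> ?y" by (simp add: tensor_mult_pure)
    have 1: "ffact HH ?x CHAR('k) = \<zero>\<^bsub>HH\<^esub>"
      using ffact_khom[OF H_kalgebra khom_tensor_left[OF H_kalgebra H_kalgebra] T x_closed, of "CHAR('k)"] by (simp add: ffact_x)
    have 2: "ffact HH ?y CHAR('k) = \<zero>\<^bsub>HH\<^esub>"
      using ffact_khom[OF H_kalgebra khom_tensor_right[OF H_kalgebra H_kalgebra] T x_closed, of "CHAR('k)"] by (simp add: ffact_x)
    have 3: "?g \<otimes>\<^bsub>HH\<^esub> ?x = ?x \<otimes>\<^bsub>HH\<^esub> ?g \<oplus>\<^bsub>HH\<^esub> ?g \<ominus>\<^bsub>HH\<^esub> ?g \<otimes>\<^bsub>HH\<^esub> ?g"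
      using T by (simp add: tensor_mult_pure skew_commute pure_linear e_mult)
        (rule lincomb_eqI[where V = HH], (rule lincomb_intros | rule lincomb_atom | simp)+)
    have "ffact HH ?X CHAR('k) = \<zero>\<^bsub>HH\<^esub>"
      unfolding e by (subst ffact_CHAR_add[OF T _ _ _ 3 _ _ char_pos])
        (use T in \<open>simp_all add: 1 2 tensor_mult_pure\<close>)
    then show ?thesis using power_CHAR_iff[OF T _ char_pos, of ?X] T by simp
  qed
  have rel: "khom H HH (alg_eval HH ?\<psi>)" "\<And>t. t \<in> carrier G \<Longrightarrow> alg_eval HH ?\<psi> (e t) = ?\<psi> (Grp t)" "alg_eval HH ?\<psi> x = ?\<psi> Skew"
    by (rule universal[OF T]; use T comm pow in \<open>simp add: tensor_mult_pure e_mult tensor_simps(6) e_one\<close>)+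
  show "khom H HH (comult H)" "t \<in> carrier G \<Longrightarrow> comult H (e t) = pure_tensor H H (e t) (e t)"
    "comult H x = ?X" using rel unfolding comult_H by simp_all
qed

lemma counit_khom: "khom H ground (counit H)"
  and counit_e: "t \<in> carrier G \<Longrightarrow> counit H (e t) = 1"
  and counit_x: "counit H x = 0"
proof -
  let ?\<psi> = "\<lambda>a. case a of Grp (t::'g) \<Rightarrow> 1 | Skew \<Rightarrow> (0::'k)"
  have shift: "a \<ominus>\<^bsub>ground\<^esub> b = a - b" for a b :: 'k by (subst vs_minus_smult) auto
  have p0: "(0::'k) [^]\<^bsub>ground\<^esub> CHAR('k) = 0"
  proof -
    have "(a::'k) [^]\<^bsub>ground\<^esub> (n::nat) = a ^ n" for a n by (induction n) (simp_all add: mult.commute)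
    then show ?thesis using char_pos by simp
  qed
  have rel: "khom H ground (alg_eval ground ?\<psi>)" "\<And>t. t \<in> carrier G \<Longrightarrow> alg_eval ground ?\<psi> (e t) = ?\<psi> (Grp t)" "alg_eval ground ?\<psi> x = ?\<psi> Skew"
    by (rule universal[OF kalgebra_ground]; simp add: shift p0)+
  show "khom H ground (counit H)" "t \<in> carrier G \<Longrightarrow> counit H (e t) = 1"
    "counit H x = 0" using rel unfolding counit_H by simp_all
qed

text \<open>
  Put \<open>s = 1 - g\<^bsup>-1\<^esup>\<close>. Then \<open>S(x) = -g\<^bsup>-1\<^esup> x = (1 - s) (-x)\<close>, and \<open>-x\<close> is shifted by \<open>s\<close>, so \<open>ffact_shift\<close> shows
  that \<open>S(x)\<close> satisfies \<open>y\<^sup>p = y\<close>. The remaining relations are checked in the opposite algebra.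
\<close>

lemma antipode_e: "t \<in> carrier G \<Longrightarrow> antipode H (e t) = e (inv t)"
  and antipode_x: "antipode H x = \<ominus>\<^sub>H (e (inv g) \<otimes>\<^sub>H x)"
  and antipode_klinear: "klinear H H (antipode H)"
  and antipode_one: "antipode H \<one>\<^sub>H = \<one>\<^sub>H"
  and antipode_mult: "u \<in> carrier H \<Longrightarrow> v \<in> carrier H \<Longrightarrow> antipode H (u \<otimes>\<^sub>H v) = antipode H v \<otimes>\<^sub>H antipode H u"
proof -
  let ?O = "opposite A0"
  have um: "\<ominus>\<^bsub>A0\<^esub> a = \<ominus>\<^sub>H a" "\<ominus>\<^bsub>?O\<^esub> a = \<ominus>\<^sub>H a" if "a \<in> carrier H" for a
    using that A0_kalgebra kalgebra_opposite[OF A0_kalgebra] by (simp_all add: vs_uminus_smult H_sel)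
  have mi: "a \<ominus>\<^bsub>?O\<^esub> b = a \<ominus>\<^sub>H b" if "a \<in> carrier H" "b \<in> carrier H" for a b
    using that by (simp add: a_minus_def um) (simp add: H_sel)
  let ?y = "\<ominus>\<^sub>H (e (inv g) \<otimes>\<^sub>H x)"
  let ?\<psi> = "\<lambda>a. case a of Grp t \<Rightarrow> e (inv t) | Skew \<Rightarrow> \<ominus>\<^bsub>A0\<^esub> (e (inv g) \<otimes>\<^bsub>A0\<^esub> x)"
  have sk: "?\<psi> Skew = ?y" by (simp add: um(1)[symmetric]) (simp add: H_sel)
  have y: "?y \<in> carrier H" by simp
  have gt: "inv g \<otimes> t = t \<otimes> inv g" if "t \<in> carrier G" for t
    using that g_central[OF that] by (metis g_closed inv_closed inv_solve_left inv_solve_right m_assoc m_closed)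
  have comm: "?y \<otimes>\<^bsub>?O\<^esub> e (inv t) = e (inv t) \<otimes>\<^bsub>?O\<^esub> ?y \<ominus>\<^bsub>?O\<^esub>
     f t \<odot>\<^bsub>?O\<^esub> (e (inv t) \<ominus>\<^bsub>?O\<^esub> e (inv (t \<otimes> g)))"
    if t: "t \<in> carrier G" for t
  proof -
    let ?s = "inv t" and ?h = "inv g"
    have i: "inv (t \<otimes> g) = ?h \<otimes> ?s" using t by (simp add: inv_mult_group)
    have sg: "?h \<otimes> (?s \<otimes> g) = ?s" using t g_central[of ?s] by (metis g_closed inv_closed inv_solve_left m_closed)
    have sh: "?s \<otimes> ?h = ?h \<otimes> ?s" using gt[of ?s] t by simp
    have "e ?s \<otimes>\<^sub>H ?y = ?y \<otimes>\<^sub>H e ?s \<ominus>\<^sub>H f t \<odot>\<^sub>H (e ?s \<ominus>\<^sub>H e (?h \<otimes> ?s))"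
    proof -
      have 1: "e ?s \<otimes>\<^sub>H ?y = \<ominus>\<^sub>H (e (?h \<otimes> ?s) \<otimes>\<^sub>H x)"
        using t by (simp add: ka_mult_uminus ka_assoc[symmetric] e_mult sh)
      have "?y \<otimes>\<^sub>H e ?s = \<ominus>\<^sub>H (e ?h \<otimes>\<^sub>H (x \<otimes>\<^sub>H e ?s))"
        using t by (simp add: ka_uminus_mult ka_assoc)
      also have "e ?h \<otimes>\<^sub>H (x \<otimes>\<^sub>H e ?s) = e (?h \<otimes> ?s) \<otimes>\<^sub>H x \<ominus>\<^sub>H (- f t) \<odot>\<^sub>H (e (?h \<otimes> ?s) \<ominus>\<^sub>H e ?s)"
        using t by (simp add: x_mult_e ka_mult_minus ka_mult_smult ka_assoc[symmetric] e_mult sg)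
      finally show ?thesis unfolding 1 using t
        by (simp del: ka_mult) (rule lincomb_eqI[where V = H], (rule lincomb_intros | rule lincomb_atom | simp)+, (simp add: algebra_simps)?)
    qed
    moreover have "\<And>a b. a \<otimes>\<^bsub>?O\<^esub> b = b \<otimes>\<^sub>H a" "\<And>c a. c \<odot>\<^bsub>?O\<^esub> a = c \<odot>\<^sub>H a" by (simp_all add: H_sel)
    ultimately show ?thesis using t y by (simp only:) (simp add: mi i)
  qed
  have pow: "?y [^]\<^bsub>?O\<^esub> CHAR('k) = ?y"
  proof -
    let ?s = "\<one>\<^sub>H \<ominus>\<^sub>H e (inv g)"
    have 1: "\<one>\<^sub>H \<ominus>\<^sub>H ?s = e (inv g)"
      by (rule lincomb_eqI[where V = H], (rule lincomb_intros | rule lincomb_atom | simp add: algebra_simps)+)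
    have e: "?y = (\<one>\<^sub>H \<ominus>\<^sub>H ?s) \<otimes>\<^sub>H (\<ominus>\<^sub>H x)" unfolding 1 by (simp add: ka_mult_uminus)
    have sh: "(\<ominus>\<^sub>H x) \<otimes>\<^sub>H ?s = ?s \<otimes>\<^sub>H (\<ominus>\<^sub>H x) \<ominus>\<^sub>H ?s"
      by (simp add: ka_distribs x_mult_e e_one)
        (rule lincomb_eqI[where V = H], (rule lincomb_intros | rule lincomb_atom | simp)+, (simp add: algebra_simps)?)
    have "ffact H (\<ominus>\<^sub>H x) CHAR('k) = \<zero>\<^sub>H"
      using power_CHAR_uminus[OF H_kalgebra char_pos x_closed] power_CHAR_iff[OF H_kalgebra _ char_pos, of "\<ominus>\<^sub>H x"]
      by (simp add: x_power)
    then have "ffact H ?y CHAR('k) = \<zero>\<^sub>H" unfolding e by (subst ffact_shift[OF H_kalgebra _ _ sh]) simp_all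
    then have "?y [^]\<^bsub>H\<^esub> CHAR('k) = ?y" using power_CHAR_iff[OF H_kalgebra y char_pos] by simp
    moreover have "?y [^]\<^bsub>?O\<^esub> n = ?y [^]\<^bsub>H\<^esub> n" for n :: nat
    proof -
      have "?y [^]\<^bsub>?O\<^esub> n = ?y [^]\<^bsub>A0\<^esub> n"
        by (rule opposite_power[OF A0_kalgebra]) (use y in \<open>simp add: H_sel\<close>)
      also have "\<dots> = ?y [^]\<^bsub>H\<^esub> n" by (simp add: nat_pow_def H_sel)
      finally show ?thesis .
    qed
    ultimately show ?thesis by simp
  qed
  have mult: "e (inv s) \<otimes>\<^bsub>?O\<^esub> e (inv t) = e (inv (s \<otimes> t))" if "s \<in> carrier G" "t \<in> carrier G" for s t
    using e_mult[of "inv t" "inv s"] that by (simp add: inv_mult_group H_sel)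
  have cl: "t \<in> carrier G \<Longrightarrow> ?\<psi> (Grp t) \<in> carrier ?O" "?\<psi> Skew \<in> carrier ?O"
    "s \<in> carrier G \<Longrightarrow> t \<in> carrier G \<Longrightarrow> ?\<psi> (Grp s) \<otimes>\<^bsub>?O\<^esub> ?\<psi> (Grp t) = ?\<psi> (Grp (s \<otimes> t))"
    "?\<psi> (Grp \<one>) = \<one>\<^bsub>?O\<^esub>"
    "t \<in> carrier G \<Longrightarrow> ?\<psi> Skew \<otimes>\<^bsub>?O\<^esub> ?\<psi> (Grp t) =
       ?\<psi> (Grp t) \<otimes>\<^bsub>?O\<^esub> ?\<psi> Skew \<ominus>\<^bsub>?O\<^esub> f t \<odot>\<^bsub>?O\<^esub> (?\<psi> (Grp t) \<ominus>\<^bsub>?O\<^esub> ?\<psi> (Grp (t \<otimes> g)))"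
    "?\<psi> Skew [^]\<^bsub>?O\<^esub> CHAR('k) = ?\<psi> Skew" for s t
    unfolding sk using mult e_closed[of "inv t"] y comm[of t] pow e_one by (simp_all add: H_sel)
  note O = kalgebra_opposite[OF A0_kalgebra]
  have u1: "khom H ?O (antipode H)" unfolding antipode_H by (rule universal(1)[OF O]) (fact cl)+
  show "antipode H (e t) = e (inv t)" if "t \<in> carrier G"
  proof -
    have "alg_eval ?O ?\<psi> (e t) = ?\<psi> (Grp t)" by (rule universal(2)[OF O _ _ _ _ _ _ that]) (fact cl)+
    then show ?thesis by (simp add: antipode_H)
  qed
  have "alg_eval ?O ?\<psi> x = ?\<psi> Skew" by (rule universal(3)[OF O]) (fact cl)+
  then show "antipode H x = ?y" unfolding antipode_H[symmetric] using sk by simp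
  note k = khom_opposite[OF u1]
  show "klinear H H (antipode H)" using k(1) by (simp add: klinear_def H_sel)
  show "antipode H \<one>\<^sub>H = \<one>\<^sub>H" using k(2) by (simp add: H_sel)
  show "antipode H (u \<otimes>\<^sub>H v) = antipode H v \<otimes>\<^sub>H antipode H u" if "u \<in> carrier H" "v \<in> carrier H"
    using k(3)[OF that] by (simp add: H_sel)
qed

lemma sweedler_e:
  "vspace P \<Longrightarrow> bilin H H P \<beta> \<Longrightarrow> t \<in> carrier G \<Longrightarrow> sweedler P (comult H (e t)) \<beta> = \<beta> (e t) (e t)"
  by (simp add: comult_e sweedler_pure[of H H P])

lemma sweedler_x:
  "vspace P \<Longrightarrow> bilin H H P \<beta> \<Longrightarrow> sweedler P (comult H x) \<beta> = \<beta> x \<one>\<^sub>H \<oplus>\<^bsub>P\<^esub> \<beta> (e g) x"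
  by (simp add: comult_x klinear_add[OF klinear_sweedler[of H H P]] sweedler_pure[of H H P])

theorem hopf_algebra_H: "hopf_algebra H"
proof -
  note D = comult_khom and E = counit_khom
  have v: "vspace H" "vspace HH" "vspace (tensor H HH)" by simp_all
  note lD = khom_klinear[OF D] and lE = khom_klinear[OF E]
  let ?TT = "tensor H HH"
  note b1 = bilin_coassoc(1)[OF v(1) lD] and b2 = bilin_coassoc(2)[OF v(1)] and b3 = bilin_coassoc(3)[OF v(1) lD]
  have b4: "bilin H H H (\<lambda>c1 c2. counit H c1 \<odot>\<^sub>H c2)" by (rule bilin_comp[OF bilin_smult lE klinear_id]) simp
  have b6: "bilin H H H (\<lambda>u1 u2. antipode H u1 \<otimes>\<^sub>H u2)" "bilin H H H (\<lambda>u1 u2. u1 \<otimes>\<^sub>H antipode H u2)"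
    by (rule bilin_comp[OF bilin_mult antipode_klinear klinear_id] bilin_comp[OF bilin_mult klinear_id antipode_klinear]; simp)+
  note sw = sweedler_e[OF v(3) b1] sweedler_e[OF v(3) b2] sweedler_e[OF v(3) b3] sweedler_e[OF v(1) b4]
    sweedler_e[OF v(1) bilin_flip[OF b4]] sweedler_e[OF v(1) b6(1)] sweedler_e[OF v(1) b6(2)]
    sweedler_x[OF v(3) b1] sweedler_x[OF v(3) b2] sweedler_x[OF v(3) b3] sweedler_x[OF v(1) b4]
    sweedler_x[OF v(1) bilin_flip[OF b4]] sweedler_x[OF v(1) b6(1)] sweedler_x[OF v(1) b6(2)]
  have one: "comult H \<one>\<^sub>H = pure_tensor H H \<one>\<^sub>H \<one>\<^sub>H" "counit H \<one>\<^sub>H = 1"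
    using khom_one[OF D] khom_one[OF E] by (simp_all add: tensor_simps(6))
  show ?thesis
  proof (rule hopf_algebra_generators[OF H_kalgebra D E antipode_klinear antipode_one antipode_mult generates_H])
    fix c assume "c \<in> insert x (e ` carrier G)"
    then consider t where "t \<in> carrier G" "c = e t" | "c = x" by auto
    then have "sweedler ?TT (comult H c) (\<lambda>c1 c2. pure_tensor H HH c1 (comult H c2)) =
        sweedler ?TT (comult H c) (\<lambda>c1 c2.
          sweedler ?TT (comult H c1) (\<lambda>c11 c12. pure_tensor H HH c11 (pure_tensor H H c12 c2))) \<and>
      sweedler H (comult H c) (\<lambda>c1 c2. counit H c1 \<odot>\<^sub>H c2) = c \<and>
      sweedler H (comult H c) (\<lambda>c1 c2. counit H c2 \<odot>\<^sub>H c1) = c \<and>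
      sweedler H (comult H c) (\<lambda>u1 u2. antipode H u1 \<otimes>\<^sub>H u2) = counit H c \<odot>\<^sub>H \<one>\<^sub>H \<and>
      sweedler H (comult H c) (\<lambda>u1 u2. u1 \<otimes>\<^sub>H antipode H u2) = counit H c \<odot>\<^sub>H \<one>\<^sub>H"
    proof cases
      case 1
      then show ?thesis by (simp add: sw counit_e antipode_e e_inv) (simp add: comult_e)
    next
      case 2
      have a: "\<ominus>\<^sub>H (e (inv g) \<otimes>\<^sub>H x) \<oplus>\<^sub>H e (inv g) \<otimes>\<^sub>H x = \<zero>\<^sub>H"
        by (rule lincomb_eqI[where V = H], (rule lincomb_intros | rule lincomb_atom | simp)+)
      have b: "x \<oplus>\<^sub>H e g \<otimes>\<^sub>H \<ominus>\<^sub>H (e (inv g) \<otimes>\<^sub>H x) = \<zero>\<^sub>H"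
        by (simp add: ka_mult_uminus ka_assoc[symmetric] e_inv)
          (rule lincomb_eqI[where V = H], (rule lincomb_intros | rule lincomb_atom | simp)+)
      show ?thesis unfolding 2
        by (simp add: sw antipode_one one(2) counit_e counit_x antipode_e antipode_x a b)
          (simp add: sw one comult_e comult_x pure_linear vs_assoc sweedler_pure[OF v(1) v(1) v(3) b2])
    qed
    then show "sweedler ?TT (comult H c) (\<lambda>c1 c2. pure_tensor H HH c1 (comult H c2)) =
        sweedler ?TT (comult H c) (\<lambda>c1 c2.
          sweedler ?TT (comult H c1) (\<lambda>c11 c12. pure_tensor H HH c11 (pure_tensor H H c12 c2)))"
      "sweedler H (comult H c) (\<lambda>c1 c2. counit H c1 \<odot>\<^sub>H c2) = c"
      "sweedler H (comult H c) (\<lambda>c1 c2. counit H c2 \<odot>\<^sub>H c1) = c"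
      "sweedler H (comult H c) (\<lambda>u1 u2. antipode H u1 \<otimes>\<^sub>H u2) = counit H c \<odot>\<^sub>H \<one>\<^sub>H"
      "sweedler H (comult H c) (\<lambda>u1 u2. u1 \<otimes>\<^sub>H antipode H u2) = counit H c \<odot>\<^sub>H \<one>\<^sub>H"
      by blast+
  qed
qed

end

section \<open>A basis of the third-type Hopf algebra\<close>

text \<open>
  The algebra of linear endomorphisms of the space of functions on a set \<open>S\<close>, which are extended
  by zero outside \<open>S\<close>.
\<close>

definition fun_end :: "'x set \<Rightarrow> ('k::field, ('x \<Rightarrow> 'k) \<Rightarrow> ('x \<Rightarrow> 'k)) module" where
  "fun_end S = \<lparr>carrier = {T. (\<forall>v w. T (\<lambda>t. v t + w t) = (\<lambda>t. T v t + T w t)) \<and> (\<forall>c v. T (\<lambda>t. c * v t) = (\<lambda>t. c * T v t)) \<and>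
       (\<forall>v t. t \<notin> S \<longrightarrow> T v t = 0) \<and> (\<forall>v. T (\<lambda>t. if t \<in> S then v t else 0) = T v)},
     monoid.mult = (\<lambda>S T v. S (T v)), one = (\<lambda>v t. if t \<in> S then v t else 0), ring.zero = (\<lambda>v t. 0),
     add = (\<lambda>S T v t. S v t + T v t), module.smult = (\<lambda>c T v t. c * T v t)\<rparr>"

lemma fun_end_simps [simp]:
  "carrier (fun_end S) = {T. (\<forall>v w. T (\<lambda>t. v t + w t) = (\<lambda>t. T v t + T w t)) \<and> (\<forall>c v. T (\<lambda>t. c * v t) = (\<lambda>t. c * T v t)) \<and>
       (\<forall>v t. t \<notin> S \<longrightarrow> T v t = 0) \<and> (\<forall>v. T (\<lambda>t. if t \<in> S then v t else 0) = T v)}"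
  "T \<otimes>\<^bsub>fun_end S\<^esub> T' = (\<lambda>v. T (T' v))" "\<one>\<^bsub>fun_end S\<^esub> = (\<lambda>v t. if t \<in> S then v t else 0)" "\<zero>\<^bsub>fun_end S\<^esub> = (\<lambda>v t. 0)"
  "T \<oplus>\<^bsub>fun_end S\<^esub> T' = (\<lambda>v t. T v t + T' v t)" "c \<odot>\<^bsub>fun_end S\<^esub> T = (\<lambda>v t. c * T v t)"
  by (simp_all add: fun_end_def)

lemma kalgebra_fun_end: "kalgebra (fun_end S)"
proof (rule kalgebraI, rule vspaceI, rule abelian_groupI)
  fix T :: "('a \<Rightarrow> 'b) \<Rightarrow> 'a \<Rightarrow> 'b" assume "T \<in> carrier (fun_end S)"
  then show "\<exists>T'\<in>carrier (fun_end S). T' \<oplus>\<^bsub>fun_end S\<^esub> T = \<zero>\<^bsub>fun_end S\<^esub>"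
    by (intro bexI[of _ "\<lambda>v t. - T v t"]) (auto simp: fun_eq_iff)
next
  fix T T' :: "('a \<Rightarrow> 'b) \<Rightarrow> 'a \<Rightarrow> 'b" assume "T \<in> carrier (fun_end S)" "T' \<in> carrier (fun_end S)"
  then show "T \<otimes>\<^bsub>fun_end S\<^esub> T' \<in> carrier (fun_end S)" by auto
next
  fix T :: "('a \<Rightarrow> 'b) \<Rightarrow> 'a \<Rightarrow> 'b" assume "T \<in> carrier (fun_end S)"
  then show "\<one>\<^bsub>fun_end S\<^esub> \<otimes>\<^bsub>fun_end S\<^esub> T = T" "T \<otimes>\<^bsub>fun_end S\<^esub> \<one>\<^bsub>fun_end S\<^esub> = T" by (auto simp: fun_eq_iff)
qed (auto simp: fun_eq_iff algebra_simps)

lemma fun_end_minus: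
  "T \<in> carrier (fun_end S) \<Longrightarrow> T' \<in> carrier (fun_end S) \<Longrightarrow> T \<ominus>\<^bsub>fun_end S\<^esub> T' = (\<lambda>v t. T v t - T' v t)"
  by (subst vs_minus_smult) (auto simp: kalgebra_fun_end)

context third_type
begin

text \<open>
  The basis \<open>t x\<^bsup>(n)\<^esup>\<close>, where \<open>t \<in> G\<close> and \<open>n < p\<close>. For \<open>n \<ge> p\<close> the element is \<open>0\<close>.
\<close>

definition bas :: "'g \<Rightarrow> nat \<Rightarrow> ('g letter list \<Rightarrow>\<^sub>0 'k) set" where
  "bas t n = e t \<otimes>\<^sub>H ffact H x n"

lemma bas_closed [simp]: "t \<in> carrier G \<Longrightarrow> bas t n \<in> carrier H"
  by (simp add: bas_def)

lemma bas_0 [simp]: "t \<in> carrier G \<Longrightarrow> bas t 0 = e t"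
  by (simp add: bas_def)

lemma bas_one_1: "bas \<one> (Suc 0) = x"
  by (simp add: bas_def e_one a_minus_def vs_uminus_smult)

lemma bas_mult_x: "t \<in> carrier G \<Longrightarrow> bas t n \<otimes>\<^sub>H x = bas t (Suc n) \<oplus>\<^sub>H of_nat n \<odot>\<^sub>H bas t n"
  by (simp add: bas_def ka_assoc ffact_mult ka_mult_add ka_mult_smult del: ffact.simps)

lemma bas_Suc: "t \<in> carrier G \<Longrightarrow> bas t (Suc n) = bas t n \<otimes>\<^sub>H (x \<ominus>\<^sub>H of_nat n \<odot>\<^sub>H \<one>\<^sub>H)"
  by (simp add: bas_def ka_assoc)

lemma bas_ge: "t \<in> carrier G \<Longrightarrow> CHAR('k) \<le> n \<Longrightarrow> bas t n = \<zero>\<^sub>H"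
proof -
  assume t: "t \<in> carrier G" and "CHAR('k) \<le> n"
  from this(2) have "ffact H x n = \<zero>\<^sub>H"
    by (induction n rule: dec_induct) (simp_all add: ffact_x)
  then show ?thesis using t by (simp add: bas_def)
qed

lemma e_mult_bas: "s \<in> carrier G \<Longrightarrow> t \<in> carrier G \<Longrightarrow> e s \<otimes>\<^sub>H bas t n = bas (s \<otimes> t) n"
  by (simp add: bas_def ka_assoc[symmetric] e_mult)

lemma x_mult_bas:
  assumes t: "t \<in> carrier G"
  shows "x \<otimes>\<^sub>H bas t n = bas t (Suc n) \<oplus>\<^sub>H of_nat n \<odot>\<^sub>H bas t n \<ominus>\<^sub>H f t \<odot>\<^sub>H (bas t n \<ominus>\<^sub>H bas (t \<otimes> g) n)"
proof -
  have c: "x \<otimes>\<^sub>H ffact H x n = ffact H x n \<otimes>\<^sub>H x" by (rule ffact_commute) simp_all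
  have "x \<otimes>\<^sub>H bas t n = (x \<otimes>\<^sub>H e t) \<otimes>\<^sub>H ffact H x n" using t by (simp add: bas_def ka_assoc)
  also have "\<dots> = e t \<otimes>\<^sub>H (x \<otimes>\<^sub>H ffact H x n) \<ominus>\<^sub>H f t \<odot>\<^sub>H (bas t n \<ominus>\<^sub>H bas (t \<otimes> g) n)"
    unfolding x_mult_e[OF t] using t by (simp add: bas_def ka_minus_mult ka_smult_mult ka_assoc)
  also have "e t \<otimes>\<^sub>H (x \<otimes>\<^sub>H ffact H x n) = bas t n \<otimes>\<^sub>H x"
    unfolding c using t by (simp add: bas_def ka_assoc)
  finally show ?thesis unfolding bas_mult_x[OF t] .
qed

text \<open>
  The span is stable under left multiplication by the generators and contains \<open>1\<close>, so it is all
  of \<open>H\<close>.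
\<close>

inductive_set bas_span where
  bas: "t \<in> carrier G \<Longrightarrow> bas t n \<in> bas_span"
| add: "u \<in> bas_span \<Longrightarrow> v \<in> bas_span \<Longrightarrow> u \<oplus>\<^sub>H v \<in> bas_span"
| smult: "u \<in> bas_span \<Longrightarrow> c \<odot>\<^sub>H u \<in> bas_span"

lemma bas_span_closed: "u \<in> bas_span \<Longrightarrow> u \<in> carrier H"
  by (induction rule: bas_span.induct) auto

lemma bas_span_minus: "u \<in> bas_span \<Longrightarrow> v \<in> bas_span \<Longrightarrow> u \<ominus>\<^sub>H v \<in> bas_span"
  by (simp add: vs_minus_smult bas_span_closed bas_span.add bas_span.smult)

lemma bas_span_UNIV: "u \<in> carrier H \<Longrightarrow> u \<in> bas_span"
proof (induction rule: generates_induct[OF generates_H, consumes 1, case_names one mult add smult])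
  case one
  show ?case using bas_span.bas[of "\<one>" 0] by (simp add: e_one)
next
  case (mult u w)
  have 1: "e s \<otimes>\<^sub>H w \<in> bas_span" if s: "s \<in> carrier G" for s
    using mult(4)
  proof (induction rule: bas_span.induct)
    case (bas t n)
    then show ?case using s by (auto simp: e_mult_bas intro: bas_span.intros)
  next
    case (add u v)
    then show ?case using s by (simp add: ka_mult_add bas_span_closed bas_span.add)
  next
    case (smult u c)
    then show ?case using s by (simp add: ka_mult_smult bas_span_closed bas_span.smult)
  qed
  have 2: "x \<otimes>\<^sub>H w \<in> bas_span"
    using mult(4)
  proof (induction rule: bas_span.induct)
    case (bas t n)
    then show ?case by (auto simp: x_mult_bas intro!: bas_span.intros bas_span_minus)
  next
    case (add u v)
    then show ?case by (simp add: ka_mult_add bas_span_closed bas_span.add)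
  next
    case (smult u c)
    then show ?case by (simp add: ka_mult_smult bas_span_closed bas_span.smult)
  qed
  show ?case using mult(1) 1 2 by auto
qed (auto intro: bas_span.intros)

lemma H_induct [consumes 1, case_names bas add smult]:
  assumes u: "u \<in> carrier H" and bas: "\<And>t n. t \<in> carrier G \<Longrightarrow> n < CHAR('k) \<Longrightarrow> Q (bas t n)"
    and add: "\<And>u v. u \<in> carrier H \<Longrightarrow> v \<in> carrier H \<Longrightarrow> Q u \<Longrightarrow> Q v \<Longrightarrow> Q (u \<oplus>\<^sub>H v)"
    and smult: "\<And>c u. u \<in> carrier H \<Longrightarrow> Q u \<Longrightarrow> Q (c \<odot>\<^sub>H u)"
  shows "Q u"
  using bas_span_UNIV[OF u]
proof (induction rule: bas_span.induct)
  case (bas t n)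
  have "Q (0 \<odot>\<^sub>H bas t 0)" by (rule smult[OF bas_closed assms(2)[OF _ char_pos]]) (use bas in auto)
  then have "Q \<zero>\<^sub>H" using bas by simp
  then show ?case using bas assms(2) bas_ge[of t n] by (cases "n < CHAR('k)") auto
qed (auto intro: add smult bas_span_closed)

lemma H_ext:
  assumes "klinear H W \<phi>" "klinear H W \<psi>" "\<And>t n. t \<in> carrier G \<Longrightarrow> n < CHAR('k) \<Longrightarrow> \<phi> (bas t n) = \<psi> (bas t n)"
    and "u \<in> carrier H"
  shows "\<phi> u = \<psi> u"
  using assms(4)
  by (induction rule: H_induct)
    (use assms(3) in \<open>auto simp: klinear_add[OF assms(1)] klinear_add[OF assms(2)] klinear_smult[OF assms(1)] klinear_smult[OF assms(2)]\<close>)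

subsection \<open>Linear independence\<close>

text \<open>
  For every \<open>c\<close> in the prime field, \<open>H\<close> acts on functions on \<open>G\<close>: the group by translations, and
  \<open>x\<close> by \<open>c + (E\<^sub>g - 1) D\<close>, where \<open>D\<close> multiplies a function by \<open>f\<close>.
\<close>

abbreviation "FE \<equiv> fun_end (carrier G) :: ('k, ('g \<Rightarrow> 'k) \<Rightarrow> 'g \<Rightarrow> 'k) module"

definition transl :: "'g \<Rightarrow> ('g \<Rightarrow> 'k) \<Rightarrow> ('g \<Rightarrow> 'k)" where
  "transl s v = (\<lambda>t. if t \<in> carrier G then v (inv s \<otimes> t) else 0)"

definition f0 :: "'g \<Rightarrow> 'k" where "f0 t = (if t \<in> carrier G then f t else 0)"

definition neg_mult_f :: "('g \<Rightarrow> 'k) \<Rightarrow> ('g \<Rightarrow> 'k)" where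
  "neg_mult_f v = (\<lambda>t. - f0 t * v t)"

definition x_act :: "nat \<Rightarrow> ('g \<Rightarrow> 'k) \<Rightarrow> ('g \<Rightarrow> 'k)" where
  "x_act c = (\<one>\<^bsub>FE\<^esub> \<ominus>\<^bsub>FE\<^esub> transl g) \<otimes>\<^bsub>FE\<^esub> neg_mult_f \<oplus>\<^bsub>FE\<^esub> of_nat c \<odot>\<^bsub>FE\<^esub> \<one>\<^bsub>FE\<^esub>"

definition act :: "nat \<Rightarrow> ('g letter list \<Rightarrow>\<^sub>0 'k) set \<Rightarrow> ('g \<Rightarrow> 'k) \<Rightarrow> ('g \<Rightarrow> 'k)" where
  "act c = alg_eval FE (\<lambda>a. case a of Grp t \<Rightarrow> transl t | Skew \<Rightarrow> x_act c)"

lemma transl_closed: "s \<in> carrier G \<Longrightarrow> transl s \<in> carrier FE"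
  by (auto simp: transl_def fun_eq_iff)
lemma neg_mult_f_closed: "neg_mult_f \<in> carrier FE" by (auto simp: neg_mult_f_def f0_def fun_eq_iff algebra_simps)
lemma x_act_closed: "x_act c \<in> carrier FE"
proof -
  have E: "kalgebra FE" by (rule kalgebra_fun_end)
  show ?thesis unfolding x_act_def
    using E transl_closed[OF g_closed] neg_mult_f_closed by (simp del: fun_end_simps)
qed

lemma x_act_eq: "x_act c v t = (if t \<in> carrier G then transl g (\<lambda>t. f0 t * v t) t - f0 t * v t + of_nat c * v t else 0)"
proof -
  have "\<one>\<^bsub>FE\<^esub> \<in> carrier FE" by (rule ka_one[OF kalgebra_fun_end])
  then show ?thesis unfolding x_act_def
    by (subst fun_end_minus[OF _ transl_closed[OF g_closed]])
      (auto simp: neg_mult_f_def transl_def f0_def simp del: fun_end_simps(1))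
qed

text \<open>
  With \<open>E\<^sub>g\<close> the translation by \<open>g\<close> and \<open>D\<close> the multiplication by \<open>f\<close>, the operator \<open>-D\<close> is shifted
  by \<open>E\<^sub>g\<close>. So the falling factorial of \<open>(1 - E\<^sub>g) (-D)\<close> with \<open>p\<close> factors is \<open>(1 - (E\<^sub>g)\<^sup>p) (D - D\<^sup>p)\<close>.
  Either \<open>g\<^sup>p = 1\<close> and the first factor vanishes, or \<open>f\<close> takes values in the prime field and the second
  one does.
\<close>

lemma ffact_x_act:
  assumes c: "c < CHAR('k)"
  shows "ffact FE (x_act c) (CHAR('k)) = \<zero>\<^bsub>FE\<^esub>"
proof -
  let ?E = "FE" and ?p = "CHAR('k)"
  have E: "kalgebra ?E" by (rule kalgebra_fun_end)
  let ?s = "transl g" and ?D = "neg_mult_f"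
  have cl: "?s \<in> carrier ?E" "?D \<in> carrier ?E" by (rule transl_closed neg_mult_f_closed; simp)+
  let ?Z = "(\<one>\<^bsub>?E\<^esub> \<ominus>\<^bsub>?E\<^esub> ?s) \<otimes>\<^bsub>?E\<^esub> ?D"
  have cZ: "?Z \<in> carrier ?E" using E cl by (simp del: fun_end_simps)
  have co: "of_nat c \<odot>\<^bsub>?E\<^esub> \<one>\<^bsub>?E\<^esub> \<in> carrier ?E" using E by (simp del: fun_end_simps)
  have "ffact ?E (?Z \<oplus>\<^bsub>?E\<^esub> of_nat c \<odot>\<^bsub>?E\<^esub> \<one>\<^bsub>?E\<^esub>) ?p = ffact ?E ?Z ?p \<oplus>\<^bsub>?E\<^esub> ffact ?E (of_nat c \<odot>\<^bsub>?E\<^esub> \<one>\<^bsub>?E\<^esub>) ?p"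
    by (rule ffact_CHAR_add_commuting[OF E char_pos cZ co]) (use E cZ in \<open>simp add: ka_distribs del: fun_end_simps\<close>)
  moreover have "ffact ?E (of_nat c \<odot>\<^bsub>?E\<^esub> \<one>\<^bsub>?E\<^esub>) ?p = \<zero>\<^bsub>?E\<^esub>"
  proof -
    have "(\<Prod>i<?p. (of_nat c :: 'k) - of_nat i) = 0" using c by (intro prod_zero) auto
    then show ?thesis unfolding ffact_scalar[OF E] using E by (simp del: fun_end_simps prod_zero_iff)
  qed
  moreover have "ffact ?E ?Z ?p = \<zero>\<^bsub>?E\<^esub>"
  proof -
    have Ds: "?D \<otimes>\<^bsub>?E\<^esub> ?s = ?s \<otimes>\<^bsub>?E\<^esub> ?D \<ominus>\<^bsub>?E\<^esub> ?s"
      using cl E by (subst fun_end_minus[OF ka_mult[OF E] _]) (auto simp: fun_eq_iff transl_def neg_mult_f_def f0_def algebra_simps simp del: fun_end_simps(1))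
    have "ffact ?E ?Z ?p = (\<one>\<^bsub>?E\<^esub> \<ominus>\<^bsub>?E\<^esub> ?s) [^]\<^bsub>?E\<^esub> ?p \<otimes>\<^bsub>?E\<^esub> ffact ?E ?D ?p"
      by (rule ffact_shift[OF E cl Ds])
    also have "(\<one>\<^bsub>?E\<^esub> \<ominus>\<^bsub>?E\<^esub> ?s) [^]\<^bsub>?E\<^esub> ?p = \<one>\<^bsub>?E\<^esub> \<ominus>\<^bsub>?E\<^esub> ?s [^]\<^bsub>?E\<^esub> ?p"
      by (rule power_CHAR_one_minus[OF E char_pos cl(1)])
    also have "(\<one>\<^bsub>?E\<^esub> \<ominus>\<^bsub>?E\<^esub> ?s [^]\<^bsub>?E\<^esub> ?p) \<otimes>\<^bsub>?E\<^esub> ffact ?E ?D ?p = \<zero>\<^bsub>?E\<^esub>"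
    proof (cases "g [^] ?p = \<one>")
      case True
      have "?s [^]\<^bsub>?E\<^esub> n = transl (g [^] n)" for n :: nat
      proof (induction n)
        case 0
        show ?case by (auto simp: transl_def fun_eq_iff)
      next
        case (Suc n)
        then show ?case by (auto simp: transl_def fun_eq_iff inv_mult_group m_assoc)
      qed
      then have "?s [^]\<^bsub>?E\<^esub> ?p = \<one>\<^bsub>?E\<^esub>" using True by (auto simp: transl_def fun_eq_iff)
      then have "\<one>\<^bsub>?E\<^esub> \<ominus>\<^bsub>?E\<^esub> ?s [^]\<^bsub>?E\<^esub> ?p = \<zero>\<^bsub>?E\<^esub>"
        using vs_minus_eq_zero[of ?E "\<one>\<^bsub>?E\<^esub>" "\<one>\<^bsub>?E\<^esub>"] E by (simp del: fun_end_simps)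
      then show ?thesis using E cl by (simp del: fun_end_simps)
    next
      case False
      have fp: "f t ^ ?p = f t" if "t \<in> carrier G" for t
        using f_k_set[OF that] False k_set_iff[OF group_axioms g_closed] by auto
      have pow: "(?D [^]\<^bsub>?E\<^esub> n) v t = (if t \<in> carrier G then (- f0 t) ^ n * v t else 0)" for n :: nat and v t
        by (induction n arbitrary: v) (auto simp: neg_mult_f_def)
      have "(-1 :: 'k) ^ ?p = - (1 ^ ?p)"
        using prime_CHAR_semidom[OF char_pos] by (intro minus_power_prime_CHAR) simp_all
      then have m: "(- a) ^ ?p = - (a ^ ?p)" for a :: 'k
        by (metis mult_minus1 power_mult_distrib power_one)
      have fn: "(- f0 t) ^ ?p = - f0 t" for t
        using fp[of t] char_pos unfolding m by (auto simp: f0_def)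
      then have "?D [^]\<^bsub>?E\<^esub> ?p = ?D" unfolding fun_eq_iff pow fn by (simp add: neg_mult_f_def f0_def)
      then have "ffact ?E ?D ?p = \<zero>\<^bsub>?E\<^esub>" using power_CHAR_iff[OF E cl(2) char_pos] by simp
      then show ?thesis using E cl by (simp del: fun_end_simps)
    qed
    finally show ?thesis .
  qed
  ultimately show ?thesis using E unfolding x_act_def by (simp del: fun_end_simps)
qed

lemma act:
  assumes c: "c < CHAR('k)"
  shows "khom H FE (act c)" "t \<in> carrier G \<Longrightarrow> act c (e t) = transl t" "act c x = x_act c"
proof -
  let ?\<psi> = "\<lambda>a. case a of Grp t \<Rightarrow> transl t | Skew \<Rightarrow> x_act c"
  have E: "kalgebra FE" by (rule kalgebra_fun_end)
  have pow: "x_act c [^]\<^bsub>FE\<^esub> CHAR('k) = x_act c"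
    using power_CHAR_iff[OF E x_act_closed char_pos] ffact_x_act[OF c] by simp
  have comm: "x_act c \<otimes>\<^bsub>FE\<^esub> transl t = transl t \<otimes>\<^bsub>FE\<^esub> x_act c \<ominus>\<^bsub>FE\<^esub>
      f t \<odot>\<^bsub>FE\<^esub> (transl t \<ominus>\<^bsub>FE\<^esub> transl (t \<otimes> g))" if t: "t \<in> carrier G" for t
  proof -
    have m: "transl t \<ominus>\<^bsub>FE\<^esub> transl (t \<otimes> g) = (\<lambda>v r. transl t v r - transl (t \<otimes> g) v r)"
      by (rule fun_end_minus) (use t in \<open>auto intro!: transl_closed simp del: fun_end_simps\<close>)
    have c2: "f t \<odot>\<^bsub>FE\<^esub> (transl t \<ominus>\<^bsub>FE\<^esub> transl (t \<otimes> g)) \<in> carrier FE"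
      using E transl_closed[of t] transl_closed[of "t \<otimes> g"] t by (simp del: fun_end_simps)
    have c1: "transl t \<otimes>\<^bsub>FE\<^esub> x_act c \<in> carrier FE"
      using E transl_closed[OF t] x_act_closed by (simp del: fun_end_simps)
    have gt: "inv g \<otimes> (inv t \<otimes> r) = inv t \<otimes> (inv g \<otimes> r)" if "r \<in> carrier G" for r
    proof -
      have "inv g \<otimes> inv t = inv t \<otimes> inv g"
        using g_central[OF t] t by (simp add: inv_mult_group[symmetric])
      then show ?thesis using t that by (simp add: m_assoc[symmetric])
    qed
    show ?thesis unfolding fun_end_minus[OF c1 c2] unfolding m
      using t gt by (auto simp: fun_eq_iff x_act_eq transl_def f0_def inv_mult_group m_assoc algebra_simps)
  qed
  have cl: "\<And>t. t \<in> carrier G \<Longrightarrow> ?\<psi> (Grp t) \<in> carrier FE" "?\<psi> Skew \<in> carrier FE"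
    "\<And>s t. s \<in> carrier G \<Longrightarrow> t \<in> carrier G \<Longrightarrow> ?\<psi> (Grp s) \<otimes>\<^bsub>FE\<^esub> ?\<psi> (Grp t) = ?\<psi> (Grp (s \<otimes> t))"
    "?\<psi> (Grp \<one>) = \<one>\<^bsub>FE\<^esub>"
    "\<And>t. t \<in> carrier G \<Longrightarrow> ?\<psi> Skew \<otimes>\<^bsub>FE\<^esub> ?\<psi> (Grp t) =
       ?\<psi> (Grp t) \<otimes>\<^bsub>FE\<^esub> ?\<psi> Skew \<ominus>\<^bsub>FE\<^esub> f t \<odot>\<^bsub>FE\<^esub> (?\<psi> (Grp t) \<ominus>\<^bsub>FE\<^esub> ?\<psi> (Grp (t \<otimes> g)))"
    "?\<psi> Skew [^]\<^bsub>FE\<^esub> CHAR('k) = ?\<psi> Skew"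
    using comm pow transl_closed x_act_closed
    by (simp_all del: fun_end_simps) (auto simp: transl_def fun_eq_iff inv_mult_group m_assoc)
  show "khom H FE (act c)" unfolding act_def by (rule universal(1)[OF E]) (fact cl)+
  show "act c (e t) = transl t" if "t \<in> carrier G"
  proof -
    have "alg_eval FE ?\<psi> (e t) = ?\<psi> (Grp t)" by (rule universal(2)[OF E _ _ _ _ _ _ that]) (fact cl)+
    then show ?thesis by (simp add: act_def)
  qed
  have "alg_eval FE ?\<psi> x = ?\<psi> Skew" by (rule universal(3)[OF E]) (fact cl)+
  then show "act c x = x_act c" by (simp add: act_def)
qed

text \<open>
  The value of the \<open>n\<close>-th falling factorial at the element \<open>c\<close> of the prime field. These values form
  a triangular matrix with nonzero diagonal.
\<close>

definition ff :: "nat \<Rightarrow> nat \<Rightarrow> 'k" where "ff c n = (\<Prod>i<n. of_nat c - of_nat i)"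

lemma ff_eq_0: "c < n \<Longrightarrow> ff c n = 0"
  unfolding ff_def by (rule prod_zero) auto

lemma ff_self: "n < CHAR('k) \<Longrightarrow> ff n n \<noteq> 0"
proof -
  assume n: "n < CHAR('k)"
  have "(of_nat n :: 'k) - of_nat i \<noteq> 0" if "i < n" for i
  proof -
    have "\<not> CHAR('k) dvd (n - i)" using that n by (auto dest: dvd_imp_le)
    then have "(of_nat (n - i) :: 'k) \<noteq> 0" by (simp add: of_nat_eq_0_iff_char_dvd)
    then show ?thesis using that by (simp add: of_nat_diff)
  qed
  then show ?thesis by (simp add: ff_def)
qed

definition point_val :: "nat \<Rightarrow> 'g \<Rightarrow> ('g letter list \<Rightarrow>\<^sub>0 'k) set \<Rightarrow> 'k" where
  "point_val c t u = act c u (\<lambda>s. if s = \<one> then 1 else 0) t"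

text \<open>
  Since \<open>f(1) = 0\<close>, \<open>D\<close> kills the delta function at \<open>1\<close>, on which therefore \<open>x\<close> acts as the scalar \<open>c\<close>.
  Evaluating the result at \<open>t\<close> separates the group elements.
\<close>

lemma point_val:
  assumes c: "c < CHAR('k)" and t: "t \<in> carrier G"
  shows "klinear H ground (point_val c t)"
    "s \<in> carrier G \<Longrightarrow> point_val c t (bas s n) = (if s = t then ff c n else 0)"
proof -
  note h = act(1)[OF c]
  note l = khom_klinear[OF h]
  have E: "kalgebra FE" by (rule kalgebra_fun_end)
  show "klinear H ground (point_val c t)"
    by (rule klinearI) (simp_all add: point_val_def klinear_add[OF l] klinear_smult[OF l])
  let ?d = "\<lambda>s. if s = \<one> then (1::'k) else 0"
  have xd: "x_act c (\<lambda>t. a * ?d t) = (\<lambda>t. of_nat c * (a * ?d t))" for a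
  proof
    fix t
    have "transl g (\<lambda>t. f0 t * (a * ?d t)) t = 0"
      by (auto simp: transl_def f0_def simp del: f_mult)
    moreover have "f0 t * (a * ?d t) = 0" by (auto simp: f0_def)
    ultimately show "x_act c (\<lambda>t. a * ?d t) t = of_nat c * (a * ?d t)" unfolding x_act_eq by simp
  qed
  have fd: "ffact FE (x_act c) n (\<lambda>t. a * ?d t) = (\<lambda>t. ff c n * (a * ?d t))" for n a
  proof (induction n arbitrary: a)
    case 0
    show ?case by (auto simp: ff_def fun_eq_iff)
  next
    case (Suc n)
    have m: "x_act c \<ominus>\<^bsub>FE\<^esub> of_nat n \<odot>\<^bsub>FE\<^esub> \<one>\<^bsub>FE\<^esub> = (\<lambda>v t. x_act c v t - (of_nat n \<odot>\<^bsub>FE\<^esub> \<one>\<^bsub>FE\<^esub>) v t)"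
      by (rule fun_end_minus[OF x_act_closed]) (use E in \<open>simp del: fun_end_simps\<close>)
    have "(x_act c \<ominus>\<^bsub>FE\<^esub> of_nat n \<odot>\<^bsub>FE\<^esub> \<one>\<^bsub>FE\<^esub>) (\<lambda>t. a * ?d t) = (\<lambda>t. ((of_nat c - of_nat n) * a) * ?d t)"
      unfolding m by (simp only: xd) (simp add: fun_eq_iff algebra_simps)
    then have "ffact FE (x_act c) (Suc n) (\<lambda>t. a * ?d t) = ffact FE (x_act c) n (\<lambda>t. ((of_nat c - of_nat n) * a) * ?d t)"
      by simp
    also have "\<dots> = (\<lambda>t. ff c n * (((of_nat c - of_nat n) * a) * ?d t))" by (rule Suc)
    finally show ?case by (simp add: ff_def fun_eq_iff algebra_simps)
  qed
  show "point_val c t (bas s n) = (if s = t then ff c n else 0)" if s: "s \<in> carrier G"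
  proof -
    have i: "inv s \<otimes> t = \<one> \<longleftrightarrow> s = t"
      using s t by (metis inv_closed inv_equality inv_inv l_inv)
    have "point_val c t (bas s n) = transl s (ffact FE (x_act c) n (\<lambda>t. 1 * ?d t)) t"
      using s by (simp add: point_val_def bas_def khom_mult[OF h] act(2,3)[OF c] ffact_khom[OF H_kalgebra h E x_closed])
    also have "\<dots> = (if s = t then ff c n else 0)" unfolding fd using t i by (simp add: transl_def)
    finally show ?thesis .
  qed
qed

definition is_coord where
  "is_coord t n d \<longleftrightarrow> klinear H ground d \<and> (\<forall>s\<in>carrier G. \<forall>m. d (bas s m) = (if s = t \<and> m = n then 1 else 0))"

text \<open>
  The coordinates are obtained from the point values by inverting the triangular matrix \<^const>\<open>ff\<close>.
\<close>

lemma coord_exists: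
  assumes t: "t \<in> carrier G"
  shows "n < CHAR('k) \<Longrightarrow> \<exists>d. is_coord t n d"
proof (induction n rule: less_induct)
  case (less n)
  then have "\<forall>m\<in>{..<n}. \<exists>d. is_coord t m d" by auto
  then obtain d where d: "\<And>m. m < n \<Longrightarrow> is_coord t m (d m)" by (metis lessThan_iff)
  \<comment> \<open>The point value at \<open>c = n\<close> is \<open>ff n n\<close> times the wanted coordinate plus lower coordinates.\<close>
  let ?d = "\<lambda>u. inverse (ff n n) \<odot>\<^bsub>ground\<^esub> (point_val n t u \<oplus>\<^bsub>ground\<^esub> (\<Oplus>\<^bsub>ground\<^esub>m\<in>{..<n}. (- ff n m) \<odot>\<^bsub>ground\<^esub> d m u))"
  interpret gr: abelian_group "ground :: ('k, 'k) module" by (rule vspace_abelian_group) simp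
  have "klinear H ground ?d"
    by (intro klinear_scale klinear_sum klinear_finsum_map point_val(1)) (use d less t in \<open>auto simp: is_coord_def\<close>)
  moreover have "?d (bas s m) = (if s = t \<and> m = n then 1 else 0)" if s: "s \<in> carrier G" for s m
  proof -
    have fs: "(\<Oplus>\<^bsub>ground\<^esub>m\<in>A. F m) = (\<Sum>m\<in>A. F m)" if "finite A" for A and F :: "nat \<Rightarrow> 'k"
      using that by (induction A rule: finite_induct) (auto simp: gr.finsum_insert)
    have "(\<Sum>j<n. - ff n j * d j (bas s m)) = (\<Sum>j<n. if j = m then (if s = t then - ff n m else 0) else 0)"
      by (intro sum.cong) (use d s in \<open>auto simp: is_coord_def\<close>)
    also have "\<dots> = (if m < n \<and> s = t then - ff n m else 0)" by simp
    finally show ?thesis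
      using point_val(2)[OF less(2) t s, of m] ff_self[OF less(2)] ff_eq_0[of n m]
      by (auto simp: fs not_less_iff_gr_or_eq)
  qed
  ultimately show ?case unfolding is_coord_def by blast
qed

definition coord :: "'g \<Rightarrow> nat \<Rightarrow> ('g letter list \<Rightarrow>\<^sub>0 'k) set \<Rightarrow> 'k" where
  "coord t n = (SOME d. is_coord t n d)"

lemma coord:
  assumes "t \<in> carrier G" "n < CHAR('k)"
  shows "klinear H ground (coord t n)" "s \<in> carrier G \<Longrightarrow> coord t n (bas s m) = (if s = t \<and> m = n then 1 else 0)"
proof -
  have "is_coord t n (coord t n)" unfolding coord_def using coord_exists[OF assms] by (rule someI_ex)
  then show "klinear H ground (coord t n)" "s \<in> carrier G \<Longrightarrow> coord t n (bas s m) = (if s = t \<and> m = n then 1 else 0)"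
    by (auto simp: is_coord_def)
qed

lemma coord_e:
  "t \<in> carrier G \<Longrightarrow> n < CHAR('k) \<Longrightarrow> s \<in> carrier G \<Longrightarrow> coord t n (e s) = (if s = t \<and> n = 0 then 1 else 0)"
  using coord(2)[of t n s 0] by auto

text \<open>
  The linear map with values \<open>\<beta> t n\<close> on the basis.
\<close>

definition blin :: "('k, 'b, 'm) module_scheme \<Rightarrow> ('g \<Rightarrow> nat \<Rightarrow> 'b) \<Rightarrow> ('g letter list \<Rightarrow>\<^sub>0 'k) set \<Rightarrow> 'b" where
  "blin W \<beta> u = (\<Oplus>\<^bsub>W\<^esub>i\<in>carrier G \<times> {..<CHAR('k)}. coord (fst i) (snd i) u \<odot>\<^bsub>W\<^esub> \<beta> (fst i) (snd i))"

lemma finite_index: "finite (carrier G \<times> {..<CHAR('k)})"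
  using finite_G by simp

lemma blin:
  assumes W: "vspace W" and \<beta>: "\<And>t n. t \<in> carrier G \<Longrightarrow> n < CHAR('k) \<Longrightarrow> \<beta> t n \<in> carrier W"
  shows "klinear H W (blin W \<beta>)" "t \<in> carrier G \<Longrightarrow> n < CHAR('k) \<Longrightarrow> blin W \<beta> (bas t n) = \<beta> t n"
proof -
  interpret W: abelian_group W using W by (rule vspace_abelian_group)
  have "klinear H W (\<lambda>u. (\<Oplus>\<^bsub>W\<^esub>i\<in>carrier G \<times> {..<CHAR('k)}. coord (fst i) (snd i) u \<odot>\<^bsub>W\<^esub> \<beta> (fst i) (snd i)))"
    by (rule klinear_finsum_map[OF finite_index W _ H_vspace], rule klinear_comp[OF coord(1) klinear_smult_vec[OF W]])
      (use \<beta> in auto)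
  then show "klinear H W (blin W \<beta>)" unfolding blin_def[abs_def] .
  show "blin W \<beta> (bas t n) = \<beta> t n" if t: "t \<in> carrier G" "n < CHAR('k)"
  proof -
    have "blin W \<beta> (bas t n) = (\<Oplus>\<^bsub>W\<^esub>i\<in>carrier G \<times> {..<CHAR('k)}. if (t, n) = i then \<beta> (fst i) (snd i) else \<zero>\<^bsub>W\<^esub>)"
      unfolding blin_def by (rule W.finsum_cong') (use \<beta> W t in \<open>auto simp: coord split: if_splits\<close>)
    also have "\<dots> = \<beta> t n"
    proof -
      have "(\<lambda>i. \<beta> (fst i) (snd i)) \<in> carrier G \<times> {..<CHAR('k)} \<rightarrow> carrier W" using \<beta> by auto
      from W.finsum_singleton[OF _ finite_index this, of "(t, n)"] show ?thesis using t by simp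
    qed
    finally show ?thesis .
  qed
qed

lemma basis_ext:
  assumes \<phi>: "klinear H W \<phi>" "klinear H W \<psi>" "vspace W" and u: "u \<in> carrier H"
    and eq: "\<And>t n. t \<in> carrier G \<Longrightarrow> n < CHAR('k) \<Longrightarrow> coord t n u \<noteq> 0 \<Longrightarrow> \<phi> (bas t n) = \<psi> (bas t n)"
  shows "\<phi> u = \<psi> u"
proof -
  interpret W: abelian_group W using assms(3) by (rule vspace_abelian_group)
  have *: "\<phi> u = blin W (\<lambda>t n. \<phi> (bas t n)) u" if "klinear H W \<phi>" for \<phi>
    by (rule H_ext[OF that blin(1) _ u]) (use assms(3) klinear_closed[OF that] in \<open>auto simp: blin\<close>)
  have "blin W (\<lambda>t n. \<phi> (bas t n)) u = blin W (\<lambda>t n. \<psi> (bas t n)) u"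
    unfolding blin_def
  proof (rule W.finsum_cong')
    fix i assume i: "i \<in> carrier G \<times> {..<CHAR('k)}"
    then have "\<phi> (bas (fst i) (snd i)) \<in> carrier W" "\<psi> (bas (fst i) (snd i)) \<in> carrier W"
      using klinear_closed[OF \<phi>(1)] klinear_closed[OF \<phi>(2)] by auto
    then show "coord (fst i) (snd i) u \<odot>\<^bsub>W\<^esub> \<phi> (bas (fst i) (snd i)) = coord (fst i) (snd i) u \<odot>\<^bsub>W\<^esub> \<psi> (bas (fst i) (snd i))"
      using eq[of "fst i" "snd i"] i assms(3) by (cases "coord (fst i) (snd i) u = 0") auto
  qed (use assms(3) klinear_closed[OF \<phi>(2)] in auto)
  then show ?thesis using *[OF \<phi>(1)] *[OF \<phi>(2)] by simp
qed

subsection \<open>Coproducts of basis elements\<close>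

lemma e_pow: "t \<in> carrier G \<Longrightarrow> e t [^]\<^bsub>H\<^esub> (n::nat) = e (t [^] n)"
  by (induction n) (simp_all add: e_one e_mult)

text \<open>
  Stated for \<open>y\<close> in place of \<open>x\<close>, because it is needed both for \<open>x\<close> and for \<open>x \<triangleleft> h = x + \<gamma>\<^sub>h (1 - g)\<close>: it is
  the binomial theorem for \<open>y \<otimes> 1 + (g \<otimes> 1) (1 \<otimes> y)\<close>.
\<close>

lemma comult_skew_ffact:
  assumes t: "t \<in> carrier G" and y: "y \<in> carrier H"
    and D: "comult H y = pure_tensor H H y \<one>\<^sub>H \<oplus>\<^bsub>HH\<^esub> pure_tensor H H (e g) y"
    and gy: "e g \<otimes>\<^sub>H y = y \<otimes>\<^sub>H e g \<oplus>\<^sub>H e g \<ominus>\<^sub>H e g \<otimes>\<^sub>H e g"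
  shows "comult H (e t \<otimes>\<^sub>H ffact H y n) = (\<Oplus>\<^bsub>HH\<^esub>k\<in>{..n}. of_nat (n choose k) \<odot>\<^bsub>HH\<^esub>
    pure_tensor H H ((e t \<otimes>\<^sub>H ffact H y (n - k)) \<otimes>\<^sub>H e (g [^] k)) (e t \<otimes>\<^sub>H ffact H y k))"
proof -
  have T: "kalgebra HH" by simp
  interpret T: Ring.ring HH using T by (rule kalgebra_ring)
  let ?x = "pure_tensor H H y \<one>\<^sub>H" and ?g = "pure_tensor H H (e g) \<one>\<^sub>H" and ?y = "pure_tensor H H \<one>\<^sub>H y"
  let ?X = "pure_tensor H H y \<one>\<^sub>H \<oplus>\<^bsub>HH\<^esub> pure_tensor H H (e g) y" and ?t = "pure_tensor H H (e t) (e t)"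
  have X: "?X = ?x \<oplus>\<^bsub>HH\<^esub> ?g \<otimes>\<^bsub>HH\<^esub> ?y" using y by (simp add: tensor_mult_pure)
  have 3: "?g \<otimes>\<^bsub>HH\<^esub> ?x = ?x \<otimes>\<^bsub>HH\<^esub> ?g \<oplus>\<^bsub>HH\<^esub> ?g \<ominus>\<^bsub>HH\<^esub> ?g \<otimes>\<^bsub>HH\<^esub> ?g"
    using T y by (simp add: tensor_mult_pure gy pure_linear)
  have kl: "khom H HH (\<lambda>a. pure_tensor H H a \<one>\<^sub>H)" "khom H HH (\<lambda>b. pure_tensor H H \<one>\<^sub>H b)"
    by (rule khom_tensor_left khom_tensor_right; simp)+
  have "comult H (e t \<otimes>\<^sub>H ffact H y n) = ?t \<otimes>\<^bsub>HH\<^esub> ffact HH ?X n"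
    using t y by (simp add: khom_mult[OF comult_khom] comult_e ffact_khom[OF H_kalgebra comult_khom T y] D)
  also have "ffact HH ?X n = (\<Oplus>\<^bsub>HH\<^esub>k\<in>{..n}. of_nat (n choose k) \<odot>\<^bsub>HH\<^esub> (ffact HH ?x (n - k) \<otimes>\<^bsub>HH\<^esub> (?g [^]\<^bsub>HH\<^esub> k \<otimes>\<^bsub>HH\<^esub> ffact HH ?y k)))"
    unfolding X by (rule ffact_binomial[OF T _ _ _ 3]) (use y in \<open>simp_all add: tensor_mult_pure\<close>)
  also have "\<dots> = (\<Oplus>\<^bsub>HH\<^esub>k\<in>{..n}. of_nat (n choose k) \<odot>\<^bsub>HH\<^esub> pure_tensor H H (ffact H y (n - k) \<otimes>\<^sub>H e (g [^] k)) (ffact H y k))"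
    by (rule T.finsum_cong')
      (use y in \<open>auto simp: ffact_khom[OF H_kalgebra kl(1) T y, symmetric] ffact_khom[OF H_kalgebra kl(2) T y, symmetric]
        khom_power[OF H_kalgebra kl(1) T, symmetric] tensor_mult_pure e_pow\<close>)
  also have "?t \<otimes>\<^bsub>HH\<^esub> \<dots> = (\<Oplus>\<^bsub>HH\<^esub>k\<in>{..n}. ?t \<otimes>\<^bsub>HH\<^esub> (of_nat (n choose k) \<odot>\<^bsub>HH\<^esub> pure_tensor H H (ffact H y (n - k) \<otimes>\<^sub>H e (g [^] k)) (ffact H y k)))"
    by (rule T.finsum_rdistr) (use t y in auto)
  also have "\<dots> = (\<Oplus>\<^bsub>HH\<^esub>k\<in>{..n}. of_nat (n choose k) \<odot>\<^bsub>HH\<^esub>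
    pure_tensor H H ((e t \<otimes>\<^sub>H ffact H y (n - k)) \<otimes>\<^sub>H e (g [^] k)) (e t \<otimes>\<^sub>H ffact H y k))"
    by (rule T.finsum_cong') (use t y T in \<open>auto simp: ka_mult_smult tensor_mult_pure ka_assoc\<close>)
  finally show ?thesis .
qed

lemma comult_bas:
  assumes t: "t \<in> carrier G"
  shows "comult H (bas t n) = (\<Oplus>\<^bsub>HH\<^esub>k\<in>{..n}. of_nat (n choose k) \<odot>\<^bsub>HH\<^esub>
    pure_tensor H H (bas t (n - k) \<otimes>\<^sub>H e (g [^] k)) (bas t k))"
  unfolding bas_def
proof (rule comult_skew_ffact[OF t x_closed comult_x])
  show "e g \<otimes>\<^sub>H x = x \<otimes>\<^sub>H e g \<oplus>\<^sub>H e g \<ominus>\<^sub>H e g \<otimes>\<^sub>H e g"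
    by (simp add: skew_commute e_mult)
      (rule lincomb_eqI[where V = H], (rule lincomb_intros | rule lincomb_atom | simp)+)
qed

lemma sweedler_bas:
  assumes P: "vspace P" and \<beta>: "bilin H H P \<beta>" and t: "t \<in> carrier G"
  shows "sweedler P (comult H (bas t n)) \<beta> = (\<Oplus>\<^bsub>P\<^esub>k\<in>{..n}. of_nat (n choose k) \<odot>\<^bsub>P\<^esub>
    \<beta> (bas t (n - k) \<otimes>\<^sub>H e (g [^] k)) (bas t k))"
proof -
  interpret P: abelian_group P using P by (rule vspace_abelian_group)
  note L = klinear_sweedler[OF H_vspace H_vspace P \<beta>]
  have "sweedler P (comult H (bas t n)) \<beta> = (\<Oplus>\<^bsub>P\<^esub>k\<in>{..n}. sweedler P (of_nat (n choose k) \<odot>\<^bsub>HH\<^esub>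
    pure_tensor H H (bas t (n - k) \<otimes>\<^sub>H e (g [^] k)) (bas t k)) \<beta>)"
    unfolding comult_bas[OF t] by (rule klinear_finsum[OF L]) (use P t in auto)
  also have "\<dots> = (\<Oplus>\<^bsub>P\<^esub>k\<in>{..n}. of_nat (n choose k) \<odot>\<^bsub>P\<^esub> \<beta> (bas t (n - k) \<otimes>\<^sub>H e (g [^] k)) (bas t k))"
    by (rule P.finsum_cong')
      (use t P bilin_closed[OF \<beta>] in \<open>auto simp: klinear_smult[OF L] sweedler_pure[OF H_vspace H_vspace P \<beta>]\<close>)
  finally show ?thesis .
qed

lemma sweedler_bas_single:
  assumes P: "vspace P" and \<beta>: "bilin H H P \<beta>" and t: "t \<in> carrier G" and k: "k \<le> n"
    and z: "\<And>j. j \<le> n \<Longrightarrow> j \<noteq> k \<Longrightarrow> \<beta> (bas t (n - j) \<otimes>\<^sub>H e (g [^] j)) (bas t j) = \<zero>\<^bsub>P\<^esub>"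
  shows "sweedler P (comult H (bas t n)) \<beta> = of_nat (n choose k) \<odot>\<^bsub>P\<^esub>
    \<beta> (bas t (n - k) \<otimes>\<^sub>H e (g [^] k)) (bas t k)"
proof -
  interpret P: abelian_group P using P by (rule vspace_abelian_group)
  let ?F = "\<lambda>k. of_nat (n choose k) \<odot>\<^bsub>P\<^esub> \<beta> (bas t (n - k) \<otimes>\<^sub>H e (g [^] k)) (bas t k)"
  have c: "?F j \<in> carrier P" for j using t P bilin_closed[OF \<beta>] by simp
  have "sweedler P (comult H (bas t n)) \<beta> = (\<Oplus>\<^bsub>P\<^esub>j\<in>{..n}. if k = j then ?F j else \<zero>\<^bsub>P\<^esub>)"
    unfolding sweedler_bas[OF P \<beta> t] by (rule P.finsum_cong') (use c z P in auto)
  also have "\<dots> = ?F k" by (rule P.finsum_singleton) (use k c in auto)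
  finally show ?thesis .
qed

text \<open>The contraction of \<open>\<Delta>(u)\<close> in the second factor with a coordinate functional.\<close>

definition slice :: "'g \<Rightarrow> nat \<Rightarrow> ('g letter list \<Rightarrow>\<^sub>0 'k) set \<Rightarrow> ('g letter list \<Rightarrow>\<^sub>0 'k) set" where
  "slice t k u = sweedler H (comult H u) (\<lambda>a b. coord t k b \<odot>\<^sub>H a)"

lemma bilin_slice: "t \<in> carrier G \<Longrightarrow> k < CHAR('k) \<Longrightarrow> bilin H H H (\<lambda>a b. coord t k b \<odot>\<^sub>H a)"
  by (rule bilin_flip[OF bilin_comp[OF bilin_smult coord(1) klinear_id]]) auto

lemma klinear_slice: "t \<in> carrier G \<Longrightarrow> k < CHAR('k) \<Longrightarrow> klinear H H (slice t k)"
  unfolding slice_def by (rule klinear_comp[OF khom_klinear[OF comult_khom] klinear_sweedler[OF _ _ _ bilin_slice]]) auto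

lemma slice_bas:
  assumes t: "t \<in> carrier G" "k < CHAR('k)" and s: "s \<in> carrier G"
  shows "slice t k (bas s n) = (if s = t \<and> k \<le> n then of_nat (n choose k) \<odot>\<^sub>H (bas t (n - k) \<otimes>\<^sub>H e (g [^] k)) else \<zero>\<^sub>H)"
proof (cases "s = t \<and> k \<le> n")
  case True
  then show ?thesis unfolding slice_def
    by (subst sweedler_bas_single[OF H_vspace bilin_slice[OF t] s, of k]) (use s t in \<open>auto simp: coord\<close>)
next
  case False
  then show ?thesis unfolding slice_def
    by (subst sweedler_bas_single[OF H_vspace bilin_slice[OF t] s, of 0]) (use s t in \<open>auto simp: coord coord_e\<close>)
qed

lemma slice_split:
  assumes t: "t \<in> carrier G" "k < CHAR('k)" and u: "u \<in> carrier H" "comult H u = pure_tensor H H a b \<oplus>\<^bsub>HH\<^esub> pure_tensor H H c d"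
    and "a \<in> carrier H" "b \<in> carrier H" "c \<in> carrier H" "d \<in> carrier H"
  shows "slice t k u = coord t k b \<odot>\<^sub>H a \<oplus>\<^sub>H coord t k d \<odot>\<^sub>H c"
  unfolding slice_def u(2)
  using assms by (simp add: klinear_add[OF klinear_sweedler[OF H_vspace H_vspace H_vspace bilin_slice[OF t]]]
    sweedler_pure[OF H_vspace H_vspace H_vspace bilin_slice[OF t]])

lemma H_eq_zero: "u \<in> carrier H \<Longrightarrow> (\<And>t n. t \<in> carrier G \<Longrightarrow> n < CHAR('k) \<Longrightarrow> coord t n u = 0) \<Longrightarrow> u = \<zero>\<^sub>H"
  by (rule basis_ext[OF klinear_id klinear_const_zero[OF H_vspace] H_vspace, of u]) auto

lemma counit_bas: "t \<in> carrier G \<Longrightarrow> counit H (bas t n) = (if n = 0 then 1 else 0)"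
proof -
  assume t: "t \<in> carrier G"
  have "ffact ground 0 n = (if n = 0 then 1 else (0::'k))"
    by (induction n) (auto simp: vs_minus_smult)
  then show ?thesis using t
    by (simp add: bas_def khom_mult[OF counit_khom] ffact_khom[OF H_kalgebra counit_khom] counit_x counit_e)
qed

text \<open>
  Take \<open>n\<close> maximal such that a coordinate of \<open>u\<close> at some \<open>t x\<^bsup>(n)\<^esup>\<close> is nonzero, and contract the second
  factor of \<open>\<Delta>(u)\<close> with that coordinate. By maximality the result is a multiple of the group element
  \<open>t g\<^sup>n\<close>; as \<open>\<Delta>(u) = u \<otimes> u\<close> it is a nonzero multiple of \<open>u\<close>.
\<close>

theorem group_like_H:
  assumes u: "u \<in> carrier H" "comult H u = pure_tensor H H u u" "u \<noteq> \<zero>\<^sub>H"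
  shows "\<exists>t\<in>carrier G. u = e t"
proof -
  let ?N = "{n. n < CHAR('k) \<and> (\<exists>t\<in>carrier G. coord t n u \<noteq> 0)}"
  have "?N \<noteq> {}" using H_eq_zero[OF u(1)] u(3) by blast
  moreover have "finite ?N" by simp
  ultimately have N: "Max ?N \<in> ?N" "\<And>n. n \<in> ?N \<Longrightarrow> n \<le> Max ?N" by (rule Max_in[rotated], auto)
  define n where "n = Max ?N"
  obtain t where t: "t \<in> carrier G" "coord t n u \<noteq> 0" "n < CHAR('k)" using N(1) by (auto simp: n_def)
  have "slice t n u = coord t n u \<odot>\<^sub>H e (t \<otimes> g [^] n)"
  proof (rule basis_ext[OF klinear_slice[OF t(1,3)] _ _ u(1)])
    show "klinear H H (\<lambda>v. coord t n v \<odot>\<^sub>H e (t \<otimes> g [^] n))"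
      by (rule klinear_comp[OF coord(1)[OF t(1,3)] klinear_smult_vec]) (use t in auto)
    fix s m assume s: "s \<in> carrier G" "m < CHAR('k)" "coord s m u \<noteq> 0"
    then have "m \<le> n" unfolding n_def by (intro N(2)) auto
    then show "slice t n (bas s m) = coord t n (bas s m) \<odot>\<^sub>H e (t \<otimes> g [^] n)"
      using s t by (auto simp: slice_bas coord e_mult)
  qed simp
  moreover have "slice t n u = coord t n u \<odot>\<^sub>H u"
    unfolding slice_def u(2) by (rule sweedler_pure[OF _ _ _ bilin_slice]) (use t u in auto)
  ultimately have "coord t n u \<odot>\<^sub>H u = coord t n u \<odot>\<^sub>H e (t \<otimes> g [^] n)" by simp
  then have "inverse (coord t n u) \<odot>\<^sub>H (coord t n u \<odot>\<^sub>H u) = inverse (coord t n u) \<odot>\<^sub>H (coord t n u \<odot>\<^sub>H e (t \<otimes> g [^] n))"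
    by simp
  then have "u = e (t \<otimes> g [^] n)" using t u(1) by simp
  then show ?thesis using t by auto
qed

text \<open>
  Contracting the second factor of \<open>\<Delta>(v)\<close> with the coordinate at \<open>t x\<close> lowers \<open>n\<close> by one, up to
  the factors \<open>n\<close> and \<open>g\<close>, and contracting with the coordinate at \<open>t\<close> extracts the part of \<open>v\<close> in
  \<open>t k[x]\<close>. For \<open>\<Delta>(u) = u \<otimes> 1 + s \<otimes> u\<close> both contractions are combinations of \<open>u\<close> and \<open>s\<close>, which
  leaves only \<open>1\<close>, \<open>s\<close> and, when \<open>s = g\<close>, \<open>x\<close> in the support of \<open>u\<close>. The counit relates the
  coefficients of \<open>1\<close> and \<open>s\<close>.
\<close>

theorem skew_primitive_H:
  assumes u: "u \<in> carrier H" "comult H u = pure_tensor H H u \<one>\<^sub>H \<oplus>\<^bsub>HH\<^esub> pure_tensor H H (e s) u"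
    and s: "s \<in> carrier G"
  shows "\<exists>a b. u = a \<odot>\<^sub>H x \<oplus>\<^sub>H b \<odot>\<^sub>H (\<one>\<^sub>H \<ominus>\<^sub>H e s) \<and> (a \<noteq> 0 \<longrightarrow> s = g)"
proof -
  have p1: "1 < CHAR('k)" using prime_CHAR_semidom[OF char_pos] prime_gt_1_nat by blast
  have one: "coord t k \<one>\<^sub>H = (if t = \<one> \<and> k = 0 then 1 else 0)" if "t \<in> carrier G" "k < CHAR('k)" for t k
    using coord(2)[OF that, of "\<one>" 0] by (auto simp: e_one)
  have es: "coord t k (e s) = (if t = s \<and> k = 0 then 1 else 0)" if "t \<in> carrier G" "k < CHAR('k)" "s \<in> carrier G" for t k s
    using coord(2)[OF that(1,2), of s 0] that by auto
  have sl: "slice t k u = coord t k \<one>\<^sub>H \<odot>\<^sub>H u \<oplus>\<^sub>H coord t k u \<odot>\<^sub>H e s" if "t \<in> carrier G" "k < CHAR('k)" for t k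
    by (rule slice_split[OF that u]) (use u s in auto)
  \<comment> \<open>The contraction with the coordinate at \<open>t x\<close>, multiplied by \<open>g\<^bsup>-1\<^esup>\<close>, acts as \<open>n\<close> times a lowering operator.\<close>
  have c1: "coord t (n - 1) (slice t 1 v \<otimes>\<^sub>H e (inv g)) = of_nat n * coord t n v"
    if t: "t \<in> carrier G" "n < CHAR('k)" "n \<ge> 1" and v: "v \<in> carrier H" for t n v
  proof (rule H_ext[OF _ _ _ v])
    show "klinear H ground (\<lambda>v. coord t (n - 1) (slice t 1 v \<otimes>\<^sub>H e (inv g)))"
      by (rule klinear_comp[OF klinear_comp[OF klinear_slice klinear_mult_right] coord(1)]) (use t p1 in auto)
    show "klinear H ground (\<lambda>v. of_nat n * coord t n v)"
      using klinear_scale[OF coord(1)[OF t(1,2)], of "of_nat n"] by simp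
    fix s m assume sm: "s \<in> carrier G" "m < CHAR('k)"
    show "coord t (n - 1) (slice t 1 (bas s m) \<otimes>\<^sub>H e (inv g)) = of_nat n * coord t n (bas s m)"
    proof (cases "s = t \<and> 1 \<le> m")
      case True
      have "slice t 1 (bas s m) \<otimes>\<^sub>H e (inv g) = of_nat m \<odot>\<^sub>H bas t (m - 1)"
        using True t p1 sm by (simp add: slice_bas ka_smult_mult ka_assoc e_inv)
      then show ?thesis using True t sm by (auto simp: klinear_smult[OF coord(1)] coord)
    next
      case False
      then have "slice t 1 (bas s m) = \<zero>\<^sub>H" using t p1 sm by (subst slice_bas) auto
      then show ?thesis using False t sm klinear_zero[OF coord(1)] by (auto simp: coord)
    qed
  qed
  \<comment> \<open>The contraction with the coordinate at \<open>t\<close> is the projection onto \<open>t k[x]\<close>.\<close>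
  have c0: "coord t n (slice t 0 v) = coord t n v" if t: "t \<in> carrier G" "n < CHAR('k)" and v: "v \<in> carrier H" for t n v
  proof (rule H_ext[OF _ _ _ v])
    show "klinear H ground (\<lambda>v. coord t n (slice t 0 v))"
      by (rule klinear_comp[OF klinear_slice coord(1)]) (use t p1 in auto)
    show "klinear H ground (coord t n)" by (rule coord(1)[OF t])
    fix s m assume sm: "s \<in> carrier G" "m < CHAR('k)"
    show "coord t n (slice t 0 (bas s m)) = coord t n (bas s m)"
      using t p1 sm klinear_zero[OF coord(1)] by (auto simp: slice_bas coord e_one)
  qed
  \<comment> \<open>The contraction of \<open>\<Delta>(u)\<close> at \<open>t x\<close> is a multiple of \<open>s\<close>, so it has no component in degree \<open>n - 1 > 0\<close>.\<close>
  have a: "coord t n u = 0" if t: "t \<in> carrier G" "n < CHAR('k)" "n \<ge> 2" for t n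
  proof -
    have "slice t 1 u \<otimes>\<^sub>H e (inv g) = coord t 1 u \<odot>\<^sub>H e (s \<otimes> inv g)"
      using sl[of t 1] t p1 s u one[of t 1] by (simp add: ka_smult_mult e_mult)
    then have "of_nat n * coord t n u = coord t 1 u * coord t (n - 1) (e (s \<otimes> inv g))"
      using c1[OF t(1,2) _ u(1)] t s by (simp add: klinear_smult[OF coord(1)])
    also have "coord t (n - 1) (e (s \<otimes> inv g)) = 0" using t s by (subst es) auto
    finally have "of_nat n = (0 :: 'k) \<or> coord t n u = 0" by simp
    moreover have "(of_nat n :: 'k) \<noteq> 0" using t by (auto simp: of_nat_eq_0_iff_char_dvd dest: dvd_imp_le)
    ultimately show ?thesis by simp
  qed
  \<comment> \<open>In degree one, \<open>t x\<close> is lowered to \<open>t\<close>, which has to be \<open>s g\<^bsup>-1\<^esup>\<close>.\<close>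
  have b: "s = t \<otimes> g" if t: "t \<in> carrier G" "coord t 1 u \<noteq> 0" for t
  proof -
    have "slice t 1 u \<otimes>\<^sub>H e (inv g) = coord t 1 u \<odot>\<^sub>H e (s \<otimes> inv g)"
      using sl[of t 1] t p1 s u one[of t 1] by (simp add: ka_smult_mult e_mult)
    then have "coord t 1 u = coord t 1 u * coord t 0 (e (s \<otimes> inv g))"
      using c1[OF t(1) p1 _ u(1)] t s p1 by (simp add: klinear_smult[OF coord(1)])
    then have "t = s \<otimes> inv g" using t s p1 by (subst (asm) es) (auto split: if_splits)
    then show ?thesis using t s by (simp add: m_assoc)
  qed
  have c: "coord t n u = coord t 0 u * coord t n (e s)" if t: "t \<in> carrier G" "n < CHAR('k)" "t \<noteq> \<one>" for t n
  proof -
    have "slice t 0 u = coord t 0 u \<odot>\<^sub>H e s"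
      using sl[of t 0] t p1 s u one[of t 0] by simp
    then show ?thesis using c0[OF t(1,2) u(1)] t s by (simp add: klinear_smult[OF coord(1)])
  qed
  have supp: "(n = 1 \<and> t = \<one> \<and> s = g) \<or> (n = 0 \<and> (t = \<one> \<or> t = s))"
    if t: "t \<in> carrier G" "n < CHAR('k)" "coord t n u \<noteq> 0" for t n
  proof -
    have n: "n < 2" using a t by force
    show ?thesis
    proof (cases "t = \<one>")
      case True
      have "n = 0 \<or> n = 1" using n by auto
      then show ?thesis using b[of t] t True by auto
    next
      case False
      then show ?thesis using c[OF t(1,2) False] t es[OF t(1,2) s] by (auto split: if_splits)
    qed
  qed
  let ?a = "coord \<one> 1" and ?b = "coord \<one> 0" and ?c = "\<lambda>v. if s = \<one> then 0 else coord s 0 v"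
  have lin: "klinear H ground ?a" "klinear H ground ?b" "klinear H ground ?c"
    using p1 s coord(1) by (auto simp: klinear_def coord)
  have b1: "bas \<one> 1 = x" using bas_one_1 by simp
  have ue: "u = ?a u \<odot>\<^sub>H x \<oplus>\<^sub>H (?b u \<odot>\<^sub>H \<one>\<^sub>H \<oplus>\<^sub>H ?c u \<odot>\<^sub>H e s)"
  proof (rule basis_ext[OF klinear_id _ _ u(1)])
    show "klinear H H (\<lambda>u. ?a u \<odot>\<^sub>H x \<oplus>\<^sub>H (?b u \<odot>\<^sub>H \<one>\<^sub>H \<oplus>\<^sub>H ?c u \<odot>\<^sub>H e s))"
      by (intro klinear_sum klinear_comp[OF lin(1) klinear_smult_vec] klinear_comp[OF lin(2) klinear_smult_vec]
          klinear_comp[OF lin(3) klinear_smult_vec]) (use s in auto)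
    fix t n assume t: "t \<in> carrier G" "n < CHAR('k)" "coord t n u \<noteq> 0"
    from supp[OF t] consider "n = 1" "t = \<one>" | "n = 0" "t = \<one>" | "n = 0" "t = s" "s \<noteq> \<one>" by blast
    then show "bas t n = ?a (bas t n) \<odot>\<^sub>H x \<oplus>\<^sub>H (?b (bas t n) \<odot>\<^sub>H \<one>\<^sub>H \<oplus>\<^sub>H ?c (bas t n) \<odot>\<^sub>H e s)"
    proof cases
      case 1
      then show ?thesis using coord(2)[OF one_closed p1 one_closed, of 1] coord(2)[OF one_closed char_pos one_closed, of 1]
          coord(2)[OF s char_pos one_closed, of 1] b1 s by simp
    next
      case 2
      then show ?thesis using coord(2)[OF one_closed p1 one_closed, of 0] coord(2)[OF one_closed char_pos one_closed, of 0]
          coord(2)[OF s char_pos one_closed, of 0] e_one s by auto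
    next
      case 3
      then show ?thesis using coord(2)[OF one_closed p1 s, of 0] coord(2)[OF one_closed char_pos s, of 0]
          coord(2)[OF s char_pos s, of 0] s by auto
    qed
  qed simp
  \<comment> \<open>Apply the counit axiom to \<open>\<Delta>(u) = u \<otimes> 1 + s \<otimes> u\<close>.\<close>
  have eu: "counit H u = 0"
  proof -
    have bl: "bilin H H H (\<lambda>c1 c2. counit H c1 \<odot>\<^sub>H c2)"
      by (rule bilin_comp[OF bilin_smult khom_klinear[OF counit_khom] klinear_id]) simp
    have "sweedler H (comult H u) (\<lambda>c1 c2. counit H c1 \<odot>\<^sub>H c2) = u"
      using hopf_algebra_H u(1) by (simp add: hopf_algebra_def bialgebra_def coalgebra_def)
    then have "counit H u \<odot>\<^sub>H \<one>\<^sub>H \<oplus>\<^sub>H u = u"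
      unfolding u(2) using u(1) s by (simp add: klinear_add[OF klinear_sweedler[OF _ _ _ bl]] sweedler_pure[OF _ _ _ bl] counit_e)
    moreover have "counit H u \<odot>\<^sub>H \<one>\<^sub>H = (counit H u \<odot>\<^sub>H \<one>\<^sub>H \<oplus>\<^sub>H u) \<ominus>\<^sub>H u"
      using u(1) by (intro lincomb_eqI[where V = H]) (rule lincomb_intros | rule lincomb_atom | simp)+
    ultimately have "counit H u \<odot>\<^sub>H \<one>\<^sub>H = \<zero>\<^sub>H"
      using vs_minus_eq_zero[OF H_vspace u(1) u(1)] by simp
    then have "counit H (counit H u \<odot>\<^sub>H \<one>\<^sub>H) = counit H \<zero>\<^sub>H" by simp
    then show ?thesis using klinear_smult[OF khom_klinear[OF counit_khom], of "\<one>\<^sub>H"]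
        klinear_zero[OF khom_klinear[OF counit_khom]] khom_one[OF counit_khom] by simp
  qed
  have "counit H u = ?b u + ?c u"
  proof -
    note l = khom_klinear[OF counit_khom]
    have "counit H u = counit H (?a u \<odot>\<^sub>H x \<oplus>\<^sub>H (?b u \<odot>\<^sub>H \<one>\<^sub>H \<oplus>\<^sub>H ?c u \<odot>\<^sub>H e s))"
      using ue by simp
    also have "\<dots> = ?b u + ?c u"
      using s khom_one[OF counit_khom] by (simp add: klinear_add[OF l] klinear_smult[OF l] counit_x counit_e)
    finally show ?thesis .
  qed
  then have cb: "?c u = - ?b u" using eu by (simp add: add_eq_0_iff)
  have "u = ?a u \<odot>\<^sub>H x \<oplus>\<^sub>H ?b u \<odot>\<^sub>H (\<one>\<^sub>H \<ominus>\<^sub>H e s)"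
    by (subst ue, unfold cb)
      (rule lincomb_eqI[where V = H], (rule lincomb_intros | rule lincomb_atom | simp add: s algebra_simps)+)
  moreover have "?a u \<noteq> 0 \<longrightarrow> s = g" using supp[OF one_closed p1] by auto
  ultimately show ?thesis by blast
qed

end

section \<open>From group data to matched pairs of Hopf algebras\<close>

context third_type
begin

text \<open>
  The possible values of \<open>x \<triangleleft> h\<close>.
\<close>

definition xc :: "'k \<Rightarrow> ('g letter list \<Rightarrow>\<^sub>0 'k) set" where
  "xc c = x \<oplus>\<^sub>H c \<odot>\<^sub>H (\<one>\<^sub>H \<ominus>\<^sub>H e g)"

lemma xc_closed [simp]: "xc c \<in> carrier H"
  by (simp add: xc_def)

lemma xc_0 [simp]: "xc 0 = x"
  by (simp add: xc_def)

lemma xc_mult_e: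
  assumes t: "t \<in> carrier G"
  shows "xc c \<otimes>\<^sub>H e t = e t \<otimes>\<^sub>H xc c \<ominus>\<^sub>H f t \<odot>\<^sub>H (e t \<ominus>\<^sub>H e (t \<otimes> g))"
  using t unfolding xc_def
  by (simp add: ka_distribs e_mult x_mult_e g_central)
    (rule lincomb_eqI[where V = H], (rule lincomb_intros | rule lincomb_atom | simp)+, (simp add: algebra_simps)?)

lemma g_mult_xc: "e g \<otimes>\<^sub>H xc c = xc c \<otimes>\<^sub>H e g \<oplus>\<^sub>H e g \<ominus>\<^sub>H e g \<otimes>\<^sub>H e g"
  by (simp add: xc_mult_e e_mult)
    (rule lincomb_eqI[where V = H], (rule lincomb_intros | rule lincomb_atom | simp)+, (simp add: algebra_simps)?)

lemma comult_xc: "comult H (xc c) = pure_tensor H H (xc c) \<one>\<^sub>H \<oplus>\<^bsub>HH\<^esub> pure_tensor H H (e g) (xc c)"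
proof -
  note l = khom_klinear[OF comult_khom]
  show ?thesis unfolding xc_def
    by (simp add: klinear_add[OF l] klinear_smult[OF l] klinear_minus[OF l] comult_x comult_e
        khom_one[OF comult_khom] tensor_simps(6) pure_linear)
      (rule lincomb_eqI[where V = HH], (rule lincomb_intros | rule lincomb_atom | simp)+, (simp add: algebra_simps)?)
qed

text \<open>
  Apply the binomial theorem twice, to \<open>(x + c) + g (-c)\<close> and to \<open>x + c\<close>; a scalar \<open>a\<close> contributes
  \<open>a\<^sup>p - a\<close>.
\<close>

lemma ffact_xc: "ffact H (xc c) (CHAR('k)) = (c ^ CHAR('k) - c) \<odot>\<^sub>H (\<one>\<^sub>H \<ominus>\<^sub>H e (g [^] CHAR('k)))"
proof -
  let ?n = "CHAR('k)"
  interpret Ring.ring H using H_kalgebra by (rule kalgebra_ring)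
  have s: "ffact H (a \<odot>\<^sub>H \<one>\<^sub>H) ?n = (a ^ ?n - a) \<odot>\<^sub>H \<one>\<^sub>H" for a :: 'k
    by (simp add: ffact_CHAR[OF H_kalgebra _ char_pos] smult_power)
      (rule lincomb_eqI[where V = H], (rule lincomb_intros | rule lincomb_atom | simp)+, (simp add: algebra_simps)?)
  have m: "(- c) ^ ?n = - (c ^ ?n)"
    using prime_CHAR_semidom[OF char_pos] by (intro minus_power_prime_CHAR) simp_all
  let ?x = "x \<oplus>\<^sub>H c \<odot>\<^sub>H \<one>\<^sub>H" and ?y = "(- c) \<odot>\<^sub>H \<one>\<^sub>H"
  \<comment> \<open>\<open>x + c (1 - g) = (x + c) + g (-c)\<close>, to which the binomial theorem applies.\<close>
  have e: "xc c = ?x \<oplus>\<^sub>H e g \<otimes>\<^sub>H ?y"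
    unfolding xc_def by (simp add: ka_mult_smult)
      (rule lincomb_eqI[where V = H], (rule lincomb_intros | rule lincomb_atom | simp)+, (simp add: algebra_simps)?)
  have gx: "e g \<otimes>\<^sub>H ?x = ?x \<otimes>\<^sub>H e g \<oplus>\<^sub>H e g \<ominus>\<^sub>H e g \<otimes>\<^sub>H e g"
    by (simp add: ka_distribs skew_commute e_mult)
      (rule lincomb_eqI[where V = H], (rule lincomb_intros | rule lincomb_atom | simp)+, (simp add: algebra_simps)?)
  have 1: "ffact H ?x ?n = (c ^ ?n - c) \<odot>\<^sub>H \<one>\<^sub>H"
    by (subst ffact_CHAR_add_commuting[OF H_kalgebra char_pos]) (simp_all add: ka_distribs ffact_x s ka_mult_smult)
  have "ffact H (xc c) ?n = ffact H ?x ?n \<oplus>\<^sub>H e g [^]\<^bsub>H\<^esub> ?n \<otimes>\<^sub>H ffact H ?y ?n"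
    unfolding e by (rule ffact_CHAR_add[OF H_kalgebra _ _ _ gx _ _ char_pos]) (simp_all add: ka_distribs ka_mult_smult vs_smult_distr)
  also have "\<dots> = (c ^ ?n - c) \<odot>\<^sub>H (\<one>\<^sub>H \<ominus>\<^sub>H e (g [^] ?n))"
    unfolding 1 s m by (simp add: e_pow ka_mult_smult)
      (rule lincomb_eqI[where V = H], (rule lincomb_intros | rule lincomb_atom | simp)+, (simp add: algebra_simps)?)
  finally show ?thesis .
qed

end

locale third_type_pair = third_type G g f + \<Gamma>: group \<Gamma>
  for G :: "'g monoid" (structure) and g :: 'g and f :: "'g \<Rightarrow> 'k::field" and \<Gamma> :: "'c monoid"
begin

definition A :: "('k, 'c \<Rightarrow>\<^sub>0 'k) hopf" where "A = group_hopf \<Gamma>"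

lemmas A_kalgebra [simp] = kalgebra_group_hopf[OF \<Gamma>.group_axioms, where ?'k = 'k, folded A_def]
lemmas bv_closed [simp] = basis_closed[OF \<Gamma>.group_axioms, where ?'k = 'k, folded A_def]
lemmas bv_mult = basis_mult[OF \<Gamma>.group_axioms, where ?'k = 'k, folded A_def]
lemmas comult_A_khom = khom_comult_group[OF \<Gamma>.group_axioms, where ?'k = 'k, folded A_def]
lemmas counit_A_khom = khom_counit_group[OF \<Gamma>.group_axioms, where ?'k = 'k, folded A_def]
lemmas A_bv = group_hopf_basis[OF \<Gamma>.group_axioms, where ?'k = 'k, folded A_def]
lemmas A_ext = group_hopf_ext[OF \<Gamma>.group_axioms, where ?'k = 'k, folded A_def]
lemmas hopf_algebra_A = hopf_algebra_group_hopf[OF \<Gamma>.group_axioms, where ?'k = 'k, folded A_def]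

lemma A_vspace [simp]: "vspace A" by simp

lemma A_one: "\<one>\<^bsub>A\<^esub> = basis_vec \<one>\<^bsub>\<Gamma>\<^esub>" by (simp add: A_def)

abbreviation "HA \<equiv> tensor H A"

lemma bilin_ext:
  assumes "bilin H A W \<Phi>" "bilin H A W \<Psi>" "vspace W"
    and eq: "\<And>t n h. t \<in> carrier G \<Longrightarrow> n < CHAR('k) \<Longrightarrow> h \<in> carrier \<Gamma> \<Longrightarrow> \<Phi> (bas t n) (basis_vec h) = \<Psi> (bas t n) (basis_vec h)"
    and u: "u \<in> carrier H" and a: "a \<in> carrier A"
  shows "\<Phi> u a = \<Psi> u a"
proof (rule A_ext[OF bilin_right[OF assms(1) u] bilin_right[OF assms(2) u] assms(3) _ a])
  fix h assume h: "h \<in> carrier \<Gamma>"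
  show "\<Phi> u (basis_vec h) = \<Psi> u (basis_vec h)"
    by (rule H_ext[OF bilin_left[OF assms(1)] bilin_left[OF assms(2)] _ u]) (use eq h in auto)
qed

subsection \<open>Double Sweedler sums\<close>

context
  fixes U :: "('k, 'u, 'm) module_scheme" and V :: "('k, 'v, 'n) module_scheme" and W :: "('k, 'w, 'o) module_scheme"
    and p q \<Phi>
  assumes UVW: "vspace U" "vspace V" "vspace W"
    and p: "bilin H A U p" and q: "bilin H A V q" and \<Phi>: "bilin U V W \<Phi>"
begin

lemma bilin_inner_A: "u1 \<in> carrier H \<Longrightarrow> u2 \<in> carrier H \<Longrightarrow> bilin A A W (\<lambda>a1 a2. \<Phi> (p u1 a1) (q u2 a2))"
  by (rule bilin_comp[OF \<Phi> bilin_right[OF p] bilin_right[OF q]])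

lemma bilin_inner_H: "a1 \<in> carrier A \<Longrightarrow> a2 \<in> carrier A \<Longrightarrow> bilin H H W (\<lambda>u1 u2. \<Phi> (p u1 a1) (q u2 a2))"
  by (rule bilin_comp[OF \<Phi> bilin_left[OF p] bilin_left[OF q]])

lemmas bilin_middle = bilin_sweedler_sweedler(1)[OF H_vspace A_vspace UVW(3) khom_klinear[OF comult_khom] khom_klinear[OF comult_A_khom] p q \<Phi>]
lemmas bilin_double_sweedler = bilin_sweedler_sweedler(2)[OF H_vspace A_vspace UVW(3) khom_klinear[OF comult_khom] khom_klinear[OF comult_A_khom] p q \<Phi>]

lemma double_sweedler_bv:
  assumes u: "u \<in> carrier H" and h: "h \<in> carrier \<Gamma>"
  shows "sweedler W (comult H u) (\<lambda>u1 u2. sweedler W (comult A (basis_vec h)) (\<lambda>a1 a2. \<Phi> (p u1 a1) (q u2 a2))) =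
    sweedler W (comult H u) (\<lambda>u1 u2. \<Phi> (p u1 (basis_vec h)) (q u2 (basis_vec h)))"
  by (rule sweedler_cong[OF H_vspace H_vspace UVW(3) bilin_middle[OF khom_closed[OF comult_A_khom bv_closed[OF h]]] khom_closed[OF comult_khom u]])
    (use h in \<open>simp add: A_bv sweedler_pure[OF A_vspace A_vspace UVW(3) bilin_inner_A]\<close>)

text \<open>
  In the axioms that involve \<open>\<triangleright>\<close>, all terms of the coproduct of a basis element vanish except for the
  first or the last one.
\<close>

lemma double_sweedler_bas:
  assumes t: "t \<in> carrier G" and h: "h \<in> carrier \<Gamma>" and k: "k \<le> n"
    and z: "\<And>j. j \<le> n \<Longrightarrow> j \<noteq> k \<Longrightarrow> p (bas t (n - j) \<otimes>\<^sub>H e (g [^] j)) (basis_vec h) = \<zero>\<^bsub>U\<^esub> \<or> q (bas t j) (basis_vec h) = \<zero>\<^bsub>V\<^esub>"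
  shows "sweedler W (comult H (bas t n)) (\<lambda>u1 u2. sweedler W (comult A (basis_vec h)) (\<lambda>a1 a2. \<Phi> (p u1 a1) (q u2 a2))) =
    of_nat (n choose k) \<odot>\<^bsub>W\<^esub> \<Phi> (p (bas t (n - k) \<otimes>\<^sub>H e (g [^] k)) (basis_vec h)) (q (bas t k) (basis_vec h))"
proof -
  have c: "p (bas t m \<otimes>\<^sub>H e (g [^] j)) (basis_vec h) \<in> carrier U" "q (bas t j) (basis_vec h) \<in> carrier V" for m j
    using t h by (auto intro!: bilin_closed[OF p] bilin_closed[OF q])
  have "\<Phi> (p (bas t (n - j) \<otimes>\<^sub>H e (g [^] j)) (basis_vec h)) (q (bas t j) (basis_vec h)) = \<zero>\<^bsub>W\<^esub>" if "j \<le> n" "j \<noteq> k" for j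
    using z[OF that] klinear_zero[OF bilin_left[OF \<Phi> c(2)[of j]] UVW(1,3)] klinear_zero[OF bilin_right[OF \<Phi> c(1)] UVW(2,3)] by auto
  then show ?thesis using t h
    by (subst double_sweedler_bv) (auto intro!: sweedler_bas_single[OF UVW(3) bilin_inner_H t k])
qed

lemma double_sweedler_e:
  "t \<in> carrier G \<Longrightarrow> h \<in> carrier \<Gamma> \<Longrightarrow> sweedler W (comult H (e t)) (\<lambda>u1 u2. sweedler W (comult A (basis_vec h)) (\<lambda>a1 a2. \<Phi> (p u1 a1) (q u2 a2))) =
    \<Phi> (p (e t) (basis_vec h)) (q (e t) (basis_vec h))"
  by (subst double_sweedler_bv) (simp_all add: sweedler_e[OF UVW(3) bilin_inner_H])

lemma double_sweedler_x:
  "h \<in> carrier \<Gamma> \<Longrightarrow> sweedler W (comult H x) (\<lambda>u1 u2. sweedler W (comult A (basis_vec h)) (\<lambda>a1 a2. \<Phi> (p u1 a1) (q u2 a2))) =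
    \<Phi> (p x (basis_vec h)) (q \<one>\<^sub>H (basis_vec h)) \<oplus>\<^bsub>W\<^esub> \<Phi> (p (e g) (basis_vec h)) (q x (basis_vec h))"
  by (subst double_sweedler_bv) (simp_all add: sweedler_x[OF UVW(3) bilin_inner_H])

end

end

subsection \<open>The matched pair attached to a datum\<close>

locale pair_datum = third_type_pair G g f \<Gamma>
  for G :: "'g monoid" (structure) and g :: 'g and f :: "'g \<Rightarrow> 'k::field" and \<Gamma> :: "'c monoid" +
  fixes l :: "'g \<times> 'c \<Rightarrow> 'c" and r :: "'g \<times> 'c \<Rightarrow> 'g" and \<gamma> :: "'c \<Rightarrow> 'k"
  assumes pair: "matched_pair_datum \<Gamma> G g f l r \<gamma>"
begin

lemma lr_closed [simp]: "t \<in> carrier G \<Longrightarrow> h \<in> carrier \<Gamma> \<Longrightarrow> l (t, h) \<in> carrier \<Gamma>"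
  "t \<in> carrier G \<Longrightarrow> h \<in> carrier \<Gamma> \<Longrightarrow> r (t, h) \<in> carrier G"
  using pair by (auto simp: matched_pair_datum_def group_matched_pair_def PiE_iff)

lemma group_pair_laws:
  "h \<in> carrier \<Gamma> \<Longrightarrow> l (\<one>, h) = h"
  "s \<in> carrier G \<Longrightarrow> t \<in> carrier G \<Longrightarrow> h \<in> carrier \<Gamma> \<Longrightarrow> l (t \<otimes> s, h) = l (t, l (s, h))"
  "t \<in> carrier G \<Longrightarrow> r (t, \<one>\<^bsub>\<Gamma>\<^esub>) = t"
  "t \<in> carrier G \<Longrightarrow> h \<in> carrier \<Gamma> \<Longrightarrow> k \<in> carrier \<Gamma> \<Longrightarrow> r (t, h \<otimes>\<^bsub>\<Gamma>\<^esub> k) = r (r (t, h), k)"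
  "t \<in> carrier G \<Longrightarrow> h \<in> carrier \<Gamma> \<Longrightarrow> k \<in> carrier \<Gamma> \<Longrightarrow> l (t, h \<otimes>\<^bsub>\<Gamma>\<^esub> k) = l (t, h) \<otimes>\<^bsub>\<Gamma>\<^esub> l (r (t, h), k)"
  "s \<in> carrier G \<Longrightarrow> t \<in> carrier G \<Longrightarrow> h \<in> carrier \<Gamma> \<Longrightarrow> r (t \<otimes> s, h) = r (t, l (s, h)) \<otimes> r (s, h)"
  "h \<in> carrier \<Gamma> \<Longrightarrow> l (g, h) = h" "h \<in> carrier \<Gamma> \<Longrightarrow> r (g, h) = g"
  using pair by (auto simp: matched_pair_datum_def group_matched_pair_def)

lemma \<gamma>:
  "h \<in> carrier \<Gamma> \<Longrightarrow> \<gamma> h \<in> k_set G g"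
  "h \<in> carrier \<Gamma> \<Longrightarrow> k \<in> carrier \<Gamma> \<Longrightarrow> \<gamma> (h \<otimes>\<^bsub>\<Gamma>\<^esub> k) = \<gamma> h + \<gamma> k"
  "t \<in> carrier G \<Longrightarrow> h \<in> carrier \<Gamma> \<Longrightarrow> f (r (t, h)) = f t + \<gamma> (l (t, h)) - \<gamma> h"
  using pair by (auto simp: matched_pair_datum_def hom_def)

lemma \<gamma>_one [simp]: "\<gamma> \<one>\<^bsub>\<Gamma>\<^esub> = 0"
  using \<gamma>(2)[of "\<one>\<^bsub>\<Gamma>\<^esub>" "\<one>\<^bsub>\<Gamma>\<^esub>"] by (metis \<Gamma>.l_one \<Gamma>.one_closed add_cancel_right_right)

lemma l_one [simp]: "t \<in> carrier G \<Longrightarrow> l (t, \<one>\<^bsub>\<Gamma>\<^esub>) = \<one>\<^bsub>\<Gamma>\<^esub>"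
  using group_pair_laws(5)[of t "\<one>\<^bsub>\<Gamma>\<^esub>" "\<one>\<^bsub>\<Gamma>\<^esub>"] by (simp add: group_pair_laws(3))

lemma r_one [simp]: "h \<in> carrier \<Gamma> \<Longrightarrow> r (\<one>, h) = \<one>"
  using group_pair_laws(6)[of "\<one>" "\<one>" h] by (simp add: group_pair_laws(1))

lemma lr_g: "t \<in> carrier G \<Longrightarrow> h \<in> carrier \<Gamma> \<Longrightarrow> l (t \<otimes> g, h) = l (t, h)"
  "t \<in> carrier G \<Longrightarrow> h \<in> carrier \<Gamma> \<Longrightarrow> r (t \<otimes> g, h) = r (t, h) \<otimes> g"
  by (simp_all add: group_pair_laws)

lemma lr_gpow: "h \<in> carrier \<Gamma> \<Longrightarrow> l (g [^] (n::nat), h) = h" "h \<in> carrier \<Gamma> \<Longrightarrow> r (g [^] n, h) = g [^] n"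
  by (induction n) (simp_all add: group_pair_laws)

definition xh :: "'c \<Rightarrow> ('g letter list \<Rightarrow>\<^sub>0 'k) set" where "xh h = xc (\<gamma> h)"

lemma xh_closed [simp]: "xh h \<in> carrier H" by (simp add: xh_def)

text \<open>
  This is where \<open>\<gamma>\<^sub>h \<in> k\<^sub>g\<close> enters.
\<close>

lemma ffact_xh: "h \<in> carrier \<Gamma> \<Longrightarrow> ffact H (xh h) (CHAR('k)) = \<zero>\<^sub>H"
proof -
  assume h: "h \<in> carrier \<Gamma>"
  have "\<gamma> h ^ CHAR('k) = \<gamma> h \<or> g [^] CHAR('k) = \<one>"
    using \<gamma>(1)[OF h] k_set_iff[OF group_axioms g_closed, of "\<gamma> h"] by simp
  moreover have "\<one>\<^sub>H \<ominus>\<^sub>H \<one>\<^sub>H = \<zero>\<^sub>H"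
    by (subst vs_minus_eq_zero) simp_all
  ultimately show ?thesis unfolding xh_def ffact_xc by (elim disjE) (simp_all add: e_one)
qed

text \<open>
  The prescribed values of \<open>t x\<^bsup>(n)\<^esup> \<triangleleft> h\<close> and \<open>t x\<^bsup>(n)\<^esup> \<triangleright> h\<close>.
\<close>

definition Rb :: "'c \<Rightarrow> 'g \<Rightarrow> nat \<Rightarrow> ('g letter list \<Rightarrow>\<^sub>0 'k) set" where
  "Rb h t n = e (r (t, h)) \<otimes>\<^sub>H ffact H (xh h) n"

definition Lb :: "'c \<Rightarrow> 'g \<Rightarrow> nat \<Rightarrow> 'c \<Rightarrow>\<^sub>0 'k" where
  "Lb h t n = (if n = 0 then basis_vec (l (t, h)) else \<zero>\<^bsub>A\<^esub>)"

definition ract where "ract u a = lin_ext H (\<lambda>h. blin H (Rb h) u) a"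
definition lact where "lact u a = lin_ext A (\<lambda>h. blin A (Lb h) u) a"

lemma Rb_closed [simp]: "h \<in> carrier \<Gamma> \<Longrightarrow> t \<in> carrier G \<Longrightarrow> Rb h t n \<in> carrier H" by (simp add: Rb_def)
lemma Lb_closed [simp]: "h \<in> carrier \<Gamma> \<Longrightarrow> t \<in> carrier G \<Longrightarrow> Lb h t n \<in> carrier A" by (simp add: Lb_def)

lemma bilin_lin_ext:
  assumes W: "vspace W" and \<phi>: "\<And>h. h \<in> carrier \<Gamma> \<Longrightarrow> klinear H W (\<phi> h)"
  shows "bilin H A W (\<lambda>u a. lin_ext W (\<lambda>h. \<phi> h u) a)"
proof (rule bilinI)
  fix u assume u: "u \<in> carrier H"
  have "klinear (group_alg \<Gamma>) W (lin_ext W (\<lambda>h. \<phi> h u))"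
    by (rule klinear_group_alg[OF W]) (use klinear_closed[OF \<phi>] u in auto)
  then show "klinear A W (lin_ext W (\<lambda>h. \<phi> h u))" by (simp add: klinear_def A_def)
next
  fix a assume a: "a \<in> carrier A"
  have k: "Poly_Mapping.keys a \<subseteq> carrier \<Gamma>" using a by (simp add: A_def)
  show "klinear H W (\<lambda>u. lin_ext W (\<lambda>h. \<phi> h u) a)" unfolding lin_ext_def
    by (rule klinear_finsum_map[OF _ W klinear_scale[OF \<phi> W] H_vspace]) (use k in auto)
qed

lemma bilin_ract: "bilin H A H ract"
  unfolding ract_def[abs_def] by (rule bilin_lin_ext[OF H_vspace blin(1)]) auto
lemma bilin_lact: "bilin H A A lact"
  unfolding lact_def[abs_def] by (rule bilin_lin_ext[OF A_vspace blin(1)]) auto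

text \<open>
  For \<open>n \<ge> p\<close> both sides are \<open>0\<close>, the right-hand side because \<open>\<gamma>\<^sub>h \<in> k\<^sub>g\<close>.
\<close>

lemma ract_bas: assumes "t \<in> carrier G" "h \<in> carrier \<Gamma>" shows "ract (bas t n) (basis_vec h) = Rb h t n"
proof -
  have "ract (bas t n) (basis_vec h) = blin H (Rb h) (bas t n)"
    unfolding ract_def by (rule lin_ext_basis) (use assms klinear_closed[OF blin(1)[OF H_vspace, of "Rb h"]] in simp_all)
  also have "\<dots> = Rb h t n"
  proof (cases "n < CHAR('k)")
    case True then show ?thesis using assms by (intro blin(2)) auto
  next
    case False
    then have "CHAR('k) \<le> n" by simp
    then have "ffact H (xh h) n = \<zero>\<^sub>H"
      by (induction n rule: dec_induct) (simp_all add: ffact_xh assms)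
    then show ?thesis using False assms klinear_zero[OF blin(1)[of H "Rb h"]] by (simp add: bas_ge Rb_def)
  qed
  finally show ?thesis .
qed

lemma lact_bas: assumes "t \<in> carrier G" "h \<in> carrier \<Gamma>" shows "lact (bas t n) (basis_vec h) = Lb h t n"
proof -
  have "lact (bas t n) (basis_vec h) = blin A (Lb h) (bas t n)"
    unfolding lact_def by (rule lin_ext_basis) (use assms klinear_closed[OF blin(1)[OF A_vspace, of "Lb h"]] in simp_all)
  also have "\<dots> = Lb h t n"
  proof (cases "n < CHAR('k)")
    case True then show ?thesis using assms by (intro blin(2)) auto
  next
    case False
    then show ?thesis using assms klinear_zero[OF blin(1)[of A "Lb h"]] char_pos by (auto simp: bas_ge Lb_def)
  qed
  finally show ?thesis .
qed

lemma act_closed [simp]: "u \<in> carrier H \<Longrightarrow> a \<in> carrier A \<Longrightarrow> ract u a \<in> carrier H"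
  "u \<in> carrier H \<Longrightarrow> a \<in> carrier A \<Longrightarrow> lact u a \<in> carrier A"
  by (rule bilin_closed[OF bilin_ract] bilin_closed[OF bilin_lact]; assumption)+

lemmas rlin = bilin_left[OF bilin_ract] and llin = bilin_left[OF bilin_lact]

lemma act_e: "t \<in> carrier G \<Longrightarrow> h \<in> carrier \<Gamma> \<Longrightarrow> ract (e t) (basis_vec h) = e (r (t, h))"
  "t \<in> carrier G \<Longrightarrow> h \<in> carrier \<Gamma> \<Longrightarrow> lact (e t) (basis_vec h) = basis_vec (l (t, h))"
  using ract_bas[of t h 0] lact_bas[of t h 0] by (simp_all add: Rb_def Lb_def)

text \<open>
  Besides the values on the basis, the axioms only use how the actions behave on right multiples
  \<open>w x\<close> and \<open>w t\<close>. These four rules hold for arbitrary \<open>w\<close> and are the axiom for \<open>(u v) \<triangleleft> a\<close> and the module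
  law for \<open>\<triangleright>\<close> at generators \<open>v\<close>.
\<close>

lemma ract_mult_x:
  assumes h: "h \<in> carrier \<Gamma>" and w: "w \<in> carrier H"
  shows "ract (w \<otimes>\<^sub>H x) (basis_vec h) = ract w (basis_vec h) \<otimes>\<^sub>H xh h"
proof (rule H_ext[OF _ _ _ w])
  note L = rlin[OF bv_closed[OF h]]
  show "klinear H H (\<lambda>w. ract (w \<otimes>\<^sub>H x) (basis_vec h))"
    by (rule klinear_comp[OF klinear_mult_right L]) simp_all
  show "klinear H H (\<lambda>w. ract w (basis_vec h) \<otimes>\<^sub>H xh h)"
    by (rule klinear_comp[OF L klinear_mult_right]) simp_all
  fix t n assume t: "t \<in> carrier G"
  then show "ract (bas t n \<otimes>\<^sub>H x) (basis_vec h) = ract (bas t n) (basis_vec h) \<otimes>\<^sub>H xh h"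
    using h by (simp add: bas_mult_x klinear_add[OF L] klinear_smult[OF L] ract_bas Rb_def ka_assoc
        ffact_mult ka_mult_add ka_mult_smult del: ffact.simps)
qed

lemma lact_mult_x:
  assumes h: "h \<in> carrier \<Gamma>" and w: "w \<in> carrier H"
  shows "lact (w \<otimes>\<^sub>H x) (basis_vec h) = \<zero>\<^bsub>A\<^esub>"
proof (rule H_ext[OF _ _ _ w])
  note L = llin[OF bv_closed[OF h]]
  show "klinear H A (\<lambda>w. lact (w \<otimes>\<^sub>H x) (basis_vec h))"
    by (rule klinear_comp[OF klinear_mult_right L]) simp_all
  show "klinear H A (\<lambda>w. \<zero>\<^bsub>A\<^esub>)" by (rule klinear_const_zero) simp
  fix t n assume t: "t \<in> carrier G"
  then show "lact (bas t n \<otimes>\<^sub>H x) (basis_vec h) = \<zero>\<^bsub>A\<^esub>"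
    using h by (auto simp: bas_mult_x klinear_add[OF L] klinear_smult[OF L] lact_bas Lb_def)
qed

lemma bas_Suc_mult_e:
  assumes s: "s \<in> carrier G" and t: "t \<in> carrier G"
  shows "bas s (Suc n) \<otimes>\<^sub>H e t = (bas s n \<otimes>\<^sub>H e t) \<otimes>\<^sub>H x \<ominus>\<^sub>H
     f t \<odot>\<^sub>H (bas s n \<otimes>\<^sub>H e t \<ominus>\<^sub>H bas s n \<otimes>\<^sub>H e (t \<otimes> g)) \<ominus>\<^sub>H of_nat n \<odot>\<^sub>H (bas s n \<otimes>\<^sub>H e t)"
proof -
  have "bas s (Suc n) \<otimes>\<^sub>H e t = bas s n \<otimes>\<^sub>H (x \<otimes>\<^sub>H e t) \<ominus>\<^sub>H of_nat n \<odot>\<^sub>H (bas s n \<otimes>\<^sub>H e t)"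
    using s t by (simp add: bas_Suc ka_assoc ka_minus_mult ka_smult_mult ka_mult_minus ka_mult_smult)
  then show ?thesis unfolding x_mult_e[OF t] using s t
    by (simp add: ka_mult_minus ka_mult_smult ka_assoc)
qed

lemma lact_mult_e:
  assumes h: "h \<in> carrier \<Gamma>" and w: "w \<in> carrier H" and t: "t \<in> carrier G"
  shows "lact (w \<otimes>\<^sub>H e t) (basis_vec h) = lact w (basis_vec (l (t, h)))"
proof (rule H_ext[OF _ _ _ w])
  note L = llin[OF bv_closed[OF h]]
  show "klinear H A (\<lambda>w. lact (w \<otimes>\<^sub>H e t) (basis_vec h))"
    by (rule klinear_comp[OF klinear_mult_right L]) (use t in simp_all)
  show "klinear H A (\<lambda>w. lact w (basis_vec (l (t, h))))" by (rule llin) (use t h in simp)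
  fix s n assume s: "s \<in> carrier G"
  show "lact (bas s n \<otimes>\<^sub>H e t) (basis_vec h) = lact (bas s n) (basis_vec (l (t, h)))"
    using t
  proof (induction n arbitrary: t)
    case 0
    then show ?case using s h by (simp add: e_mult act_e group_pair_laws)
  next
    case (Suc n)
    have z: "of_nat n \<odot>\<^bsub>A\<^esub> Lb (l (t, h)) s n = \<zero>\<^bsub>A\<^esub>" using s h Suc(2) by (simp add: Lb_def)
    show ?case unfolding bas_Suc_mult_e[OF s Suc(2)]
      using s h Suc(2) vs_minus_eq_zero[of A "Lb (l (t, h)) s n" "Lb (l (t, h)) s n"] vs_minus_eq_zero[of A "\<zero>\<^bsub>A\<^esub>" "\<zero>\<^bsub>A\<^esub>"]
      by (simp add: klinear_minus[OF L] klinear_smult[OF L] lact_mult_x Suc(1) lr_g lact_bas z) (auto simp: Lb_def)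
  qed
qed

text \<open>
  By induction on \<open>n\<close>, moving \<open>x\<close> to the right of \<open>t\<close>. The step amounts to
  \<open>(t \<triangleleft> h) x\<^sub>h - f(t) (t \<triangleleft> h) (1 - g) = x\<^sub>l (t \<triangleleft> h)\<close> for \<open>x\<^sub>h = x \<triangleleft> h\<close> and \<open>l = t \<triangleright> h\<close>, which is equivalent to the
  equation for \<open>f(t \<triangleleft> h)\<close>.
\<close>

lemma ract_mult_e:
  assumes h: "h \<in> carrier \<Gamma>" and w: "w \<in> carrier H" and t: "t \<in> carrier G"
  shows "ract (w \<otimes>\<^sub>H e t) (basis_vec h) = ract w (basis_vec (l (t, h))) \<otimes>\<^sub>H e (r (t, h))"
proof (rule H_ext[OF _ _ _ w])
  note L = rlin[OF bv_closed[OF h]]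
  show "klinear H H (\<lambda>w. ract (w \<otimes>\<^sub>H e t) (basis_vec h))"
    by (rule klinear_comp[OF klinear_mult_right L]) (use t in simp_all)
  show "klinear H H (\<lambda>w. ract w (basis_vec (l (t, h))) \<otimes>\<^sub>H e (r (t, h)))"
    by (rule klinear_comp[OF rlin klinear_mult_right]) (use t h in simp_all)
  fix s n assume s: "s \<in> carrier G"
  show "ract (bas s n \<otimes>\<^sub>H e t) (basis_vec h) = ract (bas s n) (basis_vec (l (t, h))) \<otimes>\<^sub>H e (r (t, h))"
    using t
  proof (induction n arbitrary: t)
    case 0
    then show ?case using s h by (simp add: e_mult act_e group_pair_laws)
  next
    case (Suc n)
    note t = Suc(2)
    let ?R = "Rb (l (t, h)) s n" and ?r = "r (t, h)" and ?c = "\<gamma> (l (t, h))"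
    have [simp]: "?R \<in> carrier H" using s t h by simp
    have "ract (bas s (Suc n) \<otimes>\<^sub>H e t) (basis_vec h) = (?R \<otimes>\<^sub>H e ?r) \<otimes>\<^sub>H xh h \<ominus>\<^sub>H
       f t \<odot>\<^sub>H (?R \<otimes>\<^sub>H e ?r \<ominus>\<^sub>H ?R \<otimes>\<^sub>H e (?r \<otimes> g)) \<ominus>\<^sub>H of_nat n \<odot>\<^sub>H (?R \<otimes>\<^sub>H e ?r)"
      unfolding bas_Suc_mult_e[OF s t]
      using s h t by (simp add: klinear_minus[OF L] klinear_smult[OF L] ract_mult_x Suc(1) lr_g ract_bas)
    also have "\<dots> = ?R \<otimes>\<^sub>H (e ?r \<otimes>\<^sub>H xh h \<ominus>\<^sub>H f t \<odot>\<^sub>H (e ?r \<ominus>\<^sub>H e (?r \<otimes> g)) \<ominus>\<^sub>H of_nat n \<odot>\<^sub>H e ?r)"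
      using s h t by (simp add: ka_mult_minus ka_mult_smult ka_assoc)
    also have "e ?r \<otimes>\<^sub>H xh h \<ominus>\<^sub>H f t \<odot>\<^sub>H (e ?r \<ominus>\<^sub>H e (?r \<otimes> g)) = xh (l (t, h)) \<otimes>\<^sub>H e ?r"
      using s h t unfolding xh_def xc_def
      by (simp add: ka_distribs e_mult x_mult_e g_central \<gamma>(3))
        (rule lincomb_eqI[where V = H], (rule lincomb_intros | rule lincomb_atom | simp)+, (simp add: algebra_simps)?)
    also have "?R \<otimes>\<^sub>H (xh (l (t, h)) \<otimes>\<^sub>H e ?r \<ominus>\<^sub>H of_nat n \<odot>\<^sub>H e ?r) = (?R \<otimes>\<^sub>H (xh (l (t, h)) \<ominus>\<^sub>H of_nat n \<odot>\<^sub>H \<one>\<^sub>H)) \<otimes>\<^sub>H e ?r"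
      using s h t by (simp add: ka_distribs ka_assoc)
    also have "?R \<otimes>\<^sub>H (xh (l (t, h)) \<ominus>\<^sub>H of_nat n \<odot>\<^sub>H \<one>\<^sub>H) = Rb (l (t, h)) s (Suc n)"
      using s h t by (simp add: Rb_def ka_assoc)
    finally show ?case using s h t by (simp add: ract_bas)
  qed
qed

lemma ract_mult_gpow: "h \<in> carrier \<Gamma> \<Longrightarrow> w \<in> carrier H \<Longrightarrow> ract (w \<otimes>\<^sub>H e (g [^] (n::nat))) (basis_vec h) = ract w (basis_vec h) \<otimes>\<^sub>H e (g [^] n)"
  and lact_mult_gpow: "h \<in> carrier \<Gamma> \<Longrightarrow> w \<in> carrier H \<Longrightarrow> lact (w \<otimes>\<^sub>H e (g [^] (n::nat))) (basis_vec h) = lact w (basis_vec h)"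
  by (simp_all add: ract_mult_e lact_mult_e lr_gpow)

text \<open>
  Additivity of \<open>\<gamma>\<close> in the form needed for \<open>u \<triangleleft> (h k) = (u \<triangleleft> h) \<triangleleft> k\<close>.
\<close>

lemma act_mult_xh:
  assumes h: "h \<in> carrier \<Gamma>" "k \<in> carrier \<Gamma>" and w: "w \<in> carrier H"
  shows "ract (w \<otimes>\<^sub>H xh h) (basis_vec k) = ract w (basis_vec k) \<otimes>\<^sub>H xh (h \<otimes>\<^bsub>\<Gamma>\<^esub> k)"
    "lact (w \<otimes>\<^sub>H xh h) (basis_vec k) = \<zero>\<^bsub>A\<^esub>"
proof -
  have e: "w \<otimes>\<^sub>H xh h = w \<otimes>\<^sub>H x \<oplus>\<^sub>H \<gamma> h \<odot>\<^sub>H (w \<ominus>\<^sub>H w \<otimes>\<^sub>H e g)"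
    using w by (simp add: xh_def xc_def ka_distribs)
  note L = rlin[OF bv_closed[OF h(2)]] and M = llin[OF bv_closed[OF h(2)]]
  have "ract (w \<otimes>\<^sub>H xh h) (basis_vec k) = ract w (basis_vec k) \<otimes>\<^sub>H xh k \<oplus>\<^sub>H \<gamma> h \<odot>\<^sub>H (ract w (basis_vec k) \<ominus>\<^sub>H ract w (basis_vec k) \<otimes>\<^sub>H e g)"
    unfolding e using w h by (simp add: klinear_add[OF L] klinear_smult[OF L] klinear_minus[OF L] ract_mult_x ract_mult_e group_pair_laws)
  also have "\<dots> = ract w (basis_vec k) \<otimes>\<^sub>H xh (h \<otimes>\<^bsub>\<Gamma>\<^esub> k)"
    using w h by (simp add: xh_def xc_def ka_distribs \<gamma>(2))
      (rule lincomb_eqI[where V = H], (rule lincomb_intros | rule lincomb_atom | simp)+, (simp add: algebra_simps)?)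
  finally show "ract (w \<otimes>\<^sub>H xh h) (basis_vec k) = ract w (basis_vec k) \<otimes>\<^sub>H xh (h \<otimes>\<^bsub>\<Gamma>\<^esub> k)" .
  show "lact (w \<otimes>\<^sub>H xh h) (basis_vec k) = \<zero>\<^bsub>A\<^esub>"
    unfolding e using w h vs_minus_eq_zero[of A "lact w (basis_vec k)" "lact w (basis_vec k)"]
    by (simp add: klinear_add[OF M] klinear_smult[OF M] klinear_minus[OF M] lact_mult_x lact_mult_e group_pair_laws)
qed

lemma act_mult_ffact_xh:
  assumes h: "h \<in> carrier \<Gamma>" "k \<in> carrier \<Gamma>" and w: "w \<in> carrier H"
  shows "ract (w \<otimes>\<^sub>H ffact H (xh h) n) (basis_vec k) = ract w (basis_vec k) \<otimes>\<^sub>H ffact H (xh (h \<otimes>\<^bsub>\<Gamma>\<^esub> k)) n"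
    "lact (w \<otimes>\<^sub>H ffact H (xh h) n) (basis_vec k) = (if n = 0 then lact w (basis_vec k) else \<zero>\<^bsub>A\<^esub>)"
proof -
  note L = rlin[OF bv_closed[OF h(2)]] and M = llin[OF bv_closed[OF h(2)]]
  have s: "w \<otimes>\<^sub>H ffact H (xh h) (Suc n) = (w \<otimes>\<^sub>H ffact H (xh h) n) \<otimes>\<^sub>H xh h \<ominus>\<^sub>H of_nat n \<odot>\<^sub>H (w \<otimes>\<^sub>H ffact H (xh h) n)" for n
    using w by (simp add: ka_distribs ka_assoc)
  show "ract (w \<otimes>\<^sub>H ffact H (xh h) n) (basis_vec k) = ract w (basis_vec k) \<otimes>\<^sub>H ffact H (xh (h \<otimes>\<^bsub>\<Gamma>\<^esub> k)) n"
  proof (induction n)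
    case (Suc n)
    show ?case unfolding s using w h
      by (simp add: klinear_minus[OF L] klinear_smult[OF L] act_mult_xh Suc del: ffact.simps) (simp add: ka_distribs ka_assoc)
  qed (use w h in simp)
  show "lact (w \<otimes>\<^sub>H ffact H (xh h) n) (basis_vec k) = (if n = 0 then lact w (basis_vec k) else \<zero>\<^bsub>A\<^esub>)"
  proof (induction n)
    case (Suc n)
    show ?case unfolding s using w h vs_minus_eq_zero[of A "\<zero>\<^bsub>A\<^esub>" "\<zero>\<^bsub>A\<^esub>"]
      by (simp add: klinear_minus[OF M] klinear_smult[OF M] act_mult_xh Suc del: ffact.simps)
  qed (use w h in simp)
qed

lemma xh_one [simp]: "xh \<one>\<^bsub>\<Gamma>\<^esub> = x" by (simp add: xh_def)

lemma act_mult_bas: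
  assumes h: "h \<in> carrier \<Gamma>" and w: "w \<in> carrier H" and t: "t \<in> carrier G"
  shows "ract (w \<otimes>\<^sub>H bas t n) (basis_vec h) = ract w (basis_vec (l (t, h))) \<otimes>\<^sub>H Rb h t n"
    "lact (w \<otimes>\<^sub>H bas t n) (basis_vec h) = (if n = 0 then lact w (basis_vec (l (t, h))) else \<zero>\<^bsub>A\<^esub>)"
  using act_mult_ffact_xh[of "\<one>\<^bsub>\<Gamma>\<^esub>" h "w \<otimes>\<^sub>H e t" n] assms
  by (simp_all add: bas_def Rb_def ka_assoc[symmetric] ract_mult_e lact_mult_e)

definition alpha where "alpha = restrict (\<lambda>T. sweedler A T lact) (carrier HA)"
definition beta where "beta = restrict (\<lambda>T. sweedler H T ract) (carrier HA)"

lemma alpha_beta_pure [simp]: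
  "u \<in> carrier H \<Longrightarrow> a \<in> carrier A \<Longrightarrow> alpha (pure_tensor H A u a) = lact u a"
  "u \<in> carrier H \<Longrightarrow> a \<in> carrier A \<Longrightarrow> beta (pure_tensor H A u a) = ract u a"
  by (simp_all add: alpha_def beta_def sweedler_pure[OF H_vspace A_vspace A_vspace bilin_lact]
    sweedler_pure[OF H_vspace A_vspace H_vspace bilin_ract])

lemma klinear_alpha: "klinear HA A alpha" and klinear_beta: "klinear HA H beta"
  unfolding alpha_def beta_def
  by (rule klinear_cong[OF klinear_sweedler[OF H_vspace A_vspace A_vspace bilin_lact]]
        klinear_cong[OF klinear_sweedler[OF H_vspace A_vspace H_vspace bilin_ract]]; simp)+

lemma bilin_alpha: "bilin H A A (\<lambda>u a. alpha (pure_tensor H A u a))"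
  by (rule bilin_out[OF bilin_pure_tensor klinear_alpha]) simp_all
lemma bilin_beta: "bilin H A H (\<lambda>u a. beta (pure_tensor H A u a))"
  by (rule bilin_out[OF bilin_pure_tensor klinear_beta]) simp_all

text \<open>
  Every axiom compares maps that are linear in each argument, so the arguments may be taken from the
  bases of \<open>A\<close> and \<open>H\<close>. As \<open>t x\<^bsup>(n)\<^esup> \<triangleright> h = 0\<close> for \<open>n > 0\<close>, one term remains of each Sweedler sum that
  contains \<open>\<triangleright>\<close>; the compatibility of \<open>\<triangleleft>\<close> with the coproduct is the binomial theorem for \<open>x \<triangleleft> h\<close>.
\<close>

theorem hopf_matched_pair_datum: "hopf_matched_pair A H alpha beta"
proof -
  let ?l = "\<lambda>u a. alpha (pure_tensor H A u a)" and ?r = "\<lambda>u a. beta (pure_tensor H A u a)"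
  note bl = bilin_alpha and br = bilin_beta
  let ?AA = "tensor A A"
  have v: "vspace A" "vspace H" "vspace ?AA" "vspace HH" "vspace HA" by simp_all
  note pAA = bilin_pure_tensor[OF v(1) v(1)] and pHH = bilin_pure_tensor[OF v(2) v(2)] and pHA = bilin_pure_tensor[OF v(2) v(1)]
  note cA = khom_klinear[OF comult_A_khom] and cH = khom_klinear[OF comult_khom]
  note eA = khom_klinear[OF counit_A_khom] and eH = khom_klinear[OF counit_khom]
  note lc = klinear_closed[OF klinear_alpha pure_tensor_closed[OF v(2) v(1)]]
  note rc = klinear_closed[OF klinear_beta pure_tensor_closed[OF v(2) v(1)]]
  have gmul: "bilin ground ground ground (\<lambda>c d :: 'k. c * d)"
    by (rule bilinI; rule klinearI) (simp_all add: algebra_simps)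
  have L1: "?l \<one>\<^sub>H a = a" if a: "a \<in> carrier A" for a
    by (rule A_ext[OF bilin_right[OF bl] klinear_id _ _ a])
      (use act_e(2)[of "\<one>"] in \<open>auto simp: e_one group_pair_laws\<close>)
  have L2: "?l (u \<otimes>\<^sub>H w) a = ?l u (?l w a)" if u: "u \<in> carrier H" "w \<in> carrier H" "a \<in> carrier A" for u w a
  proof (rule bilin_ext[OF _ _ _ _ u(2,3)])
    show "bilin H A A (\<lambda>w a. ?l (u \<otimes>\<^sub>H w) a)"
      by (rule bilin_comp[OF bl klinear_mult_left klinear_id]) (use u in auto)
    show "bilin H A A (\<lambda>w a. ?l u (?l w a))"
      by (rule bilin_out[OF bl bilin_right[OF bl]]) (use u in auto)
    fix t n h assume th: "t \<in> carrier G" "h \<in> carrier \<Gamma>"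
    have z: "lact u \<zero>\<^bsub>A\<^esub> = \<zero>\<^bsub>A\<^esub>" using klinear_zero[OF bilin_right[OF bilin_lact u(1)]] by simp
    show "?l (u \<otimes>\<^sub>H bas t n) (basis_vec h) = ?l u (?l (bas t n) (basis_vec h))"
      using th u by (simp add: act_mult_bas lact_bas Lb_def z)
  qed simp
  have L3: "comult A (?l u a) = sweedler ?AA (comult H u) (\<lambda>u1 u2.
      sweedler ?AA (comult A a) (\<lambda>a1 a2. pure_tensor A A (?l u1 a1) (?l u2 a2)))" if u: "u \<in> carrier H" "a \<in> carrier A" for u a
  proof (rule bilin_ext[OF bilin_out[OF bl cA] bilin_double_sweedler[OF v(1,1,3) bl bl pAA] v(3) _ u])
    fix t n h assume th: "t \<in> carrier G" "h \<in> carrier \<Gamma>"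
    show "comult A (?l (bas t n) (basis_vec h)) = sweedler ?AA (comult H (bas t n)) (\<lambda>u1 u2.
      sweedler ?AA (comult A (basis_vec h)) (\<lambda>a1 a2. pure_tensor A A (?l u1 a1) (?l u2 a2)))"
      by (subst double_sweedler_bas[OF v(1,1,3) bl bl pAA th, of 0])
        (use th klinear_zero[OF cA] in \<open>auto simp: lact_bas lact_mult_gpow Lb_def e_one A_bv act_e\<close>)
  qed
  have L4: "counit A (?l u a) = counit H u * counit A a" if u: "u \<in> carrier H" "a \<in> carrier A" for u a
    by (rule bilin_ext[OF bilin_out[OF bl eA] bilin_comp[OF gmul eH eA] vspace_ground _ u])
      (use klinear_zero[OF eA] in \<open>auto simp: lact_bas Lb_def A_bv counit_bas\<close>)
  have R1: "?r u \<one>\<^bsub>A\<^esub> = u" if u: "u \<in> carrier H" for u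
    by (rule H_ext[OF bilin_left[OF br] klinear_id _ u]) (auto simp: A_one ract_bas, simp_all add: Rb_def group_pair_laws bas_def)
  have R2: "?r u (a \<otimes>\<^bsub>A\<^esub> b) = ?r (?r u a) b" if u: "u \<in> carrier H" "a \<in> carrier A" "b \<in> carrier A" for u a b
  proof (rule A_ext[OF _ _ v(2) _ u(3)])
    show "klinear A H (\<lambda>b. ?r u (a \<otimes>\<^bsub>A\<^esub> b))"
      by (rule klinear_comp[OF klinear_mult_left bilin_right[OF br]]) (use u in auto)
    show "klinear A H (\<lambda>b. ?r (?r u a) b)" by (rule bilin_right[OF br]) (use u rc in auto)
    fix k assume k: "k \<in> carrier \<Gamma>"
    show "?r u (a \<otimes>\<^bsub>A\<^esub> basis_vec k) = ?r (?r u a) (basis_vec k)"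
    proof (rule bilin_ext[OF _ _ v(2) _ u(1,2)])
      show "bilin H A H (\<lambda>u a. ?r u (a \<otimes>\<^bsub>A\<^esub> basis_vec k))"
        by (rule bilin_comp[OF br klinear_id klinear_mult_right]) (use k in auto)
      show "bilin H A H (\<lambda>u a. ?r (?r u a) (basis_vec k))"
        by (rule bilin_out[OF br bilin_left[OF br]]) (use k in auto)
      fix t n h assume th: "t \<in> carrier G" "h \<in> carrier \<Gamma>"
      show "?r (bas t n) (basis_vec h \<otimes>\<^bsub>A\<^esub> basis_vec k) = ?r (?r (bas t n) (basis_vec h)) (basis_vec k)"
        using th k by (simp add: bv_mult ract_bas) (simp add: Rb_def act_mult_ffact_xh act_e group_pair_laws)
    qed
  qed
  have R3: "comult H (?r u a) = sweedler HH (comult H u) (\<lambda>u1 u2.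
      sweedler HH (comult A a) (\<lambda>a1 a2. pure_tensor H H (?r u1 a1) (?r u2 a2)))" if u: "u \<in> carrier H" "a \<in> carrier A" for u a
  proof (rule bilin_ext[OF bilin_out[OF br cH] bilin_double_sweedler[OF v(2,2,4) br br pHH] v(4) _ u])
    fix t n h assume th: "t \<in> carrier G" "h \<in> carrier \<Gamma>"
    interpret T: abelian_group HH by (rule vspace_abelian_group) simp
    have "sweedler HH (comult H (bas t n)) (\<lambda>u1 u2. sweedler HH (comult A (basis_vec h)) (\<lambda>a1 a2. pure_tensor H H (?r u1 a1) (?r u2 a2))) =
      (\<Oplus>\<^bsub>HH\<^esub>k\<in>{..n}. of_nat (n choose k) \<odot>\<^bsub>HH\<^esub> pure_tensor H H (?r (bas t (n - k) \<otimes>\<^sub>H e (g [^] k)) (basis_vec h)) (?r (bas t k) (basis_vec h)))"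
      using th by (subst double_sweedler_bv[OF v(2,2,4) br br pHH])
        (simp_all add: sweedler_bas[OF v(4) bilin_inner_H[OF v(2,2,4) br br pHH]] del: alpha_beta_pure)
    also have "\<dots> = (\<Oplus>\<^bsub>HH\<^esub>k\<in>{..n}. of_nat (n choose k) \<odot>\<^bsub>HH\<^esub>
      pure_tensor H H ((e (r (t, h)) \<otimes>\<^sub>H ffact H (xh h) (n - k)) \<otimes>\<^sub>H e (g [^] k)) (e (r (t, h)) \<otimes>\<^sub>H ffact H (xh h) k))"
      by (rule T.finsum_cong') (use th in \<open>auto simp: ract_mult_gpow ract_bas Rb_def\<close>)
    also have "\<dots> = comult H (e (r (t, h)) \<otimes>\<^sub>H ffact H (xh h) n)"
      by (rule comult_skew_ffact[symmetric]) (use th in \<open>auto simp: xh_def comult_xc g_mult_xc\<close>)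
    finally show "comult H (?r (bas t n) (basis_vec h)) = sweedler HH (comult H (bas t n)) (\<lambda>u1 u2.
      sweedler HH (comult A (basis_vec h)) (\<lambda>a1 a2. pure_tensor H H (?r u1 a1) (?r u2 a2)))"
      using th by (simp add: ract_bas Rb_def)
  qed
  have R4: "counit H (?r u a) = counit H u * counit A a" if u: "u \<in> carrier H" "a \<in> carrier A" for u a
  proof (rule bilin_ext[OF bilin_out[OF br eH] bilin_comp[OF gmul eH eA] vspace_ground _ u])
    fix t n h assume th: "t \<in> carrier G" "h \<in> carrier \<Gamma>"
    have "counit H (xh h) = 0"
      unfolding xh_def xc_def by (simp add: klinear_add[OF eH] klinear_smult[OF eH] klinear_minus[OF eH] counit_x counit_e khom_one[OF counit_khom])
        (simp add: vs_minus_smult)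
    moreover have "ffact ground 0 n = (if n = 0 then 1 else (0::'k))"
      by (induction n) (auto simp: vs_minus_smult)
    ultimately have "counit H (ffact H (xh h) n) = (if n = 0 then 1 else 0)"
      using ffact_khom[OF H_kalgebra counit_khom kalgebra_ground xh_closed] by simp
    then show "counit H (?r (bas t n) (basis_vec h)) = counit H (bas t n) * counit A (basis_vec h)"
      using th by (simp add: ract_bas Rb_def khom_mult[OF counit_khom] counit_e counit_bas A_bv)
  qed
  have U1: "?l u \<one>\<^bsub>A\<^esub> = counit H u \<odot>\<^bsub>A\<^esub> \<one>\<^bsub>A\<^esub>" if u: "u \<in> carrier H" for u
    by (rule H_ext[OF bilin_left[OF bl] klinear_comp[OF eH klinear_smult_vec] _ u])
      (auto simp: A_one lact_bas Lb_def counit_bas)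
  have U2: "?r \<one>\<^sub>H a = counit A a \<odot>\<^sub>H \<one>\<^sub>H" if a: "a \<in> carrier A" for a
    by (rule A_ext[OF bilin_right[OF br] klinear_comp[OF eA klinear_smult_vec] _ _ a])
      (use act_e(1)[of "\<one>"] in \<open>auto simp: A_bv e_one\<close>)
  have C1: "?l u (a \<otimes>\<^bsub>A\<^esub> b) = sweedler A (comult H u) (\<lambda>u1 u2. sweedler A (comult A a) (\<lambda>a1 a2.
      ?l u1 a1 \<otimes>\<^bsub>A\<^esub> ?l (?r u2 a2) b))" if u: "u \<in> carrier H" "a \<in> carrier A" "b \<in> carrier A" for u a b
  proof (rule bilin_ext[OF _ _ v(1) _ u(1,2)])
    have bq: "bilin H A A (\<lambda>u a. ?l (?r u a) b)" by (rule bilin_out[OF br bilin_left[OF bl u(3)]])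
    show "bilin H A A (\<lambda>u a. ?l u (a \<otimes>\<^bsub>A\<^esub> b))"
      by (rule bilin_comp[OF bl klinear_id klinear_mult_right]) (use u in auto)
    show "bilin H A A (\<lambda>u a. sweedler A (comult H u) (\<lambda>u1 u2. sweedler A (comult A a) (\<lambda>a1 a2. ?l u1 a1 \<otimes>\<^bsub>A\<^esub> ?l (?r u2 a2) b)))"
      by (rule bilin_double_sweedler[OF v(1,1,1) bl bq bilin_mult]) simp
    fix t n h assume th: "t \<in> carrier G" "h \<in> carrier \<Gamma>"
    have "sweedler A (comult H (bas t n)) (\<lambda>u1 u2. sweedler A (comult A (basis_vec h)) (\<lambda>a1 a2. ?l u1 a1 \<otimes>\<^bsub>A\<^esub> ?l (?r u2 a2) b))
      = basis_vec (l (t, h)) \<otimes>\<^bsub>A\<^esub> ?l (Rb h t n) b"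
      by (subst double_sweedler_bas[OF v(1,1,1) bl bq bilin_mult[OF A_kalgebra] th order_refl])
        (use th u in \<open>auto simp: lact_mult_gpow act_e ract_bas lact_bas Lb_def\<close>)
    moreover have "?l (bas t n) (basis_vec h \<otimes>\<^bsub>A\<^esub> b) = basis_vec (l (t, h)) \<otimes>\<^bsub>A\<^esub> ?l (Rb h t n) b"
    proof (rule A_ext[OF _ _ v(1) _ u(3)])
      show "klinear A A (\<lambda>b. ?l (bas t n) (basis_vec h \<otimes>\<^bsub>A\<^esub> b))"
        by (rule klinear_comp[OF klinear_mult_left bilin_right[OF bl]]) (use th in auto)
      show "klinear A A (\<lambda>b. basis_vec (l (t, h)) \<otimes>\<^bsub>A\<^esub> ?l (Rb h t n) b)"
        by (rule klinear_comp[OF bilin_right[OF bl] klinear_mult_left]) (use th in auto)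
      fix k assume k: "k \<in> carrier \<Gamma>"
      show "?l (bas t n) (basis_vec h \<otimes>\<^bsub>A\<^esub> basis_vec k) = basis_vec (l (t, h)) \<otimes>\<^bsub>A\<^esub> ?l (Rb h t n) (basis_vec k)"
        using th k by (simp add: bv_mult lact_bas) (simp add: Rb_def Lb_def act_mult_ffact_xh act_e group_pair_laws bv_mult)
    qed
    ultimately show "?l (bas t n) (basis_vec h \<otimes>\<^bsub>A\<^esub> b) = sweedler A (comult H (bas t n)) (\<lambda>u1 u2. sweedler A (comult A (basis_vec h)) (\<lambda>a1 a2. ?l u1 a1 \<otimes>\<^bsub>A\<^esub> ?l (?r u2 a2) b))"
      by simp
  qed
  have C2: "?r (u \<otimes>\<^sub>H w) a = sweedler H (comult H w) (\<lambda>v1 v2. sweedler H (comult A a) (\<lambda>a1 a2.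
      ?r u (?l v1 a1) \<otimes>\<^sub>H ?r v2 a2))" if u: "u \<in> carrier H" "w \<in> carrier H" "a \<in> carrier A" for u w a
  proof (rule bilin_ext[OF _ _ v(2) _ u(2,3)])
    have bp: "bilin H A H (\<lambda>v a. ?r u (?l v a))" by (rule bilin_out[OF bl bilin_right[OF br u(1)]])
    show "bilin H A H (\<lambda>w a. ?r (u \<otimes>\<^sub>H w) a)"
      by (rule bilin_comp[OF br klinear_mult_left klinear_id]) (use u in auto)
    show "bilin H A H (\<lambda>w a. sweedler H (comult H w) (\<lambda>v1 v2. sweedler H (comult A a) (\<lambda>a1 a2. ?r u (?l v1 a1) \<otimes>\<^sub>H ?r v2 a2)))"
      by (rule bilin_double_sweedler[OF v(2,2,2) bp br bilin_mult]) simp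
    fix t n h assume th: "t \<in> carrier G" "h \<in> carrier \<Gamma>"
    have z: "beta \<zero>\<^bsub>HA\<^esub> = \<zero>\<^sub>H" by (rule klinear_zero[OF klinear_beta v(5,2)])
    show "?r (u \<otimes>\<^sub>H bas t n) (basis_vec h) = sweedler H (comult H (bas t n)) (\<lambda>v1 v2. sweedler H (comult A (basis_vec h)) (\<lambda>a1 a2. ?r u (?l v1 a1) \<otimes>\<^sub>H ?r v2 a2))"
      by (subst double_sweedler_bas[OF v(2,2,2) bp br bilin_mult[OF H_kalgebra] th order_refl])
        (use th u in \<open>auto simp: lact_mult_gpow act_e ract_bas lact_bas Lb_def z act_mult_bas\<close>)
  qed
  have C3: "sweedler HA (comult H u) (\<lambda>u1 u2. sweedler HA (comult A a) (\<lambda>a1 a2. pure_tensor H A (?r u1 a1) (?l u2 a2))) =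
        sweedler HA (comult H u) (\<lambda>u1 u2. sweedler HA (comult A a) (\<lambda>a1 a2. pure_tensor H A (?r u2 a2) (?l u1 a1)))"
    if u: "u \<in> carrier H" "a \<in> carrier A" for u a
  proof (rule bilin_ext[OF bilin_double_sweedler[OF v(2,1,5) br bl pHA] bilin_double_sweedler[OF v(1,2,5) bl br bilin_flip[OF pHA]] v(5) _ u])
    fix t n h assume th: "t \<in> carrier G" "h \<in> carrier \<Gamma>"
    show "sweedler HA (comult H (bas t n)) (\<lambda>u1 u2. sweedler HA (comult A (basis_vec h)) (\<lambda>a1 a2. pure_tensor H A (?r u1 a1) (?l u2 a2))) =
        sweedler HA (comult H (bas t n)) (\<lambda>u1 u2. sweedler HA (comult A (basis_vec h)) (\<lambda>a1 a2. pure_tensor H A (?r u2 a2) (?l u1 a1)))"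
      apply (subst double_sweedler_bas[OF v(2,1,5) br bl pHA th, of 0])
        apply (use th in \<open>auto simp: lact_bas Lb_def\<close>)[2]
      apply (subst double_sweedler_bas[OF v(1,2,5) bl br bilin_flip[OF pHA] th order_refl])
       apply (use th in \<open>auto simp: lact_mult_gpow act_e ract_bas lact_bas Lb_def e_one\<close>)
      done
  qed
  show ?thesis unfolding hopf_matched_pair_def Let_def left_module_coalgebra_def right_module_coalgebra_def
    using hopf_algebra_A hopf_algebra_H klinear_alpha klinear_beta L1 L2 L3 L4 R1 R2 R3 R4 U1 U2 C1 C2 C3
    by (simp add: alpha_def beta_def)
qed

end

section \<open>From matched pairs of Hopf algebras to group data\<close>

lemma ground_minus [simp]: "(a :: 'b::field) \<ominus>\<^bsub>ground\<^esub> b = a - b"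
  by (simp add: vs_minus_smult)

context third_type
begin

lemma char_gt_1: "1 < CHAR('k)"
  using prime_CHAR_semidom[OF char_pos] prime_gt_1_nat by blast

lemma e_inj: "s \<in> carrier G \<Longrightarrow> t \<in> carrier G \<Longrightarrow> e s = e t \<longleftrightarrow> s = t"
  by (metis coord_e char_pos one_neq_zero)

lemma coord_one: "t \<in> carrier G \<Longrightarrow> n < CHAR('k) \<Longrightarrow> coord t n \<one>\<^sub>H = (if t = \<one> \<and> n = 0 then 1 else 0)"
  using coord_e[of t n "\<one>"] by (auto simp: e_one)

lemma coord_x: "t \<in> carrier G \<Longrightarrow> n < CHAR('k) \<Longrightarrow> coord t n x = (if t = \<one> \<and> n = 1 then 1 else 0)"
  using coord(2)[of t n "\<one>" "Suc 0"] by (auto simp: bas_one_1)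

lemma coord_e_x: "t \<in> carrier G \<Longrightarrow> n < CHAR('k) \<Longrightarrow> s \<in> carrier G \<Longrightarrow> coord t n (e s \<otimes>\<^sub>H x) = (if s = t \<and> n = 1 then 1 else 0)"
  using coord(2)[of t n s "Suc 0"] bas_mult_x[of s 0] by auto

lemmas coord_lin = klinear_add[OF coord(1)] klinear_smult[OF coord(1)] klinear_minus[OF coord(1)]

lemma coord_xc: "coord \<one> 0 (xc c) = c"
  using g_neq_one by (simp add: xc_def coord_lin char_pos coord_x coord_one coord_e)

lemma xc_add: "xc c \<oplus>\<^sub>H d \<odot>\<^sub>H (\<one>\<^sub>H \<ominus>\<^sub>H e g) = xc (c + d)"
  unfolding xc_def by (rule lincomb_eqI[where V = H], (rule lincomb_intros | rule lincomb_atom | simp)+, (simp add: algebra_simps)?)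

end

context third_type_pair
begin

lemma klinear_lookup: "klinear A ground (\<lambda>v. Poly_Mapping.lookup v h)"
  by (rule klinearI) (auto simp: A_def lookup_add)

text \<open>
  Contract \<open>\<Delta>(a) = a \<otimes> a\<close> with the coefficient at a point \<open>h\<close> of the support of \<open>a\<close>: since the group
  elements are group-like, the result is a multiple of \<open>h\<close>.
\<close>

lemma group_like_A:
  assumes a: "a \<in> carrier A" "comult A a = pure_tensor A A a a" "a \<noteq> \<zero>\<^bsub>A\<^esub>"
  shows "\<exists>h\<in>carrier \<Gamma>. a = basis_vec h"
proof -
  have "a \<noteq> 0" using a(3) by (simp add: A_def)
  then obtain h where h: "Poly_Mapping.lookup a h \<noteq> 0" by (metis poly_mapping_eqI lookup_zero)
  then have hc: "h \<in> carrier \<Gamma>" using a(1) by (auto simp: A_def in_keys_iff)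
  let ?c = "\<lambda>v :: 'c \<Rightarrow>\<^sub>0 'k. Poly_Mapping.lookup v h"
  have b: "bilin A A A (\<lambda>a b. ?c b \<odot>\<^bsub>A\<^esub> a)"
    by (rule bilin_flip[OF bilin_comp[OF bilin_smult klinear_lookup klinear_id]]) simp
  have "sweedler A (comult A a) (\<lambda>a b. ?c b \<odot>\<^bsub>A\<^esub> a) = ?c a \<odot>\<^bsub>A\<^esub> basis_vec h"
  proof (rule A_ext[OF _ _ A_vspace _ a(1)])
    show "klinear A A (\<lambda>a. sweedler A (comult A a) (\<lambda>a b. ?c b \<odot>\<^bsub>A\<^esub> a))"
      by (rule klinear_comp[OF khom_klinear[OF comult_A_khom] klinear_sweedler[OF _ _ _ b]]) simp_all
    show "klinear A A (\<lambda>a. ?c a \<odot>\<^bsub>A\<^esub> basis_vec h)"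
      by (rule klinear_comp[OF klinear_lookup klinear_smult_vec]) (use hc in simp_all)
    fix k assume k: "k \<in> carrier \<Gamma>"
    then show "sweedler A (comult A (basis_vec k)) (\<lambda>a b. ?c b \<odot>\<^bsub>A\<^esub> a) = ?c (basis_vec k) \<odot>\<^bsub>A\<^esub> basis_vec h"
      using hc by (simp add: A_bv sweedler_pure[OF _ _ _ b]) (auto simp: basis_vec_def lookup_single when_def A_def)
  qed
  then have "?c a \<odot>\<^bsub>A\<^esub> basis_vec h = ?c a \<odot>\<^bsub>A\<^esub> a" using a(1) by (simp add: a(2) sweedler_pure[OF _ _ _ b])
  then have "inverse (?c a) \<odot>\<^bsub>A\<^esub> (?c a \<odot>\<^bsub>A\<^esub> basis_vec h) = inverse (?c a) \<odot>\<^bsub>A\<^esub> (?c a \<odot>\<^bsub>A\<^esub> a)" by simp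
  then have "basis_vec h = a" using h hc a(1) by simp
  then show ?thesis using hc by blast
qed

end

locale hopf_pair = third_type_pair G g f \<Gamma>
  for G :: "'g monoid" (structure) and g :: 'g and f :: "'g \<Rightarrow> 'k::field" and \<Gamma> :: "'c monoid" +
  fixes \<alpha> :: "(('g letter list \<Rightarrow>\<^sub>0 'k) set \<times> ('c \<Rightarrow>\<^sub>0 'k) \<Rightarrow>\<^sub>0 'k) set \<Rightarrow> 'c \<Rightarrow>\<^sub>0 'k"
    and \<beta> :: "(('g letter list \<Rightarrow>\<^sub>0 'k) set \<times> ('c \<Rightarrow>\<^sub>0 'k) \<Rightarrow>\<^sub>0 'k) set \<Rightarrow> ('g letter list \<Rightarrow>\<^sub>0 'k) set"
  assumes hmp: "hopf_matched_pair A H \<alpha> \<beta>"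
begin

definition L where "L u a = \<alpha> (pure_tensor H A u a)"
definition R where "R u a = \<beta> (pure_tensor H A u a)"

lemma klinear_actions: "klinear HA A \<alpha>" "klinear HA H \<beta>"
  using hmp by (simp_all add: hopf_matched_pair_def Let_def)

lemma bilin_L: "bilin H A A L" and bilin_R: "bilin H A H R"
  unfolding L_def[abs_def] R_def[abs_def]
  by (rule bilin_out[OF bilin_pure_tensor klinear_actions(1)] bilin_out[OF bilin_pure_tensor klinear_actions(2)]; simp)+

lemma LR_closed [simp]: "u \<in> carrier H \<Longrightarrow> a \<in> carrier A \<Longrightarrow> L u a \<in> carrier A"
  "u \<in> carrier H \<Longrightarrow> a \<in> carrier A \<Longrightarrow> R u a \<in> carrier H"
  using bilin_closed[OF bilin_L] bilin_closed[OF bilin_R] by auto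

lemma pair_laws:
  "a \<in> carrier A \<Longrightarrow> L \<one>\<^sub>H a = a"
  "u \<in> carrier H \<Longrightarrow> v \<in> carrier H \<Longrightarrow> a \<in> carrier A \<Longrightarrow> L (u \<otimes>\<^sub>H v) a = L u (L v a)"
  "u \<in> carrier H \<Longrightarrow> a \<in> carrier A \<Longrightarrow> comult A (L u a) = sweedler (tensor A A) (comult H u) (\<lambda>u1 u2.
          sweedler (tensor A A) (comult A a) (\<lambda>a1 a2. pure_tensor A A (L u1 a1) (L u2 a2)))"
  "u \<in> carrier H \<Longrightarrow> a \<in> carrier A \<Longrightarrow> counit A (L u a) = counit H u * counit A a"
  "u \<in> carrier H \<Longrightarrow> R u \<one>\<^bsub>A\<^esub> = u"
  "u \<in> carrier H \<Longrightarrow> a \<in> carrier A \<Longrightarrow> b \<in> carrier A \<Longrightarrow> R u (a \<otimes>\<^bsub>A\<^esub> b) = R (R u a) b"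
  "u \<in> carrier H \<Longrightarrow> a \<in> carrier A \<Longrightarrow> comult H (R u a) = sweedler HH (comult H u) (\<lambda>u1 u2.
          sweedler HH (comult A a) (\<lambda>a1 a2. pure_tensor H H (R u1 a1) (R u2 a2)))"
  "u \<in> carrier H \<Longrightarrow> a \<in> carrier A \<Longrightarrow> counit H (R u a) = counit H u * counit A a"
  "a \<in> carrier A \<Longrightarrow> R \<one>\<^sub>H a = counit A a \<odot>\<^sub>H \<one>\<^sub>H"
  "u \<in> carrier H \<Longrightarrow> a \<in> carrier A \<Longrightarrow> b \<in> carrier A \<Longrightarrow>
        L u (a \<otimes>\<^bsub>A\<^esub> b) = sweedler A (comult H u) (\<lambda>u1 u2. sweedler A (comult A a) (\<lambda>a1 a2.
          L u1 a1 \<otimes>\<^bsub>A\<^esub> L (R u2 a2) b))"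
  "u \<in> carrier H \<Longrightarrow> v \<in> carrier H \<Longrightarrow> a \<in> carrier A \<Longrightarrow>
        R (u \<otimes>\<^sub>H v) a = sweedler H (comult H v) (\<lambda>v1 v2. sweedler H (comult A a) (\<lambda>a1 a2.
          R u (L v1 a1) \<otimes>\<^sub>H R v2 a2))"
  "u \<in> carrier H \<Longrightarrow> a \<in> carrier A \<Longrightarrow>
        sweedler HA (comult H u) (\<lambda>u1 u2. sweedler HA (comult A a) (\<lambda>a1 a2.
          pure_tensor H A (R u1 a1) (L u2 a2))) =
        sweedler HA (comult H u) (\<lambda>u1 u2. sweedler HA (comult A a) (\<lambda>a1 a2.
          pure_tensor H A (R u2 a2) (L u1 a1)))"
  using hmp unfolding hopf_matched_pair_def left_module_coalgebra_def right_module_coalgebra_def Let_def L_def R_def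
  by simp_all

lemma bilin_R_L: "u \<in> carrier H \<Longrightarrow> bilin H A H (\<lambda>v a. R u (L v a))"
  by (rule bilin_out[OF bilin_L bilin_right[OF bilin_R]])

lemma bilin_L_R: "b \<in> carrier A \<Longrightarrow> bilin H A A (\<lambda>v a. L (R v a) b)"
  by (rule bilin_out[OF bilin_R bilin_left[OF bilin_L]])

lemmas LRlin = klinear_add[OF bilin_left[OF bilin_L]] klinear_smult[OF bilin_left[OF bilin_L]] klinear_minus[OF bilin_left[OF bilin_L]]
  klinear_add[OF bilin_left[OF bilin_R]] klinear_smult[OF bilin_left[OF bilin_R]] klinear_minus[OF bilin_left[OF bilin_R]]

lemma LR_zero [simp]: "u \<in> carrier H \<Longrightarrow> L u \<zero>\<^bsub>A\<^esub> = \<zero>\<^bsub>A\<^esub>" "u \<in> carrier H \<Longrightarrow> R u \<zero>\<^bsub>A\<^esub> = \<zero>\<^sub>H"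
  by (rule klinear_zero[OF bilin_right[OF bilin_L]] klinear_zero[OF bilin_right[OF bilin_R]]; simp)+

lemma R_one_bv: "h \<in> carrier \<Gamma> \<Longrightarrow> R \<one>\<^sub>H (basis_vec h) = \<one>\<^sub>H"
  by (simp add: pair_laws(9) A_bv)

subsection \<open>Group-like elements\<close>

lemma L_e_exists: assumes t: "t \<in> carrier G" "h \<in> carrier \<Gamma>" shows "\<exists>k\<in>carrier \<Gamma>. L (e t) (basis_vec h) = basis_vec k"
proof (rule group_like_A)
  show "comult A (L (e t) (basis_vec h)) = pure_tensor A A (L (e t) (basis_vec h)) (L (e t) (basis_vec h))"
    using t by (simp add: pair_laws(3) double_sweedler_e[OF A_vspace A_vspace vspace_tensor[OF A_vspace A_vspace] bilin_L bilin_L bilin_pure_tensor[OF A_vspace A_vspace]])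
  show "L (e t) (basis_vec h) \<noteq> \<zero>\<^bsub>A\<^esub>"
    using pair_laws(4)[of "e t" "basis_vec h"] t klinear_zero[OF khom_klinear[OF counit_A_khom]] by (auto simp: A_bv counit_e)
qed (use t in simp)

lemma R_e_exists: assumes t: "t \<in> carrier G" "h \<in> carrier \<Gamma>" shows "\<exists>s\<in>carrier G. R (e t) (basis_vec h) = e s"
proof (rule group_like_H)
  show "comult H (R (e t) (basis_vec h)) = pure_tensor H H (R (e t) (basis_vec h)) (R (e t) (basis_vec h))"
    using t by (simp add: pair_laws(7) double_sweedler_e[OF H_vspace H_vspace vspace_tensor[OF H_vspace H_vspace] bilin_R bilin_R bilin_pure_tensor[OF H_vspace H_vspace]])
  show "R (e t) (basis_vec h) \<noteq> \<zero>\<^sub>H"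
    using pair_laws(8)[of "e t" "basis_vec h"] t klinear_zero[OF khom_klinear[OF counit_khom]] by (auto simp: A_bv counit_e)
qed (use t in simp)

text \<open>
  On arguments outside the groups the restricted actions are undefined, as for group matched pairs.
\<close>

definition left_act where "left_act = (\<lambda>p\<in>carrier G \<times> carrier \<Gamma>. SOME k. k \<in> carrier \<Gamma> \<and> L (e (fst p)) (basis_vec (snd p)) = basis_vec k)"
definition right_act where "right_act = (\<lambda>p\<in>carrier G \<times> carrier \<Gamma>. SOME s. s \<in> carrier G \<and> R (e (fst p)) (basis_vec (snd p)) = e s)"

lemma left_act: assumes t: "t \<in> carrier G" "h \<in> carrier \<Gamma>"
  shows "left_act (t, h) \<in> carrier \<Gamma>" "L (e t) (basis_vec h) = basis_vec (left_act (t, h))"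
  using someI_ex[of "\<lambda>k. k \<in> carrier \<Gamma> \<and> L (e t) (basis_vec h) = basis_vec k"] L_e_exists[OF t] t by (auto simp: left_act_def)

lemma right_act: assumes t: "t \<in> carrier G" "h \<in> carrier \<Gamma>"
  shows "right_act (t, h) \<in> carrier G" "R (e t) (basis_vec h) = e (right_act (t, h))"
  using someI_ex[of "\<lambda>s. s \<in> carrier G \<and> R (e t) (basis_vec h) = e s"] R_e_exists[OF t] t by (auto simp: right_act_def)

lemma R_mult_e: "u \<in> carrier H \<Longrightarrow> t \<in> carrier G \<Longrightarrow> h \<in> carrier \<Gamma> \<Longrightarrow>
    R (u \<otimes>\<^sub>H e t) (basis_vec h) = R u (basis_vec (left_act (t, h))) \<otimes>\<^sub>H e (right_act (t, h))"
  by (simp add: pair_laws(11) double_sweedler_e[OF H_vspace H_vspace H_vspace bilin_R_L bilin_R bilin_mult[OF H_kalgebra]] left_act right_act)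

lemma group_matched_pair_acts: "group_matched_pair \<Gamma> G left_act right_act"
proof -
  have l1: "left_act (\<one>, h) = h" if "h \<in> carrier \<Gamma>" for h
    using left_act(2)[of "\<one>" h] that by (simp add: e_one pair_laws(1) basis_vec_inj)
  have l2: "left_act (t \<otimes> s, h) = left_act (t, left_act (s, h))" if "t \<in> carrier G" "s \<in> carrier G" "h \<in> carrier \<Gamma>" for t s h
    using left_act(2)[of "t \<otimes> s" h] that pair_laws(2)[of "e t" "e s" "basis_vec h"] by (simp add: e_mult left_act basis_vec_inj)
  have r1: "right_act (t, \<one>\<^bsub>\<Gamma>\<^esub>) = t" if "t \<in> carrier G" for t
    using right_act[of t "\<one>\<^bsub>\<Gamma>\<^esub>"] that pair_laws(5)[of "e t"] by (simp add: A_one e_inj)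
  have r2: "right_act (t, h \<otimes>\<^bsub>\<Gamma>\<^esub> k) = right_act (right_act (t, h), k)" if "t \<in> carrier G" "h \<in> carrier \<Gamma>" "k \<in> carrier \<Gamma>" for t h k
    using right_act[of t "h \<otimes>\<^bsub>\<Gamma>\<^esub> k"] that pair_laws(6)[of "e t" "basis_vec h" "basis_vec k"] by (simp add: bv_mult right_act e_inj)
  have l3: "left_act (t, h \<otimes>\<^bsub>\<Gamma>\<^esub> k) = left_act (t, h) \<otimes>\<^bsub>\<Gamma>\<^esub> left_act (right_act (t, h), k)" if "t \<in> carrier G" "h \<in> carrier \<Gamma>" "k \<in> carrier \<Gamma>" for t h k
  proof -
    have "L (e t) (basis_vec h \<otimes>\<^bsub>A\<^esub> basis_vec k) = L (e t) (basis_vec h) \<otimes>\<^bsub>A\<^esub> L (R (e t) (basis_vec h)) (basis_vec k)"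
      using that by (simp add: pair_laws(10) double_sweedler_e[OF A_vspace A_vspace A_vspace bilin_L bilin_L_R bilin_mult[OF A_kalgebra]])
    then show ?thesis using that by (simp add: bv_mult left_act right_act basis_vec_inj)
  qed
  have r3: "right_act (t \<otimes> s, h) = right_act (t, left_act (s, h)) \<otimes> right_act (s, h)" if "t \<in> carrier G" "s \<in> carrier G" "h \<in> carrier \<Gamma>" for t s h
    using R_mult_e[of "e t" s h] that by (simp add: e_mult right_act left_act e_inj)
  have "left_act \<in> carrier G \<times> carrier \<Gamma> \<rightarrow>\<^sub>E carrier \<Gamma>" "right_act \<in> carrier G \<times> carrier \<Gamma> \<rightarrow>\<^sub>E carrier G"
    using left_act(1) right_act(1) by (auto simp: left_act_def right_act_def)
  then show ?thesis unfolding group_matched_pair_def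
    using \<Gamma>.group_axioms group_axioms by (intro conjI ballI) (simp_all only: l1 l2 l3 r1 r2 r3)
qed

subsection \<open>The skew-primitive generator\<close>

text \<open>
  The element \<open>x \<triangleleft> h\<close> is skew-primitive for \<open>g \<triangleleft> h\<close>, which leaves the two cases \<open>g \<triangleleft> h = g\<close> and \<open>a = 0\<close>.
  In the latter \<open>x = (x \<triangleleft> h) \<triangleleft> h\<^bsup>-1\<^esup>\<close> would lie in \<open>k[G]\<close>.
\<close>

lemma R_x_exists:
  assumes h: "h \<in> carrier \<Gamma>"
  shows "\<exists>a b. R x (basis_vec h) = a \<odot>\<^sub>H x \<oplus>\<^sub>H b \<odot>\<^sub>H (\<one>\<^sub>H \<ominus>\<^sub>H e g) \<and> a \<noteq> 0"
    and "right_act (g, h) = g"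
proof -
  let ?s = "right_act (g, h)"
  have s: "?s \<in> carrier G" "R (e g) (basis_vec h) = e ?s" using right_act[of g h] h by auto
  have "comult H (R x (basis_vec h)) = pure_tensor H H (R x (basis_vec h)) \<one>\<^sub>H \<oplus>\<^bsub>HH\<^esub> pure_tensor H H (e ?s) (R x (basis_vec h))"
    using h by (simp add: pair_laws(7) double_sweedler_x[OF H_vspace H_vspace vspace_tensor[OF H_vspace H_vspace] bilin_R bilin_R bilin_pure_tensor[OF H_vspace H_vspace]] R_one_bv s)
  then obtain a b where ab: "R x (basis_vec h) = a \<odot>\<^sub>H x \<oplus>\<^sub>H b \<odot>\<^sub>H (\<one>\<^sub>H \<ominus>\<^sub>H e ?s)" "a \<noteq> 0 \<longrightarrow> ?s = g"
    using skew_primitive_H[of "R x (basis_vec h)" ?s] h s by auto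
  have "a \<noteq> 0"
  proof
    assume "a = 0"
    then have "R x (basis_vec h) = b \<odot>\<^sub>H (\<one>\<^sub>H \<ominus>\<^sub>H e ?s)" using ab s by simp
    moreover have "x = R (R x (basis_vec h)) (basis_vec (inv\<^bsub>\<Gamma>\<^esub> h))"
      using pair_laws(6)[of x "basis_vec h" "basis_vec (inv\<^bsub>\<Gamma>\<^esub> h)"] pair_laws(5)[of x] h by (simp add: bv_mult A_one)
    ultimately have "x = b \<odot>\<^sub>H (\<one>\<^sub>H \<ominus>\<^sub>H e (right_act (?s, inv\<^bsub>\<Gamma>\<^esub> h)))"
      using h s by (simp add: LRlin R_one_bv right_act)
    then have "coord \<one> 1 x = coord \<one> 1 (b \<odot>\<^sub>H (\<one>\<^sub>H \<ominus>\<^sub>H e (right_act (?s, inv\<^bsub>\<Gamma>\<^esub> h))))" by simp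
    then show False using right_act(1)[of ?s "inv\<^bsub>\<Gamma>\<^esub> h"] s h char_gt_1 by (simp add: coord_lin coord_x coord_one coord_e)
  qed
  then show "\<exists>a b. R x (basis_vec h) = a \<odot>\<^sub>H x \<oplus>\<^sub>H b \<odot>\<^sub>H (\<one>\<^sub>H \<ominus>\<^sub>H e g) \<and> a \<noteq> 0" "right_act (g, h) = g"
    using ab by auto
qed

text \<open>
  The last compatibility axiom at \<open>(x, h)\<close> reads
  \<open>(x \<triangleleft> h) \<otimes> h + g \<otimes> (x \<triangleright> h) = 1 \<otimes> (x \<triangleright> h) + (x \<triangleleft> h) \<otimes> (g \<triangleright> h)\<close>. The coordinate at \<open>x\<close> of the first factor
  gives \<open>g \<triangleright> h = h\<close>. Then the coordinate at \<open>1\<close> gives \<open>x \<triangleright> h = 0\<close>, as \<open>g \<noteq> 1\<close>.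
\<close>

lemma L_x:
  assumes h: "h \<in> carrier \<Gamma>"
  shows "left_act (g, h) = h" "L x (basis_vec h) = \<zero>\<^bsub>A\<^esub>"
proof -
  let ?b = "basis_vec h :: 'c \<Rightarrow>\<^sub>0 'k" and ?y = "L x (basis_vec h)"
  note v = H_vspace A_vspace vspace_tensor[OF H_vspace A_vspace]
  note pHA = bilin_pure_tensor[OF H_vspace A_vspace]
  have g: "L (e g) ?b = basis_vec (left_act (g, h))" "left_act (g, h) \<in> carrier \<Gamma>" "R (e g) ?b = e g"
    using left_act[of g h] right_act(2)[of g h] R_x_exists(2)[OF h] h by auto
  have C3: "pure_tensor H A (R x ?b) ?b \<oplus>\<^bsub>HA\<^esub> pure_tensor H A (e g) ?y =
     pure_tensor H A \<one>\<^sub>H ?y \<oplus>\<^bsub>HA\<^esub> pure_tensor H A (R x ?b) (basis_vec (left_act (g, h)))"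
    using pair_laws(12)[of x ?b] h g
    by (simp add: double_sweedler_x[OF v bilin_R bilin_L pHA] double_sweedler_x[OF v(2,1,3) bilin_L bilin_R bilin_flip[OF pHA]] R_one_bv pair_laws(1))
  have bl: "bilin H A A (\<lambda>u a. coord \<one> n u \<odot>\<^bsub>A\<^esub> a)" if "n < CHAR('k)" for n
    by (rule bilin_comp[OF bilin_smult coord(1) klinear_id]) (use that in auto)
  have eq: "coord \<one> n (R x ?b) \<odot>\<^bsub>A\<^esub> ?b \<oplus>\<^bsub>A\<^esub> coord \<one> n (e g) \<odot>\<^bsub>A\<^esub> ?y =
     coord \<one> n \<one>\<^sub>H \<odot>\<^bsub>A\<^esub> ?y \<oplus>\<^bsub>A\<^esub> coord \<one> n (R x ?b) \<odot>\<^bsub>A\<^esub> basis_vec (left_act (g, h))" if n: "n < CHAR('k)" for n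
    using arg_cong[OF C3, of "\<lambda>T. sweedler A T (\<lambda>u a. coord \<one> n u \<odot>\<^bsub>A\<^esub> a)"] h g
    by (simp add: klinear_add[OF klinear_sweedler[OF v(1,2,2) bl[OF n]]] sweedler_pure[OF v(1,2,2) bl[OF n]])
  obtain a b where ab: "R x ?b = a \<odot>\<^sub>H x \<oplus>\<^sub>H b \<odot>\<^sub>H (\<one>\<^sub>H \<ominus>\<^sub>H e g)" "a \<noteq> 0"
    using R_x_exists(1)[OF h] by blast
  have "coord \<one> 1 (R x ?b) = a" using char_gt_1 unfolding ab(1) by (simp add: coord_lin coord_x coord_one coord_e)
  then have "a \<odot>\<^bsub>A\<^esub> ?b = a \<odot>\<^bsub>A\<^esub> basis_vec (left_act (g, h))"
    using eq[OF char_gt_1] h g char_gt_1 by (simp add: coord_one coord_e)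
  then have "inverse a \<odot>\<^bsub>A\<^esub> (a \<odot>\<^bsub>A\<^esub> ?b) = inverse a \<odot>\<^bsub>A\<^esub> (a \<odot>\<^bsub>A\<^esub> basis_vec (left_act (g, h)))" by simp
  then have "?b = basis_vec (left_act (g, h))" using ab(2) h g by simp
  then show l: "left_act (g, h) = h" by (simp add: basis_vec_inj)
  have "coord \<one> 0 (R x ?b) \<odot>\<^bsub>A\<^esub> ?b = ?y \<oplus>\<^bsub>A\<^esub> coord \<one> 0 (R x ?b) \<odot>\<^bsub>A\<^esub> ?b"
    using eq[OF char_pos] h l g_neq_one char_pos by (simp add: coord_one coord_e)
  then have "(?y \<oplus>\<^bsub>A\<^esub> coord \<one> 0 (R x ?b) \<odot>\<^bsub>A\<^esub> ?b) \<ominus>\<^bsub>A\<^esub> coord \<one> 0 (R x ?b) \<odot>\<^bsub>A\<^esub> ?b = \<zero>\<^bsub>A\<^esub>"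
    using h by (simp add: vs_minus_eq_zero)
  moreover have "?y = (?y \<oplus>\<^bsub>A\<^esub> coord \<one> 0 (R x ?b) \<odot>\<^bsub>A\<^esub> ?b) \<ominus>\<^bsub>A\<^esub> coord \<one> 0 (R x ?b) \<odot>\<^bsub>A\<^esub> ?b"
    using h by (intro lincomb_eqI[where V = A]) (rule lincomb_intros | rule lincomb_atom | simp)+
  ultimately show "?y = \<zero>\<^bsub>A\<^esub>" by simp
qed

lemma R_mult_x: "u \<in> carrier H \<Longrightarrow> h \<in> carrier \<Gamma> \<Longrightarrow> R (u \<otimes>\<^sub>H x) (basis_vec h) = R u (basis_vec h) \<otimes>\<^sub>H R x (basis_vec h)"
  by (simp add: pair_laws(11) double_sweedler_x[OF H_vspace H_vspace H_vspace bilin_R_L bilin_R bilin_mult[OF H_kalgebra]] L_x left_act)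

definition shift :: "'c \<Rightarrow> 'k" where "shift = (\<lambda>h\<in>carrier \<Gamma>. coord \<one> 0 (R x (basis_vec h)))"

text \<open>
  Let \<open>x \<triangleleft> h = a x + b (1 - g)\<close>, let \<open>c\<close> and \<open>d\<close> be the coefficients for \<open>t \<triangleright> h\<close> instead of \<open>h\<close>, and let \<open>h\<close> act
  on \<open>x t = t x - f(t) t (1 - g)\<close>. For \<open>r = t \<triangleleft> h\<close> the coordinates at \<open>r x\<close> and at \<open>r\<close> give \<open>a = c\<close> and
  \<open>b - f(t) = d - c f(r)\<close>. For \<open>t = g\<close> the second equation yields \<open>a = 1\<close>.
\<close>

lemma R_x_shift:
  assumes h: "h \<in> carrier \<Gamma>"
  shows "R x (basis_vec h) = xc (shift h)" "t \<in> carrier G \<Longrightarrow> f (right_act (t, h)) = f t + shift (left_act (t, h)) - shift h"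
proof -
  define P where "P h a b \<longleftrightarrow> R x (basis_vec h) = a \<odot>\<^sub>H x \<oplus>\<^sub>H b \<odot>\<^sub>H (\<one>\<^sub>H \<ominus>\<^sub>H e g)" for h a b
  have Pshift: "b = shift h" if "P h a b" "h \<in> carrier \<Gamma>" for a b h
    using that g_neq_one char_pos unfolding P_def by (simp add: shift_def coord_lin coord_x coord_one coord_e)
  have key: "a = c \<and> b - f t = d - c * f (right_act (t, h))" if t: "t \<in> carrier G" and P: "P h a b" "P (left_act (t, h)) c d" and h: "h \<in> carrier \<Gamma>" for t a b c d h
  proof -
    let ?r = "right_act (t, h)"
    have r: "?r \<in> carrier G" "left_act (t, h) \<in> carrier \<Gamma>" using right_act left_act t h by auto
    have rg: "R (e (t \<otimes> g)) (basis_vec h) = e (?r \<otimes> g)"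
      using R_mult_e[of "e t" g h] t h R_x_exists(2)[OF h] L_x(1)[OF h] r by (simp add: e_mult right_act(2))
    have "R (x \<otimes>\<^sub>H e t) (basis_vec h) = R (e t \<otimes>\<^sub>H x \<ominus>\<^sub>H f t \<odot>\<^sub>H (e t \<ominus>\<^sub>H e (t \<otimes> g))) (basis_vec h)"
      using x_mult_e[OF t] by simp
    then have eq: "R x (basis_vec (left_act (t, h))) \<otimes>\<^sub>H e ?r = e ?r \<otimes>\<^sub>H R x (basis_vec h) \<ominus>\<^sub>H f t \<odot>\<^sub>H (e ?r \<ominus>\<^sub>H e (?r \<otimes> g))"
      using t h r by (simp add: R_mult_e LRlin R_mult_x right_act rg)
    have "c \<odot>\<^sub>H (e ?r \<otimes>\<^sub>H x \<ominus>\<^sub>H f ?r \<odot>\<^sub>H (e ?r \<ominus>\<^sub>H e (?r \<otimes> g))) \<oplus>\<^sub>H d \<odot>\<^sub>H (e ?r \<ominus>\<^sub>H e (?r \<otimes> g))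
       = (a \<odot>\<^sub>H (e ?r \<otimes>\<^sub>H x) \<oplus>\<^sub>H b \<odot>\<^sub>H (e ?r \<ominus>\<^sub>H e (?r \<otimes> g))) \<ominus>\<^sub>H f t \<odot>\<^sub>H (e ?r \<ominus>\<^sub>H e (?r \<otimes> g))" (is "?l = ?rhs")
      using eq t h r P unfolding P_def by (simp add: ka_distribs ka_mult_smult e_mult x_mult_e g_central)
    then have "coord ?r n ?l = coord ?r n ?rhs" for n by simp
    from this[of 1] this[of 0] show ?thesis using r char_gt_1 char_pos g_neq_one
      by (simp add: coord_lin coord_e_x coord_e algebra_simps)
  qed
  have one: "P h 1 (shift h)" if h: "h \<in> carrier \<Gamma>" for h
  proof -
    obtain a b where ab: "P h a b" using R_x_exists(1)[OF h] unfolding P_def by blast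
    have group_pair_laws: "left_act (g, h) = h" "right_act (g, h) = g" using L_x(1)[OF that] R_x_exists(2)[OF that] .
    then have "P (left_act (g, h)) a b" using ab by simp
    from key[OF g_closed ab this that] have "a = 1" by (simp add: group_pair_laws)
    then show ?thesis using ab Pshift[OF ab that] by simp
  qed
  show "R x (basis_vec h) = xc (shift h)" using one[OF h] unfolding P_def xc_def by simp
  show "f (right_act (t, h)) = f t + shift (left_act (t, h)) - shift h" if t: "t \<in> carrier G"
    using key[OF t one[OF h] one h] left_act t h by (simp add: algebra_simps)
qed

lemma R_ffact: "u \<in> carrier H \<Longrightarrow> h \<in> carrier \<Gamma> \<Longrightarrow> R (u \<otimes>\<^sub>H ffact H x n) (basis_vec h) = R u (basis_vec h) \<otimes>\<^sub>H ffact H (xc (shift h)) n"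
proof (induction n)
  case (Suc n)
  have "u \<otimes>\<^sub>H ffact H x (Suc n) = (u \<otimes>\<^sub>H ffact H x n) \<otimes>\<^sub>H x \<ominus>\<^sub>H of_nat n \<odot>\<^sub>H (u \<otimes>\<^sub>H ffact H x n)"
    using Suc(2) by (simp add: ka_distribs ka_mult_smult ka_assoc)
  then show ?case using Suc
    by (simp add: LRlin R_mult_x R_x_shift(1) del: ffact.simps) (simp add: ka_distribs ka_mult_smult ka_assoc)
qed simp

text \<open>
  Acting by \<open>h\<close> on \<open>x\<^bsup>(p)\<^esup> = 0\<close> gives \<open>0 = (c\<^sup>p - c) (1 - g\<^sup>p)\<close> for \<open>c = \<gamma>\<^sub>h\<close>.
\<close>

lemma shift_k_set: assumes h: "h \<in> carrier \<Gamma>" shows "shift h \<in> k_set G g"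
proof -
  have "ffact H (xc (shift h)) (CHAR('k)) = R (\<one>\<^sub>H \<otimes>\<^sub>H ffact H x (CHAR('k))) (basis_vec h)"
    using h R_ffact[of "\<one>\<^sub>H" h] by (simp add: R_one_bv)
  also have "\<dots> = \<zero>\<^sub>H"
    using klinear_zero[OF bilin_left[OF bilin_R bv_closed[OF h]]] by (simp add: ffact_x)
  finally have z: "(shift h ^ CHAR('k) - shift h) \<odot>\<^sub>H (\<one>\<^sub>H \<ominus>\<^sub>H e (g [^] CHAR('k))) = \<zero>\<^sub>H"
    by (simp add: ffact_xc)
  have "shift h ^ CHAR('k) = shift h \<or> \<one>\<^sub>H \<ominus>\<^sub>H e (g [^] CHAR('k)) = \<zero>\<^sub>H"
    using vs_smult_cancel[OF _ _ _ z] by auto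
  then have "shift h ^ CHAR('k) = shift h \<or> e \<one> = e (g [^] CHAR('k))"
    by (simp add: vs_minus_eq_zero e_one)
  then show ?thesis by (simp add: e_inj k_set_iff[OF group_axioms g_closed, of "shift h"]) metis
qed

lemma shift_mult:
  assumes h: "h \<in> carrier \<Gamma>" "k \<in> carrier \<Gamma>"
  shows "shift (h \<otimes>\<^bsub>\<Gamma>\<^esub> k) = shift h + shift k"
proof -
  have k: "R (e g) (basis_vec k) = e g" using right_act(2)[of g k] R_x_exists(2)[OF h(2)] h by simp
  have "xc (shift (h \<otimes>\<^bsub>\<Gamma>\<^esub> k)) = R (R x (basis_vec h)) (basis_vec k)"
    using h pair_laws(6)[of x "basis_vec h" "basis_vec k"] by (simp add: bv_mult R_x_shift(1))
  also have "\<dots> = R x (basis_vec k) \<oplus>\<^sub>H shift h \<odot>\<^sub>H (\<one>\<^sub>H \<ominus>\<^sub>H e g)"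
    unfolding R_x_shift(1)[OF h(1)] xc_def using h by (simp add: LRlin R_one_bv k)
  also have "\<dots> = xc (shift k + shift h)" by (simp add: R_x_shift(1) h xc_add)
  finally show ?thesis by (metis coord_xc add.commute)
qed

theorem matched_pair_datum_actions: "matched_pair_datum \<Gamma> G g f left_act right_act shift"
  unfolding matched_pair_datum_def
proof (intro conjI ballI)
  show "shift \<in> hom \<Gamma> ((add_monoid ground)\<lparr>carrier := k_set G g\<rparr>)"
    by (rule homI) (simp_all add: shift_k_set shift_mult)
  show "shift \<in> extensional (carrier \<Gamma>)" by (simp add: shift_def)
qed (simp_all add: group_matched_pair_acts L_x R_x_exists R_x_shift)

sublocale datum: pair_datum G g f \<Gamma> left_act right_act shift
  by unfold_locales (rule matched_pair_datum_actions)

text \<open>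
  The values on the basis are forced, since \<open>x \<triangleright> h = 0\<close> and \<open>x \<triangleleft> h\<close> is known.
\<close>

lemma L_bas: "t \<in> carrier G \<Longrightarrow> h \<in> carrier \<Gamma> \<Longrightarrow> L (bas t n) (basis_vec h) = datum.Lb h t n"
proof (induction n)
  case (Suc n)
  have "bas t (Suc n) = bas t n \<otimes>\<^sub>H x \<ominus>\<^sub>H of_nat n \<odot>\<^sub>H bas t n"
    using Suc(2) by (simp add: bas_Suc ka_distribs ka_mult_smult)
  then have "L (bas t (Suc n)) (basis_vec h) = \<zero>\<^bsub>A\<^esub> \<ominus>\<^bsub>A\<^esub> of_nat n \<odot>\<^bsub>A\<^esub> datum.Lb h t n"
    using Suc by (simp add: LRlin pair_laws(2) L_x)
  also have "\<dots> = \<zero>\<^bsub>A\<^esub>" using Suc(2,3) by (cases n) (simp_all add: datum.Lb_def left_act vs_minus_smult)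
  finally show ?case by (simp add: datum.Lb_def)
qed (simp add: datum.Lb_def left_act)

lemma R_bas: "t \<in> carrier G \<Longrightarrow> h \<in> carrier \<Gamma> \<Longrightarrow> R (bas t n) (basis_vec h) = datum.Rb h t n"
  by (simp add: bas_def datum.Rb_def datum.xh_def R_ffact right_act)

theorem actions_eq: "\<alpha> = datum.alpha" "\<beta> = datum.beta"
proof -
  have "L u a = datum.lact u a" if "u \<in> carrier H" "a \<in> carrier A" for u a
    by (rule bilin_ext[OF bilin_L datum.bilin_lact A_vspace _ that]) (simp add: L_bas datum.lact_bas)
  then have "\<alpha> T = datum.alpha T" if "T \<in> carrier HA" for T
    by (intro tensor_ext[OF H_vspace A_vspace klinear_actions(1) datum.klinear_alpha A_vspace _ that]) (simp add: L_def)
  then show "\<alpha> = datum.alpha" using hmp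
    by (intro extensionalityI[of \<alpha> "carrier HA"]) (auto simp: hopf_matched_pair_def Let_def datum.alpha_def)
  have "R u a = datum.ract u a" if "u \<in> carrier H" "a \<in> carrier A" for u a
    by (rule bilin_ext[OF bilin_R datum.bilin_ract H_vspace _ that]) (simp add: R_bas datum.ract_bas)
  then have "\<beta> T = datum.beta T" if "T \<in> carrier HA" for T
    by (intro tensor_ext[OF H_vspace A_vspace klinear_actions(2) datum.klinear_beta H_vspace _ that]) (simp add: R_def)
  then show "\<beta> = datum.beta" using hmp
    by (intro extensionalityI[of \<beta> "carrier HA"]) (auto simp: hopf_matched_pair_def Let_def datum.beta_def)
qed

end

subsection \<open>The bijection\<close>

context pair_datum
begin

lemma act_x:
  assumes h: "h \<in> carrier \<Gamma>"
  shows "ract x (basis_vec h) = xc (\<gamma> h)" "lact x (basis_vec h) = \<zero>\<^bsub>A\<^esub>"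
  using ract_mult_x[OF h, of "\<one>\<^sub>H"] lact_mult_x[OF h, of "\<one>\<^sub>H"] act_e(1)[of "\<one>" h] h
  by (simp_all add: e_one xh_def)

end

context third_type_pair
begin

abbreviation datum_actions where
  "datum_actions \<equiv> \<lambda>(l, r, \<gamma>). (pair_datum.alpha G g f \<Gamma> l, pair_datum.beta G g f \<Gamma> r \<gamma>)"

theorem bij_datum_actions:
  "bij_betw datum_actions {(l, r, \<gamma>). matched_pair_datum \<Gamma> G g f l r \<gamma>} {(\<alpha>, \<beta>). hopf_matched_pair A H \<alpha> \<beta>}"
proof (rule bij_betw_imageI)
  have pd: "pair_datum G g f \<Gamma> l r \<gamma>" if "matched_pair_datum \<Gamma> G g f l r \<gamma>" for l r \<gamma>
    using that by (simp add: pair_datum_def pair_datum_axioms_def third_type_pair_axioms)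
  show "inj_on datum_actions {(l, r, \<gamma>). matched_pair_datum \<Gamma> G g f l r \<gamma>}"
  proof (rule inj_onI, clarsimp)
    fix l r \<gamma> l' r' \<gamma>'
    assume d: "matched_pair_datum \<Gamma> G g f l r \<gamma>" "matched_pair_datum \<Gamma> G g f l' r' \<gamma>'"
      and eq: "pair_datum.alpha G g f \<Gamma> l = pair_datum.alpha G g f \<Gamma> l'"
        "pair_datum.beta G g f \<Gamma> r \<gamma> = pair_datum.beta G g f \<Gamma> r' \<gamma>'"
    interpret D: pair_datum G g f \<Gamma> l r \<gamma> by (rule pd[OF d(1)])
    interpret D': pair_datum G g f \<Gamma> l' r' \<gamma>' by (rule pd[OF d(2)])
    have ax: "l \<in> extensional (carrier G \<times> carrier \<Gamma>)" "l' \<in> extensional (carrier G \<times> carrier \<Gamma>)"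
      "r \<in> extensional (carrier G \<times> carrier \<Gamma>)" "r' \<in> extensional (carrier G \<times> carrier \<Gamma>)"
      "\<gamma> \<in> extensional (carrier \<Gamma>)" "\<gamma>' \<in> extensional (carrier \<Gamma>)"
      using d by (auto simp: matched_pair_datum_def group_matched_pair_def PiE_iff)
    have "l p = l' p" if p: "p \<in> carrier G \<times> carrier \<Gamma>" for p
      using p arg_cong[OF eq(1), of "\<lambda>\<alpha>. \<alpha> (pure_tensor H A (e (fst p)) (basis_vec (snd p)))"]
      by (auto simp: D.act_e D'.act_e basis_vec_inj)
    moreover have "r p = r' p" if p: "p \<in> carrier G \<times> carrier \<Gamma>" for p
      using p arg_cong[OF eq(2), of "\<lambda>\<alpha>. \<alpha> (pure_tensor H A (e (fst p)) (basis_vec (snd p)))"]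
      by (auto simp: D.act_e D'.act_e e_inj)
    moreover have "\<gamma> h = \<gamma>' h" if h: "h \<in> carrier \<Gamma>" for h
    proof -
      have "xc (\<gamma> h) = pair_datum.beta G g f \<Gamma> r \<gamma> (pure_tensor H A x (basis_vec h))" using h by (simp add: D.act_x)
      also have "\<dots> = xc (\<gamma>' h)" unfolding eq(2) using h by (simp add: D'.act_x)
      finally show ?thesis by (metis coord_xc)
    qed
    ultimately show "l = l' \<and> r = r' \<and> \<gamma> = \<gamma>'"
      using extensionalityI[OF ax(1,2)] extensionalityI[OF ax(3,4)] extensionalityI[OF ax(5,6)] by blast
  qed
  show "datum_actions ` {(l, r, \<gamma>). matched_pair_datum \<Gamma> G g f l r \<gamma>} = {(\<alpha>, \<beta>). hopf_matched_pair A H \<alpha> \<beta>}" (is "?l = ?r")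
  proof (rule subset_antisym; rule subsetI)
    fix p assume "p \<in> ?l"
    then obtain l r \<gamma> where d: "matched_pair_datum \<Gamma> G g f l r \<gamma>" and p: "p = datum_actions (l, r, \<gamma>)" by auto
    interpret D: pair_datum G g f \<Gamma> l r \<gamma> by (rule pd[OF d(1)])
    show "p \<in> ?r" using D.hopf_matched_pair_datum p by simp
  next
    fix p assume "p \<in> ?r"
    then obtain \<alpha> \<beta> where p: "p = (\<alpha>, \<beta>)" "hopf_matched_pair A H \<alpha> \<beta>" by auto
    interpret P: hopf_pair G g f \<Gamma> \<alpha> \<beta> using p by unfold_locales
    show "p \<in> ?l" using P.actions_eq P.matched_pair_datum_actions p(1) by (intro image_eqI[of _ _ "(P.left_act, P.right_act, P.shift)"]) auto
  qed
qed

end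

section \<open>Transport of Hopf algebra structures\<close>

text \<open>
  The structure of \<open>C\<close> is that of \<open>B\<close> carried over by the bijection \<open>\<nu>\<close>, whose inverse is \<open>\<mu>\<close>. Sweedler
  sums over \<open>C\<close> are Sweedler sums over \<open>B\<close> with \<open>\<nu>\<close> inserted, and so the axioms of \<open>C\<close> are the images
  under \<open>\<nu>\<close>, or under its tensor cube, of those of \<open>B\<close>.
\<close>

lemma hopf_transport:
  fixes B :: "('k::field, 'b) hopf" and C :: "('k, 'c) hopf"
  assumes B: "hopf_algebra B" and C: "kalgebra C" and \<nu>: "khom B C \<nu>"
    and \<mu>: "\<And>c. c \<in> carrier C \<Longrightarrow> \<mu> c \<in> carrier B" "\<And>b. b \<in> carrier B \<Longrightarrow> \<mu> (\<nu> b) = b" "\<And>c. c \<in> carrier C \<Longrightarrow> \<nu> (\<mu> c) = c"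
    and comult: "\<And>b. b \<in> carrier B \<Longrightarrow> comult C (\<nu> b) =
       sweedler (tensor C C) (comult B b) (\<lambda>b1 b2. pure_tensor C C (\<nu> b1) (\<nu> b2))"
    and counit: "\<And>b. b \<in> carrier B \<Longrightarrow> counit C (\<nu> b) = counit B b"
    and antipode: "\<And>b. b \<in> carrier B \<Longrightarrow> antipode C (\<nu> b) = \<nu> (antipode B b)"
  shows "hopf_algebra C" "\<mu> \<in> hopf_iso C B"
proof -
  have Bk: "kalgebra B" and dB: "khom B (tensor B B) (comult B)" and eB: "khom B ground (counit B)"
    and sB: "klinear B B (antipode B)"
    using B by (auto simp: hopf_algebra_def bialgebra_def coalgebra_def khom_def)
  note [simp] = \<mu> khom_closed[OF \<nu>] khom_closed[OF dB] klinear_closed[OF sB]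
  note \<nu>l = khom_klinear[OF \<nu>]
  have vB [simp]: "vspace B" and vC [simp]: "vspace C" using Bk C by simp_all
  have \<mu>h: "khom C B \<mu>"
  proof (rule khomI[OF klinearI])
    show "\<mu> (a \<oplus>\<^bsub>C\<^esub> b) = \<mu> a \<oplus>\<^bsub>B\<^esub> \<mu> b" if "a \<in> carrier C" "b \<in> carrier C" for a b
      using \<mu>(2)[of "\<mu> a \<oplus>\<^bsub>B\<^esub> \<mu> b"] that by (simp add: klinear_add[OF \<nu>l])
    show "\<mu> (c \<odot>\<^bsub>C\<^esub> a) = c \<odot>\<^bsub>B\<^esub> \<mu> a" if "a \<in> carrier C" for a c
      using \<mu>(2)[of "c \<odot>\<^bsub>B\<^esub> \<mu> a"] that by (simp add: klinear_smult[OF \<nu>l])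
    show "\<mu> (a \<otimes>\<^bsub>C\<^esub> b) = \<mu> a \<otimes>\<^bsub>B\<^esub> \<mu> b" if "a \<in> carrier C" "b \<in> carrier C" for a b
      using \<mu>(2)[of "\<mu> a \<otimes>\<^bsub>B\<^esub> \<mu> b"] that Bk by (simp add: khom_mult[OF \<nu>])
    show "\<mu> \<one>\<^bsub>C\<^esub> = \<one>\<^bsub>B\<^esub>" using \<mu>(2)[of "\<one>\<^bsub>B\<^esub>"] Bk by (simp add: khom_one[OF \<nu>])
  qed simp
  let ?CC = "tensor C C" and ?BB = "tensor B B"
  let ?CCC = "tensor C ?CC" and ?BBB = "tensor B ?BB"
  have alg: "kalgebra ?CC" "kalgebra ?BB" "kalgebra ?CCC" using Bk C by simp_all
  have bN: "bilin B B ?CC (\<lambda>b1 b2. pure_tensor C C (\<nu> b1) (\<nu> b2))"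
    by (rule bilin_comp[OF bilin_pure_tensor \<nu>l \<nu>l]) simp_all
  define N where "N T = sweedler ?CC T (\<lambda>b1 b2. pure_tensor C C (\<nu> b1) (\<nu> b2))" for T
  have N: "khom ?BB ?CC N" unfolding N_def
    by (rule khom_sweedler[OF Bk Bk alg(1) bN])
      (use C in \<open>auto simp: khom_one[OF \<nu>] khom_mult[OF \<nu>] tensor_simps(6) tensor_mult_pure\<close>)
  have comC: "comult C c = N (comult B (\<mu> c))" if "c \<in> carrier C" for c
    using comult[of "\<mu> c"] that by (simp add: N_def)
  have dC: "khom C ?CC (comult C)"
  proof (rule khomI)
    note h = khom_comp[OF \<mu>h khom_comp[OF dB N]]
    show "klinear C ?CC (comult C)" by (rule klinear_cong[OF khom_klinear[OF h]]) (simp_all add: comC)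
    show "comult C \<one>\<^bsub>C\<^esub> = \<one>\<^bsub>?CC\<^esub>" using khom_one[OF h] C by (simp add: comC)
    show "comult C (a \<otimes>\<^bsub>C\<^esub> b) = comult C a \<otimes>\<^bsub>?CC\<^esub> comult C b" if "a \<in> carrier C" "b \<in> carrier C" for a b
      using khom_mult[OF h that] that C by (simp add: comC)
  qed
  have counC: "counit C c = counit B (\<mu> c)" if "c \<in> carrier C" for c
    using counit[of "\<mu> c"] that by simp
  have eC: "khom C ground (counit C)"
  proof (rule khomI)
    note h = khom_comp[OF \<mu>h eB]
    show "klinear C ground (counit C)" by (rule klinear_cong[OF khom_klinear[OF h]]) (simp_all add: counC)
    show "counit C \<one>\<^bsub>C\<^esub> = \<one>\<^bsub>ground\<^esub>" using khom_one[OF h] C by (simp add: counC)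
    show "counit C (a \<otimes>\<^bsub>C\<^esub> b) = counit C a \<otimes>\<^bsub>ground\<^esub> counit C b" if "a \<in> carrier C" "b \<in> carrier C" for a b
      using khom_mult[OF h that] that C by (simp add: counC)
  qed
  have antiC: "antipode C c = \<nu> (antipode B (\<mu> c))" if "c \<in> carrier C" for c
    using antipode[of "\<mu> c"] that by simp
  have sC: "klinear C C (antipode C)"
    by (rule klinear_cong[OF klinear_comp[OF khom_klinear[OF \<mu>h] klinear_comp[OF sB \<nu>l]]]) (simp_all add: antiC)
  note lC = khom_klinear[OF dC] and lB = khom_klinear[OF dB]
  have [simp]: "c \<in> carrier C \<Longrightarrow> comult C c \<in> carrier ?CC" for c by (rule klinear_closed[OF lC])
  have [simp]: "c \<in> carrier C \<Longrightarrow> antipode C c \<in> carrier C" for c by (rule klinear_closed[OF sC])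
  have sw: "sweedler P (comult C c) \<Psi> = sweedler P (comult B (\<mu> c)) (\<lambda>b1 b2. \<Psi> (\<nu> b1) (\<nu> b2))"
    if "vspace P" "bilin C C P \<Psi>" "c \<in> carrier C" for P :: "('k, 'p, 'q) module_scheme" and \<Psi> c
    unfolding comC[OF that(3)] N_def by (rule sweedler_map[OF _ _ _ _ that(1,2) bN]) (use that in simp_all)
  note c1 = bilin_coassoc(1)[OF vC lC] and c2 = bilin_coassoc(2)[OF vC] and c3 = bilin_coassoc(3)[OF vC lC]
  note b1 = bilin_coassoc(1)[OF vB lB] and b2 = bilin_coassoc(2)[OF vB] and b3 = bilin_coassoc(3)[OF vB lB]
  have bM: "bilin B ?BB ?CCC (\<lambda>b T. pure_tensor C ?CC (\<nu> b) (N T))"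
    by (rule bilin_comp[OF bilin_pure_tensor \<nu>l khom_klinear[OF N]]) simp_all
  define M where "M T = sweedler ?CCC T (\<lambda>b T. pure_tensor C ?CC (\<nu> b) (N T))" for T
  have M: "klinear ?BBB ?CCC M" unfolding M_def by (rule klinear_sweedler[OF _ _ _ bM]) simp_all
  have Mp: "M (pure_tensor B ?BB b T) = pure_tensor C ?CC (\<nu> b) (N T)" if "b \<in> carrier B" "T \<in> carrier ?BB" for b T
    unfolding M_def by (rule sweedler_pure[OF _ _ _ bM that]) simp_all
  have Np: "N (pure_tensor B B a b) = pure_tensor C C (\<nu> a) (\<nu> b)" if "a \<in> carrier B" "b \<in> carrier B" for a b
    unfolding N_def by (rule sweedler_pure[OF _ _ _ bN that]) simp_all
  have coassoc: "sweedler ?CCC (comult C c) (\<lambda>c1 c2. pure_tensor C ?CC c1 (comult C c2)) =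
        sweedler ?CCC (comult C c) (\<lambda>c1 c2. sweedler ?CCC (comult C c1) (\<lambda>c11 c12. pure_tensor C ?CC c11 (pure_tensor C C c12 c2)))"
    if c: "c \<in> carrier C" for c
  proof -
    let ?b = "\<mu> c"
    have b: "?b \<in> carrier B" "comult B ?b \<in> carrier ?BB" using c by simp_all
    have "sweedler ?CCC (comult C c) (\<lambda>c1 c2. pure_tensor C ?CC c1 (comult C c2)) =
       sweedler ?CCC (comult B ?b) (\<lambda>b1 b2. pure_tensor C ?CC (\<nu> b1) (comult C (\<nu> b2)))"
      by (rule sw[OF _ c1 c]) simp
    also have "\<dots> = sweedler ?CCC (comult B ?b) (\<lambda>b1 b2. M (pure_tensor B ?BB b1 (comult B b2)))"
      by (rule sym, rule sweedler_cong[OF _ _ _ bilin_out[OF b1 M] b(2)]) (simp_all add: Mp comult N_def)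
    also have "\<dots> = M (sweedler ?BBB (comult B ?b) (\<lambda>b1 b2. pure_tensor B ?BB b1 (comult B b2)))"
      by (rule sym, rule sweedler_comp[OF _ _ _ b1 M _ b(2)]) simp_all
    also have "sweedler ?BBB (comult B ?b) (\<lambda>b1 b2. pure_tensor B ?BB b1 (comult B b2)) =
       sweedler ?BBB (comult B ?b) (\<lambda>c1 c2. sweedler ?BBB (comult B c1) (\<lambda>c11 c12. pure_tensor B ?BB c11 (pure_tensor B B c12 c2)))"
      using B b by (simp add: hopf_algebra_def bialgebra_def coalgebra_def)
    also have "M \<dots> = sweedler ?CCC (comult B ?b) (\<lambda>c1 c2. M (sweedler ?BBB (comult B c1) (\<lambda>c11 c12. pure_tensor B ?BB c11 (pure_tensor B B c12 c2))))"
      by (rule sweedler_comp[OF _ _ _ b3 M _ b(2)]) simp_all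
    also have "\<dots> = sweedler ?CCC (comult B ?b) (\<lambda>b1 b2. sweedler ?CCC (comult C (\<nu> b1)) (\<lambda>c11 c12. pure_tensor C ?CC c11 (pure_tensor C C c12 (\<nu> b2))))"
    proof (rule sweedler_cong[OF _ _ _ bilin_out[OF b3 M] b(2)])
      fix b1 b2' assume bb: "b1 \<in> carrier B" "b2' \<in> carrier B"
      have "M (sweedler ?BBB (comult B b1) (\<lambda>c11 c12. pure_tensor B ?BB c11 (pure_tensor B B c12 b2'))) =
         sweedler ?CCC (comult B b1) (\<lambda>c11 c12. M (pure_tensor B ?BB c11 (pure_tensor B B c12 b2')))"
        by (rule sweedler_comp[OF _ _ _ b2 M]) (use bb in simp_all)
      also have "\<dots> = sweedler ?CCC (comult B b1) (\<lambda>c11 c12. pure_tensor C ?CC (\<nu> c11) (pure_tensor C C (\<nu> c12) (\<nu> b2')))"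
        by (rule sweedler_cong[OF _ _ _ bilin_out[OF b2 M]]) (use bb in \<open>simp_all add: Mp Np\<close>)
      also have "\<dots> = sweedler ?CCC (comult C (\<nu> b1)) (\<lambda>c11 c12. pure_tensor C ?CC c11 (pure_tensor C C c12 (\<nu> b2')))"
        using bb by (simp add: sw[OF _ c2])
      finally show "M (sweedler ?BBB (comult B b1) (\<lambda>c11 c12. pure_tensor B ?BB c11 (pure_tensor B B c12 b2'))) =
        sweedler ?CCC (comult C (\<nu> b1)) (\<lambda>c11 c12. pure_tensor C ?CC c11 (pure_tensor C C c12 (\<nu> b2')))" .
    qed simp_all
    also have "\<dots> = sweedler ?CCC (comult C c) (\<lambda>c1 c2. sweedler ?CCC (comult C c1) (\<lambda>c11 c12. pure_tensor C ?CC c11 (pure_tensor C C c12 c2)))"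
      by (rule sym, rule sw[OF _ c3 c]) simp
    finally show ?thesis .
  qed
  have eC': "klinear C ground (counit C)" and eB': "klinear B ground (counit B)"
    using eC eB by (simp_all add: khom_klinear)
  have c4: "bilin C C C (\<lambda>c1 c2. counit C c1 \<odot>\<^bsub>C\<^esub> c2)" by (rule bilin_comp[OF bilin_smult eC' klinear_id]) simp
  have b4: "bilin B B B (\<lambda>c1 c2. counit B c1 \<odot>\<^bsub>B\<^esub> c2)" by (rule bilin_comp[OF bilin_smult eB' klinear_id]) simp
  have c6: "bilin C C C (\<lambda>u1 u2. antipode C u1 \<otimes>\<^bsub>C\<^esub> u2)" "bilin C C C (\<lambda>u1 u2. u1 \<otimes>\<^bsub>C\<^esub> antipode C u2)"
    by (rule bilin_comp[OF bilin_mult[OF C] sC klinear_id] bilin_comp[OF bilin_mult[OF C] klinear_id sC])+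
  have b6: "bilin B B B (\<lambda>u1 u2. antipode B u1 \<otimes>\<^bsub>B\<^esub> u2)" "bilin B B B (\<lambda>u1 u2. u1 \<otimes>\<^bsub>B\<^esub> antipode B u2)"
    by (rule bilin_comp[OF bilin_mult[OF Bk] sB klinear_id] bilin_comp[OF bilin_mult[OF Bk] klinear_id sB])+
  have tr: "sweedler C (comult C c) \<Psi> = \<nu> (sweedler B (comult B (\<mu> c)) \<Psi>')"
    if "bilin C C C \<Psi>" "bilin B B B \<Psi>'" "c \<in> carrier C"
      "\<And>a b. a \<in> carrier B \<Longrightarrow> b \<in> carrier B \<Longrightarrow> \<Psi> (\<nu> a) (\<nu> b) = \<nu> (\<Psi>' a b)" for c \<Psi> \<Psi>'
  proof -
    have "sweedler C (comult C c) \<Psi> = sweedler C (comult B (\<mu> c)) (\<lambda>a b. \<Psi> (\<nu> a) (\<nu> b))"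
      by (rule sw[OF _ that(1,3)]) simp
    also have "\<dots> = sweedler C (comult B (\<mu> c)) (\<lambda>a b. \<nu> (\<Psi>' a b))"
      by (rule sweedler_cong[OF _ _ _ bilin_comp[OF that(1) \<nu>l \<nu>l]]) (use that in simp_all)
    also have "\<dots> = \<nu> (sweedler B (comult B (\<mu> c)) \<Psi>')"
      by (rule sym, rule sweedler_comp[OF _ _ _ that(2) \<nu>l]) (use that in simp_all)
    finally show ?thesis .
  qed
  have axB: "sweedler B (comult B b) (\<lambda>c1 c2. counit B c1 \<odot>\<^bsub>B\<^esub> c2) = b"
      "sweedler B (comult B b) (\<lambda>c1 c2. counit B c2 \<odot>\<^bsub>B\<^esub> c1) = b"
      "sweedler B (comult B b) (\<lambda>u1 u2. antipode B u1 \<otimes>\<^bsub>B\<^esub> u2) = counit B b \<odot>\<^bsub>B\<^esub> \<one>\<^bsub>B\<^esub>"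
      "sweedler B (comult B b) (\<lambda>u1 u2. u1 \<otimes>\<^bsub>B\<^esub> antipode B u2) = counit B b \<odot>\<^bsub>B\<^esub> \<one>\<^bsub>B\<^esub>" if "b \<in> carrier B" for b
    using B that by (simp_all add: hopf_algebra_def bialgebra_def coalgebra_def)
  have ax: "sweedler C (comult C c) (\<lambda>c1 c2. counit C c1 \<odot>\<^bsub>C\<^esub> c2) = c"
      "sweedler C (comult C c) (\<lambda>c1 c2. counit C c2 \<odot>\<^bsub>C\<^esub> c1) = c"
      "sweedler C (comult C c) (\<lambda>u1 u2. antipode C u1 \<otimes>\<^bsub>C\<^esub> u2) = counit C c \<odot>\<^bsub>C\<^esub> \<one>\<^bsub>C\<^esub>"
      "sweedler C (comult C c) (\<lambda>u1 u2. u1 \<otimes>\<^bsub>C\<^esub> antipode C u2) = counit C c \<odot>\<^bsub>C\<^esub> \<one>\<^bsub>C\<^esub>" if "c \<in> carrier C" for c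
    using that Bk
    by (simp_all add: tr[OF c4 b4] tr[OF bilin_flip[OF c4] bilin_flip[OF b4]] tr[OF c6(1) b6(1)] tr[OF c6(2) b6(2)]
      counit antipode klinear_smult[OF \<nu>l] khom_mult[OF \<nu>] khom_one[OF \<nu>] counC axB)
  show "hopf_algebra C"
    unfolding hopf_algebra_def bialgebra_def coalgebra_def
    using C lC eC' sC coassoc ax khom_ring_hom[OF dC] khom_ring_hom[OF eC] by auto
  have bB: "bilin C C ?BB (\<lambda>a b. pure_tensor B B (\<mu> a) (\<mu> b))"
    by (rule bilin_comp[OF bilin_pure_tensor khom_klinear[OF \<mu>h] khom_klinear[OF \<mu>h]]) simp_all
  have "comult B (\<mu> c) = sweedler ?BB (comult C c) (\<lambda>a b. pure_tensor B B (\<mu> a) (\<mu> b))" if c: "c \<in> carrier C" for c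
  proof -
    have "sweedler ?BB (comult C c) (\<lambda>a b. pure_tensor B B (\<mu> a) (\<mu> b)) = sweedler ?BB (comult B (\<mu> c)) (\<lambda>a b. pure_tensor B B (\<mu> (\<nu> a)) (\<mu> (\<nu> b)))"
      by (rule sw[OF _ bB c]) simp
    also have "\<dots> = sweedler ?BB (comult B (\<mu> c)) (pure_tensor B B)"
      by (rule sweedler_cong[OF _ _ _ bilin_comp[OF bB \<nu>l \<nu>l]]) (use c in simp_all)
    also have "\<dots> = comult B (\<mu> c)" by (rule sweedler_id) (use c in simp_all)
    finally show ?thesis by simp
  qed
  moreover have "bij_betw \<mu> (carrier C) (carrier B)"
    by (rule bij_betw_byWitness[of _ \<nu>]) auto
  ultimately show "\<mu> \<in> hopf_iso C B"
    using \<mu>h by (simp add: hopf_iso_def ring_iso_def khom_def counC antiC)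
qed

section \<open>The bicrossed product as a third-type Hopf algebra\<close>

lemma group_bicrossed_simps [simp]:
  "carrier (group_bicrossed \<Gamma> G l r) = carrier \<Gamma> \<times> carrier G"
  "(h, t) \<otimes>\<^bsub>group_bicrossed \<Gamma> G l r\<^esub> (k, s) = (h \<otimes>\<^bsub>\<Gamma>\<^esub> l (t, k), r (t, k) \<otimes>\<^bsub>G\<^esub> s)"
  "\<one>\<^bsub>group_bicrossed \<Gamma> G l r\<^esub> = (\<one>\<^bsub>\<Gamma>\<^esub>, \<one>\<^bsub>G\<^esub>)"
  by (simp_all add: group_bicrossed_def)

locale finite_pair_datum = pair_datum G g f \<Gamma> l r \<gamma>
  for G :: "'g monoid" (structure) and g :: 'g and f :: "'g \<Rightarrow> 'k::field" and \<Gamma> :: "'c monoid"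
    and l :: "'g \<times> 'c \<Rightarrow> 'c" and r :: "'g \<times> 'c \<Rightarrow> 'g" and \<gamma> :: "'c \<Rightarrow> 'k" +
  assumes finite_\<Gamma>: "finite (carrier \<Gamma>)"
begin

abbreviation "L \<equiv> group_bicrossed \<Gamma> G l r"
abbreviation "g' \<equiv> (\<one>\<^bsub>\<Gamma>\<^esub>, g)"
abbreviation F :: "'c \<times> 'g \<Rightarrow> 'k" where "F \<equiv> \<lambda>(h, t). f t - \<gamma> h"

lemma group_L: "group L"
proof (rule groupI)
  fix p assume "p \<in> carrier L"
  then obtain h t where p: "p = (h, t)" "h \<in> carrier \<Gamma>" "t \<in> carrier G" by auto
  \<comment> \<open>A left inverse \<open>(k, s)\<close> of \<open>(h, t)\<close> needs \<open>s \<triangleleft> h = t\<^bsup>-1\<^esup>\<close> and \<open>k (s \<triangleright> h) = 1\<close>.\<close>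
  let ?s = "r (inv t, inv\<^bsub>\<Gamma>\<^esub> h)"
  have s: "?s \<in> carrier G" "r (?s, h) = inv t" using p by (simp_all add: group_pair_laws(4)[symmetric] group_pair_laws(3))
  show "\<exists>q\<in>carrier L. q \<otimes>\<^bsub>L\<^esub> p = \<one>\<^bsub>L\<^esub>"
    using p s by (intro bexI[of _ "(inv\<^bsub>\<Gamma>\<^esub> l (?s, h), ?s)"]) simp_all
qed (auto simp: group_pair_laws \<Gamma>.m_assoc m_assoc)

lemma pow_L: "t \<in> carrier G \<Longrightarrow> (\<one>\<^bsub>\<Gamma>\<^esub>, t) [^]\<^bsub>L\<^esub> (n::nat) = (\<one>\<^bsub>\<Gamma>\<^esub>, t [^] n)"
proof -
  interpret L: group L by (rule group_L)
  show "t \<in> carrier G \<Longrightarrow> ?thesis" by (induction n) (simp_all add: group_pair_laws(3))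
qed

theorem third_type_datum_L: "third_type_datum L g' F"
  unfolding third_type_datum_def
proof (intro conjI ballI)
  show "F \<in> hom L (add_monoid ground)"
    by (rule homI) (auto simp: \<gamma>)
  fix p assume "p \<in> carrier L"
  then obtain h t where p: "p = (h, t)" "h \<in> carrier \<Gamma>" "t \<in> carrier G" by auto
  show "g' \<otimes>\<^bsub>L\<^esub> p = p \<otimes>\<^bsub>L\<^esub> g'" using p by (simp add: group_pair_laws g_central)
  have "(- \<gamma> h) ^ CHAR('k) = - (\<gamma> h ^ CHAR('k))"
    using prime_CHAR_semidom[OF char_pos] by (intro minus_power_prime_CHAR) simp_all
  moreover have "(f t + - \<gamma> h) ^ CHAR('k) = f t ^ CHAR('k) + (- \<gamma> h) ^ CHAR('k)"
    using prime_CHAR_semidom[OF char_pos] by (intro freshmans_dream) simp_all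
  ultimately have "(f t - \<gamma> h) ^ CHAR('k) = f t ^ CHAR('k) - \<gamma> h ^ CHAR('k)"
    by simp
  then show "F p \<in> k_set L g'"
    using f_k_set[OF p(3)] \<gamma>(1)[OF p(2)] p
    by (auto simp: k_set_iff[OF group_L] k_set_iff[OF group_axioms g_closed] pow_L)
qed (simp_all add: group_L finite_\<Gamma> finite_G)

text \<open>
  The Hopf algebra that will turn out to be the bicrossed product.
\<close>

sublocale B: third_type L g' F
  by unfold_locales (rule char_pos third_type_datum_L)+

abbreviation "AH \<equiv> tensor A H"

lemma AH_vspace [simp]: "vspace AH" by simp

definition inc_A :: "('c \<Rightarrow>\<^sub>0 'k) \<Rightarrow> (('c \<times> 'g) letter list \<Rightarrow>\<^sub>0 'k) set" where
  "inc_A = lin_ext B.H (\<lambda>h. B.e (h, \<one>))"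

definition inc_H :: "('g letter list \<Rightarrow>\<^sub>0 'k) set \<Rightarrow> (('c \<times> 'g) letter list \<Rightarrow>\<^sub>0 'k) set" where
  "inc_H = alg_eval B.H (\<lambda>a. case a of Grp t \<Rightarrow> B.e (\<one>\<^bsub>\<Gamma>\<^esub>, t) | Skew \<Rightarrow> B.x)"

lemma B_e_one: "B.e (\<one>\<^bsub>\<Gamma>\<^esub>, \<one>) = \<one>\<^bsub>B.H\<^esub>"
  using B.e_one by simp

lemma khom_inc_A: "khom A B.H inc_A"
  and inc_A_bv: "h \<in> carrier \<Gamma> \<Longrightarrow> inc_A (basis_vec h) = B.e (h, \<one>)"
proof -
  show "khom A B.H inc_A" unfolding inc_A_def A_def
    by (rule khom_group_hopf[OF \<Gamma>.group_axioms]) (simp_all add: B.e_mult group_pair_laws B_e_one)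
  show "inc_A (basis_vec h) = B.e (h, \<one>)" if "h \<in> carrier \<Gamma>"
    unfolding inc_A_def by (rule lin_ext_basis) (use that in simp_all)
qed

lemma khom_inc_H: "khom H B.H inc_H"
  and inc_H_e: "t \<in> carrier G \<Longrightarrow> inc_H (e t) = B.e (\<one>\<^bsub>\<Gamma>\<^esub>, t)"
  and inc_H_x: "inc_H x = B.x"
proof -
  let ?\<psi> = "\<lambda>a. case a of Grp t \<Rightarrow> B.e (\<one>\<^bsub>\<Gamma>\<^esub>, t) | Skew \<Rightarrow> B.x"
  note [simp] = B.e_mult group_pair_laws B.x_mult_e B_e_one B.x_power
  have "khom H B.H (alg_eval B.H ?\<psi>)" by (rule universal(1)[of B.H ?\<psi>]) simp_all
  moreover have "alg_eval B.H ?\<psi> (e t) = ?\<psi> (Grp t)" if "t \<in> carrier G" for t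
    by (rule universal(2)[of B.H ?\<psi>]) (simp_all add: that)
  moreover have "alg_eval B.H ?\<psi> x = ?\<psi> Skew" by (rule universal(3)[of B.H ?\<psi>]) simp_all
  ultimately show "khom H B.H inc_H" "t \<in> carrier G \<Longrightarrow> inc_H (e t) = B.e (\<one>\<^bsub>\<Gamma>\<^esub>, t)" "inc_H x = B.x"
    by (simp_all add: inc_H_def)
qed

lemmas inc_closed [simp] = khom_closed[OF khom_inc_A] khom_closed[OF khom_inc_H]

lemma inc_H_bas: "t \<in> carrier G \<Longrightarrow> inc_H (bas t n) = B.bas (\<one>\<^bsub>\<Gamma>\<^esub>, t) n"
  by (simp add: bas_def B.bas_def khom_mult[OF khom_inc_H] inc_H_e ffact_khom[OF H_kalgebra khom_inc_H] inc_H_x)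

lemma inc_bas: "h \<in> carrier \<Gamma> \<Longrightarrow> t \<in> carrier G \<Longrightarrow> inc_A (basis_vec h) \<otimes>\<^bsub>B.H\<^esub> inc_H (bas t n) = B.bas (h, t) n"
  by (simp add: inc_A_bv inc_H_bas B.e_mult_bas group_pair_laws)

text \<open>
  The multiplication map and its inverse, which is given on the basis of \<open>B\<close>.
\<close>

definition mu where "mu T = sweedler B.H T (\<lambda>a u. inc_A a \<otimes>\<^bsub>B.H\<^esub> inc_H u)"
definition nu where "nu = B.blin AH (\<lambda>p n. pure_tensor A H (basis_vec (fst p)) (bas (snd p) n))"

lemma bilin_mu: "bilin A H B.H (\<lambda>a u. inc_A a \<otimes>\<^bsub>B.H\<^esub> inc_H u)"
  by (rule bilin_comp[OF bilin_mult khom_klinear[OF khom_inc_A] khom_klinear[OF khom_inc_H]]) simp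

lemma klinear_mu: "klinear AH B.H mu"
  unfolding mu_def[abs_def] by (rule klinear_sweedler[OF _ _ _ bilin_mu]) simp_all

lemma mu_pure: "a \<in> carrier A \<Longrightarrow> u \<in> carrier H \<Longrightarrow> mu (pure_tensor A H a u) = inc_A a \<otimes>\<^bsub>B.H\<^esub> inc_H u"
  unfolding mu_def by (rule sweedler_pure[OF _ _ _ bilin_mu]) simp_all

lemma klinear_nu: "klinear B.H AH nu"
  and nu_bas: "h \<in> carrier \<Gamma> \<Longrightarrow> t \<in> carrier G \<Longrightarrow> n < CHAR('k) \<Longrightarrow> nu (B.bas (h, t) n) = pure_tensor A H (basis_vec h) (bas t n)"
  unfolding nu_def using B.blin[of AH "\<lambda>p n. pure_tensor A H (basis_vec (fst p)) (bas (snd p) n)"] by auto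

lemma mu_closed [simp]: "T \<in> carrier AH \<Longrightarrow> mu T \<in> carrier B.H" by (rule klinear_closed[OF klinear_mu])
lemma nu_closed [simp]: "u \<in> carrier B.H \<Longrightarrow> nu u \<in> carrier AH" by (rule klinear_closed[OF klinear_nu])

lemma mu_nu [simp]: "u \<in> carrier B.H \<Longrightarrow> mu (nu u) = u"
  by (rule B.H_ext[OF klinear_comp[OF klinear_nu klinear_mu] klinear_id])
    (auto simp: nu_bas mu_pure inc_bas)

lemma nu_mu_pure: "a \<in> carrier A \<Longrightarrow> u \<in> carrier H \<Longrightarrow> nu (inc_A a \<otimes>\<^bsub>B.H\<^esub> inc_H u) = pure_tensor A H a u"
  by (rule bilin_ext[OF bilin_flip[OF bilin_out[OF bilin_mu klinear_nu]] bilin_flip[OF bilin_pure_tensor[OF A_vspace H_vspace]] AH_vspace])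
    (simp_all add: inc_bas nu_bas)

lemma nu_mu [simp]: "T \<in> carrier AH \<Longrightarrow> nu (mu T) = T"
  by (rule tensor_ext[OF _ _ klinear_comp[OF klinear_mu klinear_nu] klinear_id]) (auto simp: mu_pure nu_mu_pure)

subsection \<open>The commutation rule\<close>

text \<open>
  For basis elements \<open>u = t x\<^bsup>(n)\<^esup>\<close> and \<open>b = h\<close> this says \<open>t x\<^bsup>(n)\<^esup> h = (t \<triangleright> h) (t \<triangleleft> h) (x \<triangleleft> h)\<^bsup>(n)\<^esup>\<close> in \<open>B\<close>. In \<open>L\<close> the
  product of \<open>t\<close> and \<open>h\<close> is \<open>(t \<triangleright> h) (t \<triangleleft> h)\<close>, and the relation \<open>x h = h (x + \<gamma>\<^sub>h (1 - g))\<close> holds because of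
  \<open>F(h, 1) = -\<gamma>\<^sub>h\<close>.
\<close>

lemma inc_commute:
  assumes u: "u \<in> carrier H" and b: "b \<in> carrier A"
  shows "inc_H u \<otimes>\<^bsub>B.H\<^esub> inc_A b = sweedler B.H (comult H u) (\<lambda>u1 u2. sweedler B.H (comult A b) (\<lambda>b1 b2.
     inc_A (lact u1 b1) \<otimes>\<^bsub>B.H\<^esub> inc_H (ract u2 b2)))"
proof (rule bilin_ext[OF _ _ _ _ u b])
  show "bilin H A B.H (\<lambda>u b. inc_H u \<otimes>\<^bsub>B.H\<^esub> inc_A b)"
    by (rule bilin_comp[OF bilin_mult khom_klinear[OF khom_inc_H] khom_klinear[OF khom_inc_A]]) simp
  show "bilin H A B.H (\<lambda>u b. sweedler B.H (comult H u) (\<lambda>u1 u2. sweedler B.H (comult A b) (\<lambda>b1 b2.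
     inc_A (lact u1 b1) \<otimes>\<^bsub>B.H\<^esub> inc_H (ract u2 b2))))"
    by (rule bilin_double_sweedler[OF _ _ _ bilin_lact bilin_ract bilin_mu]) simp_all
  fix t n h assume th: "t \<in> carrier G" "h \<in> carrier \<Gamma>"
  have x: "B.x \<otimes>\<^bsub>B.H\<^esub> B.e (h, \<one>) = B.e (h, \<one>) \<otimes>\<^bsub>B.H\<^esub> inc_H (xh h)"
  proof -
    note il = khom_klinear[OF khom_inc_H]
    have "inc_H (xh h) = B.x \<oplus>\<^bsub>B.H\<^esub> \<gamma> h \<odot>\<^bsub>B.H\<^esub> (\<one>\<^bsub>B.H\<^esub> \<ominus>\<^bsub>B.H\<^esub> B.e g')"
      by (simp add: xh_def xc_def klinear_add[OF il] klinear_smult[OF il] klinear_minus[OF il] inc_H_x inc_H_e khom_one[OF khom_inc_H])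
    then show ?thesis using th
      by (simp add: B.x_mult_e ka_distribs ka_mult_smult B.e_mult group_pair_laws)
        (rule lincomb_eqI[where V = B.H], (rule lincomb_intros | rule lincomb_atom | simp)+, (simp add: algebra_simps)?)
  qed
  have "inc_H (bas t n) \<otimes>\<^bsub>B.H\<^esub> inc_A (basis_vec h) = B.e (\<one>\<^bsub>\<Gamma>\<^esub>, t) \<otimes>\<^bsub>B.H\<^esub> (ffact B.H B.x n \<otimes>\<^bsub>B.H\<^esub> B.e (h, \<one>))"
    using th by (simp add: inc_H_bas inc_A_bv B.bas_def ka_assoc)
  also have "\<dots> = (B.e (\<one>\<^bsub>\<Gamma>\<^esub>, t) \<otimes>\<^bsub>B.H\<^esub> B.e (h, \<one>)) \<otimes>\<^bsub>B.H\<^esub> ffact B.H (inc_H (xh h)) n"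
    using th by (simp add: ffact_intertwine[OF _ _ _ _ x] ka_assoc)
  also have "\<dots> = inc_A (basis_vec (l (t, h))) \<otimes>\<^bsub>B.H\<^esub> inc_H (Rb h t n)"
    using th by (simp add: B.e_mult group_pair_laws inc_A_bv Rb_def khom_mult[OF khom_inc_H] inc_H_e ffact_khom[OF H_kalgebra khom_inc_H]
      ka_assoc[symmetric])
  also have "\<dots> = sweedler B.H (comult H (bas t n)) (\<lambda>u1 u2. sweedler B.H (comult A (basis_vec h)) (\<lambda>b1 b2.
     inc_A (lact u1 b1) \<otimes>\<^bsub>B.H\<^esub> inc_H (ract u2 b2)))"
    using th
    by (subst double_sweedler_bas[OF _ _ _ bilin_lact bilin_ract bilin_mu th order_refl])
      (auto simp: lact_mult_gpow act_e ract_bas lact_bas Lb_def)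
  finally show "inc_H (bas t n) \<otimes>\<^bsub>B.H\<^esub> inc_A (basis_vec h) = sweedler B.H (comult H (bas t n)) (\<lambda>u1 u2.
     sweedler B.H (comult A (basis_vec h)) (\<lambda>b1 b2. inc_A (lact u1 b1) \<otimes>\<^bsub>B.H\<^esub> inc_H (ract u2 b2)))" .
qed simp

subsection \<open>Transport along the multiplication map\<close>

lemma double_sweedler_comp:
  assumes v: "vspace U" "vspace V" "vspace W" and b: "bilin H A U p" "bilin H A V q" "bilin U V W \<Phi>"
    and \<phi>: "klinear W W' \<phi>" "vspace W'" and u: "u \<in> carrier H" and a: "a \<in> carrier A"
  shows "\<phi> (sweedler W (comult H u) (\<lambda>u1 u2. sweedler W (comult A a) (\<lambda>a1 a2. \<Phi> (p u1 a1) (q u2 a2)))) =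
    sweedler W' (comult H u) (\<lambda>u1 u2. sweedler W' (comult A a) (\<lambda>a1 a2. \<phi> (\<Phi> (p u1 a1) (q u2 a2))))"
proof -
  note c = khom_closed[OF comult_khom u] khom_closed[OF comult_A_khom a]
  note m = bilin_middle[OF v b c(2)]
  have "\<phi> (sweedler W (comult H u) (\<lambda>u1 u2. sweedler W (comult A a) (\<lambda>a1 a2. \<Phi> (p u1 a1) (q u2 a2)))) =
    sweedler W' (comult H u) (\<lambda>u1 u2. \<phi> (sweedler W (comult A a) (\<lambda>a1 a2. \<Phi> (p u1 a1) (q u2 a2))))"
    by (rule sweedler_comp[OF H_vspace H_vspace v(3) m \<phi> c(1)])
  also have "\<dots> = sweedler W' (comult H u) (\<lambda>u1 u2. sweedler W' (comult A a) (\<lambda>a1 a2. \<phi> (\<Phi> (p u1 a1) (q u2 a2))))"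
    by (rule sweedler_cong[OF H_vspace H_vspace \<phi>(2) bilin_out[OF m \<phi>(1)] c(1)])
      (rule sweedler_comp[OF A_vspace A_vspace v(3) bilin_inner_A[OF v b] \<phi> c(2)])
  finally show ?thesis .
qed

text \<open>
  The commutation rule, multiplied by \<open>i(a)\<close> on the left and by \<open>j(w)\<close> on the right.
\<close>

lemma bicrossed_term:
  assumes [simp]: "a \<in> carrier A" "b \<in> carrier A" "u \<in> carrier H" "w \<in> carrier H"
  shows "sweedler AH (comult H u) (\<lambda>u1 u2. sweedler AH (comult A b) (\<lambda>b1 b2.
     pure_tensor A H (a \<otimes>\<^bsub>A\<^esub> alpha (pure_tensor H A u1 b1)) (beta (pure_tensor H A u2 b2) \<otimes>\<^bsub>H\<^esub> w))) =
     nu ((inc_A a \<otimes>\<^bsub>B.H\<^esub> inc_H u) \<otimes>\<^bsub>B.H\<^esub> (inc_A b \<otimes>\<^bsub>B.H\<^esub> inc_H w))" (is "?l = nu ?r")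
proof -
  note v = A_vspace H_vspace AH_vspace
  have b1: "bilin A H AH (\<lambda>c z. pure_tensor A H (a \<otimes>\<^bsub>A\<^esub> c) (z \<otimes>\<^bsub>H\<^esub> w))"
    by (rule bilin_comp[OF bilin_pure_tensor klinear_mult_left klinear_mult_right]) simp_all
  \<comment> \<open>The two outer factors are multiplied to both sides of the commutation rule.\<close>
  have K: "klinear B.H B.H (\<lambda>z. inc_A a \<otimes>\<^bsub>B.H\<^esub> (z \<otimes>\<^bsub>B.H\<^esub> inc_H w))"
    by (rule klinear_comp[OF klinear_mult_right klinear_mult_left]) simp_all
  have cl: "?l \<in> carrier AH"
    by (rule bilin_closed[OF bilin_double_sweedler[OF v bilin_alpha bilin_beta b1]]) simp_all
  have "mu ?l = sweedler B.H (comult H u) (\<lambda>u1 u2. sweedler B.H (comult A b) (\<lambda>b1 b2.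
     mu (pure_tensor A H (a \<otimes>\<^bsub>A\<^esub> alpha (pure_tensor H A u1 b1)) (beta (pure_tensor H A u2 b2) \<otimes>\<^bsub>H\<^esub> w))))"
    by (rule double_sweedler_comp[OF v bilin_alpha bilin_beta b1 klinear_mu]) simp_all
  also have "\<dots> = sweedler B.H (comult H u) (\<lambda>u1 u2. sweedler B.H (comult A b) (\<lambda>b1 b2.
     inc_A a \<otimes>\<^bsub>B.H\<^esub> ((inc_A (lact u1 b1) \<otimes>\<^bsub>B.H\<^esub> inc_H (ract u2 b2)) \<otimes>\<^bsub>B.H\<^esub> inc_H w)))"
  proof (rule sweedler_cong_closed[OF _ khom_closed[OF comult_khom]])
    note b2 = bilin_out[OF bilin_mu K]
    note m = bilin_middle[OF v(1,2) _ bilin_lact bilin_ract b2 khom_closed[OF comult_A_khom]]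
    fix u1 u2 assume uu: "u1 \<in> carrier H" "u2 \<in> carrier H"
    show "sweedler B.H (comult A b) (\<lambda>b1 b2. inc_A a \<otimes>\<^bsub>B.H\<^esub> ((inc_A (lact u1 b1) \<otimes>\<^bsub>B.H\<^esub> inc_H (ract u2 b2)) \<otimes>\<^bsub>B.H\<^esub> inc_H w)) \<in> carrier B.H"
      by (rule bilin_closed[OF m]) (use uu in simp_all)
    show "sweedler B.H (comult A b) (\<lambda>b1 b2. mu (pure_tensor A H (a \<otimes>\<^bsub>A\<^esub> alpha (pure_tensor H A u1 b1)) (beta (pure_tensor H A u2 b2) \<otimes>\<^bsub>H\<^esub> w))) =
      sweedler B.H (comult A b) (\<lambda>b1 b2. inc_A a \<otimes>\<^bsub>B.H\<^esub> ((inc_A (lact u1 b1) \<otimes>\<^bsub>B.H\<^esub> inc_H (ract u2 b2)) \<otimes>\<^bsub>B.H\<^esub> inc_H w))"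
      by (rule sweedler_cong_closed[OF _ khom_closed[OF comult_A_khom]])
        (use uu in \<open>simp_all add: mu_pure khom_mult[OF khom_inc_A] khom_mult[OF khom_inc_H] ka_assoc\<close>)
  qed simp_all
  also have "\<dots> = inc_A a \<otimes>\<^bsub>B.H\<^esub> ((inc_H u \<otimes>\<^bsub>B.H\<^esub> inc_A b) \<otimes>\<^bsub>B.H\<^esub> inc_H w)"
    unfolding inc_commute[OF assms(3,2)]
    by (rule double_sweedler_comp[symmetric, OF v(1,2) _ bilin_lact bilin_ract bilin_mu K]) simp_all
  also have "\<dots> = ?r" by (simp add: ka_assoc)
  finally show ?thesis using nu_mu[OF cl] by simp
qed

lemma bicrossed_mult_eq:
  assumes ST: "S \<in> carrier AH" "T \<in> carrier AH"
  shows "bicrossed_mult A H alpha beta S T = nu (mu S \<otimes>\<^bsub>B.H\<^esub> mu T)"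
proof -
  note v = A_vspace H_vspace
  have "bicrossed_mult A H alpha beta S T = sweedler AH S (\<lambda>a u. nu ((inc_A a \<otimes>\<^bsub>B.H\<^esub> inc_H u) \<otimes>\<^bsub>B.H\<^esub> mu T))"
    unfolding bicrossed_mult_def Let_def
  proof (rule sweedler_cong_closed[OF _ ST(1)])
    fix a u assume au: "a \<in> carrier A" "u \<in> carrier H"
    have K: "klinear B.H AH (\<lambda>z. nu ((inc_A a \<otimes>\<^bsub>B.H\<^esub> inc_H u) \<otimes>\<^bsub>B.H\<^esub> z))"
      by (rule klinear_comp[OF klinear_mult_left klinear_nu]) (use au in simp_all)
    have "sweedler AH T (\<lambda>b v. sweedler AH (comult H u) (\<lambda>u1 u2. sweedler AH (comult A b) (\<lambda>b1 b2.
         pure_tensor A H (a \<otimes>\<^bsub>A\<^esub> alpha (pure_tensor H A u1 b1)) (beta (pure_tensor H A u2 b2) \<otimes>\<^bsub>H\<^esub> v)))) =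
      sweedler AH T (\<lambda>b v. nu ((inc_A a \<otimes>\<^bsub>B.H\<^esub> inc_H u) \<otimes>\<^bsub>B.H\<^esub> (inc_A b \<otimes>\<^bsub>B.H\<^esub> inc_H v)))"
      by (rule sweedler_cong_closed[OF _ ST(2)]) (use au in \<open>simp_all add: bicrossed_term\<close>)
    also have "\<dots> = nu ((inc_A a \<otimes>\<^bsub>B.H\<^esub> inc_H u) \<otimes>\<^bsub>B.H\<^esub> mu T)"
      unfolding mu_def by (rule sym, rule sweedler_comp[OF v _ bilin_mu K _ ST(2)]) simp_all
    finally show "sweedler AH T (\<lambda>b v. sweedler AH (comult H u) (\<lambda>u1 u2. sweedler AH (comult A b) (\<lambda>b1 b2.
         pure_tensor A H (a \<otimes>\<^bsub>A\<^esub> alpha (pure_tensor H A u1 b1)) (beta (pure_tensor H A u2 b2) \<otimes>\<^bsub>H\<^esub> v)))) =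
      nu ((inc_A a \<otimes>\<^bsub>B.H\<^esub> inc_H u) \<otimes>\<^bsub>B.H\<^esub> mu T)" .
  qed (use ST in simp_all)
  also have "\<dots> = nu (mu S \<otimes>\<^bsub>B.H\<^esub> mu T)"
  proof -
    have K: "klinear B.H AH (\<lambda>z. nu (z \<otimes>\<^bsub>B.H\<^esub> mu T))"
      by (rule klinear_comp[OF klinear_mult_right klinear_nu]) (use ST in simp_all)
    show ?thesis
      unfolding mu_def[of S] by (rule sym, rule sweedler_comp[OF v _ bilin_mu K _ ST(1)]) simp_all
  qed
  finally show ?thesis .
qed

definition C where "C = bicrossed A H alpha beta"

lemma C_simps [simp]:
  "carrier C = carrier AH" "\<zero>\<^bsub>C\<^esub> = \<zero>\<^bsub>AH\<^esub>" "\<one>\<^bsub>C\<^esub> = pure_tensor A H \<one>\<^bsub>A\<^esub> \<one>\<^bsub>H\<^esub>"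
  "a \<oplus>\<^bsub>C\<^esub> b = a \<oplus>\<^bsub>AH\<^esub> b" "c \<odot>\<^bsub>C\<^esub> a = c \<odot>\<^bsub>AH\<^esub> a" "a \<otimes>\<^bsub>C\<^esub> b = bicrossed_mult A H alpha beta a b"
  by (simp_all add: C_def bicrossed_def Let_def module.defs hopf.defs tensor_simps(6))

abbreviation "AH_bicrossed \<equiv> AH\<lparr>monoid.mult := bicrossed_mult A H alpha beta\<rparr>"

text \<open>
  The coproduct of the bicrossed product is defined over the tensor square of the underlying algebra;
  it agrees with the tensor square of the Hopf algebra \<^const>\<open>C\<close>.
\<close>

lemma C_tensor: "tensor AH_bicrossed AH_bicrossed = tensor C C" "pure_tensor AH_bicrossed AH_bicrossed = pure_tensor C C"
  by (rule tensor_cong; simp add: tensor_simps(6))+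

lemma C_coalgebra:
  "comult C T = sweedler (tensor C C) T (\<lambda>a u. sweedler (tensor C C) (comult A a) (\<lambda>a1 a2.
     sweedler (tensor C C) (comult H u) (\<lambda>u1 u2. pure_tensor C C (pure_tensor A H a1 u1) (pure_tensor A H a2 u2))))"
  "counit C T = sweedler ground T (\<lambda>a u. counit A a * counit H u)"
  "antipode C T = sweedler AH_bicrossed T (\<lambda>a u. bicrossed_mult A H alpha beta
     (pure_tensor A H \<one>\<^bsub>A\<^esub> (antipode H u)) (pure_tensor A H (antipode A a) \<one>\<^bsub>H\<^esub>))"
  unfolding C_tensor[symmetric] by (simp_all add: C_def bicrossed_def Let_def module.defs hopf.defs)

lemma kalgebra_C: "kalgebra C" and khom_nu: "khom B.H C nu"
proof -
  have *: "nu v \<in> carrier C" if "v \<in> carrier B.H" for v using that by simp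
  have "\<one>\<^bsub>C\<^esub> = nu \<one>\<^bsub>B.H\<^esub>"
    using nu_mu_pure[of "\<one>\<^bsub>A\<^esub>" "\<one>\<^bsub>H\<^esub>"] by (simp add: khom_one[OF khom_inc_A] khom_one[OF khom_inc_H])
  moreover have "carrier C \<subseteq> nu ` carrier B.H" 
  proof
    fix T assume "T \<in> carrier C"
    then have "T = nu (mu T)" "mu T \<in> carrier B.H" by simp_all
    then show "T \<in> nu ` carrier B.H" by (rule image_eqI)
  qed
  ultimately show "kalgebra C" "khom B.H C nu"
    using kalgebra_image[OF B.H_kalgebra *] by (simp_all add: klinear_add[OF klinear_nu] klinear_smult[OF klinear_nu]
        klinear_zero[OF klinear_nu] bicrossed_mult_eq)
qed

lemma C_vspace [simp]: "vspace C" using kalgebra_C by simp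

lemma counit_inc:
  "a \<in> carrier A \<Longrightarrow> counit B.H (inc_A a) = counit A a"
  "u \<in> carrier H \<Longrightarrow> counit B.H (inc_H u) = counit H u"
proof -
  note k = khom_klinear
  show "counit B.H (inc_A a) = counit A a" if "a \<in> carrier A"
    by (rule A_ext[OF klinear_comp[OF k[OF khom_inc_A] k[OF B.counit_khom]] k[OF counit_A_khom] _ _ that])
      (simp_all add: inc_A_bv B.counit_e A_bv)
  show "counit B.H (inc_H u) = counit H u" if "u \<in> carrier H"
    by (rule H_ext[OF klinear_comp[OF k[OF khom_inc_H] k[OF B.counit_khom]] k[OF counit_khom] _ that])
      (simp_all add: inc_H_bas B.counit_bas counit_bas)
qed

lemma antipode_inc:
  "a \<in> carrier A \<Longrightarrow> antipode B.H (inc_A a) = inc_A (antipode A a)"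
  "u \<in> carrier H \<Longrightarrow> antipode B.H (inc_H u) = inc_H (antipode H u)"
proof -
  note k = khom_klinear and aA = antipode_group[OF \<Gamma>.group_axioms, where ?'k = 'k, folded A_def]
  have i: "inv\<^bsub>L\<^esub> (h, \<one>) = (inv\<^bsub>\<Gamma>\<^esub> h, \<one>)" if "h \<in> carrier \<Gamma>" for h
    by (rule B.inv_equality) (use that in \<open>simp_all add: group_pair_laws\<close>)
  have j: "inv\<^bsub>L\<^esub> (\<one>\<^bsub>\<Gamma>\<^esub>, t) = (\<one>\<^bsub>\<Gamma>\<^esub>, inv t)" if "t \<in> carrier G" for t
    by (rule B.inv_equality) (use that in \<open>simp_all add: group_pair_laws\<close>)
  show "antipode B.H (inc_A a) = inc_A (antipode A a)" if "a \<in> carrier A"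
    by (rule A_ext[OF klinear_comp[OF k[OF khom_inc_A] B.antipode_klinear] klinear_comp[OF aA(1) k[OF khom_inc_A]] _ _ that])
      (simp_all add: inc_A_bv B.antipode_e A_bv i)
  note S1 = klinear_comp[OF k[OF khom_inc_H] B.antipode_klinear] and S2 = klinear_comp[OF antipode_klinear k[OF khom_inc_H]]
  note [simp] = klinear_closed[OF antipode_klinear]
  show "antipode B.H (inc_H u) = inc_H (antipode H u)" if "u \<in> carrier H"
    using generates_H that
  proof (induction rule: generates_induct)
    case one
    show ?case by (simp add: khom_one[OF khom_inc_H] B.antipode_one antipode_one)
  next
    case (mult u w)
    have "antipode B.H (inc_H u) = inc_H (antipode H u)" using mult(1)
      by (auto simp: inc_H_e inc_H_x antipode_e antipode_x B.antipode_e B.antipode_x j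
        klinear_uminus[OF k[OF khom_inc_H]] khom_mult[OF khom_inc_H])
    then show ?case using mult by (auto simp: khom_mult[OF khom_inc_H] B.antipode_mult antipode_mult)
  next
    case (add u w)
    then show ?case using klinear_add[OF S1, of u w] klinear_add[OF S2, of u w] by simp
  next
    case (smult c u)
    then show ?case using klinear_smult[OF S1, of u c] klinear_smult[OF S2, of u c] by simp
  qed
qed

text \<open>
  On basis elements both sides are given by the binomial formula, since \<open>h\<close> is group-like and
  \<open>\<mu>\<close> respects the factors \<open>g\<^sup>k\<close>.
\<close>

lemma comult_nu:
  assumes b: "b \<in> carrier B.H"
  shows "comult C (nu b) = sweedler (tensor C C) (comult B.H b) (\<lambda>b1 b2. pure_tensor C C (nu b1) (nu b2))"
proof -
  let ?CC = "tensor C C"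
  note nuC = khom_klinear[OF khom_nu]
  have bN: "bilin B.H B.H ?CC (\<lambda>b1 b2. pure_tensor C C (nu b1) (nu b2))"
    by (rule bilin_comp[OF bilin_pure_tensor nuC nuC]) simp_all
  define N where "N w = sweedler ?CC (comult B.H w) (\<lambda>b1 b2. pure_tensor C C (nu b1) (nu b2))" for w
  have N: "klinear B.H ?CC N"
    unfolding N_def[abs_def] by (rule klinear_comp[OF khom_klinear[OF B.comult_khom] klinear_sweedler[OF _ _ _ bN]]) simp_all
  have bp: "bilin A H C (pure_tensor A H)"
    using bilin_pure_tensor[OF A_vspace H_vspace] by (simp add: bilin_def klinear_def)
  note cA = khom_klinear[OF comult_A_khom] and cH = khom_klinear[OF comult_khom]
  note pC = bilin_pure_tensor[OF C_vspace C_vspace]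
  let ?E = "\<lambda>a u. sweedler ?CC (comult A a) (\<lambda>a1 a2. sweedler ?CC (comult H u) (\<lambda>u1 u2.
    pure_tensor C C (pure_tensor A H a1 u1) (pure_tensor A H a2 u2)))"
  have m: "bilin A A ?CC (\<lambda>a1 a2. sweedler ?CC (comult H u) (\<lambda>u1 u2. pure_tensor C C (pure_tensor A H a1 u1) (pure_tensor A H a2 u2)))"
    if "u \<in> carrier H" for u
    by (rule bilin_sweedler_sweedler(1)[OF _ _ _ cA cH bp bp pC]) (use khom_closed[OF comult_khom that] in simp_all)
  have E: "bilin A H ?CC ?E"
    by (rule bilin_sweedler_sweedler(2)[OF _ _ _ cA cH bp bp pC]) simp_all
  have key: "?E a u = N (inc_A a \<otimes>\<^bsub>B.H\<^esub> inc_H u)" if au: "a \<in> carrier A" "u \<in> carrier H" for a u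
  proof (rule bilin_ext[OF bilin_flip[OF E] bilin_flip[OF bilin_out[OF bilin_mu N]] _ _ au(2,1)])
    fix t n h assume th: "t \<in> carrier G" "h \<in> carrier \<Gamma>"
    interpret CC: abelian_group ?CC by (rule vspace_abelian_group) simp
    have bH: "bilin H H ?CC (\<lambda>u1 u2. pure_tensor C C (pure_tensor A H (basis_vec h) u1) (pure_tensor A H (basis_vec h) u2))"
      by (rule bilin_comp[OF pC bilin_right[OF bp] bilin_right[OF bp]]) (use th in simp_all)
    have "?E (basis_vec h) (bas t n) = sweedler ?CC (comult H (bas t n)) (\<lambda>u1 u2. pure_tensor C C (pure_tensor A H (basis_vec h) u1) (pure_tensor A H (basis_vec h) u2))"
      using th by (simp add: A_bv sweedler_pure[OF _ _ _ m])
    also have "\<dots> = (\<Oplus>\<^bsub>?CC\<^esub>k\<in>{..n}. of_nat (n choose k) \<odot>\<^bsub>?CC\<^esub> pure_tensor C C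
      (pure_tensor A H (basis_vec h) (bas t (n - k) \<otimes>\<^bsub>H\<^esub> e (g [^] k))) (pure_tensor A H (basis_vec h) (bas t k)))"
      by (rule sweedler_bas[OF _ bH th(1)]) simp
    also have "\<dots> = (\<Oplus>\<^bsub>?CC\<^esub>k\<in>{..n}. of_nat (n choose k) \<odot>\<^bsub>?CC\<^esub> pure_tensor C C
      (nu (B.bas (h, t) (n - k) \<otimes>\<^bsub>B.H\<^esub> B.e (g' [^]\<^bsub>L\<^esub> k))) (nu (B.bas (h, t) k)))"
    proof -
      have 1: "nu (B.bas (h, t) m \<otimes>\<^bsub>B.H\<^esub> B.e (g' [^]\<^bsub>L\<^esub> k)) = pure_tensor A H (basis_vec h) (bas t m \<otimes>\<^bsub>H\<^esub> e (g [^] k))" for m k :: nat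
        using nu_mu_pure[of "basis_vec h" "bas t m \<otimes>\<^bsub>H\<^esub> e (g [^] k)"] th
        by (simp add: pow_L khom_mult[OF khom_inc_H] inc_H_e ka_assoc[symmetric] inc_bas)
      have 2: "nu (B.bas (h, t) m) = pure_tensor A H (basis_vec h) (bas t m)" for m
        using nu_mu_pure[of "basis_vec h" "bas t m"] th by (simp add: inc_bas)
      show ?thesis
      proof (rule CC.finsum_cong')
      fix k assume "k \<in> {..n}"
      show "of_nat (n choose k) \<odot>\<^bsub>?CC\<^esub> pure_tensor C C
      (pure_tensor A H (basis_vec h) (bas t (n - k) \<otimes>\<^bsub>H\<^esub> e (g [^] k))) (pure_tensor A H (basis_vec h) (bas t k)) =
        of_nat (n choose k) \<odot>\<^bsub>?CC\<^esub> pure_tensor C C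
      (nu (B.bas (h, t) (n - k) \<otimes>\<^bsub>B.H\<^esub> B.e (g' [^]\<^bsub>L\<^esub> k))) (nu (B.bas (h, t) k))" unfolding 1 2 ..
    next
      show "(\<lambda>k. of_nat (n choose k) \<odot>\<^bsub>?CC\<^esub> pure_tensor C C
        (nu (B.bas (h, t) (n - k) \<otimes>\<^bsub>B.H\<^esub> B.e (g' [^]\<^bsub>L\<^esub> k))) (nu (B.bas (h, t) k))) \<in> {..n} \<rightarrow> carrier ?CC"
        using th by (simp add: 1 2)
      qed simp
    qed
    also have "\<dots> = N (B.bas (h, t) n)"
      unfolding N_def by (rule B.sweedler_bas[OF _ bN, symmetric]) (use th in simp_all)
    finally show "?E (basis_vec h) (bas t n) = N (inc_A (basis_vec h) \<otimes>\<^bsub>B.H\<^esub> inc_H (bas t n))"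
      using th by (simp add: inc_bas)
  qed simp
  have nb: "nu b \<in> carrier AH" using b by simp
  have "comult C (nu b) = sweedler ?CC (nu b) (\<lambda>a u. N (inc_A a \<otimes>\<^bsub>B.H\<^esub> inc_H u))"
    unfolding C_coalgebra by (rule sweedler_cong[OF _ _ _ E nb]) (simp_all add: key)
  also have "\<dots> = N (mu (nu b))"
    unfolding mu_def by (rule sweedler_comp[OF _ _ _ bilin_mu N _ nb, symmetric]) simp_all
  finally show ?thesis using b by (simp add: N_def)
qed

theorem hopf_isomorphic_bicrossed: "hopf_isomorphic (bicrossed A H alpha beta) (a3_hopf L g' F)"
proof -
  have counit: "counit C (nu b) = counit B.H b" if b: "b \<in> carrier B.H" for b
  proof -
    have "counit C (nu b) = sweedler ground (nu b) (\<lambda>a u. counit B.H (inc_A a \<otimes>\<^bsub>B.H\<^esub> inc_H u))"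
      unfolding C_coalgebra
      by (rule sweedler_cong_closed[of _ _ A H]) (use b in \<open>simp_all add: khom_mult[OF B.counit_khom] counit_inc\<close>)
    also have "\<dots> = counit B.H (mu (nu b))"
      unfolding mu_def by (rule sweedler_comp[OF _ _ _ bilin_mu khom_klinear[OF B.counit_khom], symmetric]) (use b in simp_all)
    finally show ?thesis using b by simp
  qed
  have vV: "vspace AH_bicrossed" by (rule vspace_cong[of AH]) simp_all
  have SB [simp]: "antipode B.H b \<in> carrier B.H" if "b \<in> carrier B.H" for b
    using that by (rule klinear_closed[OF B.antipode_klinear])
  have SA: "antipode A a \<in> carrier A" if "a \<in> carrier A" for a
    using that by (rule klinear_closed[OF antipode_group(1)[OF \<Gamma>.group_axioms, where ?'k = 'k, folded A_def]])
  have SH: "antipode H u \<in> carrier H" if "u \<in> carrier H" for u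
    using that by (rule klinear_closed[OF antipode_klinear])
  have antipode: "antipode C (nu b) = nu (antipode B.H b)" if b: "b \<in> carrier B.H" for b
  proof -
    have K: "klinear B.H AH_bicrossed (\<lambda>b. nu (antipode B.H b))"
      using klinear_comp[OF B.antipode_klinear klinear_nu] by (simp add: klinear_def)
    have "antipode C (nu b) = sweedler AH_bicrossed (nu b) (\<lambda>a u. nu (antipode B.H (inc_A a \<otimes>\<^bsub>B.H\<^esub> inc_H u)))"
      unfolding C_coalgebra
      by (rule sweedler_cong_closed[OF vV, of _ A H])
        (use b in \<open>simp_all add: bicrossed_mult_eq SA SH mu_pure B.antipode_mult antipode_inc khom_one[OF khom_inc_A] khom_one[OF khom_inc_H]\<close>)
    also have "\<dots> = nu (antipode B.H (mu (nu b)))"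
      unfolding mu_def by (rule sweedler_comp[OF _ _ _ bilin_mu K vV, symmetric]) (use b in simp_all)
    finally show ?thesis using b by simp
  qed
  note transport = hopf_transport[OF B.hopf_algebra_H kalgebra_C khom_nu, of mu]
  have "hopf_algebra C" by (rule transport(1)) (simp_all add: comult_nu counit antipode)
  moreover have "mu \<in> hopf_iso C B.H" by (rule transport(2)) (simp_all add: comult_nu counit antipode)
  ultimately show ?thesis using B.hopf_algebra_H unfolding hopf_isomorphic_def C_def B.H_def by blast
qed

end

section \<open>Classification of matched pairs and their bicrossed products\<close>

theorem theorem1p1:
  fixes \<Gamma> :: "'c monoid" and G :: "'g monoid" and g :: 'g
    and f :: "'g \<Rightarrow> 'k::alg_closed_field"
    and A :: "('k, 'c \<Rightarrow>\<^sub>0 'k) hopf"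
    and H :: "('k, ('g letter list \<Rightarrow>\<^sub>0 'k) set) hopf"
    and e :: "'g \<Rightarrow> ('g letter list \<Rightarrow>\<^sub>0 'k) set"
    and x :: "('g letter list \<Rightarrow>\<^sub>0 'k) set"
  assumes "CHAR('k) > 0"
    and "group \<Gamma>" and "finite (carrier \<Gamma>)"
    and "third_type_datum G g f"
    and "A = group_hopf \<Gamma>" and "H = a3_hopf G g f"
    and "e = (\<lambda>t. a3_letter G g f (Grp t))" and "x = a3_letter G g f Skew"
  shows "\<exists>\<Phi>. bij_betw \<Phi>
            {(\<alpha>, \<beta>). hopf_matched_pair A H \<alpha> \<beta>}
            {(l, r, \<gamma>). matched_pair_datum \<Gamma> G g f l r \<gamma>} \<and>
          (\<forall>\<alpha> \<beta> l r \<gamma>. hopf_matched_pair A H \<alpha> \<beta> \<longrightarrow> \<Phi> (\<alpha>, \<beta>) = (l, r, \<gamma>) \<longrightarrow>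
             (\<forall>t\<in>carrier G. \<forall>h\<in>carrier \<Gamma>.
                \<alpha> (pure_tensor H A (e t) (basis_vec h)) = basis_vec (l (t, h)) \<and>
                \<beta> (pure_tensor H A (e t) (basis_vec h)) = e (r (t, h))) \<and>
             (\<forall>h\<in>carrier \<Gamma>.
                \<beta> (pure_tensor H A x (basis_vec h)) =
                  x \<oplus>\<^bsub>H\<^esub> \<gamma> h \<odot>\<^bsub>H\<^esub> (\<one>\<^bsub>H\<^esub> \<ominus>\<^bsub>H\<^esub> e g) \<and>
                \<alpha> (pure_tensor H A x (basis_vec h)) = \<zero>\<^bsub>A\<^esub>) \<and>
             (let L = group_bicrossed \<Gamma> G l r; g' = (\<one>\<^bsub>\<Gamma>\<^esub>, g); F = (\<lambda>(h, t). f t - \<gamma> h) in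
                third_type_datum L g' F \<and>
                hopf_isomorphic (bicrossed A H \<alpha> \<beta>) (a3_hopf L g' F)))"
proof -
  interpret P: third_type_pair G g f \<Gamma>
    using assms(1,2,4) by (intro third_type_pair.intro third_type.intro)
  have AH: "A = P.A" "H = P.H" "e = P.e" "x = P.x"
    by (simp_all add: assms P.A_def P.H_def P.e_def fun_eq_iff P.x_def)
  let ?D = "{(l, r, \<gamma>). matched_pair_datum \<Gamma> G g f l r \<gamma>}"
  note bij = P.bij_datum_actions
  define \<Phi> where "\<Phi> = inv_into ?D P.datum_actions"
  have \<Phi>: "bij_betw \<Phi> {(\<alpha>, \<beta>). hopf_matched_pair P.A P.H \<alpha> \<beta>} ?D"
    unfolding \<Phi>_def by (rule bij_betw_inv_into[OF bij])
  show ?thesis unfolding AH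
  proof (intro exI[of _ \<Phi>] conjI[OF \<Phi>] allI impI)
    fix \<alpha> \<beta> l r \<gamma>
    assume m: "hopf_matched_pair P.A P.H \<alpha> \<beta>" and d: "\<Phi> (\<alpha>, \<beta>) = (l, r, \<gamma>)"
    have "(l, r, \<gamma>) \<in> ?D" using bij_betwE[OF \<Phi>] m d by fastforce
    then interpret D: finite_pair_datum G g f \<Gamma> l r \<gamma>
      using assms(3) by unfold_locales auto
    have "P.datum_actions (\<Phi> (\<alpha>, \<beta>)) = (\<alpha>, \<beta>)"
      unfolding \<Phi>_def using bij_betw_inv_into_right[OF bij, of "(\<alpha>, \<beta>)"] m by simp
    then have [simp]: "\<alpha> = D.alpha" "\<beta> = D.beta" unfolding d by simp_all
    show "(\<forall>t\<in>carrier G. \<forall>h\<in>carrier \<Gamma>.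
                \<alpha> (pure_tensor P.H P.A (P.e t) (basis_vec h)) = basis_vec (l (t, h)) \<and>
                \<beta> (pure_tensor P.H P.A (P.e t) (basis_vec h)) = P.e (r (t, h))) \<and>
             (\<forall>h\<in>carrier \<Gamma>.
                \<beta> (pure_tensor P.H P.A P.x (basis_vec h)) =
                  P.x \<oplus>\<^bsub>P.H\<^esub> \<gamma> h \<odot>\<^bsub>P.H\<^esub> (\<one>\<^bsub>P.H\<^esub> \<ominus>\<^bsub>P.H\<^esub> P.e g) \<and>
                \<alpha> (pure_tensor P.H P.A P.x (basis_vec h)) = \<zero>\<^bsub>P.A\<^esub>) \<and>
             (let L = group_bicrossed \<Gamma> G l r; g' = (\<one>\<^bsub>\<Gamma>\<^esub>, g); F = (\<lambda>(h, t). f t - \<gamma> h) in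
                third_type_datum L g' F \<and>
                hopf_isomorphic (bicrossed P.A P.H \<alpha> \<beta>) (a3_hopf L g' F))"
      unfolding Let_def using D.third_type_datum_L D.hopf_isomorphic_bicrossed
      by (simp add: D.act_e D.act_x P.xc_def)
  qed
qed

end
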